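(* Let $M$ be a compact complex manifold of complex dimension $n$ with an antiholomorphic involution $\sigma$, and let $g$ be a $\sigma$-invariant Hermitian metric on $M$ (not necessarily Kähler) such that the curvature form $\omega$ of the Hermitian metric $h$ induced by $g$ on the canonical bundle $K(M)$ is a Kähler form on $M$. Let $L$ be the fixed point set of $\sigma$. Let $m$ be a positive integer large enough that the sections of $K(M)^{\otimes m}$ give a Kodaira embedding of $M$, let $g_m$ be the conformally rescaled metric and $\varphi_m$ the holomorphic section of $K(M)^{\otimes 2m}$ defined in the context, and let $D_m=\varphi_m^{-1}(0)\subset M$ be the zero set of $\varphi_m$. Suppose $L_t$, $t\in[0,1]$, is a $1$-parameter family of homotopies of $L$ with $L_0=L$, i.e. a smooth map $F:L\times[0,1]\to M$ with $F(\cdot,0)$ the inclusion of $L$ and $L_t$ given by the map $F(\cdot,t)$, such that every $L_t$ avoids $D_m$. Then $\mathrm{vol}(L_t)\ge \mathrm{vol}(L)$ for all $t$, where the volume is with respect to $g_m$.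
   Context: $K(M)=\Lambda^{(n,0)}T^*M$ is the canonical bundle. For a Hermitian metric $h$ on a holomorphic line bundle, its curvature form is the real $(1,1)$-form given locally by $-i\partial\bar\partial\log|s|_h^2$ for a local nonvanishing holomorphic section $s$. The involution $\sigma$ acts on $H^0(M,K(M)^{\otimes m})$ by the antiholomorphic involution $s\mapsto\overline{\sigma^*s}$; sections fixed by this action are called $\sigma$-invariant, and $H_m^L$ denotes the real vector space of $\sigma$-invariant sections. The space $H^0(M,K(M)^{\otimes m})$ carries the $L^2$ inner product defined by the metric $h^{\otimes m}$ and the volume form $\omega^n/n!$. Let $(\kappa_i)$ be an orthonormal basis of $H_m^L$ (it is also a unitary basis of $H^0(M,K(M)^{\otimes m})$), and let $\phi_m:M\to\mathbb{C}P^{N_m}$ be the Kodaira embedding given by $x\mapsto[\kappa_0(x):\dots:\kappa_{N_m}(x)]$. It identifies $K(M)^{\otimes m}$ with the pullback of the hyperplane bundle $\gamma^*$ of $\mathbb{C}P^{N_m}$; the standard Hermitian metric on $\gamma^*$ (in which $|z_j|^2=|z_j|^2/\sum_i|z_i|^2$ for the coordinate section $z_j$) thereby induces a Hermitian metric on $K(M)^{\otimes m}$ and, taking the $m$-th root, a Hermitian metric $h_m$ on $K(M)$. The curvature form of $h_m$ is $\omega_m=\frac1m\phi_m^*\omega_{FS}$, where $\omega_{FS}$ is the Fubini–Study form normalized as the curvature form of $\gamma^*$. Let $f_m$ be the real function on $M$ with $n\,i\partial\bar\partial f_m=\omega_m-\omega$ and integral $0$ over $M$ (with respect to $\omega^n/n!$),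 and set $g_m=e^{f_m}g$; the Hermitian metric induced by $g_m$ on $K(M)$ is a constant multiple of $h_m$. The section $\varphi_m$ of $K(M)^{\otimes 2m}$ is $\varphi_m=\sum_i\kappa_i^{\otimes 2}$, i.e. the pullback by $\phi_m$ of the section $\sum_i z_i^2$ of $(\gamma^* )^{\otimes2}$. The volume of $L_t$ is the $n$-dimensional volume of the map $F(\cdot,t):L\to M$ (counted with multiplicity). *)

theory Defs
  imports "HOL-Analysis.Analysis"
begin

section \<open>Smooth maps between Euclidean spaces\<close>

primrec Ck_on :: "nat \<Rightarrow> 'a::real_normed_vector set \<Rightarrow> ('a \<Rightarrow> 'b::real_normed_vector) \<Rightarrow> bool" where
  "Ck_on 0 S f \<longleftrightarrow> continuous_on S f"
| "Ck_on (Suc k) S f \<longleftrightarrow> (\<forall>x\<in>S. f differentiable (at x)) \<and>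
     (\<forall>v. Ck_on k S (\<lambda>x. frechet_derivative f (at x) v))"

text \<open>\<open>Ck_on\<close> is used on open sets only. On an arbitrary set (for instance a relatively open
  subset of a product with \<open>[0,1]\<close>), smooth means locally extendable to a smooth map on an
  open set.\<close>

definition smooth_on :: "'a::real_normed_vector set \<Rightarrow> ('a \<Rightarrow> 'b::real_normed_vector) \<Rightarrow> bool" where
  "smooth_on S f \<longleftrightarrow> (\<forall>x\<in>S. \<exists>U g. open U \<and> x \<in> U \<and> (\<forall>k. Ck_on k U g) \<and> (\<forall>y\<in>U \<inter> S. g y = f y))"

section \<open>Complex calculus in several variables\<close>

text \<open>The Wirtinger derivatives with respect to the \<open>j\<close>-th coordinate and its conjugate.\<close>

definition d_z :: "'n::finite \<Rightarrow> (complex^'n \<Rightarrow> complex) \<Rightarrow> complex^'n \<Rightarrow> complex" where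
  "d_z j f x = (frechet_derivative f (at x) (axis j 1) - \<i> * frechet_derivative f (at x) (axis j \<i>)) / 2"

definition d_zbar :: "'n::finite \<Rightarrow> (complex^'n \<Rightarrow> complex) \<Rightarrow> complex^'n \<Rightarrow> complex" where
  "d_zbar j f x = (frechet_derivative f (at x) (axis j 1) + \<i> * frechet_derivative f (at x) (axis j \<i>)) / 2"

definition holo_on :: "(complex^'n::finite) set \<Rightarrow> (complex^'n \<Rightarrow> complex) \<Rightarrow> bool" where
  "holo_on S f \<longleftrightarrow> (\<forall>x\<in>S. f differentiable (at x) \<and> (\<forall>j. d_zbar j f x = 0))"

definition holo_map_on :: "(complex^'n::finite) set \<Rightarrow> (complex^'n \<Rightarrow> complex^'n) \<Rightarrow> bool" where
  "holo_map_on S f \<longleftrightarrow> (\<forall>i. holo_on S (\<lambda>x. f x $ i))"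

definition jacobian :: "(complex^'n::finite \<Rightarrow> complex^'n) \<Rightarrow> complex^'n \<Rightarrow> complex^'n^'n" where
  "jacobian f x = (\<chi> i j. d_z j (\<lambda>y. f y $ i) x)"

definition vec_cnj :: "complex^'n::finite \<Rightarrow> complex^'n" where
  "vec_cnj x = (\<chi> i. cnj (x $ i))"

section \<open>Charts and measures on manifolds\<close>

type_synonym ('a, 'b) chart = "'a set \<times> ('a \<Rightarrow> 'b)"

abbreviation dom_of :: "('a, 'b) chart \<Rightarrow> 'a set" where
  "dom_of c \<equiv> fst c"

abbreviation coord :: "('a, 'b) chart \<Rightarrow> 'a \<Rightarrow> 'b" where
  "coord c \<equiv> snd c"

definition chart_inv :: "('a, 'b) chart \<Rightarrow> 'b \<Rightarrow> 'a" where
  "chart_inv c = inv_into (dom_of c) (coord c)"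

definition chart_on :: "'a::topological_space set \<Rightarrow> ('a, 'b::euclidean_space) chart \<Rightarrow> bool" where
  "chart_on S c \<longleftrightarrow> openin (top_of_set S) (dom_of c) \<and> open (coord c ` dom_of c) \<and>
     homeomorphism (dom_of c) (coord c ` dom_of c) (coord c) (chart_inv c)"

definition transition :: "('a, 'b) chart \<Rightarrow> ('a, 'b) chart \<Rightarrow> 'b \<Rightarrow> 'b" where
  "transition c c' = coord c' \<circ> chart_inv c"

text \<open>An arbitrary chart around a point; it is only used to evaluate expressions that do not
  depend on the choice of the chart.\<close>

definition chart_at :: "('a, 'b) chart set \<Rightarrow> 'a \<Rightarrow> ('a, 'b) chart" where
  "chart_at A p = (SOME c. c \<in> A \<and> p \<in> dom_of c)"

text \<open>The Borel measure, concentrated on the union of the chart domains, that is given in each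
  chart \<open>c\<close> by the density \<open>\<delta> c\<close> with respect to Lebesgue measure.\<close>

definition density_measure ::
  "('a::topological_space, 'b::euclidean_space) chart set \<Rightarrow> (('a, 'b) chart \<Rightarrow> 'b \<Rightarrow> real) \<Rightarrow> 'a measure" where
  "density_measure C \<delta> = (THE \<mu>. sets \<mu> = sets borel \<and> emeasure \<mu> (- (\<Union>c\<in>C. dom_of c)) = 0 \<and>
     (\<forall>c\<in>C. \<forall>B\<in>sets borel. B \<subseteq> dom_of c \<longrightarrow>
        emeasure \<mu> B = (\<integral>\<^sup>+ y \<in> coord c ` B. ennreal (\<delta> c y) \<partial>lborel)))"

section \<open>Complex manifolds\<close>

text \<open>The manifold is the whole type \<open>'a\<close>. Tensors are given by their components in the charts.
  A real tangent vector at \<open>p\<close> has components in \<open>complex^'n\<close>, on which the complex structure acts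
  as multiplication by \<open>\<i>\<close>.\<close>

type_synonym ('a, 'n) cchart = "('a, complex^'n) chart"

definition complex_manifold :: "('a::{t2_space,second_countable_topology}, 'n::finite) cchart set \<Rightarrow> bool" where
  "complex_manifold A \<longleftrightarrow> (\<forall>c\<in>A. chart_on UNIV c) \<and> (\<Union>c\<in>A. dom_of c) = UNIV \<and>
     (\<forall>c\<in>A. \<forall>c'\<in>A. holo_map_on (coord c ` (dom_of c \<inter> dom_of c')) (transition c c'))"

definition smooth_function :: "('a, 'n::finite) cchart set \<Rightarrow> ('a \<Rightarrow> real) \<Rightarrow> bool" where
  "smooth_function A f \<longleftrightarrow> (\<forall>c\<in>A. smooth_on (coord c ` dom_of c) (f \<circ> chart_inv c))"

definition antiholomorphic_involution ::
  "('a::topological_space, 'n::finite) cchart set \<Rightarrow> ('a \<Rightarrow> 'a) \<Rightarrow> bool" where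
  "antiholomorphic_involution A \<sigma> \<longleftrightarrow> continuous_on UNIV \<sigma> \<and> (\<forall>p. \<sigma> (\<sigma> p) = p) \<and>
     (\<forall>c\<in>A. \<forall>c'\<in>A. holo_map_on (coord c ` {p \<in> dom_of c. \<sigma> p \<in> dom_of c'})
        (vec_cnj \<circ> coord c' \<circ> \<sigma> \<circ> chart_inv c))"

subsection \<open>Hermitian metrics\<close>

text \<open>\<open>g c p v w\<close> is the value of the metric at \<open>p\<close> on the tangent vectors with components
  \<open>v\<close> and \<open>w\<close> in the chart \<open>c\<close>.\<close>

type_synonym ('a, 'n) metric = "('a, 'n) cchart \<Rightarrow> 'a \<Rightarrow> complex^'n \<Rightarrow> complex^'n \<Rightarrow> real"

definition hermitian_metric :: "('a, 'n::finite) cchart set \<Rightarrow> ('a, 'n) metric \<Rightarrow> bool" where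
  "hermitian_metric A g \<longleftrightarrow>
     (\<forall>c\<in>A. \<forall>p\<in>dom_of c. bilinear (g c p) \<and> (\<forall>v w. g c p v w = g c p w v) \<and>
        (\<forall>v. v \<noteq> 0 \<longrightarrow> 0 < g c p v v) \<and> (\<forall>v w. g c p (\<i> *s v) (\<i> *s w) = g c p v w)) \<and>
     (\<forall>c\<in>A. \<forall>v w. smooth_on (coord c ` dom_of c) (\<lambda>y. g c (chart_inv c y) v w)) \<and>
     (\<forall>c\<in>A. \<forall>c'\<in>A. \<forall>p\<in>dom_of c \<inter> dom_of c'. \<forall>v w.
        (let D = frechet_derivative (transition c c') (at (coord c p))
         in g c p v w = g c' p (D v) (D w)))"

definition invariant_metric :: "('a, 'n::finite) cchart set \<Rightarrow> ('a \<Rightarrow> 'a) \<Rightarrow> ('a, 'n) metric \<Rightarrow> bool" where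
  "invariant_metric A \<sigma> g \<longleftrightarrow> (\<forall>c\<in>A. \<forall>c'\<in>A. \<forall>p\<in>dom_of c. \<sigma> p \<in> dom_of c' \<longrightarrow> (\<forall>v w.
     (let D = frechet_derivative (coord c' \<circ> \<sigma> \<circ> chart_inv c) (at (coord c p))
      in g c p v w = g c' (\<sigma> p) (D v) (D w))))"

definition conformal_metric :: "('a \<Rightarrow> real) \<Rightarrow> ('a, 'n) metric \<Rightarrow> ('a, 'n) metric" where
  "conformal_metric f g = (\<lambda>c p v w. exp (f p) * g c p v w)"

text \<open>The Hermitian form with real part \<open>b\<close> that is linear in the first argument.\<close>

definition herm :: "(complex^'n \<Rightarrow> complex^'n \<Rightarrow> real) \<Rightarrow> complex^'n \<Rightarrow> complex^'n \<Rightarrow> complex" where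
  "herm b v w = Complex (b v w) (b v (\<i> *s w))"

definition herm_matrix :: "(complex^'n::finite \<Rightarrow> complex^'n \<Rightarrow> real) \<Rightarrow> complex^'n^'n" where
  "herm_matrix b = (\<chi> j k. herm b (axis j 1) (axis k 1))"

subsection \<open>Real (1,1)-forms\<close>

text \<open>A (1,1)-form is given by its coefficient matrices: in the chart \<open>c\<close> with coordinates \<open>z\<close>,
  the matrix \<open>a\<close> stands for the form \<open>i \<Sum> a\<^sub>j\<^sub>k dz\<^sub>j \<and> dzbar\<^sub>k\<close>. It is real if and only if the
  matrices are Hermitian.\<close>

type_synonym ('a, 'n) form11 = "('a, 'n) cchart \<Rightarrow> 'a \<Rightarrow> complex^'n^'n"

definition real_form11 :: "('a, 'n::finite) cchart set \<Rightarrow> ('a, 'n) form11 \<Rightarrow> bool" where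
  "real_form11 A a \<longleftrightarrow>
     (\<forall>c\<in>A. \<forall>j k. smooth_on (coord c ` dom_of c) (\<lambda>y. a c (chart_inv c y) $ j $ k)) \<and>
     (\<forall>c\<in>A. \<forall>p\<in>dom_of c. \<forall>j k. a c p $ k $ j = cnj (a c p $ j $ k)) \<and>
     (\<forall>c\<in>A. \<forall>c'\<in>A. \<forall>p\<in>dom_of c \<inter> dom_of c'. \<forall>j k.
        (let J = jacobian (transition c c') (coord c p)
         in a c p $ j $ k = (\<Sum>l\<in>UNIV. \<Sum>r\<in>UNIV. a c' p $ l $ r * J $ l $ j * cnj (J $ r $ k))))"

definition closed_form11 :: "('a, 'n::finite) cchart set \<Rightarrow> ('a, 'n) form11 \<Rightarrow> bool" where
  "closed_form11 A a \<longleftrightarrow> (\<forall>c\<in>A. \<forall>y\<in>coord c ` dom_of c. \<forall>j k l.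
     d_z l (\<lambda>x. a c (chart_inv c x) $ j $ k) y = d_z j (\<lambda>x. a c (chart_inv c x) $ l $ k) y \<and>
     d_zbar l (\<lambda>x. a c (chart_inv c x) $ j $ k) y = d_zbar k (\<lambda>x. a c (chart_inv c x) $ j $ l) y)"

definition kahler_form :: "('a, 'n::finite) cchart set \<Rightarrow> ('a, 'n) form11 \<Rightarrow> bool" where
  "kahler_form A a \<longleftrightarrow> real_form11 A a \<and> closed_form11 A a \<and>
     (\<forall>c\<in>A. \<forall>p\<in>dom_of c. \<forall>v. v \<noteq> 0 \<longrightarrow>
        0 < Re (\<Sum>j\<in>UNIV. \<Sum>k\<in>UNIV. a c p $ j $ k * v $ j * cnj (v $ k)))"

text \<open>The form \<open>i \<partial> \<partial>bar u\<close>, for a real function \<open>u\<close> near a point of the domain of \<open>c\<close>.\<close>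

definition i_ddbar :: "('a \<Rightarrow> real) \<Rightarrow> ('a, 'n::finite) form11" where
  "i_ddbar u c p = (\<chi> j k. d_z j (d_zbar k (\<lambda>y. complex_of_real (u (chart_inv c y)))) (coord c p))"

text \<open>The measure of the volume form \<open>\<omega>^n / n!\<close> of \<open>\<omega> = i \<Sum> a\<^sub>j\<^sub>k dz\<^sub>j \<and> dzbar\<^sub>k\<close>; the power of 2
  comes from \<open>i dz \<and> dzbar = 2 dx \<and> dy\<close>.\<close>

definition kahler_volume ::
  "('a::topological_space, 'n::finite) cchart set \<Rightarrow> ('a, 'n) form11 \<Rightarrow> 'a measure" where
  "kahler_volume A a = density_measure A (\<lambda>c y. 2 ^ CARD('n) * Re (det (a c (chart_inv c y))))"

section \<open>The canonical bundle and its powers\<close>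

text \<open>A section \<open>s\<close> of \<open>K(M)^m\<close> is given by its coefficients: it equals
  \<open>s c p (dz\<^sub>1 \<and> \<dots> \<and> dz\<^sub>n)^m\<close> at \<open>p\<close> in the chart \<open>c\<close> with coordinates \<open>z\<close>. Outside the atlas and
  the chart domains the coefficient is 0, so that a section determines \<open>s\<close>.\<close>

type_synonym ('a, 'n) bundle_section = "('a, 'n) cchart \<Rightarrow> 'a \<Rightarrow> complex"

definition holomorphic_sections :: "('a, 'n::finite) cchart set \<Rightarrow> nat \<Rightarrow> ('a, 'n) bundle_section set" where
  "holomorphic_sections A m = {s.
     (\<forall>c p. c \<notin> A \<or> p \<notin> dom_of c \<longrightarrow> s c p = 0) \<and>
     (\<forall>c\<in>A. holo_on (coord c ` dom_of c) (s c \<circ> chart_inv c)) \<and>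
     (\<forall>c\<in>A. \<forall>c'\<in>A. \<forall>p\<in>dom_of c \<inter> dom_of c'.
        s c p = s c' p * det (jacobian (transition c c') (coord c p)) ^ m)}"

text \<open>The section \<open>s \<mapsto> cnj (\<sigma>\<^sup>* s)\<close>: in coordinates \<open>z\<close> around \<open>p\<close> and \<open>w\<close> around \<open>\<sigma> p\<close>, the
  conjugate of \<open>\<sigma>\<^sup>* (dw\<^sub>1 \<and> \<dots> \<and> dw\<^sub>n)\<close> is the determinant of the holomorphic Jacobian of \<open>cnj (w \<circ> \<sigma>)\<close>
  times \<open>dz\<^sub>1 \<and> \<dots> \<and> dz\<^sub>n\<close>.\<close>

definition cnj_pullback ::
  "('a, 'n::finite) cchart set \<Rightarrow> ('a \<Rightarrow> 'a) \<Rightarrow> nat \<Rightarrow> ('a, 'n) bundle_section \<Rightarrow> ('a, 'n) bundle_section" where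
  "cnj_pullback A \<sigma> m s c p =
     (if c \<in> A \<and> p \<in> dom_of c
      then let c' = chart_at A (\<sigma> p) in
        cnj (s c' (\<sigma> p)) * det (jacobian (vec_cnj \<circ> coord c' \<circ> \<sigma> \<circ> chart_inv c) (coord c p)) ^ m
      else 0)"

definition invariant_sections ::
  "('a, 'n::finite) cchart set \<Rightarrow> ('a \<Rightarrow> 'a) \<Rightarrow> nat \<Rightarrow> ('a, 'n) bundle_section set" where
  "invariant_sections A \<sigma> m = {s \<in> holomorphic_sections A m. cnj_pullback A \<sigma> m s = s}"

definition zero_set :: "('a, 'n::finite) cchart set \<Rightarrow> ('a, 'n) bundle_section \<Rightarrow> 'a set" where
  "zero_set A s = {p. s (chart_at A p) p = 0}"

text \<open>A Hermitian metric \<open>h\<close> on \<open>K(M)\<close> is given by the squared norms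
  \<open>h c p\<close> of \<open>dz\<^sub>1 \<and> \<dots> \<and> dz\<^sub>n\<close> at \<open>p\<close>.\<close>

type_synonym ('a, 'n) line_metric = "('a, 'n) cchart \<Rightarrow> 'a \<Rightarrow> real"

text \<open>The metric induced by \<open>g\<close>: the Gram matrix of \<open>dz\<^sub>1, \<dots>, dz\<^sub>n\<close> is the inverse (up to
  transposition) of the Gram matrix of the coordinate vector fields.\<close>

definition canonical_metric :: "('a, 'n::finite) metric \<Rightarrow> ('a, 'n) line_metric" where
  "canonical_metric g c p = 1 / Re (det (herm_matrix (g c p)))"

text \<open>The curvature form \<open>-i \<partial> \<partial>bar log |s|\<^sub>h\<^sup>2\<close>, computed for the local nonvanishing holomorphic section
  \<open>s = dz\<^sub>1 \<and> \<dots> \<and> dz\<^sub>n\<close>.\<close>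

definition curvature_form :: "('a, 'n::finite) line_metric \<Rightarrow> ('a, 'n) form11" where
  "curvature_form h c p = - i_ddbar (\<lambda>q. ln (h c q)) c p"

definition L2_inner ::
  "('a::topological_space, 'n::finite) cchart set \<Rightarrow> ('a, 'n) line_metric \<Rightarrow> 'a measure \<Rightarrow> nat \<Rightarrow>
     ('a, 'n) bundle_section \<Rightarrow> ('a, 'n) bundle_section \<Rightarrow> complex" where
  "L2_inner A h \<mu> m s t =
     (LINT p|\<mu>. (let c = chart_at A p in s c p * cnj (t c p) * complex_of_real (h c p ^ m)))"

definition orthonormal_basis_of_invariant_sections ::
  "('a::topological_space, 'n::finite) cchart set \<Rightarrow> ('a \<Rightarrow> 'a) \<Rightarrow> ('a, 'n) line_metric \<Rightarrow> 'a measure \<Rightarrow>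
     nat \<Rightarrow> nat \<Rightarrow> (nat \<Rightarrow> ('a, 'n) bundle_section) \<Rightarrow> bool" where
  "orthonormal_basis_of_invariant_sections A \<sigma> h \<mu> m N \<kappa> \<longleftrightarrow>
     (\<forall>i\<le>N. \<kappa> i \<in> invariant_sections A \<sigma> m) \<and>
     (\<forall>i\<le>N. \<forall>j\<le>N. L2_inner A h \<mu> m (\<kappa> i) (\<kappa> j) = (if i = j then 1 else 0)) \<and>
     (\<forall>s\<in>invariant_sections A \<sigma> m. \<exists>a::nat \<Rightarrow> real. \<forall>c p. s c p = (\<Sum>i\<le>N. complex_of_real (a i) * \<kappa> i c p))"

subsection \<open>The Kodaira map\<close>

text \<open>A point of projective space of dimension \<open>N\<close> is the set of nonzero multiples of a nonzero
  vector, the vectors being functions that vanish above \<open>N\<close>.\<close>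

definition proj_point :: "nat \<Rightarrow> (nat \<Rightarrow> complex) \<Rightarrow> (nat \<Rightarrow> complex) set" where
  "proj_point N z = {\<lambda>i. if i \<le> N then b * z i else 0 |b. b \<noteq> 0}"

definition kodaira_map ::
  "('a, 'n::finite) cchart set \<Rightarrow> nat \<Rightarrow> (nat \<Rightarrow> ('a, 'n) bundle_section) \<Rightarrow> 'a \<Rightarrow> (nat \<Rightarrow> complex) set" where
  "kodaira_map A N \<kappa> p = proj_point N (\<lambda>i. \<kappa> i (chart_at A p) p)"

text \<open>The Kodaira map is everywhere defined, injective, and an immersion with respect to the
  affine charts \<open>(z\<^sub>i / z\<^sub>j)\<^sub>i\<close> of projective space. The source being compact, such a map is an
  embedding.\<close>

definition kodaira_embedding ::
  "('a, 'n::finite) cchart set \<Rightarrow> nat \<Rightarrow> (nat \<Rightarrow> ('a, 'n) bundle_section) \<Rightarrow> bool" where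
  "kodaira_embedding A N \<kappa> \<longleftrightarrow>
     (\<forall>c\<in>A. \<forall>p\<in>dom_of c. \<exists>i\<le>N. \<kappa> i c p \<noteq> 0) \<and>
     inj (kodaira_map A N \<kappa>) \<and>
     (\<forall>c\<in>A. \<forall>p\<in>dom_of c. \<forall>j\<le>N. \<kappa> j c p \<noteq> 0 \<longrightarrow>
        (\<forall>v. (\<forall>i\<le>N. frechet_derivative (\<lambda>y. \<kappa> i c (chart_inv c y) / \<kappa> j c (chart_inv c y))
                       (at (coord c p)) v = 0) \<longrightarrow> v = 0))"

text \<open>The \<open>m\<close>-th root of the metric on \<open>K(M)^m\<close> induced by the standard metric of the hyperplane
  bundle. The latter gives the section \<open>\<kappa>\<^sub>j\<close> (the pullback of \<open>z\<^sub>j\<close>) the squared norm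
  \<open>|\<kappa>\<^sub>j|^2 / \<Sum>\<^sub>i |\<kappa>\<^sub>i|^2\<close>.\<close>

definition induced_metric :: "nat \<Rightarrow> nat \<Rightarrow> (nat \<Rightarrow> ('a, 'n::finite) bundle_section) \<Rightarrow> ('a, 'n) line_metric" where
  "induced_metric m N \<kappa> c p = root m (1 / (\<Sum>i\<le>N. (cmod (\<kappa> i c p))\<^sup>2))"

definition sum_of_squares :: "nat \<Rightarrow> (nat \<Rightarrow> ('a, 'n::finite) bundle_section) \<Rightarrow> ('a, 'n) bundle_section" where
  "sum_of_squares N \<kappa> c p = (\<Sum>i\<le>N. (\<kappa> i c p)\<^sup>2)"

section \<open>Real submanifolds and volumes of maps\<close>

text \<open>The charts of an embedded submanifold of real dimension \<open>n\<close>: their inverses are smooth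
  immersions into the ambient manifold and homeomorphisms onto relatively open sets.\<close>

definition submanifold_charts ::
  "('a::topological_space, 'n::finite) cchart set \<Rightarrow> 'a set \<Rightarrow> ('a, real^'n) chart set" where
  "submanifold_charts A L = {x. chart_on L x \<and>
     (\<forall>c\<in>A. smooth_on (coord x ` (dom_of x \<inter> dom_of c)) (coord c \<circ> chart_inv x) \<and>
        (\<forall>y\<in>coord x ` (dom_of x \<inter> dom_of c). inj (frechet_derivative (coord c \<circ> chart_inv x) (at y))))}"

definition smooth_homotopy ::
  "('a::topological_space, 'n::finite) cchart set \<Rightarrow> 'a set \<Rightarrow> ('a \<times> real \<Rightarrow> 'a) \<Rightarrow> bool" where
  "smooth_homotopy A L F \<longleftrightarrow> continuous_on (L \<times> {0..1}) F \<and>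
     (\<forall>x\<in>submanifold_charts A L. \<forall>c\<in>A.
        smooth_on {(y, t). y \<in> coord x ` dom_of x \<and> t \<in> {0..1} \<and> F (chart_inv x y, t) \<in> dom_of c}
          (\<lambda>(y, t). coord c (F (chart_inv x y, t))))"

text \<open>The volume, counted with multiplicity, of a map \<open>f\<close> from the submanifold \<open>L\<close>: the total mass
  of the density \<open>sqrt (det (g (df e\<^sub>j) (df e\<^sub>k)))\<close>.\<close>

definition map_volume ::
  "('a::topological_space, 'n::finite) cchart set \<Rightarrow> ('a, 'n) metric \<Rightarrow> 'a set \<Rightarrow> ('a \<Rightarrow> 'a) \<Rightarrow> ennreal" where
  "map_volume A g L f = emeasure
     (density_measure (submanifold_charts A L) (\<lambda>x y.
        let q = f (chart_inv x y); c = chart_at A q;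
            D = frechet_derivative (coord c \<circ> f \<circ> chart_inv x) (at y)
        in sqrt (det (\<chi> j k. g c q (D (axis j 1)) (D (axis k 1)) :: real^'n^'n)))) L"

end

(* The section phi_m has locally a holomorphic 2m-th root, a holomorphic n-form Omega, possibly
   multivalued. The real function u = log h_m - log h + n f_m is pluriharmonic on a compact manifold, hence
   locally constant; so, up to the locally constant factor e^(u/2), Omega is a calibration for g_m:
   the inequality |phi_m| <= sum |kappa_i|^2 and Hadamard's inequality for the determinant of a
   Hermitian metric bound |e^(u/2) Omega| on n real tangent vectors by their g_m-volume. On L all
   sections kappa_i are real and L is Lagrangian for the Hermitian form of g, so both are equalities.
   Since the homotopy avoids the zeros of phi_m, the root Omega can be continued along it, starting with
   the branch that is positive on L, and the integral of Omega over L_t does not depend on t because Omega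
   is closed. The n-form is used only through the function that compares its pullback under F(-,t)
   with the density of L; its invariance in t is proved with a partition of unity on L. *)
theory Submission
  imports Defs "HOL-Complex_Analysis.Conformal_Mappings"
begin

text \<open>What is continued along the homotopy is a quotient, the root at \<open>F (p, t)\<close>
  divided by the root at \<open>p\<close>. The choice of a root at \<open>p\<close> cancels in it,
  so \<open>L\<close> may be non-orientable or disconnected, the starting value is the identity of a
  fibre, and the pull-back becomes a complex function on \<open>L\<close> that equals 1 at time 0.
  This function is integrated against the Riemannian measure of \<open>L\<close>; the comparison of
  volumes is then the inequality between the modulus of an integral and the integral of the modulus.

  Pointwise relations are stated for \<open>2 * m\<close>-th powers, where no branch of the root
  occurs. On that level the factor e^(u/2) becomes e^(m u), which is the function \<open>Fac\<close>
  below. Being only locally constant, it is frozen on small sets when the root is differentiated and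
  compared along paths by connectedness.

  At the times 0 and 1 the homotopy is smooth only through local extensions. Time derivatives are
  therefore taken for 0 < t < 1, and the end points are reached by continuity of the
  integral.\<close>

abbreviation Fd :: "('a::real_normed_vector \<Rightarrow> 'b::real_normed_vector) \<Rightarrow> 'a \<Rightarrow> 'a \<Rightarrow> 'b" where
  "Fd f x \<equiv> frechet_derivative f (at x)"

abbreviation tjac :: "('a, 'n::finite) cchart \<Rightarrow> ('a, 'n) cchart \<Rightarrow> 'a \<Rightarrow> complex^'n^'n" where
  "tjac c c' p \<equiv> jacobian (transition c c') (coord c p)"

section \<open>Calculus of \<open>Ck_on\<close> maps on open sets\<close>

lemma Ck_on_cong:
  assumes "open S" "\<And>x. x \<in> S \<Longrightarrow> f x = g x"
  shows "Ck_on k S f \<longleftrightarrow> Ck_on k S g" using assms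
proof (induction k arbitrary: f g)
  case 0
  then show ?case by (auto cong: continuous_on_cong)
next
  case (Suc k)
  have *: "Fd f x = Fd g x"
    if "f differentiable at x" "x \<in> S" "\<And>x. x \<in> S \<Longrightarrow> f x = g x" for x and f g :: "'a \<Rightarrow> 'b"
    using frechet_derivative_transform_within_open that Suc.prems(1) by blast
  have d: "g differentiable at x" if "f differentiable at x" "x \<in> S" "\<And>x. x \<in> S \<Longrightarrow> f x = g x"
    for x and f g :: "'a \<Rightarrow> 'b" using that Suc.prems(1) unfolding differentiable_def
    by (metis has_derivative_transform_within_open)
  show ?case
  proof
    assume L: "Ck_on (Suc k) S f"
    then have "\<forall>x\<in>S. g differentiable at x" using d Suc.prems by auto
    moreover have "Ck_on k S (\<lambda>x. Fd g x v)" for v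
    proof -
      have "Ck_on k S (\<lambda>x. Fd f x v)" using L by simp
      then show ?thesis using Suc.IH[OF Suc.prems(1), of "\<lambda>x. Fd f x v" "\<lambda>x. Fd g x v"] * L Suc.prems by auto
    qed
    ultimately show "Ck_on (Suc k) S g" by auto
  next
    assume L: "Ck_on (Suc k) S g"
    then have "\<forall>x\<in>S. f differentiable at x" using d[of g _ f] Suc.prems by auto
    moreover have "Ck_on k S (\<lambda>x. Fd f x v)" for v
    proof -
      have "Ck_on k S (\<lambda>x. Fd g x v)" using L by simp
      then show ?thesis using Suc.IH[OF Suc.prems(1), of "\<lambda>x. Fd f x v" "\<lambda>x. Fd g x v"] *[of g _ f] L Suc.prems by auto
    qed
    ultimately show "Ck_on (Suc k) S f" by auto
  qed
qed

lemma Ck_on_subset: "Ck_on k S f \<Longrightarrow> T \<subseteq> S \<Longrightarrow> Ck_on k T f"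
  by (induction k arbitrary: f) (auto intro: continuous_on_subset)

lemma Ck_on_SucD: "Ck_on (Suc k) S f \<Longrightarrow> Ck_on k S f"
proof (induction k arbitrary: f)
  case 0
  then show ?case by (auto intro!: continuous_at_imp_continuous_on differentiable_imp_continuous_within)
next
  case (Suc k)
  then show ?case by auto
qed

text \<open>\<open>Ck_on\<close> uses full derivatives at each point, so it depends on germs only;
  this allows the local extensions in \<open>smooth_on\<close> to be glued.\<close>

lemma Ck_on_local:
  assumes "\<And>x. x \<in> S \<Longrightarrow> \<exists>U. open U \<and> x \<in> U \<and> Ck_on k U f"
  shows "Ck_on k S f" using assms
proof (induction k arbitrary: f)
  case 0
  then show ?case by (auto intro!: continuous_at_imp_continuous_on) (meson continuous_on_eq_continuous_at)
next
  case (Suc k)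
  have "Ck_on k S (\<lambda>x. Fd f x v)" for v
  proof (rule Suc.IH)
    fix x assume "x \<in> S"
    then obtain U where "open U" "x \<in> U" "Ck_on (Suc k) U f" using Suc.prems by blast
    then show "\<exists>U. open U \<and> x \<in> U \<and> Ck_on k U (\<lambda>x. Fd f x v)" by auto
  qed
  moreover have "\<forall>x\<in>S. f differentiable at x" using Suc.prems by fastforce
  ultimately show ?case by simp
qed

text \<open>On an open set a local extension agrees with the map near each point and has the same
  derivatives there.\<close>

lemma smooth_on_Ck_on:
  assumes "open S" "smooth_on S f"
  shows "Ck_on k S f"
proof (rule Ck_on_local)
  fix x assume x: "x \<in> S"
  then obtain U g where U: "open U" "x \<in> U" "Ck_on k U g" "\<forall>y\<in>U \<inter> S. g y = f y"
    using assms(2) unfolding smooth_on_def by metis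
  then have "Ck_on k (U \<inter> S) g" by (blast intro: Ck_on_subset)
  then have "Ck_on k (U \<inter> S) f" using Ck_on_cong[of "U \<inter> S" g f k] U assms by auto
  then show "\<exists>U. open U \<and> x \<in> U \<and> Ck_on k U f" using U x assms by blast
qed

lemma Ck_on_const: "Ck_on k S (\<lambda>x. c)" by (induction k arbitrary: c) auto

text \<open>The induction step behind the closure rules below: any explicit formula for the
  derivative may replace \<open>frechet_derivative\<close>.\<close>

lemma Ck_on_Suc_iff:
  assumes "open S" "\<And>x. x \<in> S \<Longrightarrow> (f has_derivative f' x) (at x)"
  shows "Ck_on (Suc k) S f \<longleftrightarrow> (\<forall>v. Ck_on k S (\<lambda>x. f' x v))"
proof -
  have "Fd f x = f' x" if "x \<in> S" for x using assms(2)[OF that] by (metis frechet_derivative_at)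
  then have "Ck_on k S (\<lambda>x. Fd f x v) \<longleftrightarrow> Ck_on k S (\<lambda>x. f' x v)" for v
    using Ck_on_cong[OF assms(1), of "\<lambda>x. Fd f x v" "\<lambda>x. f' x v"] by auto
  then show ?thesis using assms(2) by (auto simp: differentiable_def)
qed

lemma Ck_on_has_derivative:
  assumes "Ck_on (Suc k) S f" "x \<in> S"
  shows "(f has_derivative Fd f x) (at x)" using assms by (auto simp: frechet_derivative_works)

lemma Ck_on_add:
  assumes "open S" "Ck_on k S f" "Ck_on k S g"
  shows "Ck_on k S (\<lambda>x. f x + g x)" using assms(2,3)
proof (induction k arbitrary: f g)
  case 0
  then show ?case by (auto intro: continuous_on_add)
next
  case (Suc k)
  have "((\<lambda>x. f x + g x) has_derivative (\<lambda>v. Fd f x v + Fd g x v)) (at x)"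
    if "x \<in> S" for x using Suc.prems that by (auto intro!: has_derivative_add simp: frechet_derivative_works[symmetric])
  from Ck_on_Suc_iff[OF assms(1) this] show ?case using Suc by auto
qed

lemma Ck_on_bounded_linear:
  assumes "open S" "bounded_linear l" "Ck_on k S f"
  shows "Ck_on k S (\<lambda>x. l (f x))" using assms(3)
proof (induction k arbitrary: f)
  case 0
  then show ?case using assms(2) by (auto intro: bounded_linear.continuous_on)
next
  case (Suc k)
  have "((\<lambda>x. l (f x)) has_derivative (\<lambda>v. l (Fd f x v))) (at x)"
    if "x \<in> S" for x using bounded_linear.has_derivative[OF assms(2) Ck_on_has_derivative[OF Suc.prems that]] .
  from Ck_on_Suc_iff[OF assms(1) this] show ?case using Suc by auto
qed

text \<open>The product rule returns two products of the same kind with one factor differentiated,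
  hence the induction over both factors at once.\<close>

lemma Ck_on_bounded_bilinear:
  assumes "open S" "bounded_bilinear b" "Ck_on k S f" "Ck_on k S g"
  shows "Ck_on k S (\<lambda>x. b (f x) (g x))" using assms(3,4)
proof (induction k arbitrary: f g)
  case 0
  then show ?case using assms(2) by (auto intro: bounded_bilinear.continuous_on)
next
  case (Suc k)
  have "((\<lambda>x. b (f x) (g x)) has_derivative (\<lambda>v. b (f x) (Fd g x v) + b (Fd f x v) (g x))) (at x)" if "x \<in> S" for x
    using bounded_bilinear.FDERIV[OF assms(2) Ck_on_has_derivative[OF Suc.prems(1) that] Ck_on_has_derivative[OF Suc.prems(2) that]] .
  from Ck_on_Suc_iff[OF assms(1) this] show ?case
    using Suc Ck_on_SucD[OF Suc.prems(1)] Ck_on_SucD[OF Suc.prems(2)] by (auto intro!: Ck_on_add[OF assms(1)])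
qed

lemmas Ck_on_mult = Ck_on_bounded_bilinear[OF _ bounded_bilinear_mult]
lemmas Ck_on_inner = Ck_on_bounded_bilinear[OF _ bounded_bilinear_inner]

lemma Ck_on_sum:
  assumes "open S" "\<And>i. i \<in> I \<Longrightarrow> Ck_on k S (f i)"
  shows "Ck_on k S (\<lambda>x. \<Sum>i\<in>I. f i x)" using assms(2)
  by (induction I rule: infinite_finite_induct) (auto intro: Ck_on_const Ck_on_add[OF assms(1)])

lemma Ck_on_prod:
  fixes f :: "'i \<Rightarrow> 'a::real_normed_vector \<Rightarrow> 'b::real_normed_field"
  assumes "open S" "\<And>i. i \<in> I \<Longrightarrow> Ck_on k S (f i)"
  shows "Ck_on k S (\<lambda>x. \<Prod>i\<in>I. f i x)" using assms(2)
  by (induction I rule: infinite_finite_induct) (auto intro: Ck_on_const Ck_on_mult[OF assms(1)])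

lemma Ck_on_inverse:
  fixes f :: "'a::real_normed_vector \<Rightarrow> 'b::real_normed_field"
  assumes "open S" "Ck_on k S f" "\<And>x. x \<in> S \<Longrightarrow> f x \<noteq> 0"
  shows "Ck_on k S (\<lambda>x. inverse (f x))" using assms(2)
proof (induction k)
  case 0
  then show ?case using assms by (auto intro: continuous_on_inverse)
next
  case (Suc k)
  have "((\<lambda>x. inverse (f x)) has_derivative (\<lambda>v. - (inverse (f x) * Fd f x v * inverse (f x)))) (at x)"
    if "x \<in> S" for x using Deriv.has_derivative_inverse[OF assms(3)[OF that] Ck_on_has_derivative[OF Suc.prems that]] .
  from Ck_on_Suc_iff[OF assms(1) this] show ?case using Suc Ck_on_SucD[OF Suc.prems]
    by (auto intro!: Ck_on_mult Ck_on_bounded_linear[OF _ bounded_linear_minus[OF bounded_linear_ident]] assms(1))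
qed

text \<open>No induction is required: the derivative is a product with \<open>inverse (f x)\<close>,
  which the previous rules cover.\<close>

lemma Ck_on_ln:
  fixes f :: "'a::real_normed_vector \<Rightarrow> real"
  assumes "open S" "Ck_on k S f" "\<And>x. x \<in> S \<Longrightarrow> f x > 0"
  shows "Ck_on k S (\<lambda>x. ln (f x))"
proof (cases k)
  case 0
  have "\<forall>x\<in>S. f x \<noteq> 0" using assms(3) by force
  then show ?thesis using assms 0 by (auto intro!: continuous_on_ln)
next
  case (Suc k')
  have "((\<lambda>x. ln (f x)) has_derivative (\<lambda>v. Fd f x v * inverse (f x))) (at x)" if "x \<in> S" for x
  proof -
    have "((\<lambda>x. ln (f x)) has_derivative (*) (inverse (f x)) \<circ> Fd f x) (at x)"
      using diff_chain_at[OF Ck_on_has_derivative[of k' S f x], of ln "(*) (inverse (f x))"]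
        DERIV_ln[OF assms(3)[OF that]] assms(2) Suc that by (auto simp: has_field_derivative_def o_def)
    then show ?thesis by (simp add: o_def mult.commute)
  qed
  from Ck_on_Suc_iff[OF assms(1) this] show ?thesis using Suc assms Ck_on_SucD[of k' S f]
    by (auto intro!: Ck_on_mult Ck_on_inverse simp: less_imp_neq[symmetric] dest: less_imp_neq)
qed

section \<open>Holomorphic functions and maps of several variables\<close>

lemma cvec_expand: "(v::complex^'n) = (\<Sum>k\<in>UNIV. Re (v$k) *\<^sub>R axis k 1 + Im (v$k) *\<^sub>R axis k \<i>)"
proof -
  have "(\<Sum>k\<in>UNIV. Re (v$k) *\<^sub>R axis k 1 + Im (v$k) *\<^sub>R axis k \<i>) $ i = v $ i" for i
  proof -
    have "(\<Sum>k\<in>UNIV. Re (v$k) *\<^sub>R axis k 1 + Im (v$k) *\<^sub>R axis k \<i>) $ i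
      = (\<Sum>k\<in>UNIV. if k = i then v $ k else 0)" unfolding sum_component by (intro sum.cong) (auto simp: axis_def complex_eq_iff)
    then show ?thesis by simp
  qed
  then show ?thesis by (simp add: vec_eq_iff)
qed

text \<open>The differential is the sum of its (1,0) and (0,1) parts: expand \<open>v\<close> in the
  real basis \<open>axis k 1\<close>, \<open>axis k \<i>\<close> and collect the Wirtinger
  derivatives.\<close>

lemma frechet_wirtinger:
  assumes "f differentiable (at x)"
  shows "Fd f x v = (\<Sum>k\<in>UNIV. d_z k f x * v$k + d_zbar k f x * cnj (v$k))"
proof -
  let ?D = "Fd f x"
  have l: "linear ?D" using assms by (rule linear_frechet_derivative)
  have "?D v = (\<Sum>k\<in>UNIV. Re (v$k) *\<^sub>R ?D (axis k 1) + Im (v$k) *\<^sub>R ?D (axis k \<i>))"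
    by (subst cvec_expand) (simp add: linear_sum[OF l] linear_add[OF l] linear_scale[OF l])
  also have "\<dots> = (\<Sum>k\<in>UNIV. d_z k f x * v$k + d_zbar k f x * cnj (v$k))"
    by (rule sum.cong) (auto simp: d_z_def d_zbar_def complex_eq_iff field_simps)
  finally show ?thesis .
qed

lemma holo_on_has_derivative:
  assumes "holo_on S f" "x \<in> S"
  shows "(f has_derivative (\<lambda>v. \<Sum>k\<in>UNIV. d_z k f x * v$k)) (at x)"
proof -
  have "f differentiable at x" "\<And>j. d_zbar j f x = 0" using assms by (auto simp: holo_on_def)
  then have "Fd f x = (\<lambda>v. \<Sum>k\<in>UNIV. d_z k f x * v$k)" using frechet_wirtinger[of f x] by auto
  then show ?thesis using \<open>f differentiable at x\<close> by (metis frechet_derivative_works)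
qed

lemma has_derivative_complex_linear:
  assumes "(f has_derivative f') (at x)" "\<And>j. f' (axis j \<i>) = \<i> * f' (axis j 1)"
  shows "f differentiable (at x)" "d_zbar j f x = 0" "d_z j f x = f' (axis j 1)" using assms frechet_derivative_at[OF assms(1)]
  by (auto simp: d_zbar_def d_z_def differentiable_def algebra_simps)

lemma holo_onI:
  assumes "\<And>x. x \<in> S \<Longrightarrow> \<exists>f'. (f has_derivative f') (at x) \<and> (\<forall>j. f' (axis j \<i>) = \<i> * f' (axis j 1))"
  shows "holo_on S f" unfolding holo_on_def using assms has_derivative_complex_linear by metis

lemma holo_on_subset: "holo_on S f \<Longrightarrow> T \<subseteq> S \<Longrightarrow> holo_on T f" by (auto simp: holo_on_def)

lemma holo_on_continuous: "holo_on S f \<Longrightarrow> continuous_on S f"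
  by (auto simp: holo_on_def intro!: continuous_at_imp_continuous_on differentiable_imp_continuous_within)

lemma holo_on_cong:
  assumes "open S" "\<And>x. x \<in> S \<Longrightarrow> f x = g x" "holo_on S f"
  shows "holo_on S g"
proof (rule holo_onI)
  fix x assume x: "x \<in> S"
  have "(g has_derivative (\<lambda>v. \<Sum>k\<in>UNIV. d_z k f x * v$k)) (at x)"
    using has_derivative_transform_within_open[OF holo_on_has_derivative[OF assms(3) x] assms(1) x] assms(2) by auto
  moreover have "(\<Sum>k\<in>UNIV. d_z k f x * (axis j \<i> :: complex^'a)$k) = \<i> * (\<Sum>k\<in>UNIV. d_z k f x * (axis j 1 :: complex^'a)$k)" for j
    by (simp add: axis_def if_distrib cong: if_cong)
  ultimately show "\<exists>f'. (g has_derivative f') (at x) \<and> (\<forall>j. f' (axis j \<i>) = \<i> * f' (axis j 1))" by blast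
qed

text \<open>A circle parametrised over \<open>{0..1}\<close>, so that Cauchy's formula becomes an
  ordinary integral depending on parameters.\<close>

definition circ :: "real \<Rightarrow> real \<Rightarrow> complex" where
  "circ r t = of_real r * exp (2 * of_real pi * \<i> * of_real t)"

lemma norm_circ: "r \<ge> 0 \<Longrightarrow> cmod (circ r t) = r" by (simp add: circ_def norm_mult)

lemma circ_nonzero: "r > 0 \<Longrightarrow> circ r t \<noteq> 0" by (simp add: circ_def)

lemma continuous_on_circ [continuous_intros]: "continuous_on S f \<Longrightarrow> continuous_on S (\<lambda>x. circ r (f x))"
  unfolding circ_def by (intro continuous_intros)

text \<open>Cauchy's formula for the derivative, applied in the \<open>j\<close>-th variable alone.
  Since \<open>holo_on\<close> asks only for pointwise complex differentiability, this integral is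
  the source of all higher regularity.\<close>

lemma holo_on_d_z_integral:
  fixes f :: "complex^'n::finite \<Rightarrow> complex"
  assumes "holo_on S f" "open S" "0 < r" "\<And>\<zeta>. cmod \<zeta> \<le> r \<Longrightarrow> x + axis j \<zeta> \<in> S"
  shows "d_z j f x = integral {0..1} (\<lambda>t. f (x + axis j (circ r t)) / circ r t)"
proof -
  let ?g = "\<lambda>\<zeta>. f (x + axis j \<zeta>)"
  have ax: "((\<lambda>\<zeta>. x + axis j \<zeta>) has_derivative (\<lambda>h. axis j h)) (at \<zeta>)" for \<zeta> :: complex
  proof -
    have "bounded_linear (\<lambda>h::complex. axis j h :: complex^'n)"
      unfolding linear_conv_bounded_linear[symmetric] by (intro linearI) (auto simp: axis_def vec_eq_iff)
    then show ?thesis by (auto intro!: derivative_eq_intros bounded_linear_imp_has_derivative)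
  qed
  have d: "(?g has_field_derivative d_z j f (x + axis j \<zeta>)) (at \<zeta>)" if "cmod \<zeta> \<le> r" for \<zeta>
  proof -
    have "(?g has_derivative (\<lambda>h. \<Sum>k\<in>UNIV. d_z k f (x + axis j \<zeta>) * axis j h $ k)) (at \<zeta>)"
      using diff_chain_at[OF ax holo_on_has_derivative[OF assms(1) assms(4)[OF that]]] by (simp add: o_def)
    moreover have "(\<Sum>k\<in>UNIV. d_z k f (x + axis j \<zeta>) * axis j h $ k) = d_z j f (x + axis j \<zeta>) * h" for h
      by (simp add: axis_def if_distrib cong: if_cong)
    ultimately show ?thesis by (simp add: has_field_derivative_def)
  qed
  have "(?g has_field_derivative (1 / (2 * of_real pi * \<i>) * contour_integral (circlepath 0 r) (\<lambda>u. ?g u / (u - 0)^2))) (at 0)"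
  proof (rule Cauchy_derivative_integral_circlepath)
    show "continuous_on (cball 0 r) ?g"
    proof (intro continuous_at_imp_continuous_on ballI)
      fix \<zeta> assume "\<zeta> \<in> cball (0::complex) r"
      then have "cmod \<zeta> \<le> r" by simp
      from DERIV_isCont[OF d[OF this]] show "isCont ?g \<zeta>" .
    qed
    show "?g holomorphic_on ball 0 r" unfolding holomorphic_on_def field_differentiable_def
    proof
      fix \<zeta> assume "\<zeta> \<in> ball (0::complex) r"
      then have "cmod \<zeta> \<le> r" by simp
      from has_field_derivative_at_within[OF d[OF this]]
      have "(?g has_field_derivative d_z j f (x + axis j \<zeta>)) (at \<zeta> within ball 0 r)" .
      then show "\<exists>f'. (?g has_field_derivative f') (at \<zeta> within ball 0 r)" ..
    qed
  qed (use assms(3) in simp)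
  moreover have "x + axis j 0 = x" by (simp add: axis_def vec_eq_iff)
  then have "(?g has_field_derivative d_z j f x) (at 0)" using d[of 0] assms(3) by (simp only: norm_zero less_imp_le)
  ultimately have "d_z j f x = 1 / (2 * of_real pi * \<i>) * contour_integral (circlepath 0 r) (\<lambda>u. ?g u / (u - 0)^2)"
    using DERIV_unique by blast
  \<comment> \<open>The velocity 2 pi i \<open>circ r t\<close> of the circle cancels the constant
    in front and one of the two powers in the denominator.\<close>
  also have "\<dots> = integral {0..1} (\<lambda>t. 1 / (2 * of_real pi * \<i>) * (?g (circ r t) / (circ r t)^2 * (2 * of_real pi * \<i> * circ r t)))"
    unfolding contour_integral_integral vector_derivative_circlepath
    by (subst integral_mult_right[symmetric]) (simp add: circlepath circ_def mult_ac)
  also have "\<dots> = integral {0..1} (\<lambda>t. ?g (circ r t) / circ r t)"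
    using circ_nonzero[OF assms(3)] by (intro integral_cong) (simp add: field_simps power2_eq_square)
  finally show ?thesis .
qed

lemma norm_axis_eq [simp]: "norm (axis j z) = norm (z::'a::real_normed_vector)"
  by (simp add: norm_vec_def L2_set_def axis_def if_distrib[of norm] if_distrib[of "\<lambda>x. x\<^sup>2"] cong: if_cong)

lemma bounded_linear_axis: "bounded_linear (\<lambda>h::complex. axis j h :: complex^'n)"
  unfolding linear_conv_bounded_linear[symmetric] by (intro linearI) (auto simp: axis_def vec_eq_iff)

text \<open>One radius has to serve all centres near \<open>x0\<close>, so that the integral formula
  can be used with the centre as a parameter.\<close>

lemma holo_on_circle:
  fixes x0 :: "complex^'n::finite"
  assumes "open S" "x0 \<in> S"
  obtains r where "0 < r" "ball x0 r \<subseteq> S" "\<And>x \<zeta> j. x \<in> ball x0 r \<Longrightarrow> cmod \<zeta> \<le> r \<Longrightarrow> x + axis j \<zeta> \<in> S"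
proof -
  obtain e where e: "e > 0" "ball x0 e \<subseteq> S" using assms by (meson openE)
  have "x + axis j \<zeta> \<in> S" if "x \<in> ball x0 (e/2)" "cmod \<zeta> \<le> e/2" for x \<zeta> j
  proof -
    have "dist x0 (x + axis j \<zeta>) \<le> dist x0 x + dist x (x + axis j \<zeta>)" by (rule dist_triangle)
    also have "dist x (x + axis j \<zeta>) = cmod \<zeta>" by (simp add: dist_norm)
    finally have "dist x0 (x + axis j \<zeta>) < e" using that by simp
    then show ?thesis using e by auto
  qed
  moreover have "ball x0 (e/2) \<subseteq> S" using e by auto
  ultimately show thesis using e(1) by (intro that[of "e/2"]) auto
qed

lemma continuous_on_d_z:
  fixes f :: "complex^'n::finite \<Rightarrow> complex"
  assumes "holo_on S f" "open S"
  shows "continuous_on S (d_z j f)"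
proof (rule continuous_at_imp_continuous_on, rule ballI)
  fix x0 assume "x0 \<in> S"
  then obtain r where r: "0 < r" "ball x0 r \<subseteq> S" "\<And>x \<zeta> j. x \<in> ball x0 r \<Longrightarrow> cmod \<zeta> \<le> r \<Longrightarrow> x + axis j \<zeta> \<in> S"
    using holo_on_circle assms(2) by blast
  let ?e = "circ r"
  have e: "cmod (?e t) = r" for t using r(1) by (simp add: norm_circ)
  have e0: "?e t \<noteq> 0" for t using r(1) by (rule circ_nonzero)
  have "continuous_on (ball x0 r \<times> cbox 0 1) (\<lambda>(x,t). f (x + axis j (?e t)) / ?e t)" unfolding split_beta
  proof (intro continuous_intros continuous_on_compose2[OF holo_on_continuous[OF assms(1)]]
    bounded_linear.continuous_on[OF bounded_linear_axis])
    show "(\<lambda>p. fst p + axis j (?e (snd p))) ` (ball x0 r \<times> cbox 0 1) \<subseteq> S" using r(3) e by (auto simp: order_eq_refl)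
  qed (use e0 in auto)
  then have "continuous_on (ball x0 r) (\<lambda>x. integral (cbox 0 1) (\<lambda>t. f (x + axis j (?e t)) / ?e t))"
    by (rule integral_continuous_on_param)
  moreover have "d_z j f x = integral (cbox 0 1) (\<lambda>t. f (x + axis j (?e t)) / ?e t)" if "x \<in> ball x0 r" for x
    using holo_on_d_z_integral[OF assms r(1), of x j] r(3)[OF that] by simp
  ultimately have "continuous_on (ball x0 r) (d_z j f)" using continuous_on_eq by fastforce
  then show "isCont (d_z j f) x0" using r(1) by (simp add: continuous_on_eq_continuous_at)
qed

text \<open>Differentiation under the integral sign in Cauchy's formula. The derivative of the
  integrand involves the partial derivatives of \<open>f\<close>, so their continuity had to be
  established before; complex linearity passes through the integral.\<close>

lemma holo_on_d_z:
  fixes f :: "complex^'n::finite \<Rightarrow> complex"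
  assumes "holo_on S f" "open S"
  shows "holo_on S (d_z j f)"
proof (rule holo_onI)
  fix x0 assume "x0 \<in> S"
  then obtain r where r: "0 < r" "ball x0 r \<subseteq> S" "\<And>x \<zeta> j. x \<in> ball x0 r \<Longrightarrow> cmod \<zeta> \<le> r \<Longrightarrow> x + axis j \<zeta> \<in> S"
    using holo_on_circle assms(2) by blast
  let ?B = "ball x0 r"
  let ?e = "circ r"
  have e: "cmod (?e t) = r" for t using r(1) by (simp add: norm_circ)
  have e0: "?e t \<noteq> 0" for t using r(1) by (rule circ_nonzero)
  have im: "(\<lambda>p. fst p + axis j (?e (snd p))) ` (?B \<times> cbox 0 1) \<subseteq> S" using r(3) e by (auto simp: order_eq_refl)
  let ?D = "\<lambda>x t v. (\<Sum>k\<in>UNIV. d_z k f (x + axis j (?e t)) * v $ k) / ?e t"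
  have bl: "bounded_linear (?D x t)" for x t unfolding divide_inverse
    by (intro bounded_linear_sum bounded_linear_mult_const bounded_linear_const_mult bounded_linear_vec_nth)
  \<comment> \<open>The derivative of the integrand as a bounded linear operator that depends
    continuously on both parameters, the form in which \<open>leibniz_rule\<close> takes it.\<close>
  define fx where "fx = (\<lambda>x t. Blinfun (?D x t))"
  have fx: "blinfun_apply (fx x t) = ?D x t" for x t unfolding fx_def by (rule bounded_linear_Blinfun_apply[OF bl])
  have cfx: "continuous_on (?B \<times> cbox 0 1) (\<lambda>(x,t). fx x t)" unfolding split_beta
  proof (rule continuous_on_blinfun_componentwise)
    fix i :: "complex^'n"
    show "continuous_on (?B \<times> cbox 0 1) (\<lambda>p. fx (fst p) (snd p) i)" unfolding fx
      by (intro continuous_intros continuous_on_compose2[OF continuous_on_d_z[OF assms]]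
        bounded_linear.continuous_on[OF bounded_linear_axis] im) (use e0 in auto)
  qed
  have der: "((\<lambda>x. integral (cbox 0 1) (\<lambda>t. f (x + axis j (?e t)) / ?e t)) has_derivative
    integral (cbox 0 1) (fx x0)) (at x0 within ?B)"
  proof (rule leibniz_rule)
    fix x and t :: real assume x: "x \<in> ?B" "t \<in> cbox 0 1"
    have "((\<lambda>x. x + axis j (?e t)) has_derivative (\<lambda>h. h)) (at x)" by (auto intro!: derivative_eq_intros)
    from diff_chain_at[OF this holo_on_has_derivative[OF assms(1)]] r(3)[OF x(1)] e
    have "((\<lambda>x. f (x + axis j (?e t))) has_derivative (\<lambda>v. \<Sum>k\<in>UNIV. d_z k f (x + axis j (?e t)) * v$k)) (at x)"
      by (simp add: o_def)
    then have "((\<lambda>x. f (x + axis j (?e t)) / ?e t) has_derivative ?D x t) (at x)"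
      unfolding divide_inverse by (rule has_derivative_mult_left)
    then show "((\<lambda>x. f (x + axis j (?e t)) / ?e t) has_derivative blinfun_apply (fx x t)) (at x within ?B)"
      unfolding fx by (rule has_derivative_at_withinI)
  next
    fix x assume x: "x \<in> ?B"
    show "(\<lambda>t. f (x + axis j (?e t)) / ?e t) integrable_on cbox 0 1"
    proof (intro integrable_continuous continuous_intros continuous_on_compose2[OF holo_on_continuous[OF assms(1)]]
      bounded_linear.continuous_on[OF bounded_linear_axis])
      show "(\<lambda>t. x + axis j (?e t)) ` cbox 0 1 \<subseteq> S" using r(3)[OF x] e by auto
    qed (use e0 in auto)
  qed (use r(1) cfx in auto)
  have int: "fx x0 integrable_on cbox 0 1"
  proof (rule integrable_continuous)
    have "continuous_on (cbox 0 1) (\<lambda>t. (\<lambda>(x,t). fx x t) (x0,t))"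
      using r(1) by (intro continuous_on_compose2[OF cfx] continuous_intros) auto
    then show "continuous_on (cbox 0 1) (fx x0)" by simp
  qed
  have dz: "d_z j f x = integral (cbox 0 1) (\<lambda>t. f (x + axis j (?e t)) / ?e t)" if "x \<in> ?B" for x
    using holo_on_d_z_integral[OF assms r(1), of x j] r(3)[OF that] by simp
  have "(d_z j f has_derivative integral (cbox 0 1) (fx x0)) (at x0)"
  proof (rule has_derivative_transform_within_open[OF _ open_ball[of x0 r]])
    show "((\<lambda>x. integral (cbox 0 1) (\<lambda>t. f (x + axis j (?e t)) / ?e t)) has_derivative
      integral (cbox 0 1) (fx x0)) (at x0)" using der r(1) by (simp add: at_within_open[OF _ open_ball])
  qed (use dz r(1) in auto)
  moreover have "integral (cbox 0 1) (fx x0) (axis i \<i>) = \<i> * integral (cbox 0 1) (fx x0) (axis i 1)" for i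
  proof -
    have "?D x0 t (axis i \<i>) = \<i> * ?D x0 t (axis i 1)" for t by (simp add: axis_def if_distrib cong: if_cong)
    then show ?thesis unfolding blinfun_apply_integral[OF int] fx by (simp only: integral_mult_right)
  qed
  ultimately show "\<exists>f'. (d_z j f has_derivative f') (at x0) \<and> (\<forall>i. f' (axis i \<i>) = \<i> * f' (axis i 1))" by blast
qed

lemma holo_on_sum_mult:
  fixes f :: "'i \<Rightarrow> complex^'n::finite \<Rightarrow> complex"
  assumes "\<And>k. k \<in> I \<Longrightarrow> holo_on S (f k)"
  shows "holo_on S (\<lambda>x. \<Sum>k\<in>I. f k x * c k)"
proof (rule holo_onI)
  fix x assume x: "x \<in> S"
  have "((\<lambda>x. \<Sum>k\<in>I. f k x * c k) has_derivative (\<lambda>v. \<Sum>k\<in>I. (\<Sum>l\<in>UNIV. d_z l (f k) x * v$l) * c k)) (at x)"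
    using x assms by (intro has_derivative_sum has_derivative_mult_left holo_on_has_derivative)
  moreover have *: "(\<Sum>l\<in>UNIV. d_z l (f k) x * axis j \<i> $ l) = \<i> * (\<Sum>l\<in>UNIV. d_z l (f k) x * axis j 1 $ l)" for j k
    by (simp add: axis_def if_distrib cong: if_cong)
  then have "(\<Sum>k\<in>I. (\<Sum>l\<in>UNIV. d_z l (f k) x * axis j \<i> $ l) * c k) =
    \<i> * (\<Sum>k\<in>I. (\<Sum>l\<in>UNIV. d_z l (f k) x * axis j 1 $ l) * c k)" for j
    by (simp only: sum_distrib_left[of _ _ I] mult.assoc)
  ultimately show "\<exists>f'. ((\<lambda>x. \<Sum>k\<in>I. f k x * c k) has_derivative f') (at x) \<and> (\<forall>j. f' (axis j \<i>) = \<i> * f' (axis j 1))"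
    by blast
qed

lemma has_derivative_vecI:
  fixes f :: "'a::euclidean_space \<Rightarrow> 'b::euclidean_space^'n::finite"
  assumes "\<And>i. ((\<lambda>x. f x $ i) has_derivative (\<lambda>v. f' v $ i)) (at a within S)"
  shows "(f has_derivative f') (at a within S)" unfolding has_derivative_componentwise_within[of f]
  using assms by (auto simp: Basis_vec_def inner_axis intro!: has_derivative_inner_left)

lemma holo_map_has_derivative:
  fixes f :: "complex^'n::finite \<Rightarrow> complex^'n"
  assumes "holo_map_on S f" "x \<in> S"
  shows "(f has_derivative (\<lambda>v. jacobian f x *v v)) (at x)"
proof (rule has_derivative_vecI)
  fix i show "((\<lambda>x. f x $ i) has_derivative (\<lambda>v. (jacobian f x *v v) $ i)) (at x)"
    using holo_on_has_derivative[of S "\<lambda>x. f x $ i" x] assms by (simp add: holo_map_on_def jacobian_def matrix_vector_mult_def)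
qed

lemma matrix_vector_mult_i: "A *v axis j \<i> = \<i> *s (A *v axis j (1::complex))"
  by (simp add: vec_eq_iff matrix_vector_mult_def axis_def if_distrib cong: if_cong)

lemma matrix_vector_mult_scale: "A *v (c *s v) = c *s (A *v (v::'a::comm_semiring_1^'n))"
  by (simp add: vec_eq_iff matrix_vector_mult_def sum_distrib_left mult_ac)

lemma holo_map_onI:
  fixes f :: "complex^'n::finite \<Rightarrow> complex^'n"
  assumes "\<And>x. x \<in> S \<Longrightarrow> \<exists>f'. (f has_derivative f') (at x) \<and> (\<forall>v. f' (\<i> *s v) = \<i> *s f' v)"
  shows "holo_map_on S f" unfolding holo_map_on_def
proof (intro allI holo_onI)
  fix i x assume "x \<in> S"
  then obtain f' where f': "(f has_derivative f') (at x)" "\<And>v. f' (\<i> *s v) = \<i> *s f' v" using assms by blast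
  have "((\<lambda>x. f x $ i) has_derivative (\<lambda>v. f' v $ i)) (at x)"
    using bounded_linear.has_derivative[OF bounded_linear_vec_nth f'(1)] .
  moreover have "axis j \<i> = \<i> *s (axis j 1 :: complex^'n)" for j by (simp add: vec_eq_iff axis_def)
  ultimately show "\<exists>f'. ((\<lambda>x. f x $ i) has_derivative f') (at x) \<and> (\<forall>j. f' (axis j \<i>) = \<i> * f' (axis j 1))"
    using f'(2) by (intro exI[of _ "\<lambda>v. f' v $ i"]) auto
qed

text \<open>A complex linear derivative can only be the Jacobian, so Jacobians are read off from the
  chain rule.\<close>

lemma jacobian_unique:
  fixes f :: "complex^'n::finite \<Rightarrow> complex^'n"
  assumes "(f has_derivative (\<lambda>v. A *v v)) (at x)"
  shows "jacobian f x = A"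
proof -
  have "d_z j (\<lambda>y. f y $ i) x = A $ i $ j" for i j
  proof -
    have "((\<lambda>x. f x $ i) has_derivative (\<lambda>v. (A *v v) $ i)) (at x)"
      using bounded_linear.has_derivative[OF bounded_linear_vec_nth assms] .
    from has_derivative_complex_linear(3)[OF this, of j]
    have "d_z j (\<lambda>y. f y $ i) x = (A *v axis j 1) $ i" by (simp add: matrix_vector_mult_i)
    then show ?thesis by (simp add: matrix_vector_mult_def axis_def if_distrib cong: if_cong)
  qed
  then show ?thesis by (simp add: jacobian_def vec_eq_iff)
qed

lemma holo_map_on_compose:
  fixes f g :: "complex^'n::finite \<Rightarrow> complex^'n"
  assumes "holo_map_on S f" "holo_map_on T g" "f ` S \<subseteq> T"
  shows "holo_map_on S (g \<circ> f)" "x \<in> S \<Longrightarrow> jacobian (g \<circ> f) x = jacobian g (f x) ** jacobian f x"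
proof -
  have d: "(g \<circ> f has_derivative (\<lambda>v. (jacobian g (f x) ** jacobian f x) *v v)) (at x)" if "x \<in> S" for x
  proof -
    have "f x \<in> T" using that assms(3) by blast
    from diff_chain_at[OF holo_map_has_derivative[OF assms(1) that] holo_map_has_derivative[OF assms(2) this]]
    show ?thesis by (simp add: o_def matrix_vector_mul_assoc)
  qed
  show "holo_map_on S (g \<circ> f)" by (rule holo_map_onI) (use d in \<open>fastforce simp: matrix_vector_mult_scale\<close>)
  show "x \<in> S \<Longrightarrow> jacobian (g \<circ> f) x = jacobian g (f x) ** jacobian f x" using d jacobian_unique by blast
qed

text \<open>The derivative of \<open>f \<circ> l\<close> in a fixed direction is again a holomorphic
  map composed with \<open>l\<close>, so the induction closes. It is applied to the inclusion
  \<open>cvec\<close> of the real points.\<close>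

lemma Ck_on_holo_map_linear:
  fixes f :: "complex^'n::finite \<Rightarrow> complex^'n" and l :: "'a::euclidean_space \<Rightarrow> complex^'n"
  assumes "holo_map_on S f" "open S" "bounded_linear l" "open T" "l ` T \<subseteq> S"
  shows "Ck_on k T (\<lambda>x. f (l x))" using assms(1)
proof (induction k arbitrary: f)
  case 0
  have "continuous_on S f" by (intro continuous_at_imp_continuous_on ballI)
    (rule has_derivative_continuous[OF holo_map_has_derivative[OF 0]])
  then have "continuous_on T (\<lambda>x. f (l x))"
    using continuous_on_compose2[of S f T l] linear_continuous_on[OF assms(3)] assms(5) by blast
  then show ?case by simp
next
  case (Suc k)
  have "((\<lambda>x. f (l x)) has_derivative (\<lambda>v. jacobian f (l x) *v l v)) (at x)" if "x \<in> T" for x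
  proof -
    have "l x \<in> S" using assms(5) that by blast
    from diff_chain_at[OF bounded_linear_imp_has_derivative[OF assms(3)] holo_map_has_derivative[OF Suc.prems this]]
    show ?thesis by (simp add: o_def)
  qed
  moreover have "holo_map_on S (\<lambda>z. jacobian f z *v w)" for w unfolding holo_map_on_def matrix_vector_mult_def jacobian_def
    using Suc.prems assms(2) by (auto intro!: holo_on_sum_mult holo_on_d_z simp: holo_map_on_def)
  ultimately show ?case using Suc.IH Ck_on_Suc_iff[OF assms(4), of "\<lambda>x. f (l x)" "\<lambda>x v. jacobian f (l x) *v l v"] by blast
qed

lemma Ck_on_holo:
  fixes f :: "complex^'n::finite \<Rightarrow> complex"
  assumes "holo_on S f" "open S"
  shows "Ck_on k S f" using assms(1)
proof (induction k arbitrary: f)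
  case 0
  then show ?case by (simp add: holo_on_continuous)
next
  case (Suc k)
  have "Ck_on k S (\<lambda>x. \<Sum>k\<in>UNIV. d_z k f x * v $ k)" for v
    using Suc.prems assms(2) by (intro Suc.IH holo_on_sum_mult holo_on_d_z)
  then show ?case using Ck_on_Suc_iff[OF assms(2) holo_on_has_derivative[OF Suc.prems]] by blast
qed

text \<open>The real inverse function theorem applies because Jacobians are continuous by
  \<open>continuous_on_d_z\<close>; the derivative of the inverse is the inverse of a complex linear
  map, hence complex linear.\<close>

lemma holo_local_inverse:
  fixes f :: "complex^'n::finite \<Rightarrow> complex^'n"
  assumes "open S" "holo_map_on S f" "a \<in> S" "invertible (jacobian f a)"
  obtains U V g where "open U" "a \<in> U" "U \<subseteq> S" "open V" "homeomorphism U V f g" "holo_map_on V g"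
proof -
  define f' where "f' x = Blinfun ((*v) (jacobian f x))" for x
  have bl: "bounded_linear ((*v) (jacobian f x))" for x using matrix_vector_mul_linear linear_conv_bounded_linear by blast
  have f': "blinfun_apply (f' x) = (*v) (jacobian f x)" for x unfolding f'_def by (rule bounded_linear_Blinfun_apply[OF bl])
  obtain B where B: "B ** jacobian f a = mat 1" using assms(4) by (auto simp: invertible_def)
  have blB: "bounded_linear ((*v) B)" for x using matrix_vector_mul_linear linear_conv_bounded_linear by blast
  have contf': "continuous_on S f'"
  proof (rule continuous_on_blinfun_componentwise)
    fix i :: "complex^'n"
    have "continuous_on S (\<lambda>x. \<chi> k. \<Sum>j\<in>UNIV. d_z j (\<lambda>y. f y $ k) x * i $ j)"
      using assms(1,2) by (intro continuous_on_vec_lambda continuous_intros continuous_on_d_z) (auto simp: holo_map_on_def)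
    then show "continuous_on S (\<lambda>x. f' x i)" by (simp add: f' matrix_vector_mult_def jacobian_def)
  qed
  have inv: "Blinfun ((*v) B) o\<^sub>L f' a = id_blinfun"
    by (rule blinfun_eqI) (simp add: f' bounded_linear_Blinfun_apply[OF blB] matrix_vector_mul_assoc B)
  obtain U V g g' where UV: "open U" "U \<subseteq> S" "a \<in> U" "open V" "f a \<in> V" "homeomorphism U V f g"
    "\<And>y. y \<in> V \<Longrightarrow> (g has_derivative (g' y)) (at y)"
    "\<And>y. y \<in> V \<Longrightarrow> g' y = inv (blinfun_apply (f'(g y)))"
    "\<And>y. y \<in> V \<Longrightarrow> bij (blinfun_apply (f'(g y)))"
    using inverse_function_theorem[OF assms(1) _ contf' assms(3) inv, of f]
      holo_map_has_derivative[OF assms(2)] unfolding f' by metis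
  have "g' y (\<i> *s v) = \<i> *s g' y v" if "y \<in> V" for y v
  proof -
    let ?h = "(*v) (jacobian f (g y))"
    have b: "bij ?h" using UV(9)[OF that] by (simp add: f')
    have "?h (\<i> *s inv ?h v) = \<i> *s v" using surj_f_inv_f[OF bij_is_surj[OF b]] by (simp add: matrix_vector_mult_scale)
    then have "inv ?h (\<i> *s v) = \<i> *s inv ?h v" using inv_f_eq[OF bij_is_inj[OF b]] by blast
    then show ?thesis using UV(8)[OF that] by (simp add: f')
  qed
  then have "holo_map_on V g" using UV(7) by (intro holo_map_onI) blast
  then show thesis using that UV by blast
qed

section \<open>Pluriharmonic functions\<close>

lemma d_z_of_real_cnj:
  assumes "(\<lambda>x. complex_of_real (v x)) differentiable (at z)"
  shows "d_z k (\<lambda>x. complex_of_real (v x)) z = cnj (d_zbar k (\<lambda>x. complex_of_real (v x)) z)"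
proof -
  let ?u = "\<lambda>x. complex_of_real (v x)"
  let ?D = "Fd ?u z"
  have "(?u has_derivative ?D) (at z)" using assms by (simp add: frechet_derivative_works)
  then have "((\<lambda>x. cnj (?u x)) has_derivative (\<lambda>h. cnj (?D h))) (at z)"
    by (rule bounded_linear.has_derivative[OF bounded_linear_cnj])
  then have "(\<lambda>h. cnj (?D h)) = ?D" using frechet_derivative_at by fastforce
  then have "cnj (?D h) = ?D h" for h by (rule fun_cong)
  then show ?thesis by (simp add: d_z_def d_zbar_def)
qed

lemma d_zbar_cnj:
  assumes "f differentiable (at z)"
  shows "d_zbar k (\<lambda>x. cnj (f x)) z = cnj (d_z k f z)"
proof -
  let ?D = "Fd f z"
  have "(f has_derivative ?D) (at z)" using assms by (simp add: frechet_derivative_works)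
  then have "((\<lambda>x. cnj (f x)) has_derivative (\<lambda>h. cnj (?D h))) (at z)"
    by (rule bounded_linear.has_derivative[OF bounded_linear_cnj])
  then have "Fd (\<lambda>x. cnj (f x)) z = (\<lambda>h. cnj (?D h))" using frechet_derivative_at by metis
  then show ?thesis by (simp add: d_z_def d_zbar_def)
qed

text \<open>Along a complex line through the maximum, a pluriharmonic function is the real part of a
  holomorphic function, to which the maximum modulus principle applies.\<close>

lemma pluriharmonic_max:
  fixes v :: "complex^'n::finite \<Rightarrow> real"
  assumes "open S" "Ck_on 2 S (\<lambda>z. complex_of_real (v z))" "a \<in> S"
    and ph: "\<And>z j k. z \<in> S \<Longrightarrow> d_z j (d_zbar k (\<lambda>z. complex_of_real (v z))) z = 0"
    and max: "\<And>z. z \<in> S \<Longrightarrow> v z \<le> v a"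
  obtains e where "e > 0" "ball a e \<subseteq> S" "\<And>z. z \<in> ball a e \<Longrightarrow> v z = v a"
proof -
  let ?u = "\<lambda>z. complex_of_real (v z)"
  have C2: "Ck_on (Suc (Suc 0)) S ?u" using assms(2) by (simp add: numeral_2_eq_2)
  have C1: "Ck_on (Suc 0) S (\<lambda>x. Fd ?u x h)" for h using C2 by simp
  have du: "?u differentiable (at z)" if "z \<in> S" for z using C2 that by simp
  have dzb: "d_zbar k ?u differentiable (at z)" if "z \<in> S" for k z
  proof -
    have "(\<lambda>x. Fd ?u x h) differentiable (at z)" for h using C1[of h] that by simp
    then show ?thesis unfolding d_zbar_def by (intro derivative_intros) auto
  qed
  have dz: "d_z k ?u z = cnj (d_zbar k ?u z)" if "z \<in> S" for k z using d_z_of_real_cnj[OF du[OF that]] .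
  \<comment> \<open>By hypothesis every \<open>d_z j\<close> annihilates \<open>d_zbar k ?u\<close>.
    As \<open>?u\<close> is real, \<open>d_z k ?u\<close> is the conjugate of that function and
    hence holomorphic.\<close>
  have holo: "holo_on S (d_z k ?u)" for k
  proof (rule holo_on_cong[OF assms(1)])
    show "cnj (d_zbar k ?u z) = d_z k ?u z" if "z \<in> S" for z using dz[OF that] by simp
    show "holo_on S (\<lambda>z. cnj (d_zbar k ?u z))" unfolding holo_on_def
    proof (intro ballI conjI allI)
      fix z j assume z: "z \<in> S"
      show "d_zbar j (\<lambda>z. cnj (d_zbar k ?u z)) z = 0" using d_zbar_cnj[OF dzb[OF z]] ph[OF z] by simp
      show "(\<lambda>z. cnj (d_zbar k ?u z)) differentiable at z"
        using dzb[OF z] bounded_linear.has_derivative[OF bounded_linear_cnj] unfolding differentiable_def by blast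
    qed
  qed
  obtain e where e: "e > 0" "ball a e \<subseteq> S" using assms(1,3) by (meson openE)
  have "v z = v a" if z: "z \<in> ball a e" for z
  proof (cases "z = a")
    case False
    define w where "w = z - a"
    \<comment> \<open>The radius exceeds 1, so the disc contains the parameters 0 and 1 that belong
      to \<open>a\<close> and to \<open>z\<close>.\<close>
    define D where "D = ball (0::complex) (e / norm w)"
    have w: "norm w > 0" "norm w < e" using False z by (auto simp: w_def dist_norm norm_minus_commute)
    have line: "a + \<zeta> *s w \<in> S" if "\<zeta> \<in> D" for \<zeta>
    proof -
      have "norm (\<zeta> *s w) = cmod \<zeta> * norm w"
        by (simp add: norm_vec_def norm_mult L2_set_def power_mult_distrib sum_distrib_left[symmetric] real_sqrt_mult)
      also have "\<dots> < e" using that w by (simp add: D_def field_simps)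
      finally have "a + \<zeta> *s w \<in> ball a e" by (simp add: dist_norm)
      then show ?thesis using e by blast
    qed
    have dl: "((\<lambda>\<zeta>. a + \<zeta> *s w) has_derivative (\<lambda>h. h *s w)) (at \<zeta>)" for \<zeta>
    proof (rule has_derivative_vecI)
      fix i show "((\<lambda>\<zeta>. (a + \<zeta> *s w) $ i) has_derivative (\<lambda>h. (h *s w) $ i)) (at \<zeta>)"
        by (auto intro!: derivative_eq_intros)
    qed
    define \<Theta> where "\<Theta> \<zeta> = (\<Sum>k\<in>UNIV. d_z k ?u (a + \<zeta> *s w) * w $ k)" for \<zeta>
    have "\<Theta> holomorphic_on D" unfolding \<Theta>_def
    proof (intro holomorphic_intros)
      fix k
      have "((\<lambda>\<zeta>. d_z k ?u (a + \<zeta> *s w)) has_field_derivative (\<Sum>j\<in>UNIV. d_z j (d_z k ?u) (a + \<zeta> *s w) * w $ j)) (at \<zeta>)"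
        if "\<zeta> \<in> D" for \<zeta>
      proof -
        have "(\<Sum>j\<in>UNIV. d_z j (d_z k ?u) (a + \<zeta> *s w) * (h *s w) $ j) =
          (\<Sum>j\<in>UNIV. d_z j (d_z k ?u) (a + \<zeta> *s w) * w $ j) * h" for h
          by (simp add: sum_distrib_left sum_distrib_right mult_ac)
        then show ?thesis using diff_chain_at[OF dl holo_on_has_derivative[OF holo line[OF that]], of k]
          by (simp add: has_field_derivative_def o_def)
      qed
      then show "(\<lambda>\<zeta>. d_z k ?u (a + \<zeta> *s w)) holomorphic_on D"
        unfolding holomorphic_on_def field_differentiable_def using has_field_derivative_at_within by blast
    qed
    then obtain \<Psi> where \<Psi>: "\<And>\<zeta>. \<zeta> \<in> D \<Longrightarrow> (\<Psi> has_field_derivative \<Theta> \<zeta>) (at \<zeta> within D)"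
      using holomorphic_convex_primitive'[of D \<Theta>] by (auto simp: D_def)
    have oD: "open D" "connected D" by (auto simp: D_def)
    \<comment> \<open>Along the line, \<open>?u\<close> and twice the real part of the primitive
      \<Psi> have the same differential.\<close>
    have "\<exists>c. \<forall>\<zeta>\<in>D. ?u (a + \<zeta> *s w) - (\<Psi> \<zeta> + cnj (\<Psi> \<zeta>)) = c"
    proof (rule has_derivative_zero_constant)
      fix \<zeta> assume \<zeta>: "\<zeta> \<in> D"
      have "((\<lambda>\<zeta>. ?u (a + \<zeta> *s w)) has_derivative (\<lambda>h. \<Theta> \<zeta> * h + cnj (\<Theta> \<zeta> * h))) (at \<zeta>)"
      proof -
        have "Fd ?u (a + \<zeta> *s w) (h *s w) = \<Theta> \<zeta> * h + cnj (\<Theta> \<zeta> * h)" for h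
          unfolding frechet_wirtinger[OF du[OF line[OF \<zeta>]]] \<Theta>_def
          by (simp add: dz[OF line[OF \<zeta>]] sum.distrib sum_distrib_left sum_distrib_right mult_ac)
        then show ?thesis using diff_chain_at[OF dl frechet_derivative_works[THEN iffD1, OF du[OF line[OF \<zeta>]]]] by (simp add: o_def)
      qed
      moreover have \<Psi>': "(\<Psi> has_derivative (\<lambda>h. \<Theta> \<zeta> * h)) (at \<zeta>)"
        using \<Psi>[OF \<zeta>] unfolding at_within_open[OF \<zeta> oD(1)] has_field_derivative_def .
      ultimately have "((\<lambda>\<zeta>. ?u (a + \<zeta> *s w) - (\<Psi> \<zeta> + cnj (\<Psi> \<zeta>))) has_derivative
        (\<lambda>h. (\<Theta> \<zeta> * h + cnj (\<Theta> \<zeta> * h)) - (\<Theta> \<zeta> * h + cnj (\<Theta> \<zeta> * h)))) (at \<zeta>)"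
        by (intro has_derivative_diff has_derivative_add bounded_linear.has_derivative[OF bounded_linear_cnj])
      then show "((\<lambda>\<zeta>. ?u (a + \<zeta> *s w) - (\<Psi> \<zeta> + cnj (\<Psi> \<zeta>))) has_derivative (\<lambda>h. 0)) (at \<zeta> within D)"
        unfolding diff_self by (rule has_derivative_at_withinI)
    qed (auto simp: D_def)
    then obtain c where c: "?u (a + \<zeta> *s w) - (\<Psi> \<zeta> + cnj (\<Psi> \<zeta>)) = c" if "\<zeta> \<in> D" for \<zeta> by blast
    have c: "v (a + \<zeta> *s w) = 2 * Re (\<Psi> \<zeta>) + Re c" if "\<zeta> \<in> D" for \<zeta>
      using arg_cong[OF c[OF that], of Re] by simp
    have 01: "0 \<in> D" "1 \<in> D" using w e(1) by (auto simp: D_def)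
    \<comment> \<open>The modulus of \<open>exp (\<Psi> \<zeta>)\<close> depends on the real part
      alone, which is maximal at 0 together with \<open>v\<close>.\<close>
    have "(\<lambda>\<zeta>. exp (\<Psi> \<zeta>)) constant_on D"
    proof (rule maximum_modulus_principle[of _ D D 0])
      have "\<Psi> holomorphic_on D" using \<Psi> unfolding holomorphic_on_def field_differentiable_def by blast
      then show "(\<lambda>\<zeta>. exp (\<Psi> \<zeta>)) holomorphic_on D" by (intro holomorphic_intros)
      fix \<zeta> assume "\<zeta> \<in> D"
      then show "cmod (exp (\<Psi> \<zeta>)) \<le> cmod (exp (\<Psi> 0))" using c[of \<zeta>] c[OF 01(1)] max[OF line, of \<zeta>] by simp
    qed (use oD 01 in auto)
    then have "cmod (exp (\<Psi> 1)) = cmod (exp (\<Psi> 0))" using 01 unfolding constant_on_def by metis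
    then have "Re (\<Psi> 1) = Re (\<Psi> 0)" by simp
    then show ?thesis using c[OF 01(1)] c[OF 01(2)] by (simp add: w_def)
  qed simp
  then show thesis using that e by blast
qed

section \<open>Determinants and Gram matrices\<close>

text \<open>\<open>det (row_upd M j a)\<close> is dz_1 wedge ... wedge dz_n on the rows of
  \<open>M\<close> with \<open>a\<close> in slot \<open>j\<close>; for the velocity \<open>a\<close>
  of a homotopy these are the components of a flux.\<close>

definition row_upd :: "'a^'m^'n \<Rightarrow> 'n \<Rightarrow> 'a^'m \<Rightarrow> 'a^'m^'n" where
  "row_upd M j a = (\<chi> i. if i = j then a else M $ i)"

lemma holomorphic_on_det:
  assumes "\<And>i j. (\<lambda>z. M z $ i $ j) holomorphic_on S"
  shows "(\<lambda>z. det (M z :: complex^'n^'n)) holomorphic_on S" unfolding det_def using assms by (intro holomorphic_intros) auto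

lemma continuous_on_det [continuous_intros]:
  fixes M :: "'a::topological_space \<Rightarrow> 'b::real_normed_field^'n^'n"
  assumes "continuous_on S M"
  shows "continuous_on S (\<lambda>z. det (M z))" unfolding det_def using assms by (intro continuous_intros) auto

text \<open>Invertible matrices are dense: on the complex line from \<open>V\<close> to the identity
  the determinant is holomorphic and not identically zero, so its zeros are isolated. Determinant
  identities may thus be checked on invertible matrices.\<close>

lemma eq_on_singular_matrices:
  fixes P Q :: "complex^'n^'n \<Rightarrow> complex"
  assumes "continuous_on UNIV P" "continuous_on UNIV Q" "\<And>V. det V \<noteq> 0 \<Longrightarrow> P V = Q V"
  shows "P V = Q V"
proof -
  define M :: "complex \<Rightarrow> complex^'n^'n" where "M z = (\<chi> i j. (1 - z) * V $ i $ j + z * mat 1 $ i $ j)" for z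
  have M0: "M 0 = V" "M 1 = mat 1" by (simp_all add: M_def vec_eq_iff)
  have hol: "(\<lambda>z. det (M z)) holomorphic_on UNIV" by (rule holomorphic_on_det) (auto simp: M_def intro!: holomorphic_intros)
  show ?thesis
  proof (cases "det V = 0")
    case True
    obtain r where r: "0 < r" "\<And>z. z \<in> ball 0 r - {0} \<Longrightarrow> det (M z) \<noteq> 0"
      using isolated_zeros[OF hol, of 0 1] True by (auto simp: M0)
    then have "\<forall>\<^sub>F z in at 0. det (M z) \<noteq> 0" unfolding eventually_at by (intro exI[of _ r]) auto
  then have ev: "\<forall>\<^sub>F z in at 0. P (M z) = Q (M z)" by eventually_elim (rule assms(3))
  have "continuous_on UNIV M" unfolding M_def by (intro continuous_on_vec_lambda continuous_intros)
  then have M: "(M \<longlongrightarrow> V) (at 0)" by (metis M0(1) UNIV_I continuous_on_def)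
  have "((\<lambda>z. P (M z)) \<longlongrightarrow> P V) (at 0)" "((\<lambda>z. Q (M z)) \<longlongrightarrow> Q V) (at 0)"
    using assms(1,2) M by (auto intro!: isCont_tendsto_compose[of V] simp: continuous_on_eq_continuous_at)
  then show ?thesis using tendsto_cong[OF ev] tendsto_unique[of "at 0"] by (metis trivial_limit_at)
  qed (rule assms(3))
qed

text \<open>Cramer's rule by rows: replacing a row by a combination of all rows picks out one
  coefficient.\<close>

lemma row_upd_combination:
  fixes M :: "'a::field^'n^'n"
  shows "det (row_upd M j (\<Sum>k\<in>UNIV. u k *s M $ k)) = u j * det M" using cramer_lemma_transpose[of j "\<chi> k. u k" M]
  by (simp add: row_upd_def row_def vec_nth_inverse cong: if_cong)

lemma row_combination_exists:
  fixes M :: "'a::field^'n^'n"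
  assumes "det M \<noteq> 0"
  obtains u where "a = (\<Sum>k\<in>UNIV. u k *s M $ k)"
proof -
  obtain N where N: "N ** M = mat 1" using assms invertible_det_nz[of M] by (auto simp: invertible_def)
  have "a = (\<Sum>k\<in>UNIV. (a v* N) $ k *s M $ k)"
  proof -
    have "a = (a v* N) v* M" by (simp add: vector_matrix_mul_assoc N)
    also have "\<dots> = (\<Sum>k\<in>UNIV. (a v* N) $ k *s M $ k)" by (simp add: vec_eq_iff vector_matrix_mult_def mult_ac)
    finally show ?thesis .
  qed
  then show thesis using that by blast
qed

lemma continuous_on_row_upd [continuous_intros]:
  fixes M :: "'a::topological_space \<Rightarrow> 'b::topological_space^'m^'n"
  assumes "continuous_on S M"
  shows "continuous_on S (\<lambda>z. row_upd (M z) j a)" unfolding row_upd_def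
proof (rule continuous_on_vec_lambda)
  fix i show "continuous_on S (\<lambda>z. if i = j then a else M z $ i)" using assms by (cases "i = j") (auto intro!: continuous_intros)
qed

lemma continuous_on_row_upd_sum:
  fixes b :: "'n::finite \<Rightarrow> complex^'n^'n \<Rightarrow> complex"
  assumes "\<And>j. continuous_on UNIV (b j)"
  shows "continuous_on UNIV (\<lambda>M. \<Sum>j\<in>UNIV. b j M * det (row_upd M j a))" using assms by (intro continuous_intros)

text \<open>With \<Omega> = dz_1 wedge ... wedge dz_n, the left side is the wedge of \<theta> with
  the contraction of \<Omega> by \<open>a\<close>. Contracting the relation that \<theta> wedge
  \<Omega> is 0 gives the right side.\<close>

lemma cramer_functional:
  fixes M :: "complex^'n^'n"
  shows "(\<Sum>j\<in>UNIV. (\<Sum>i\<in>UNIV. \<theta> i * M $ j $ i) * det (row_upd M j a)) = (\<Sum>i\<in>UNIV. \<theta> i * a $ i) * det M"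
proof (rule eq_on_singular_matrices[where P="\<lambda>M. (\<Sum>j\<in>UNIV. (\<Sum>i\<in>UNIV. \<theta> i * M $ j $ i) * det (row_upd M j a))"])
  fix M :: "complex^'n^'n" assume "det M \<noteq> 0"
  then obtain u where a: "a = (\<Sum>k\<in>UNIV. u k *s M $ k)" using row_combination_exists by blast
  have "(\<Sum>i\<in>UNIV. \<theta> i * a $ i) = (\<Sum>j\<in>UNIV. \<Sum>i\<in>UNIV. \<theta> i * (u j * M $ j $ i))"
    unfolding a by (subst sum.swap) (simp add: sum_distrib_left)
  then show "(\<Sum>j\<in>UNIV. (\<Sum>i\<in>UNIV. \<theta> i * M $ j $ i) * det (row_upd M j a)) = (\<Sum>i\<in>UNIV. \<theta> i * a $ i) * det M"
    unfolding a row_upd_combination by (simp add: sum_distrib_left sum_distrib_right mult_ac)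
qed (auto intro!: continuous_on_row_upd_sum continuous_intros)

lemma row_upd_transform_right:
  fixes M J :: "complex^'n^'n"
  shows "det (row_upd (\<chi> j. J *v M $ j) k (J *v a)) = det J * det (row_upd M k a)"
proof -
  have "row_upd (\<chi> j. J *v M $ j) k (J *v a) = row_upd M k a ** transpose J"
    by (auto simp: row_upd_def matrix_matrix_mult_def vec_eq_iff matrix_vector_mult_def transpose_def mult_ac)
  then show ?thesis by (simp add: det_mul det_transpose)
qed

lemma det_rows_transform_right:
  fixes M J :: "'a::comm_ring_1^'n^'n"
  shows "det (\<chi> j. J *v M $ j) = det J * det M"
proof -
  have "(\<chi> j. J *v M $ j) = M ** transpose J"
    by (auto simp: matrix_matrix_mult_def vec_eq_iff matrix_vector_mult_def transpose_def mult_ac)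
  then show ?thesis by (simp add: det_mul det_transpose)
qed

lemma det_rows_transform_left:
  fixes M T :: "'a::comm_ring_1^'n^'n"
  shows "det (\<chi> j. \<Sum>k\<in>UNIV. T $ k $ j *s M $ k) = det T * det M"
proof -
  have "(\<chi> j. \<Sum>k\<in>UNIV. T $ k $ j *s M $ k) = transpose T ** M" by (auto simp: matrix_matrix_mult_def vec_eq_iff transpose_def)
  then show ?thesis by (simp add: det_mul det_transpose)
qed

text \<open>The sum is the wedge of \<open>b\<close> with the contraction of dz_1 wedge ... wedge
  dz_n by \<open>a\<close>, evaluated on the rows. It is an n-form in the rows, whence the factor
  \<open>det T\<close> under a change of frame.\<close>

lemma row_upd_transform_left:
  fixes M T :: "complex^'n^'n"
  assumes "det T \<noteq> 0"
  shows "(\<Sum>j\<in>UNIV. (\<Sum>k\<in>UNIV. T $ k $ j * b k) * det (row_upd (\<chi> j. \<Sum>k\<in>UNIV. T $ k $ j *s M $ k) j a))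
    = det T * (\<Sum>k\<in>UNIV. b k * det (row_upd M k a))"
proof (rule eq_on_singular_matrices[where Q="\<lambda>M. det T * (\<Sum>k\<in>UNIV. b k * det (row_upd M k a))" and
  P="\<lambda>M. (\<Sum>j\<in>UNIV. (\<Sum>k\<in>UNIV. T $ k $ j * b k) * det (row_upd (\<chi> j. \<Sum>k\<in>UNIV. T $ k $ j *s M $ k) j a))"])
  fix M :: "complex^'n^'n" assume "det M \<noteq> 0"
  let ?M = "\<chi> j. \<Sum>k\<in>UNIV. T $ k $ j *s M $ k"
  have dM: "det ?M = det T * det M" by (rule det_rows_transform_left)
  then obtain u where a: "a = (\<Sum>j\<in>UNIV. u j *s ?M $ j)"
    using row_combination_exists[of ?M a] assms \<open>det M \<noteq> 0\<close> by auto
  have a': "a = (\<Sum>k\<in>UNIV. (\<Sum>j\<in>UNIV. T $ k $ j * u j) *s M $ k)"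
    unfolding a by (simp add: vec_eq_iff sum_distrib_left sum_distrib_right mult_ac) (intro allI sum.swap)
  have 1: "det (row_upd ?M j a) = u j * (det T * det M)" for j unfolding a row_upd_combination dM ..
  have 2: "det (row_upd M k a) = (\<Sum>j\<in>UNIV. T $ k $ j * u j) * det M" for k by (subst a') (rule row_upd_combination)
  show "(\<Sum>j\<in>UNIV. (\<Sum>k\<in>UNIV. T $ k $ j * b k) * det (row_upd ?M j a)) = det T * (\<Sum>k\<in>UNIV. b k * det (row_upd M k a))"
    unfolding 1 2 by (simp add: sum_distrib_left sum_distrib_right mult_ac) (rule sum.swap)
next
  show "continuous_on UNIV (\<lambda>M. (\<Sum>j\<in>UNIV. (\<Sum>k\<in>UNIV. T $ k $ j * b k) * det (row_upd (\<chi> j. \<Sum>k\<in>UNIV. T $ k $ j *s M $ k) j a)))"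
    unfolding vector_scalar_mult_def by (intro continuous_intros continuous_on_vec_lambda)
qed (auto intro!: continuous_on_row_upd_sum continuous_intros)

lemma det_row_upd_swap:
  fixes M :: "complex^'n^'n"
  assumes "j \<noteq> k"
  shows "det (row_upd (row_upd M j a) k h) = - det (row_upd (row_upd M k a) j h)"
proof -
  let ?p = "Transposition.transpose j k"
  have "row_upd (row_upd M j a) k h = (\<chi> i. row_upd (row_upd M k a) j h $ ?p i)"
    using assms by (auto simp: row_upd_def vec_eq_iff Transposition.transpose_def)
  then show ?thesis using det_permute_rows[of ?p "row_upd (row_upd M k a) j h"] assms by (simp add: permutes_swap_id sign_swap_id)
qed

text \<open>A symmetric array is summed against the antisymmetry of the determinant in the slots
  \<open>j\<close> and \<open>k\<close>; \<open>h\<close> will consist of second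
  derivatives.\<close>

lemma sum_det_row_upd_symmetric:
  fixes M :: "complex^'n^'n"
  assumes "\<And>j k. h j k = h k j"
  shows "(\<Sum>j\<in>UNIV. \<Sum>k\<in>UNIV-{j}. det (row_upd (row_upd M j a) k (h j k))) = 0"
proof -
  let ?f = "\<lambda>j k. if j = k then 0 else det (row_upd (row_upd M j a) k (h j k))"
  have anti: "?f j k = - ?f k j" for j k using det_row_upd_swap[of j k M a "h j k"] assms by auto
  have "(\<Sum>j\<in>UNIV. \<Sum>k\<in>UNIV. ?f j k) = (\<Sum>j\<in>UNIV. \<Sum>k\<in>UNIV. - ?f k j)" by (intro sum.cong refl anti)
  also have "\<dots> = - (\<Sum>j\<in>UNIV. \<Sum>k\<in>UNIV. ?f j k)" by (simp only: sum_negf) (subst sum.swap, rule refl)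
  finally have "(\<Sum>j\<in>UNIV. \<Sum>k\<in>UNIV. ?f j k) = 0" by simp
  moreover have "(\<Sum>k\<in>UNIV. ?f j k) = (\<Sum>k\<in>UNIV-{j}. det (row_upd (row_upd M j a) k (h j k)))" for j
    by (rule sum.mono_neutral_cong_right) auto
  ultimately show ?thesis by simp
qed

text \<open>The product rule in each permutation term, regrouped so that one row is differentiated
  at a time.\<close>

lemma has_derivative_det_rows:
  fixes R :: "'a::real_normed_vector \<Rightarrow> complex^'n^'n"
  assumes "\<And>i. ((\<lambda>x. R x $ i) has_derivative R' i) (at x)"
  shows "((\<lambda>x. det (R x)) has_derivative (\<lambda>v. \<Sum>i\<in>UNIV. det (row_upd (R x) i (R' i v)))) (at x)"
proof -
  have c: "((\<lambda>x. R x $ i $ j) has_derivative (\<lambda>v. R' i v $ j)) (at x)" for i j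
    using bounded_linear.has_derivative[OF bounded_linear_vec_nth assms] .
  have "((\<lambda>x. det (R x)) has_derivative (\<lambda>v. \<Sum>p\<in>{p. p permutes UNIV}. of_int (sign p) *
    (\<Sum>i\<in>UNIV. R' i v $ p i * (\<Prod>j\<in>UNIV-{i}. R x $ j $ p j)))) (at x)"
    unfolding det_def by (intro has_derivative_sum has_derivative_mult_right has_derivative_prod c)
  moreover have "(\<Sum>p\<in>{p. p permutes UNIV}. of_int (sign p) *
    (\<Sum>i\<in>UNIV. R' i v $ p i * (\<Prod>j\<in>UNIV-{i}. R x $ j $ p j))) = (\<Sum>i\<in>UNIV. det (row_upd (R x) i (R' i v)))" for v
  proof -
    have "(\<Prod>j\<in>UNIV. row_upd (R x) i (R' i v) $ j $ p j) = R' i v $ p i * (\<Prod>j\<in>UNIV-{i}. R x $ j $ p j)" for i p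
    proof -
      have "(\<Prod>j\<in>UNIV. row_upd (R x) i (R' i v) $ j $ p j) =
        row_upd (R x) i (R' i v) $ i $ p i * (\<Prod>j\<in>UNIV-{i}. row_upd (R x) i (R' i v) $ j $ p j)" by (rule prod.remove) auto
      then show ?thesis by (simp add: row_upd_def cong: prod.cong_simp)
    qed
    then show ?thesis unfolding det_def by (subst sum.swap) (simp add: sum_distrib_left)
  qed
  ultimately show ?thesis by simp
qed

text \<open>By the maximum principle det (1 + z C) cannot vanish on the whole unit circle, as it is
  1 at the origin. The matrix obtained will bring an antilinear involution to standard form.\<close>

lemma real_structure_matrix:
  fixes C :: "complex^'n^'n"
  obtains l where "cmod l = 1" "det (\<chi> i j. l * mat 1 $ i $ j + cnj l * C $ i $ j) \<noteq> 0"
proof -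
  define M :: "complex \<Rightarrow> complex^'n^'n" where "M z = (\<chi> i j. mat 1 $ i $ j + z * C $ i $ j)" for z
  have hol: "(\<lambda>z. det (M z)) holomorphic_on S" for S by (rule holomorphic_on_det) (auto simp: M_def intro!: holomorphic_intros)
  have M0: "M 0 = mat 1" by (simp add: M_def vec_eq_iff)
  have "\<exists>\<mu>. cmod \<mu> = 1 \<and> det (M \<mu>) \<noteq> 0"
  proof (rule ccontr)
    assume "\<not> ?thesis"
    then have zero: "det (M z) = 0" if "cmod z = 1" for z using that by blast
    have "cmod (det (M 0)) \<le> 0"
    proof (rule maximum_modulus_frontier[where S="cball 0 1" and f="\<lambda>z. det (M z)"])
      show "cmod (det (M z)) \<le> 0" if "z \<in> frontier (cball 0 1)" for z using zero[of z] that by (simp add: dist_norm)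
    qed (auto intro: hol holomorphic_on_imp_continuous_on)
    then show False by (simp add: M0)
  qed
  then obtain \<mu> where \<mu>: "cmod \<mu> = 1" "det (M \<mu>) \<noteq> 0" by blast
  \<comment> \<open>\<open>l\<close> is a unit number with \<mu> = cnj l / l, so that the matrix of
    the claim is \<open>l\<close> times \<open>M \<mu>\<close>.\<close>
  define l where "l = csqrt (cnj \<mu>)"
  have l2: "l\<^sup>2 = cnj \<mu>" by (simp add: l_def)
  then have "(cmod l)\<^sup>2 = 1" using \<mu>(1) by (metis complex_mod_cnj norm_power)
  then have l1: "cmod l = 1" by (metis norm_ge_zero one_power2 power2_eq_iff_nonneg zero_le_one)
  then have "l * cnj l = 1" by (simp add: complex_norm_square[symmetric])
  moreover have "cnj l * cnj l = \<mu>" using arg_cong[OF l2, of cnj] by (simp add: power2_eq_square)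
  moreover have "l * (cnj l * cnj l) = (l * cnj l) * cnj l" by (rule mult.assoc[symmetric])
  ultimately have "l * \<mu> = cnj l" by (simp only: mult_1)
  then have eq: "(\<chi> i j. l * mat 1 $ i $ j + cnj l * C $ i $ j) = (\<chi> i. l *s M \<mu> $ i)"
    by (auto simp: M_def vec_eq_iff algebra_simps)
  have "det (\<chi> i. l *s M \<mu> $ i) = l ^ CARD('n) * det (M \<mu>)"
    using det_rows_mul[of "\<lambda>_. l" "\<lambda>i. M \<mu> $ i"] by (simp add: vec_nth_inverse)
  moreover have "l \<noteq> 0" using l1 by auto
  ultimately have "det (\<chi> i j. l * mat 1 $ i $ j + cnj l * C $ i $ j) \<noteq> 0" using \<mu>(2) unfolding eq by simp
  with l1 show thesis by (rule that)
qed

subsection \<open>Hermitian inner products\<close>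

text \<open>The pointwise part of \<open>hermitian_metric\<close>; it makes \<open>herm g\<close> a
  positive definite Hermitian form with real part \<open>g\<close>.\<close>

locale hermitian_product =
  fixes g :: "complex^'n::finite \<Rightarrow> complex^'n \<Rightarrow> real"
  assumes bilinear: "bilinear g"
    and commute: "g v w = g w v"
    and pos: "v \<noteq> 0 \<Longrightarrow> 0 < g v v"
    and J: "g (\<i> *s v) (\<i> *s w) = g v w"
begin

lemma linear_simps:
  "g (u + v) w = g u w + g v w" "g u (v + w) = g u v + g u w"
  "g (r *\<^sub>R v) w = r * g v w" "g v (r *\<^sub>R w) = r * g v w"
  "g (- v) w = - g v w" "g v (- w) = - g v w" "g 0 w = 0" "g v 0 = 0"
  "g (u - v) w = g u w - g v w" "g u (v - w) = g u v - g u w"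
  using bilinear by (auto simp: bilinear_ladd bilinear_radd bilinear_lmul bilinear_rmul
    bilinear_lneg bilinear_rneg bilinear_lzero bilinear_rzero bilinear_lsub bilinear_rsub)

lemma i_i: "\<i> *s (\<i> *s v) = - (v::complex^'m)" by (simp add: vec_eq_iff)

lemma g_i_left: "g (\<i> *s v) w = - g v (\<i> *s w)" using J[of v "\<i> *s w"] by (simp add: i_i linear_simps)

lemma Re_herm [simp]: "Re (herm g v w) = g v w" by (simp add: herm_def)

lemma herm_add: "herm g (u + v) w = herm g u w + herm g v w" by (simp add: herm_def linear_simps complex_eq_iff)

lemma complex_scale_expand: "c *s v = Re c *\<^sub>R v + Im c *\<^sub>R (\<i> *s (v::complex^'m))"
  by (simp add: vec_eq_iff) (simp add: complex_eq_iff)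

lemma herm_scale: "herm g (c *s v) w = c * herm g v w" unfolding complex_scale_expand[of c v]
  by (simp add: herm_def linear_simps complex_eq_iff g_i_left i_i)

lemma herm_cnj: "herm g w v = cnj (herm g v w)"
  using commute[of v "\<i> *s w"] commute[of v w] g_i_left[of w v] by (simp add: herm_def complex_eq_iff)

lemma herm_sum: "herm g (\<Sum>k\<in>I. c k *s v k) w = (\<Sum>k\<in>I. c k * herm g (v k) w)"
proof (induction I rule: infinite_finite_induct)
qed (simp_all add: herm_add herm_scale, simp_all add: herm_def linear_simps complex_eq_iff)

lemma herm_sum_right: "herm g w (\<Sum>k\<in>I. c k *s v k) = (\<Sum>k\<in>I. cnj (c k) * herm g w (v k))"
proof -
  have "herm g w (\<Sum>k\<in>I. c k *s v k) = cnj (herm g (\<Sum>k\<in>I. c k *s v k) w)" by (rule herm_cnj)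
  also have "\<dots> = (\<Sum>k\<in>I. cnj (c k) * cnj (herm g (v k) w))" by (simp add: herm_sum)
  finally show ?thesis by (simp flip: herm_cnj)
qed

lemma herm_expand: "herm g v w = (\<Sum>a\<in>UNIV. \<Sum>b\<in>UNIV. v $ a * herm_matrix g $ a $ b * cnj (w $ b))"
proof -
  have "herm g v w = herm g (\<Sum>a\<in>UNIV. v $ a *s axis a 1) (\<Sum>b\<in>UNIV. w $ b *s axis b 1)" by (simp only: basis_expansion)
  also have "\<dots> = (\<Sum>a\<in>UNIV. \<Sum>b\<in>UNIV. v $ a * herm_matrix g $ a $ b * cnj (w $ b))"
    by (subst herm_sum) (simp add: herm_sum_right herm_matrix_def sum_distrib_left mult_ac)
  finally show ?thesis .
qed

text \<open>The Hermitian Gram matrix of the rows is \<open>M\<close> times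
  \<open>herm_matrix g\<close> times the conjugate transpose of \<open>M\<close>.\<close>

lemma det_herm_rows:
  "det (\<chi> i j. herm g (M $ i) (M $ j)) = of_real ((cmod (det M))\<^sup>2) * det (herm_matrix g)"
proof -
  let ?C = "\<chi> i j. cnj (M $ j $ i)"
  have "(\<chi> i j. herm g (M $ i) (M $ j)) = M ** herm_matrix g ** ?C"
    by (simp add: vec_eq_iff herm_expand matrix_matrix_mult_def sum_distrib_right) (intro allI sum.swap)
  moreover have "det ?C = cnj (det M)"
  proof -
    have "?C = transpose (\<chi> i j. cnj (M $ i $ j))" by (simp add: transpose_def)
    then have "det ?C = det (\<chi> i j. cnj (M $ i $ j))" by (simp only: det_transpose)
    then show ?thesis by (simp add: det_def)
  qed
  ultimately show ?thesis by (simp add: det_mul complex_norm_square[symmetric] del: of_real_power)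
qed

lemma bounded_bilinear: "bounded_bilinear g" using bilinear bilinear_conv_bounded_bilinear by blast

text \<open>\<open>c\<close> is the minimum of \<open>g v v\<close> on the unit sphere, attained and
  positive. It makes the set of frames of \<open>g\<close>-unit vectors bounded.\<close>

lemma bounded_below: obtains c where "c > 0" "\<And>v. c * (norm v)\<^sup>2 \<le> g v v"
proof -
  have "continuous_on (sphere 0 1) (\<lambda>v. g v v)" by (intro bounded_bilinear.continuous_on[OF bounded_bilinear] continuous_intros)
  moreover have "sphere 0 1 \<noteq> ({}::(complex^'n) set)" by simp
  ultimately obtain u where u: "u \<in> sphere 0 1" "\<And>v. v \<in> sphere 0 1 \<Longrightarrow> g u u \<le> g v v"
    using continuous_attains_inf[of "sphere 0 1" "\<lambda>v. g v v"] by auto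
  have "g u u * (norm v)\<^sup>2 \<le> g v v" for v
  proof (cases "v = 0")
    case False
    have "g u u \<le> g (v /\<^sub>R norm v) (v /\<^sub>R norm v)" using False by (intro u(2)) auto
    then show ?thesis using False by (simp add: linear_simps field_simps power2_eq_square)
  qed (simp add: linear_simps)
  moreover have "g u u > 0" using u(1) by (intro pos) auto
  ultimately show thesis using that by blast
qed

text \<open>A frame of unit vectors with maximal determinant is orthonormal: subtracting from a row its
  component along another one keeps the determinant and shortens the row.\<close>

lemma orthonormal_frame:
  obtains B where "\<And>i j. herm g (B $ i) (B $ j) = (if i = j then 1 else 0)"
    "\<And>M. (\<And>i. g (M $ i) (M $ i) = 1) \<Longrightarrow> cmod (det M) \<le> cmod (det B)"
proof -
  let ?K = "{M::complex^'n^'n. \<forall>i. g (M $ i) (M $ i) = 1}"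
  obtain c where c: "c > 0" "\<And>v. c * (norm v)\<^sup>2 \<le> g v v" using bounded_below by blast
  have cont: "continuous_on UNIV (\<lambda>M::complex^'n^'n. g (M $ i) (M $ i))" for i
    by (intro bounded_bilinear.continuous_on[OF bounded_bilinear] continuous_intros)
  have "closed ?K" by (intro closed_Collect_all closed_Collect_eq cont continuous_intros)
  moreover have "norm M \<le> (\<Sum>i\<in>(UNIV::'n set). sqrt (1 / c))" if "M \<in> ?K" for M
  proof -
    have "norm (M $ i) \<le> sqrt (1 / c)" for i using c(1) c(2)[of "M $ i"] that by (intro real_le_rsqrt) (simp add: field_simps)
    then have "L2_set (\<lambda>i. norm (M $ i)) UNIV \<le> (\<Sum>i\<in>(UNIV::'n set). sqrt (1 / c))"
      by (intro order_trans[OF L2_set_le_sum] sum_mono) auto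
    then show ?thesis by (simp add: norm_vec_def[of M])
  qed
  then have "bounded ?K" unfolding bounded_iff by blast
  ultimately have "compact ?K" by (simp add: compact_eq_bounded_closed)
  define E :: "complex^'n^'n" where "E = (\<chi> i. (1 / sqrt (g (axis i 1) (axis i 1))) *\<^sub>R axis i 1)"
  have gax: "g (axis i 1) (axis i 1) > 0" for i by (rule pos) simp
  have E: "E \<in> ?K"
  proof -
    have "g (E $ i) (E $ i) = g (axis i 1) (axis i 1) / (sqrt (g (axis i 1) (axis i 1)))\<^sup>2" for i
      by (simp add: E_def linear_simps power2_eq_square)
    then show ?thesis using gax by (simp add: less_imp_le less_imp_neq[symmetric])
  qed
  have "det E \<noteq> 0"
  proof -
    have "E = (\<chi> i. complex_of_real (1 / sqrt (g (axis i 1) (axis i 1))) *s mat 1 $ i)"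
      by (auto simp: E_def vec_eq_iff axis_def mat_def scaleR_conv_of_real[where 'a=complex])
    then have "det E = prod (\<lambda>i. complex_of_real (1 / sqrt (g (axis i 1) (axis i 1)))) UNIV * det (\<chi> i. (mat 1 :: complex^'n^'n) $ i)"
      by (simp only: det_rows_mul)
    moreover have "(\<chi> i. (mat 1 :: complex^'n^'n) $ i) = mat 1" by (simp add: vec_eq_iff)
    ultimately show ?thesis using gax by (simp add: less_imp_neq[symmetric])
  qed
  have "continuous_on ?K (\<lambda>M. cmod (det M))" by (intro continuous_intros)
  then obtain B where B: "B \<in> ?K" "\<And>M. M \<in> ?K \<Longrightarrow> cmod (det M) \<le> cmod (det B)"
    using continuous_attains_sup[OF \<open>compact ?K\<close>, of "\<lambda>M. cmod (det M)"] E by blast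
  have dB: "cmod (det B) > 0" using B(2)[OF E] \<open>det E \<noteq> 0\<close> by (smt (verit) zero_less_norm_iff)
  have one: "herm g (B $ i) (B $ i) = 1" for i using B(1) herm_cnj[of "B $ i" "B $ i"] by (auto simp: complex_eq_iff)
  have zero: "herm g (B $ j) (B $ k) = 0" if "j \<noteq> k" for j k
  proof (rule ccontr)
    define s where "s = herm g (B $ j) (B $ k)"
    assume "herm g (B $ j) (B $ k) \<noteq> 0"
    then have s: "cmod s > 0" by (simp add: s_def)
    define b where "b = B $ j - s *s B $ k"
    have b2: "b = B $ j + (- s) *s B $ k" by (simp add: b_def vec_eq_iff)
    then have db: "det (row_upd B j b) = det B"
      using det_row_operation[OF that, of B "- s"] unfolding row_upd_def b2 by (simp add: row_def cong: if_cong)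
    have hb: "herm g b w = herm g (B $ j) w - s * herm g (B $ k) w" for w unfolding b2 herm_add herm_scale by simp
    have "herm g (B $ k) b = cnj (herm g b (B $ k))" by (rule herm_cnj)
    then have "herm g (B $ k) b = 0" by (simp add: hb one s_def)
    moreover have "herm g (B $ j) b = cnj (herm g b (B $ j))" by (rule herm_cnj)
    then have "herm g (B $ j) b = 1 - cnj s * s" using herm_cnj[of "B $ k" "B $ j"] by (simp add: hb one s_def)
    ultimately have "herm g b b = 1 - cnj s * s" by (simp add: hb)
    then have gb: "g b b = 1 - (cmod s)\<^sup>2" using Re_herm[of b b] by (simp add: cmod_power2) (simp add: power2_eq_square)
    have "b \<noteq> 0"
    proof
      assume "b = 0"
      then have "row j (row_upd B j b) = 0" by (simp add: row_def row_upd_def vec_eq_iff)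
      then have "det (row_upd B j b) = 0" by (rule det_zero_row)
      then show False using db dB by simp
    qed
    then have g0: "g b b > 0" by (rule pos)
    define r where "r = 1 / sqrt (g b b)"
    have "g b b < 1" using s gb by simp
    then have r: "r > 1" using g0 by (simp add: r_def)
    have "row_upd B j (r *\<^sub>R b) \<in> ?K"
    proof -
      have "g (r *\<^sub>R b) (r *\<^sub>R b) = 1" using g0 by (simp add: linear_simps r_def field_simps)
      then show ?thesis using B(1) by (auto simp: row_upd_def)
    qed
    then have "cmod (det (row_upd B j (r *\<^sub>R b))) \<le> cmod (det B)" by (rule B(2))
    moreover have "det (row_upd B j (r *\<^sub>R b)) = of_real r * det (row_upd B j b)"
    proof -
      have "r *\<^sub>R b = complex_of_real r *s b" by (simp add: vec_eq_iff scaleR_conv_of_real[where 'a=complex])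
      then show ?thesis unfolding row_upd_def by (simp only: det_row_mul)
    qed
    ultimately have "r * cmod (det B) \<le> cmod (det B)" using r by (simp add: db norm_mult)
    then show False using r dB by simp
  qed
  show thesis
  proof (rule that)
    show "herm g (B $ i) (B $ j) = (if i = j then 1 else 0)" for i j using one[of i] zero[of i j] by (cases "i = j") simp_all
    show "cmod (det M) \<le> cmod (det B)" if "\<And>i. g (M $ i) (M $ i) = 1" for M by (rule B(2)) (simp add: that)
  qed
qed

lemma orthonormal_frame_exists: "\<exists>B::complex^'n^'n. \<forall>i j. herm g (B $ i) (B $ j) = (if i = j then 1 else 0)"
proof (rule orthonormal_frame)
  fix B :: "complex^'n^'n" assume "\<And>i j. herm g (B $ i) (B $ j) = (if i = j then 1 else 0)"
  then show ?thesis by blast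
qed

text \<open>In an orthonormal frame the Gram matrix is the identity, so \<open>det_herm_rows\<close>
  expresses the determinant as 1 / |det B|^2.\<close>

lemma det_herm_matrix: "Im (det (herm_matrix g)) = 0" "Re (det (herm_matrix g)) > 0"
proof -
  obtain B :: "complex^'n^'n" where B: "\<And>i j. herm g (B $ i) (B $ j) = (if i = j then 1 else 0)" using orthonormal_frame_exists by blast
  have "(\<chi> i j. herm g (B $ i) (B $ j)) = mat 1" by (simp add: B mat_def)
  then have 1: "of_real ((cmod (det B))\<^sup>2) * det (herm_matrix g) = 1" using det_herm_rows[of B] by simp
  then have "(cmod (det B))\<^sup>2 \<noteq> 0" by auto
  then have c: "(cmod (det B))\<^sup>2 > 0" by simp
  have "(cmod (det B))\<^sup>2 * Re (det (herm_matrix g)) = 1" "(cmod (det B))\<^sup>2 * Im (det (herm_matrix g)) = 0"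
    using arg_cong[OF 1, of Re] arg_cong[OF 1, of Im] by auto
  with c show "Im (det (herm_matrix g)) = 0" "Re (det (herm_matrix g)) > 0" using zero_less_mult_pos[of "(cmod (det B))\<^sup>2"] by simp_all
qed

text \<open>The hypothesis says that the frame is Lagrangian: the Hermitian products of the rows are
  real, and the real and the Hermitian Gram determinant coincide.\<close>

lemma gram_det_eq:
  assumes "\<And>j k. g (M $ j) (\<i> *s M $ k) = 0"
  shows "det (\<chi> j k. g (M $ j) (M $ k)) = (cmod (det M))\<^sup>2 * Re (det (herm_matrix g))"
proof -
  have "herm g (M $ j) (M $ k) = of_real (g (M $ j) (M $ k))" for j k by (simp add: herm_def assms complex_eq_iff)
  then have "det (\<chi> j k. herm g (M $ j) (M $ k)) = of_real (det (\<chi> j k. g (M $ j) (M $ k)))" by (simp add: det_def)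
  then have "of_real (det (\<chi> j k. g (M $ j) (M $ k))) = of_real ((cmod (det M))\<^sup>2) * det (herm_matrix g)"
    unfolding det_herm_rows by (rule sym)
  from arg_cong[OF this, of Re] show ?thesis by simp
qed

end

lemma hermitian_product_inner: "hermitian_product (\<lambda>v w::complex^'n. v \<bullet> w)"
proof
  show "bilinear (\<lambda>v w::complex^'n. v \<bullet> w)" by (auto simp: bilinear_def linear_iff inner_add_left inner_add_right)
  show "v \<bullet> w = w \<bullet> v" for v w :: "complex^'n" by (rule inner_commute)
  show "v \<noteq> 0 \<Longrightarrow> 0 < v \<bullet> v" for v :: "complex^'n" by simp
  show "(\<i> *s v) \<bullet> (\<i> *s w) = v \<bullet> w" for v w :: "complex^'n" by (simp add: inner_vec_def inner_complex_def add.commute)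
qed

lemma herm_inner: "herm (\<bullet>) v w = (\<Sum>k\<in>UNIV. v $ k * cnj (w $ k))"
  by (simp add: herm_def inner_vec_def inner_complex_def complex_eq_iff sum_subtractf sum_negf algebra_simps)

text \<open>Among frames of unit vectors the largest determinant belongs to an orthonormal one,
  whose determinant has modulus 1; this is Hadamard's inequality.\<close>

lemma hadamard_unit:
  fixes M :: "complex^'n^'n"
  assumes "\<And>i. norm (M $ i) = 1"
  shows "cmod (det M) \<le> 1"
proof -
  interpret hermitian_product "\<lambda>v w::complex^'n. v \<bullet> w" by (rule hermitian_product_inner)
  obtain B :: "complex^'n^'n" where B: "\<And>i j. herm (\<bullet>) (B $ i) (B $ j :: complex^'n) = (if i = j then 1 else 0)"
    "\<And>M::complex^'n^'n. (\<And>i. M $ i \<bullet> M $ i = 1) \<Longrightarrow> cmod (det M) \<le> cmod (det B)"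
  proof (rule orthonormal_frame)
    fix B :: "complex^'n^'n"
    assume a: "\<And>i j. herm (\<bullet>) (B $ i) (B $ j) = (if i = j then 1 else 0)"
      and b: "\<And>M::complex^'n^'n. (\<And>i. M $ i \<bullet> M $ i = 1) \<Longrightarrow> cmod (det M) \<le> cmod (det B)"
    show thesis
    proof (rule that)
      show "herm (\<bullet>) (B $ i) (B $ j) = (if i = j then 1 else 0)" for i j by (rule a)
      show "cmod (det M) \<le> cmod (det B)" if "\<And>i. M $ i \<bullet> M $ i = 1" for M :: "complex^'n^'n" by (rule b) (rule that)
    qed
  qed
  have "(\<chi> i j. herm (\<bullet>) (B $ i) (B $ j)) = mat 1" by (simp add: B mat_def)
  moreover have "herm_matrix (\<lambda>v w::complex^'n. v \<bullet> w) = mat 1"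
  proof -
    have "herm (\<bullet>) (axis j 1 :: complex^'n) (axis k 1) = (if j = k then 1 else 0)" for j k :: 'n
    proof -
      have "herm (\<bullet>) (axis j 1 :: complex^'n) (axis k 1) = (\<Sum>l\<in>UNIV. if l = j then cnj (axis k 1 $ l) else 0)"
        unfolding herm_inner by (rule sum.cong) (auto simp: axis_def)
      then show ?thesis by (simp add: axis_def)
    qed
    then show ?thesis by (simp add: herm_matrix_def vec_eq_iff mat_def)
  qed
  ultimately have "of_real ((cmod (det B))\<^sup>2) = (1::complex)" using det_herm_rows[of B] by simp
  then have "(cmod (det B))\<^sup>2 = 1" using of_real_eq_1_iff by blast
  then have "cmod (det B) = 1" by (metis norm_ge_zero one_power2 power2_eq_iff_nonneg zero_le_one)
  moreover have "M $ i \<bullet> M $ i = 1" for i using assms[of i] by (simp add: norm_eq_1)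
  ultimately show ?thesis using B(2) by metis
qed

lemma det_eq_0_if_rows_dependent:
  fixes M :: "'a::field^'n^'n"
  assumes "(\<Sum>i\<in>UNIV. c i *s row i M) = 0" "c j \<noteq> 0"
  shows "det M = 0"
proof (rule ccontr)
  assume "det M \<noteq> 0"
  then have "\<exists>N. M ** N = mat 1" using invertible_det_nz[of M] unfolding invertible_def by blast
  then have "c j = 0" using matrix_right_invertible_independent_rows[of M] assms(1) by blast
  then show False using assms(2) by contradiction
qed

text \<open>Rows that are dependent over the reals make both sides 0. Otherwise take a real
  orthonormal basis of their real span as the rows of \<open>B\<close>; then \<open>W\<close> is a
  real square matrix \<open>R\<close> times \<open>B\<close>, the real Gram determinant is (det
  R)^2, and |det B| is at most 1 by Hadamard.\<close>

lemma det_le_real_gram: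
  fixes W :: "complex^'n^'n"
  shows "(cmod (det W))\<^sup>2 \<le> det (\<chi> j k. W $ j \<bullet> W $ k)"
proof (cases "\<exists>c::'n\<Rightarrow>real. (\<exists>j. c j \<noteq> 0) \<and> (\<Sum>j\<in>UNIV. c j *\<^sub>R W $ j) = 0")
  case True
  then obtain c j where c: "c j \<noteq> 0" "(\<Sum>j\<in>UNIV. c j *\<^sub>R W $ j) = 0" by blast
  have "(\<Sum>j\<in>UNIV. c j *\<^sub>R W $ j $ i) = 0" for i using arg_cong[OF c(2), of "\<lambda>v. v $ i"] by simp
  then have "(\<Sum>i\<in>UNIV. complex_of_real (c i) *s row i W) = 0" by (simp add: row_def vec_eq_iff scaleR_conv_of_real[where 'a=complex])
  then have "det W = 0" using c(1) by (intro det_eq_0_if_rows_dependent[of "\<lambda>i. complex_of_real (c i)" W j]) auto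
  moreover have "det (\<chi> j k. W $ j \<bullet> W $ k) = 0"
  proof -
    let ?G = "\<chi> j k. W $ j \<bullet> W $ k"
    have "(\<Sum>i\<in>UNIV. c i *s row i ?G) $ k = (\<Sum>j\<in>UNIV. c j *\<^sub>R W $ j) \<bullet> W $ k" for k
      by (simp add: row_def inner_sum_left)
    then have "(\<Sum>i\<in>UNIV. c i *s row i ?G) = 0" by (simp add: c(2) vec_eq_iff)
    then show ?thesis using c(1) by (rule det_eq_0_if_rows_dependent)
  qed
  ultimately show ?thesis by simp
next
  case False
  then have ind: "c j = 0" if "(\<Sum>j\<in>UNIV. c j *\<^sub>R W $ j) = 0" for c :: "'n \<Rightarrow> real" and j using that by blast
  have "inj (($) W)"
  proof (rule injI, rule ccontr)
    fix i j assume ij: "W $ i = W $ j" "i \<noteq> j"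
    have "(\<Sum>k\<in>UNIV. (if k = i then 1 else if k = j then -1 else 0) *\<^sub>R W $ k) =
      (\<Sum>k\<in>{i,j}. (if k = i then 1 else if k = j then -1 else 0) *\<^sub>R W $ k)" by (rule sum.mono_neutral_right) auto
    also have "\<dots> = 0" using ij by simp
    finally show False using ind[of "\<lambda>k. if k = i then 1 else if k = j then -1 else 0" i] by simp
  qed
  have "independent (range (($) W))"
  proof (rule independent_if_scalars_zero)
    fix f x assume f: "(\<Sum>x\<in>range (($) W). f x *\<^sub>R x) = 0" "x \<in> range (($) W)"
    then have "(\<Sum>j\<in>UNIV. f (W $ j) *\<^sub>R W $ j) = 0"
      using sum.reindex[OF \<open>inj (($) W)\<close>, of "\<lambda>x. f x *\<^sub>R x"] by simp
    then show "f x = 0" using ind[of "\<lambda>j. f (W $ j)"] f(2) by blast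
  qed simp
  then have dim: "dim (span (range (($) W))) = CARD('n)"
    using dim_eq_card_independent[of "range (($) W)"] card_image[OF \<open>inj (($) W)\<close>] by (simp add: dim_span)
  obtain S where S: "S \<subseteq> span (range (($) W))" "pairwise orthogonal S" "\<And>x. x \<in> S \<Longrightarrow> norm x = 1"
    "independent S" "card S = dim (span (range (($) W)))" "span S = span (range (($) W))"
    using orthonormal_basis_subspace[OF subspace_span] by blast
  have fS: "finite S" using S(4) independent_bound by blast
  then obtain b where b: "bij_betw b (UNIV::'n set) S" using S(5) dim bij_betw_iff_card[of "UNIV::'n set" S] by auto
  define B :: "complex^'n^'n" where "B = (\<chi> k. b k)"
  define R :: "real^'n^'n" where "R = (\<chi> j k. W $ j \<bullet> b k)"
  have ex: "W $ j = (\<Sum>k\<in>UNIV. (R $ j $ k) *\<^sub>R b k)" for j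
  proof -
    have "W $ j \<in> span S" unfolding S(6) by (auto intro: span_base)
    then have "(\<Sum>i\<in>S. (W $ j \<bullet> i) *\<^sub>R i) = W $ j" using orthonormal_basis_expand[OF S(2) S(3) _ fS] by blast
    then show ?thesis using sum.reindex_bij_betw[OF b, of "\<lambda>i. (W $ j \<bullet> i) *\<^sub>R i"] by (simp add: R_def)
  qed
  have bb: "b k \<bullet> b l = (if k = l then 1 else 0)" for k l
  proof -
    have "b k \<in> S" "b l \<in> S" using b by (auto simp: bij_betw_def)
    moreover have "b k = b l \<longleftrightarrow> k = l" using b by (auto simp: bij_betw_def inj_on_def)
    ultimately show ?thesis using S(2,3) by (auto simp: pairwise_def orthogonal_def norm_eq_1)
  qed
  have "W $ j \<bullet> W $ l = (\<Sum>k\<in>UNIV. R $ j $ k * R $ l $ k)" for j l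
  proof -
    have "W $ j \<bullet> W $ l = (\<Sum>k\<in>UNIV. R $ j $ k *\<^sub>R b k) \<bullet> W $ l" by (simp only: ex[of j])
    also have "\<dots> = (\<Sum>k\<in>UNIV. R $ j $ k * (b k \<bullet> W $ l))" by (simp add: inner_sum_left)
    also have "\<dots> = (\<Sum>k\<in>UNIV. R $ j $ k * R $ l $ k)"
      by (intro sum.cong refl arg_cong2[where f="(*)"]) (simp add: R_def inner_commute)
    finally show ?thesis .
  qed
  then have "(\<chi> j k. W $ j \<bullet> W $ k) = R ** transpose R" by (simp add: vec_eq_iff matrix_matrix_mult_def transpose_def)
  then have 1: "det (\<chi> j k. W $ j \<bullet> W $ k) = (det R)\<^sup>2" by (simp add: det_mul det_transpose power2_eq_square)
  have "W = (\<chi> j k. of_real (R $ j $ k)) ** B"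
  proof -
    have "W $ j = ((\<chi> j k. of_real (R $ j $ k)) ** B) $ j" for j
      by (subst ex) (simp add: vec_eq_iff matrix_matrix_mult_def B_def scaleR_conv_of_real[where 'a=complex])
    then show ?thesis by (rule vec_eq_iff[THEN iffD2, OF allI])
  qed
  then have "det W = det ((\<chi> j k. complex_of_real (R $ j $ k)) ** B)" by (rule arg_cong)
  then have "det W = det (\<chi> j k. complex_of_real (R $ j $ k)) * det B" by (simp only: det_mul)
  moreover have "det (\<chi> j k. complex_of_real (R $ j $ k)) = of_real (det R)" by (simp add: det_def)
  \<comment> \<open>The rows of \<open>B\<close> are orthonormal only for the real inner product, so
    |det B| may be smaller than 1.\<close>
  moreover have "cmod (det B) \<le> 1" by (rule hadamard_unit) (simp add: B_def norm_eq_1 bb)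
  ultimately have "cmod (det W) \<le> \<bar>det R\<bar>" by (simp add: norm_mult mult_left_le)
  then have "(cmod (det W))\<^sup>2 \<le> \<bar>det R\<bar>\<^sup>2" by (intro power_mono) auto
  then show ?thesis by (simp add: 1)
qed

context hermitian_product
begin

text \<open>Coordinates with respect to a \<open>g\<close>-orthonormal complex frame turn
  \<open>g\<close> into the standard inner product, which reduces the claim to
  \<open>det_le_real_gram\<close>.\<close>

lemma gram_det_ge:
  "(cmod (det M))\<^sup>2 * Re (det (herm_matrix g)) \<le> det (\<chi> j k. g (M $ j) (M $ k))"
proof -
  obtain B :: "complex^'n^'n" where B: "\<And>i j. herm g (B $ i) (B $ j) = (if i = j then 1 else 0)" using orthonormal_frame_exists by blast
  have "(\<chi> i j. herm g (B $ i) (B $ j)) = mat 1" by (simp add: B mat_def)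
  then have 1: "of_real ((cmod (det B))\<^sup>2) * det (herm_matrix g) = 1" using det_herm_rows[of B] by simp
  then have dB: "det B \<noteq> 0" by auto
  have 1: "(cmod (det B))\<^sup>2 * Re (det (herm_matrix g)) = 1" using arg_cong[OF 1, of Re] by simp
  have "\<exists>u. \<forall>j. M $ j = (\<Sum>k\<in>UNIV. u j k *s B $ k)"
    by (rule choice, rule allI) (use row_combination_exists[OF dB] in metis)
  then obtain u where u: "\<And>j. M $ j = (\<Sum>k\<in>UNIV. u j k *s B $ k)" by blast
  define W where "W = (\<chi> j k. u j k)"
  have "M $ j = (W ** B) $ j" for j by (subst u) (simp add: vec_eq_iff matrix_matrix_mult_def W_def)
  then have "M = W ** B" by (rule vec_eq_iff[THEN iffD2, OF allI])
  then have dM: "det M = det W * det B" by (simp add: det_mul)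
  have "g (M $ j) (M $ k) = W $ j \<bullet> W $ k" for j k
  proof -
    have "herm g (M $ j) (M $ k) = (\<Sum>l\<in>UNIV. u j l * cnj (u k l))"
      unfolding u[of j] u[of k] herm_sum by (simp add: herm_sum_right B if_distrib cong: if_cong)
    also have "\<dots> = herm (\<bullet>) (W $ j) (W $ k)" by (simp add: herm_inner W_def)
    finally have "Re (herm g (M $ j) (M $ k)) = Re (herm (\<bullet>) (W $ j) (W $ k))" by simp
    then show ?thesis by (simp add: herm_def)
  qed
  then have "(cmod (det W))\<^sup>2 \<le> det (\<chi> j k. g (M $ j) (M $ k))" using det_le_real_gram[of W] by simp
  moreover have "(cmod (det M))\<^sup>2 * Re (det (herm_matrix g)) = (cmod (det W))\<^sup>2 * ((cmod (det B))\<^sup>2 * Re (det (herm_matrix g)))"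
    by (simp add: dM norm_mult power_mult_distrib)
  ultimately show ?thesis by (simp add: 1)
qed

end

section \<open>Change of variables for nonnegative functions\<close>

text \<open>The change of variables theorem of the library is stated for well-ordered index types.\<close>

typedef 'a ord_copy = "UNIV :: 'a set" by simp

instance ord_copy :: (finite) finite
proof
  have "range (Abs_ord_copy :: 'a \<Rightarrow> 'a ord_copy) = UNIV" by (rule type_definition.Abs_image[OF type_definition_ord_copy])
  moreover have "finite (range (Abs_ord_copy :: 'a \<Rightarrow> 'a ord_copy))" by (rule finite_imageI) (rule finite)
  ultimately show "finite (UNIV :: 'a ord_copy set)" by (simp only:)
qed

text \<open>Any injection into the naturals will do; it carries their well-order to the
  copy.\<close>

definition ord_index :: "'a::finite ord_copy \<Rightarrow> nat" where
  "ord_index = (SOME f. inj f)"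

lemma inj_ord_index: "inj (ord_index :: 'a::finite ord_copy \<Rightarrow> nat)"
proof -
  obtain f :: "'a ord_copy \<Rightarrow> nat" where "inj f" using finite_imp_inj_to_nat_seg[of "UNIV :: 'a ord_copy set"] by auto
  then show ?thesis unfolding ord_index_def by (rule someI[of inj])
qed

instantiation ord_copy :: (finite) wellorder
begin

definition less_eq_ord_copy :: "'a ord_copy \<Rightarrow> 'a ord_copy \<Rightarrow> bool" where
  "less_eq_ord_copy x y \<longleftrightarrow> ord_index x \<le> ord_index y"

definition less_ord_copy :: "'a ord_copy \<Rightarrow> 'a ord_copy \<Rightarrow> bool" where
  "less_ord_copy x y \<longleftrightarrow> ord_index x < ord_index y"

instance
proof
  fix x y :: "'a ord_copy"
  assume "x \<le> y" "y \<le> x"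
  then have "ord_index x = ord_index y" unfolding less_eq_ord_copy_def by (rule order.antisym)
  then show "x = y" by (rule injD[OF inj_ord_index])
next
  fix P :: "'a ord_copy \<Rightarrow> bool" and a :: "'a ord_copy"
  assume step: "\<And>x. (\<And>y. y < x \<Longrightarrow> P y) \<Longrightarrow> P x"
  show "P a"
  proof (induction a rule: measure_induct_rule[of ord_index])
    case (less a)
    show ?case
    proof (rule step)
      fix y assume "y < a"
      then show "P y" using less[of y] unfolding less_ord_copy_def by blast
    qed
  qed
qed (unfold less_eq_ord_copy_def less_ord_copy_def, linarith+)

end

text \<open>Conjugating a product of transpositions yields a product of equally many transpositions;
  hence conjugation preserves the sign.\<close>

lemma swapidseq_conjugate:
  fixes \<phi> :: "'a \<Rightarrow> 'b"
  assumes "bij \<phi>" "swapidseq n p"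
  shows "swapidseq n (inv \<phi> \<circ> p \<circ> \<phi>)" using assms(2)
proof (induction rule: swapidseq.induct)
  case id
  have "inv \<phi> \<circ> id \<circ> \<phi> = id" using assms(1) by (simp only: comp_id inv_o_cancel bij_is_inj)
  then show ?case by (simp only: swapidseq.id)
next
  case (comp_Suc n p a b)
  have eq: "inv \<phi> \<circ> (Transposition.transpose a b \<circ> p) \<circ> \<phi>
    = Transposition.transpose (inv \<phi> a) (inv \<phi> b) \<circ> (inv \<phi> \<circ> p \<circ> \<phi>)"
  proof
    fix x
    show "(inv \<phi> \<circ> (Transposition.transpose a b \<circ> p) \<circ> \<phi>) x
      = (Transposition.transpose (inv \<phi> a) (inv \<phi> b) \<circ> (inv \<phi> \<circ> p \<circ> \<phi>)) x"
      using bij_is_inj[OF bij_imp_bij_inv[OF assms(1)]] by (simp add: Transposition.transpose_def inj_eq)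
  qed
  have "inv \<phi> a \<noteq> inv \<phi> b" using comp_Suc bij_is_inj[OF bij_imp_bij_inv[OF assms(1)]] by (simp add: inj_eq)
  then show ?case unfolding eq by (rule swapidseq.comp_Suc[OF comp_Suc.IH])
qed

lemma sign_conjugate:
  fixes \<phi> :: "'a::finite \<Rightarrow> 'b::finite"
  assumes "bij \<phi>" "p permutes UNIV"
  shows "sign (inv \<phi> \<circ> p \<circ> \<phi>) = sign p"
proof -
  have "permutation p" unfolding permutation_permutes using assms(2) by (intro exI[of _ UNIV] conjI finite)
  then obtain n where n: "swapidseq n p" unfolding permutation_def by blast
  have "evenperm p = even n" by (rule evenperm_unique[OF n refl])
  moreover have "evenperm (inv \<phi> \<circ> p \<circ> \<phi>) = even n"
    by (rule evenperm_unique[OF swapidseq_conjugate[OF assms(1) n] refl])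
  ultimately show ?thesis unfolding sign_def by (simp only:)
qed

text \<open>Conjugation by \<phi> matches the permutations of the two index types together with
  their signs.\<close>

lemma det_reindex:
  fixes \<phi> :: "'m::finite \<Rightarrow> 'n::finite" and A :: "'a::comm_ring_1^'n^'n"
  assumes "bij \<phi>"
  shows "det (\<chi> i j. A $ \<phi> i $ \<phi> j) = det A"
proof -
  let ?c = "\<lambda>p. inv \<phi> \<circ> p \<circ> \<phi>"
  have bij: "bij_betw ?c {p. p permutes (UNIV::'n set)} {p. p permutes (UNIV::'m set)}"
  proof (rule bij_betw_byWitness[where f'="\<lambda>q. \<phi> \<circ> q \<circ> inv \<phi>"])
    have [simp]: "\<phi> (inv \<phi> x) = x" "inv \<phi> (\<phi> y) = y" for x y
      using assms by (auto simp: bij_is_surj surj_f_inv_f bij_is_inj)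
    show "\<forall>p\<in>{p. p permutes UNIV}. \<phi> \<circ> ?c p \<circ> inv \<phi> = p" by (auto simp: fun_eq_iff)
    show "\<forall>q\<in>{p. p permutes UNIV}. ?c (\<phi> \<circ> q \<circ> inv \<phi>) = q" by (auto simp: fun_eq_iff)
    show "?c ` {p. p permutes UNIV} \<subseteq> {p. p permutes UNIV}"
      using assms by (auto intro!: bij_imp_permutes bij_comp bij_imp_bij_inv permutes_bij)
    show "(\<lambda>q. \<phi> \<circ> q \<circ> inv \<phi>) ` {p. p permutes UNIV} \<subseteq> {p. p permutes UNIV}"
      using assms by (auto intro!: bij_imp_permutes bij_comp bij_imp_bij_inv permutes_bij)
  qed
  have "det (\<chi> i j. A $ \<phi> i $ \<phi> j) = (\<Sum>p\<in>{p. p permutes UNIV}. of_int (sign (?c p)) * (\<Prod>i\<in>UNIV. A $ \<phi> i $ \<phi> (?c p i)))"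
    unfolding det_def by (subst sum.reindex_bij_betw[OF bij, symmetric]) simp
  also have "\<dots> = (\<Sum>p\<in>{p. p permutes UNIV}. of_int (sign p) * (\<Prod>i\<in>UNIV. A $ i $ p i))"
  proof (rule sum.cong)
    fix p :: "'n \<Rightarrow> 'n" assume "p \<in> {p. p permutes UNIV}"
    then have "sign (?c p) = sign p" using sign_conjugate[OF assms] by blast
    moreover have "(\<Prod>i\<in>UNIV. A $ \<phi> i $ \<phi> (?c p i)) = (\<Prod>i\<in>UNIV. A $ i $ p i)"
      using prod.reindex_bij_betw[OF assms, of "\<lambda>i. A $ i $ p i"] assms by (simp add: bij_is_surj surj_f_inv_f)
    ultimately show "of_int (sign (?c p)) * (\<Prod>i\<in>UNIV. A $ \<phi> i $ \<phi> (?c p i)) = of_int (sign p) * (\<Prod>i\<in>UNIV. A $ i $ p i)"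
      by simp
  qed simp
  finally show ?thesis unfolding det_def .
qed

definition reindex :: "('m \<Rightarrow> 'n) \<Rightarrow> real^'n \<Rightarrow> real^'m" where
  "reindex \<phi> v = (\<chi> i. v $ \<phi> i)"

lemma bounded_linear_reindex: "bounded_linear (reindex \<phi> :: real^'n::finite \<Rightarrow> real^'m::finite)"
  unfolding linear_conv_bounded_linear[symmetric] by (intro linearI) (auto simp: reindex_def vec_eq_iff)

lemma reindex_inverse: "bij \<phi> \<Longrightarrow> reindex (inv \<phi>) (reindex \<phi> v) = v" "bij \<phi> \<Longrightarrow> reindex \<phi> (reindex (inv \<phi>) w) = w"
  by (auto simp: reindex_def vec_eq_iff bij_is_surj surj_f_inv_f bij_is_inj)

lemma mem_reindex_image:
  assumes "bij \<phi>"
  shows "x \<in> reindex \<phi> ` S \<longleftrightarrow> reindex (inv \<phi>) x \<in> S"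
  by (auto simp: image_iff reindex_inverse[OF assms] intro!: bexI[of _ "reindex (inv \<phi>) x"])

lemma measurable_reindex [measurable]: "reindex \<phi> \<in> borel_measurable borel"
  for \<phi> :: "'m::finite \<Rightarrow> 'n::finite"
  using linear_continuous_on[OF bounded_linear_reindex] by (rule borel_measurable_continuous_onI)

lemma prod_Basis_vec:
  fixes f :: "real^'n::finite \<Rightarrow> 'b::comm_monoid_mult"
  shows "(\<Prod>b\<in>Basis. f b) = (\<Prod>i\<in>UNIV. f (axis i 1))"
proof -
  define a where "a i = (axis i 1 :: real^'n)" for i
  have B: "Basis = a ` UNIV" by (auto simp: a_def Basis_vec_def)
  have I: "inj_on a UNIV" by (auto simp: inj_on_def a_def axis_eq_axis)
  show ?thesis unfolding B prod.reindex[OF I] by (simp add: a_def)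
qed

text \<open>Renaming coordinates takes boxes to boxes with the same side lengths, and Lebesgue
  measure is determined by boxes.\<close>

lemma distr_lborel_reindex:
  fixes \<phi> :: "'m::finite \<Rightarrow> 'n::finite"
  assumes "bij \<phi>"
  shows "distr lborel borel (reindex \<phi>) = lborel"
proof (rule lborel_eqI[symmetric])
  fix l u :: "real^'m" assume prem: "\<And>b. b \<in> Basis \<Longrightarrow> l \<bullet> b \<le> u \<bullet> b"
  have "axis i 1 \<in> (Basis :: (real^'m) set)" for i by (auto simp: Basis_vec_def)
  then have "l \<bullet> axis i 1 \<le> u \<bullet> axis i 1" for i by (rule prem)
  then have le: "l $ i \<le> u $ i" for i by (simp add: inner_axis)
  let ?l = "reindex (inv \<phi>) l" and ?u = "reindex (inv \<phi>) u"
  have "reindex \<phi> -` box l u = box ?l ?u"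
  proof (intro set_eqI iffI)
    fix v assume v: "v \<in> reindex \<phi> -` box l u"
    have "?l $ j < v $ j \<and> v $ j < ?u $ j" for j
    proof -
      have "l $ inv \<phi> j < v $ \<phi> (inv \<phi> j)" "v $ \<phi> (inv \<phi> j) < u $ inv \<phi> j"
        using v by (auto simp: mem_box_cart reindex_def)
      then show ?thesis using assms by (simp add: reindex_def bij_is_surj surj_f_inv_f)
    qed
    then show "v \<in> box ?l ?u" by (simp add: mem_box_cart)
  next
    fix v assume "v \<in> box ?l ?u"
    then have "l $ inv \<phi> (\<phi> i) < v $ \<phi> i" "v $ \<phi> i < u $ inv \<phi> (\<phi> i)" for i by (auto simp: mem_box_cart reindex_def)
    then show "v \<in> reindex \<phi> -` box l u" using assms by (simp add: mem_box_cart reindex_def bij_is_inj)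
  qed
  moreover have "emeasure lborel (box ?l ?u) = (\<Prod>b\<in>Basis. (?u - ?l) \<bullet> b)"
    by (rule emeasure_lborel_box) (use le in \<open>auto simp: Basis_vec_def inner_axis reindex_def\<close>)
  moreover have "(\<Prod>b\<in>Basis. (?u - ?l) \<bullet> b) = (\<Prod>b\<in>Basis. (u - l) \<bullet> b)"
    using prod.reindex_bij_betw[OF bij_imp_bij_inv[OF assms], of "\<lambda>i. u $ i - l $ i"]
    by (simp add: prod_Basis_vec inner_axis reindex_def)
  ultimately show "emeasure (distr lborel borel (reindex \<phi>)) (box l u) = (\<Prod>b\<in>Basis. (u - l) \<bullet> b)"
    by (simp add: emeasure_distr)
qed simp

text \<open>Passes between the integrals of the change of variables theorem and nonnegative
  integrals over \<open>lborel\<close>, including the case of an infinite value.\<close>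

lemma absolutely_integrable_nonneg_iff:
  fixes h :: "real^'m::finite \<Rightarrow> real"
  assumes "S \<in> sets borel" "\<And>x. x \<in> S \<Longrightarrow> 0 \<le> h x" "(\<lambda>x. indicator S x * h x) \<in> borel_measurable borel"
  shows "h absolutely_integrable_on S \<longleftrightarrow> (\<integral>\<^sup>+x\<in>S. ennreal (h x) \<partial>lborel) < \<infinity>"
    and "h absolutely_integrable_on S \<Longrightarrow> (\<integral>\<^sup>+x\<in>S. ennreal (h x) \<partial>lborel) = ennreal (integral S h)"
proof -
  let ?h = "\<lambda>x. indicator S x * h x"
  have m: "?h \<in> borel_measurable lebesgue" using assms(3) by (intro measurable_completion) simp
  have eq: "ennreal (?h x) = ennreal (h x) * indicator S x" for x by (auto simp: indicator_def)
  have nn: "(\<integral>\<^sup>+x. ennreal (?h x) \<partial>lebesgue) = (\<integral>\<^sup>+x\<in>S. ennreal (h x) \<partial>lborel)"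
    using assms(3) by (subst nn_integral_completion) (auto simp: eq)
  have pos: "0 \<le> ?h x" for x using assms(2) by (auto simp: indicator_def)
  show "h absolutely_integrable_on S \<longleftrightarrow> (\<integral>\<^sup>+x\<in>S. ennreal (h x) \<partial>lborel) < \<infinity>"
    unfolding set_integrable_def using m pos nn by (simp add: integrable_iff_bounded abs_of_nonneg)
  assume i: "h absolutely_integrable_on S"
  have "(\<integral>\<^sup>+x. ennreal (?h x) \<partial>lebesgue) = ennreal (\<integral>x. ?h x \<partial>lebesgue)"
    using i pos unfolding set_integrable_def by (intro nn_integral_eq_integral) auto
  also have "(\<integral>x. ?h x \<partial>lebesgue) = integral S h"
    using set_lebesgue_integral_eq_integral(2)[OF i] by (simp add: set_lebesgue_integral_def)
  finally show "(\<integral>\<^sup>+x\<in>S. ennreal (h x) \<partial>lborel) = ennreal (integral S h)" by (simp add: nn)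
qed

text \<open>The equivalence of integrability on both sides also settles infinite values: if one side
  is not integrable, neither is the other, and both integrals are infinite.\<close>

lemma nn_integral_change_of_variables_wellorder:
  fixes g :: "real^'m::{finite,wellorder} \<Rightarrow> real^'m::_"
  assumes S: "S \<in> sets borel" "g ` S \<in> sets borel"
    and der: "\<And>x. x \<in> S \<Longrightarrow> (g has_derivative g' x) (at x)" and inj: "inj_on g S"
    and f: "\<And>y. y \<in> g ` S \<Longrightarrow> 0 \<le> f y" "(\<lambda>y. indicator (g ` S) y * f y) \<in> borel_measurable borel"
    and h: "\<And>x. x \<in> S \<Longrightarrow> h x = \<bar>det (matrix (g' x))\<bar> * f (g x)" "(\<lambda>x. indicator S x * h x) \<in> borel_measurable borel"
  shows "(\<integral>\<^sup>+x\<in>S. ennreal (h x) \<partial>lborel) = (\<integral>\<^sup>+y\<in>g ` S. ennreal (f y) \<partial>lborel)"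
proof -
  let ?h = "\<lambda>x. \<bar>det (matrix (g' x))\<bar> * f (g x)"
  \<comment> \<open>The theorem concerns vector-valued functions, so scalars enter as elements of
    \<open>real^1\<close>.\<close>
  have "(\<lambda>x. \<bar>det (matrix (g' x))\<bar> *\<^sub>R (vec (f (g x)) :: real^1)) absolutely_integrable_on S \<and>
    integral S (\<lambda>x. \<bar>det (matrix (g' x))\<bar> *\<^sub>R (vec (f (g x)) :: real^1)) = vec b
    \<longleftrightarrow> (\<lambda>y. vec (f y) :: real^1) absolutely_integrable_on (g ` S) \<and> integral (g ` S) (\<lambda>y. vec (f y) :: real^1) = vec b" for b
  proof (rule has_absolute_integral_change_of_variables)
    show "S \<in> sets lebesgue" using S(1) by simp
    show "(g has_derivative g' x) (at x within S)" if "x \<in> S" for x using der[OF that] by (rule has_derivative_at_withinI)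
  qed (rule inj)
  then have cv: "?h absolutely_integrable_on S \<and> integral S ?h = b
    \<longleftrightarrow> f absolutely_integrable_on (g ` S) \<and> integral (g ` S) f = b" for b
    unfolding absolutely_integrable_on_1_iff integral_on_1_eq by (simp add: vec_eq_iff)
  have "(\<lambda>x. indicator S x *\<^sub>R h x) = (\<lambda>x. indicator S x *\<^sub>R ?h x)" using h(1) by (auto simp: indicator_def)
  then have ha: "h absolutely_integrable_on S \<longleftrightarrow> ?h absolutely_integrable_on S" "integral S h = integral S ?h"
    using h(1) by (auto simp: set_integrable_def intro!: integral_cong)
  have hpos: "0 \<le> h x" if "x \<in> S" for x using h(1)[OF that] f(1)[of "g x"] that by simp
  show ?thesis
  proof (cases "h absolutely_integrable_on S")
    case True
    then have "f absolutely_integrable_on g ` S \<and> integral (g ` S) f = integral S h" using cv[of "integral S h"] ha by simp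
    then show ?thesis using absolutely_integrable_nonneg_iff(2)[OF S(1) hpos h(2) True] absolutely_integrable_nonneg_iff(2)[OF S(2) f] by simp
  next
    case False
    then have "\<not> f absolutely_integrable_on g ` S" using cv ha by blast
    then have "(\<integral>\<^sup>+x\<in>S. ennreal (h x) \<partial>lborel) = \<infinity>" "(\<integral>\<^sup>+y\<in>g ` S. ennreal (f y) \<partial>lborel) = \<infinity>"
      using False absolutely_integrable_nonneg_iff(1)[OF S(1) hpos h(2)] absolutely_integrable_nonneg_iff(1)[OF S(2) f]
      by (simp_all add: less_top[symmetric])
    then show ?thesis by simp
  qed
qed

lemma nn_integral_reindex:
  fixes \<phi> :: "'m::finite \<Rightarrow> 'n::finite" and f :: "real^'n \<Rightarrow> real"
  assumes "bij \<phi>" "(\<lambda>y. indicator S y * f y) \<in> borel_measurable borel" "\<And>y. y \<in> S \<Longrightarrow> 0 \<le> f y"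
  shows "(\<integral>\<^sup>+x\<in>reindex \<phi> ` S. ennreal (f (reindex (inv \<phi>) x)) \<partial>lborel) = (\<integral>\<^sup>+y\<in>S. ennreal (f y) \<partial>lborel)"
proof -
  have eq: "ennreal (indicator S y * f y) = ennreal (f y) * indicator S y" for y by (auto simp: indicator_def)
  have ind: "indicator (reindex \<phi> ` S) x = (indicator S (reindex (inv \<phi>) x) :: ennreal)" for x
    unfolding indicator_def mem_reindex_image[OF assms(1)] ..
  have "(\<integral>\<^sup>+y\<in>S. ennreal (f y) \<partial>lborel) = (\<integral>\<^sup>+y. ennreal (indicator S y * f y) \<partial>distr lborel borel (reindex (inv \<phi>)))"
    unfolding distr_lborel_reindex[OF bij_imp_bij_inv[OF assms(1)]] by (simp add: eq)
  also have "\<dots> = (\<integral>\<^sup>+x. ennreal (indicator S (reindex (inv \<phi>) x) * f (reindex (inv \<phi>) x)) \<partial>lborel)"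
    using assms(2) by (intro nn_integral_distr) simp_all
  finally show ?thesis by (simp add: eq ind)
qed

lemma measurable_indicator_reindex:
  fixes \<phi> :: "'m::finite \<Rightarrow> 'n::finite" and f :: "real^'n \<Rightarrow> real"
  assumes "bij \<phi>" "(\<lambda>y. indicator S y * f y) \<in> borel_measurable borel"
  shows "(\<lambda>x. indicator (reindex \<phi> ` S) x * f (reindex (inv \<phi>) x)) \<in> borel_measurable borel"
proof -
  have ind: "indicator (reindex \<phi> ` S) x = (indicator S (reindex (inv \<phi>) x) :: real)" for x
    unfolding indicator_def mem_reindex_image[OF assms(1)] ..
  have "(\<lambda>x. (\<lambda>y. indicator S y * f y) (reindex (inv \<phi>) x)) \<in> borel_measurable borel"
    by (rule measurable_compose[OF measurable_reindex assms(2)])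
  then show ?thesis by (simp add: ind)
qed

lemma reindex_image_borel:
  fixes \<phi> :: "'m::finite \<Rightarrow> 'n::finite"
  assumes "bij \<phi>" "S \<in> sets borel"
  shows "reindex \<phi> ` S \<in> sets borel"
proof -
  have "reindex \<phi> ` S = reindex (inv \<phi>) -` S \<inter> space borel" using mem_reindex_image[OF assms(1)] by auto
  then show ?thesis using measurable_sets[OF measurable_reindex assms(2)] by metis
qed

text \<open>The map is conjugated to the ordered copy of the index type; \<open>reindex\<close>
  preserves Lebesgue measure and the Jacobian determinant.\<close>

lemma nn_integral_change_of_variables:
  fixes g :: "real^'n::finite \<Rightarrow> real^'n"
  assumes S: "S \<in> sets borel" "g ` S \<in> sets borel"
    and der: "\<And>x. x \<in> S \<Longrightarrow> (g has_derivative g' x) (at x)" and inj: "inj_on g S"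
    and f: "\<And>y. y \<in> g ` S \<Longrightarrow> 0 \<le> f y" "(\<lambda>y. indicator (g ` S) y * f y) \<in> borel_measurable borel"
    and h: "\<And>x. x \<in> S \<Longrightarrow> h x = \<bar>det (matrix (g' x))\<bar> * f (g x)" "(\<lambda>x. indicator S x * h x) \<in> borel_measurable borel"
  shows "(\<integral>\<^sup>+x\<in>S. ennreal (h x) \<partial>lborel) = (\<integral>\<^sup>+y\<in>g ` S. ennreal (f y) \<partial>lborel)"
proof -
  define \<phi> :: "'n ord_copy \<Rightarrow> 'n" where "\<phi> = Rep_ord_copy"
  have bij: "bij \<phi>" unfolding \<phi>_def using Rep_ord_copy_inject Abs_ord_copy_inverse
    by (intro bijI injI surjI[of _ Abs_ord_copy]) auto
  let ?R = "reindex \<phi>" and ?I = "reindex (inv \<phi>)"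
  note RI = reindex_inverse[OF bij]
  let ?G = "\<lambda>x. ?R (g (?I x))"
  have GS: "?G ` (?R ` S) = ?R ` (g ` S)" using RI by (auto simp: image_iff)
  have "(\<integral>\<^sup>+x\<in>?R ` S. ennreal (h (?I x)) \<partial>lborel) = (\<integral>\<^sup>+y\<in>?G ` (?R ` S). ennreal (f (?I y)) \<partial>lborel)"
  proof (rule nn_integral_change_of_variables_wellorder)
    show "?R ` S \<in> sets borel" "?G ` (?R ` S) \<in> sets borel" unfolding GS using reindex_image_borel[OF bij] S by auto
    show "inj_on ?G (?R ` S)"
    proof (rule inj_onI)
      fix x y assume "x \<in> ?R ` S" "y \<in> ?R ` S" "?G x = ?G y"
      then obtain a b where ab: "x = ?R a" "a \<in> S" "y = ?R b" "b \<in> S" by auto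
      then have "?I (?R (g a)) = ?I (?R (g b))" using \<open>?G x = ?G y\<close> RI by simp
      then have "a = b" using RI ab inj by (simp add: inj_on_def)
      then show "x = y" using ab by simp
    qed
    show "(?G has_derivative (\<lambda>v. ?R (g' (?I x) (?I v)))) (at x)" if "x \<in> ?R ` S" for x
    proof -
      have x: "?I x \<in> S" using that RI by auto
      have "(?I has_derivative ?I) (at x)" by (rule bounded_linear_imp_has_derivative[OF bounded_linear_reindex])
      from diff_chain_at[OF this der[OF x]] have "((\<lambda>x. g (?I x)) has_derivative (\<lambda>v. g' (?I x) (?I v))) (at x)"
        by (simp add: o_def)
      then show ?thesis by (rule bounded_linear.has_derivative[OF bounded_linear_reindex])
    qed
    show "h (?I x) = \<bar>det (matrix (\<lambda>v. ?R (g' (?I x) (?I v))))\<bar> * f (?I (?G x))" if "x \<in> ?R ` S" for x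
    proof -
      have x: "?I x \<in> S" using that RI by auto
      have "?I (axis j 1) = axis (\<phi> j) 1" for j
        using bij by (auto simp: reindex_def vec_eq_iff axis_def bij_is_surj surj_f_inv_f bij_is_inj)
      then have "matrix (\<lambda>v. ?R (g' (?I x) (?I v))) = (\<chi> i j. matrix (g' (?I x)) $ \<phi> i $ \<phi> j)"
        by (simp add: matrix_def reindex_def vec_eq_iff)
      then show ?thesis using h(1)[OF x] det_reindex[OF bij, of "matrix (g' (?I x))"] RI by simp
    qed
    show "0 \<le> f (?I y)" if "y \<in> ?G ` (?R ` S)" for y using that f(1) RI unfolding GS by auto
    show "(\<lambda>y. indicator (?G ` (?R ` S)) y * f (?I y)) \<in> borel_measurable borel"
      unfolding GS by (rule measurable_indicator_reindex[OF bij f(2)])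
    show "(\<lambda>x. indicator (?R ` S) x * h (?I x)) \<in> borel_measurable borel" by (rule measurable_indicator_reindex[OF bij h(2)])
  qed
  moreover have "(\<integral>\<^sup>+x\<in>?R ` S. ennreal (h (?I x)) \<partial>lborel) = (\<integral>\<^sup>+x\<in>S. ennreal (h x) \<partial>lborel)"
    using h(1) f(1) by (intro nn_integral_reindex bij h(2)) simp
  moreover have "(\<integral>\<^sup>+y\<in>?R ` (g ` S). ennreal (f (?I y)) \<partial>lborel) = (\<integral>\<^sup>+y\<in>g ` S. ennreal (f y) \<partial>lborel)"
    using f by (intro nn_integral_reindex bij)
  ultimately show ?thesis unfolding GS by simp
qed

section \<open>Measures given by densities in charts\<close>

lemma chart_onD:
  assumes "chart_on S c"
  shows "open (coord c ` dom_of c)" "continuous_on (dom_of c) (coord c)"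
    "continuous_on (coord c ` dom_of c) (chart_inv c)"
    "p \<in> dom_of c \<Longrightarrow> chart_inv c (coord c p) = p"
    "y \<in> coord c ` dom_of c \<Longrightarrow> chart_inv c y \<in> dom_of c"
    "y \<in> coord c ` dom_of c \<Longrightarrow> coord c (chart_inv c y) = y"
    "dom_of c \<subseteq> S" "openin (top_of_set S) (dom_of c)" using assms unfolding chart_on_def homeomorphism_def openin_open by auto

lemma chart_dom_borel:
  assumes "chart_on S c" "S \<in> sets borel"
  shows "dom_of c \<in> sets borel" using chart_onD(8)[OF assms(1)] assms(2) unfolding openin_open by auto

lemma chart_inv_measurable:
  fixes c :: "('a::topological_space, 'b::euclidean_space) chart"
  assumes "chart_on S c"
  shows "chart_inv c \<in> borel_measurable (restrict_space lborel (coord c ` dom_of c))"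
proof -
  have "chart_inv c \<in> borel_measurable (restrict_space borel (coord c ` dom_of c))"
    by (rule borel_measurable_continuous_on_restrict[OF chart_onD(3)[OF assms]])
  then show ?thesis by (subst measurable_cong_sets[OF sets_restrict_space_cong[OF sets_lborel] refl])
qed

lemma chart_image_eq:
  assumes "chart_on S c"
  shows "coord c ` (B \<inter> dom_of c) = {y \<in> coord c ` dom_of c. chart_inv c y \<in> B}"
  using chart_onD(4)[OF assms] by (auto simp: image_iff)

lemma chart_image_borel:
  fixes c :: "('a::topological_space, 'b::euclidean_space) chart"
  assumes "chart_on S c" "B \<in> sets borel"
  shows "coord c ` (B \<inter> dom_of c) \<in> sets borel"
proof -
  have "chart_inv c -` B \<inter> space (restrict_space lborel (coord c ` dom_of c)) \<in> sets (restrict_space lborel (coord c ` dom_of c))"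
    by (rule measurable_sets[OF chart_inv_measurable[OF assms(1)] assms(2)])
  moreover have "chart_inv c -` B \<inter> space (restrict_space lborel (coord c ` dom_of c)) = coord c ` (B \<inter> dom_of c)"
    unfolding chart_image_eq[OF assms(1)] by (auto simp: space_restrict_space)
  ultimately show ?thesis using chart_onD(1)[OF assms(1)] by (simp add: sets_restrict_space_iff)
qed

lemma measurable_indicator_continuous_on:
  fixes d :: "'b::euclidean_space \<Rightarrow> real"
  assumes "open W" "continuous_on W d" "B \<in> sets borel" "B \<subseteq> W"
  shows "(\<lambda>y. indicator B y * d y) \<in> borel_measurable borel"
proof -
  have "(\<lambda>y. if y \<in> W then d y else 0) \<in> borel_measurable borel"
    using assms(1,2) by (intro borel_measurable_continuous_on_if) auto
  then have "(\<lambda>y. indicator B y * (if y \<in> W then d y else 0)) \<in> borel_measurable borel"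
    using assms(3) by (intro borel_measurable_times borel_measurable_indicator) auto
  moreover have "indicator B y * (if y \<in> W then d y else 0) = indicator B y * d y" for y using assms(4) by (auto simp: indicator_def)
  ultimately show ?thesis by simp
qed

text \<open>The push-forward to the manifold of the weighted Lebesgue measure on the image of the
  chart.\<close>

definition chart_measure :: "('a::topological_space, 'b::euclidean_space) chart \<Rightarrow> ('b \<Rightarrow> real) \<Rightarrow> 'a measure" where
  "chart_measure c d = distr (density (restrict_space lborel (coord c ` dom_of c)) (\<lambda>y. ennreal (d y))) borel (chart_inv c)"

lemma density_measurable_restrict:
  fixes d :: "'b::euclidean_space \<Rightarrow> real"
  assumes "continuous_on W d"
  shows "d \<in> borel_measurable (restrict_space lborel W)" using borel_measurable_continuous_on_restrict[OF assms]
  by (subst measurable_cong_sets[OF sets_restrict_space_cong[OF sets_lborel] refl])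

lemma nn_integral_chart_measure:
  assumes "chart_on S c" "continuous_on (coord c ` dom_of c) d" "f \<in> borel_measurable borel"
  shows "(\<integral>\<^sup>+p. f p \<partial>chart_measure c d) = (\<integral>\<^sup>+y\<in>coord c ` dom_of c. ennreal (d y) * f (chart_inv c y) \<partial>lborel)"
proof -
  let ?W = "coord c ` dom_of c"
  let ?M = "density (restrict_space lborel ?W) (\<lambda>y. ennreal (d y))"
  have m: "chart_inv c \<in> measurable ?M borel" using chart_inv_measurable[OF assms(1)] by simp
  have fm: "(\<lambda>y. f (chart_inv c y)) \<in> borel_measurable (restrict_space lborel ?W)"
    using measurable_compose[OF chart_inv_measurable[OF assms(1)] assms(3)] .
  have "(\<integral>\<^sup>+p. f p \<partial>chart_measure c d) = (\<integral>\<^sup>+y. f (chart_inv c y) \<partial>?M)"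
    unfolding chart_measure_def using assms(3) m by (intro nn_integral_distr) auto
  also have "\<dots> = (\<integral>\<^sup>+y. ennreal (d y) * f (chart_inv c y) \<partial>restrict_space lborel ?W)"
    using fm density_measurable_restrict[OF assms(2)] by (intro nn_integral_density) auto
  also have "\<dots> = (\<integral>\<^sup>+y\<in>?W. ennreal (d y) * f (chart_inv c y) \<partial>lborel)"
    using chart_onD(1)[OF assms(1)] by (intro nn_integral_restrict_space) auto
  finally show ?thesis .
qed

lemma emeasure_chart_measure:
  assumes "chart_on S c" "continuous_on (coord c ` dom_of c) d" "B \<in> sets borel"
  shows "emeasure (chart_measure c d) B = (\<integral>\<^sup>+y\<in>coord c ` (B \<inter> dom_of c). ennreal (d y) \<partial>lborel)"
proof -
  have "emeasure (chart_measure c d) B = (\<integral>\<^sup>+p. indicator B p \<partial>chart_measure c d)"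
    using assms(3) by (simp add: chart_measure_def)
  also have "\<dots> = (\<integral>\<^sup>+y\<in>coord c ` dom_of c. ennreal (d y) * indicator B (chart_inv c y) \<partial>lborel)"
    using assms by (intro nn_integral_chart_measure) auto
  also have "\<dots> = (\<integral>\<^sup>+y\<in>coord c ` (B \<inter> dom_of c). ennreal (d y) \<partial>lborel)"
    unfolding chart_image_eq[OF assms(1)] by (intro nn_integral_cong) (auto simp: indicator_def)
  finally show ?thesis .
qed

text \<open>Cutting \<mu> down to a chart domain gives a push-forward, so that the substitution
  rules for \<open>distr\<close> and \<open>density\<close> become available for \<mu>.\<close>

lemma chart_measure_eq_density:
  assumes "chart_on S c" "S \<in> sets borel" "continuous_on (coord c ` dom_of c) d" "sets \<mu> = sets borel"
    and "\<And>B. B \<in> sets borel \<Longrightarrow> B \<subseteq> dom_of c \<Longrightarrow> emeasure \<mu> B = (\<integral>\<^sup>+y\<in>coord c ` B. ennreal (d y) \<partial>lborel)"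
  shows "density \<mu> (indicator (dom_of c)) = chart_measure c d"
proof (rule measure_eqI)
  show "sets (density \<mu> (indicator (dom_of c))) = sets (chart_measure c d)" by (simp add: assms(4) chart_measure_def)
  fix B assume "B \<in> sets (density \<mu> (indicator (dom_of c)))"
  then have B: "B \<in> sets borel" by (simp add: assms(4))
  have d: "dom_of c \<in> sets borel" by (rule chart_dom_borel[OF assms(1,2)])
  have "emeasure (density \<mu> (indicator (dom_of c))) B = emeasure \<mu> (dom_of c \<inter> B)"
    using B d assms(4) by (intro emeasure_restricted) auto
  also have "\<dots> = (\<integral>\<^sup>+y\<in>coord c ` (dom_of c \<inter> B). ennreal (d y) \<partial>lborel)"
    using B d by (intro assms(5)) auto
  finally show "emeasure (density \<mu> (indicator (dom_of c))) B = emeasure (chart_measure c d) B"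
    by (simp add: emeasure_chart_measure[OF assms(1,3) B] Int_commute)
qed

lemma integral_chart:
  fixes f :: "'a::topological_space \<Rightarrow> complex" and c :: "('a, 'b::euclidean_space) chart"
  assumes "chart_on S c" "S \<in> sets borel" "continuous_on (coord c ` dom_of c) d" "sets \<mu> = sets borel"
    and "\<And>B. B \<in> sets borel \<Longrightarrow> B \<subseteq> dom_of c \<Longrightarrow> emeasure \<mu> B = (\<integral>\<^sup>+y\<in>coord c ` B. ennreal (d y) \<partial>lborel)"
    and d: "\<And>y. y \<in> coord c ` dom_of c \<Longrightarrow> 0 \<le> d y"
    and f: "f \<in> borel_measurable borel" "\<And>p. p \<notin> dom_of c \<Longrightarrow> f p = 0"
  shows "integrable \<mu> f \<longleftrightarrow> integrable lborel (\<lambda>y. indicator (coord c ` dom_of c) y *\<^sub>R (d y *\<^sub>R f (chart_inv c y)))"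
    and "integral\<^sup>L \<mu> f = integral\<^sup>L lborel (\<lambda>y. indicator (coord c ` dom_of c) y *\<^sub>R (d y *\<^sub>R f (chart_inv c y)))"
proof -
  let ?W = "coord c ` dom_of c"
  let ?R = "restrict_space lborel ?W"
  have dom: "dom_of c \<in> sets borel" by (rule chart_dom_borel[OF assms(1,2)])
  have f\<mu>: "f \<in> borel_measurable \<mu>" using f(1) assms(4) measurable_cong_sets by blast
  have ind: "indicator (dom_of c) p *\<^sub>R f p = f p" for p using f(2) by (auto simp: indicator_def)
  have ei: "(\<lambda>p. ennreal (indicator (dom_of c) p)) = (indicator (dom_of c) :: _ \<Rightarrow> ennreal)" by (auto simp: indicator_def)
  have eq: "density \<mu> (\<lambda>p. ennreal (indicator (dom_of c) p)) = chart_measure c d"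
    unfolding ei by (rule chart_measure_eq_density[OF assms(1-5)])
  have di: "(\<lambda>p. indicator (dom_of c) p :: real) \<in> borel_measurable \<mu>" using dom assms(4) by simp
  have 1: "integrable \<mu> f \<longleftrightarrow> integrable (chart_measure c d) f" "integral\<^sup>L \<mu> f = integral\<^sup>L (chart_measure c d) f"
    unfolding eq[symmetric] using f\<mu> di by (simp_all add: integrable_density integral_density ind)
  have m: "chart_inv c \<in> measurable (density ?R (\<lambda>y. ennreal (d y))) borel" using chart_inv_measurable[OF assms(1)] by simp
  have 2: "integrable (chart_measure c d) f \<longleftrightarrow> integrable (density ?R (\<lambda>y. ennreal (d y))) (\<lambda>y. f (chart_inv c y))"
    "integral\<^sup>L (chart_measure c d) f = integral\<^sup>L (density ?R (\<lambda>y. ennreal (d y))) (\<lambda>y. f (chart_inv c y))"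
    unfolding chart_measure_def by (rule integrable_distr_eq[OF m f(1)], rule integral_distr[OF m f(1)])
  have fm: "(\<lambda>y. f (chart_inv c y)) \<in> borel_measurable ?R" using measurable_compose[OF chart_inv_measurable[OF assms(1)] f(1)] .
  have ae: "AE y in ?R. 0 \<le> d y" using d by (intro AE_I2) (auto simp: space_restrict_space)
  have 3: "integrable (density ?R (\<lambda>y. ennreal (d y))) (\<lambda>y. f (chart_inv c y)) \<longleftrightarrow> integrable ?R (\<lambda>y. d y *\<^sub>R f (chart_inv c y))"
    "integral\<^sup>L (density ?R (\<lambda>y. ennreal (d y))) (\<lambda>y. f (chart_inv c y)) = integral\<^sup>L ?R (\<lambda>y. d y *\<^sub>R f (chart_inv c y))"
    using integrable_density[OF fm density_measurable_restrict[OF assms(3)] ae] integral_density[OF fm density_measurable_restrict[OF assms(3)] ae] by auto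
  have W: "?W \<inter> space lborel \<in> sets lborel" using chart_onD(1)[OF assms(1)] by simp
  show "integrable \<mu> f \<longleftrightarrow> integrable lborel (\<lambda>y. indicator ?W y *\<^sub>R (d y *\<^sub>R f (chart_inv c y)))"
    unfolding 1(1) 2(1) 3(1) by (rule integrable_restrict_space[OF W])
  show "integral\<^sup>L \<mu> f = integral\<^sup>L lborel (\<lambda>y. indicator ?W y *\<^sub>R (d y *\<^sub>R f (chart_inv c y)))"
    unfolding 1(2) 2(2) 3(2) by (rule integral_restrict_space[OF W])
qed

lemma nn_integral_chart:
  assumes "chart_on S c" "S \<in> sets borel" "continuous_on (coord c ` dom_of c) d" "sets \<mu> = sets borel"
    and "\<And>B. B \<in> sets borel \<Longrightarrow> B \<subseteq> dom_of c \<Longrightarrow> emeasure \<mu> B = (\<integral>\<^sup>+y\<in>coord c ` B. ennreal (d y) \<partial>lborel)"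
    and f: "f \<in> borel_measurable borel"
  shows "(\<integral>\<^sup>+p\<in>dom_of c. f p \<partial>\<mu>) = (\<integral>\<^sup>+y\<in>coord c ` dom_of c. ennreal (d y) * f (chart_inv c y) \<partial>lborel)"
proof -
  have dom: "dom_of c \<in> sets \<mu>" using chart_dom_borel[OF assms(1,2)] assms(4) by simp
  have f\<mu>: "f \<in> borel_measurable \<mu>" using f(1) assms(4) measurable_cong_sets by blast
  have "(\<integral>\<^sup>+p\<in>dom_of c. f p \<partial>\<mu>) = (\<integral>\<^sup>+p. f p \<partial>density \<mu> (indicator (dom_of c)))"
    using dom f\<mu> by (simp add: nn_integral_density mult.commute)
  also have "\<dots> = (\<integral>\<^sup>+p. f p \<partial>chart_measure c d)" by (simp only: chart_measure_eq_density[OF assms(1-5)])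
  also have "\<dots> = (\<integral>\<^sup>+y\<in>coord c ` dom_of c. ennreal (d y) * f (chart_inv c y) \<partial>lborel)"
    by (rule nn_integral_chart_measure[OF assms(1,3) f])
  finally show ?thesis .
qed

text \<open>The condition under the description operator in \<open>density_measure\<close>, named so
  that existence and uniqueness can be stated.\<close>

definition represents_densities ::
  "('a::topological_space, 'b::euclidean_space) chart set \<Rightarrow> (('a, 'b) chart \<Rightarrow> 'b \<Rightarrow> real) \<Rightarrow> 'a measure \<Rightarrow> bool" where
  "represents_densities C \<delta> \<mu> \<longleftrightarrow> sets \<mu> = sets borel \<and> emeasure \<mu> (- (\<Union>c\<in>C. dom_of c)) = 0 \<and>
    (\<forall>c\<in>C. \<forall>B\<in>sets borel. B \<subseteq> dom_of c \<longrightarrow>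
    emeasure \<mu> B = (\<integral>\<^sup>+ y \<in> coord c ` B. ennreal (\<delta> c y) \<partial>lborel))"

text \<open>The description has exactly one solution when finitely many charts cover
  \<open>S\<close> and the densities obey the transformation law. The cover is cut into disjoint
  Borel pieces, each measured in one chart; change of variables shows that other charts give the
  same masses, and a solution is determined by the pieces.\<close>

lemma represents_densities_density_measure:
  fixes C :: "('a::{t2_space,second_countable_topology}, real^'n::finite) chart set"
  assumes S: "S \<in> sets borel" and C: "\<And>c. c \<in> C \<Longrightarrow> chart_on S c"
    and C0: "finite C0" "C0 \<subseteq> C" "S \<subseteq> (\<Union>c\<in>C0. dom_of c)"
    and cont: "\<And>c. c \<in> C \<Longrightarrow> continuous_on (coord c ` dom_of c) (\<delta> c)"
    and nonneg: "\<And>c y. c \<in> C \<Longrightarrow> y \<in> coord c ` dom_of c \<Longrightarrow> 0 \<le> \<delta> c y"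
    and trans: "\<And>c c' p. c \<in> C \<Longrightarrow> c' \<in> C \<Longrightarrow> p \<in> dom_of c \<Longrightarrow> p \<in> dom_of c' \<Longrightarrow>
      \<exists>T. (transition c c' has_derivative T) (at (coord c p)) \<and> \<delta> c (coord c p) = \<bar>det (matrix T)\<bar> * \<delta> c' (coord c' p)"
  shows "represents_densities C \<delta> (density_measure C \<delta>)"
proof -
  note CD = chart_onD[OF C]
  have dom: "dom_of c \<in> sets borel" if "c \<in> C" for c by (rule chart_dom_borel[OF C[OF that] S])
  have SC: "(\<Union>c\<in>C. dom_of c) = S"
  proof
    show "(\<Union>c\<in>C. dom_of c) \<subseteq> S" by (rule UN_least) (rule CD(7))
    show "S \<subseteq> (\<Union>c\<in>C. dom_of c)" using C0(2,3) by blast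
  qed
  obtain cs where cs: "set cs = C0" using finite_list[OF C0(1)] by blast
  \<comment> \<open>Disjoint pieces, the \<open>i\<close>-th one inside the \<open>i\<close>-th
    chart domain; beyond the length of the list they are empty.\<close>
  define P where "P i = disjointed (\<lambda>i. if i < length cs then dom_of (cs ! i) else {}) i" for i
  have csC: "cs ! i \<in> C" if "i < length cs" for i using that cs C0(2) nth_mem by blast
  have Pb: "P i \<in> sets borel" for i unfolding P_def disjointed_def using dom csC by (intro sets.Diff sets.finite_UN) auto
  have Psub: "P i \<subseteq> dom_of (cs ! i)" if "i < length cs" for i
    unfolding P_def using disjointed_subset[of "\<lambda>i. if i < length cs then dom_of (cs ! i) else {}" i] that by simp
  have Pdisj: "disjoint_family P" unfolding P_def by (rule disjoint_family_disjointed)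
  have disjB: "disjoint_family_on (\<lambda>i. B \<inter> P i) I" for B I using Pdisj unfolding disjoint_family_on_def by blast
  have PU: "(\<Union>i<length cs. P i) = S"
  proof -
    have "(\<Union>i. P i) = (\<Union>i. if i < length cs then dom_of (cs ! i) else {})" unfolding P_def by (rule UN_disjointed_eq)
    also have "\<dots> = S"
    proof
      show "(\<Union>i. if i < length cs then dom_of (cs ! i) else {}) \<subseteq> S"
      proof (rule UN_least)
        fix i show "(if i < length cs then dom_of (cs ! i) else {}) \<subseteq> S"
          using CD(7)[OF csC, of i] by (cases "i < length cs") simp_all
      qed
      show "S \<subseteq> (\<Union>i. if i < length cs then dom_of (cs ! i) else {})"
      proof
        fix p assume "p \<in> S"
        then obtain c where "c \<in> set cs" "p \<in> dom_of c" using C0(3) cs by blast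
        then obtain i where "i < length cs" "cs ! i = c" by (auto simp: in_set_conv_nth)
        then show "p \<in> (\<Union>i. if i < length cs then dom_of (cs ! i) else {})" using \<open>p \<in> dom_of c\<close> by (intro UN_I[of i]) simp_all
      qed
    qed
    finally have "(\<Union>i. P i) = S" .
    have empty: "P i = {}" if "\<not> i < length cs" for i
      unfolding P_def using disjointed_subset[of "\<lambda>i. if i < length cs then dom_of (cs ! i) else {}" i] that by simp
    have "(\<Union>i<length cs. P i) = (\<Union>i. P i)"
    proof (intro equalityI subsetI)
      fix p assume "p \<in> (\<Union>i. P i)"
      then obtain i where "p \<in> P i" by blast
      moreover from this have "i < length cs" using empty[of i] by (rule_tac ccontr) simp
      ultimately show "p \<in> (\<Union>i<length cs. P i)" by blast
    qed blast
    then show ?thesis by (simp only: \<open>(\<Union>i. P i) = S\<close>)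
  qed
  have cov: "(\<integral>\<^sup>+y\<in>coord c ` B. ennreal (\<delta> c y) \<partial>lborel) = (\<integral>\<^sup>+y\<in>coord c' ` B. ennreal (\<delta> c' y) \<partial>lborel)"
    if c: "c \<in> C" "c' \<in> C" and B: "B \<in> sets borel" "B \<subseteq> dom_of c" "B \<subseteq> dom_of c'" for c c' B
  proof -
    have im: "transition c c' ` (coord c ` B) = coord c' ` B" using B CD(4)[OF c(1)] by (force simp: transition_def image_image)
    have bor: "coord c ` B \<in> sets borel" "coord c' ` B \<in> sets borel"
      using chart_image_borel[OF C[OF c(1)] B(1)] chart_image_borel[OF C[OF c(2)] B(1)] B by (simp_all add: Int_absorb2)
    \<comment> \<open>The transformation law provides a derivative at each point separately, hence
      the choice.\<close>
    define T where "T y = (SOME T. (transition c c' has_derivative T) (at y) \<and>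
      \<delta> c y = \<bar>det (matrix T)\<bar> * \<delta> c' (transition c c' y))" for y
    have T: "(transition c c' has_derivative T y) (at y) \<and> \<delta> c y = \<bar>det (matrix (T y))\<bar> * \<delta> c' (transition c c' y)"
      if y: "y \<in> coord c ` B" for y
    proof -
      obtain p where p: "p \<in> B" "y = coord c p" using y by blast
      then have "transition c c' y = coord c' p" using B CD(4)[OF c(1)] by (auto simp: transition_def)
      then have "\<exists>T. (transition c c' has_derivative T) (at y) \<and> \<delta> c y = \<bar>det (matrix T)\<bar> * \<delta> c' (transition c c' y)"
        using trans[OF c, of p] p B by auto
      then show ?thesis unfolding T_def by (rule someI_ex)
    qed
    have "(\<integral>\<^sup>+y\<in>coord c ` B. ennreal (\<delta> c y) \<partial>lborel) = (\<integral>\<^sup>+y\<in>transition c c' ` (coord c ` B). ennreal (\<delta> c' y) \<partial>lborel)"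
    proof (rule nn_integral_change_of_variables)
      show "coord c ` B \<in> sets borel" "transition c c' ` (coord c ` B) \<in> sets borel" using bor by (simp_all add: im)
      show "(transition c c' has_derivative T y) (at y)" if "y \<in> coord c ` B" for y using T[OF that] by blast
      show "\<delta> c y = \<bar>det (matrix (T y))\<bar> * \<delta> c' (transition c c' y)" if "y \<in> coord c ` B" for y using T[OF that] by blast
      show "inj_on (transition c c') (coord c ` B)"
      proof (rule inj_onI)
        fix y z assume "y \<in> coord c ` B" "z \<in> coord c ` B" and e: "transition c c' y = transition c c' z"
        then obtain p q where pq: "p \<in> B" "q \<in> B" "y = coord c p" "z = coord c q" by blast
        then have pd: "p \<in> dom_of c" "q \<in> dom_of c" "p \<in> dom_of c'" "q \<in> dom_of c'" using B by blast+
        then have "coord c' p = coord c' q" using e pq CD(4)[OF c(1)] by (simp add: transition_def)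
        then have "chart_inv c' (coord c' p) = chart_inv c' (coord c' q)" by (rule arg_cong)
        then have "p = q" unfolding CD(4)[OF c(2) pd(3)] CD(4)[OF c(2) pd(4)] .
        then show "y = z" using pq by simp
      qed
      show "0 \<le> \<delta> c' y" if "y \<in> transition c c' ` (coord c ` B)" for y using that nonneg[OF c(2)] B unfolding im by blast
      show "(\<lambda>y. indicator (transition c c' ` (coord c ` B)) y * \<delta> c' y) \<in> borel_measurable borel"
        unfolding im using B by (intro measurable_indicator_continuous_on[OF CD(1)[OF c(2)] cont[OF c(2)]] bor) blast
      show "(\<lambda>y. indicator (coord c ` B) y * \<delta> c y) \<in> borel_measurable borel"
        using B by (intro measurable_indicator_continuous_on[OF CD(1)[OF c(1)] cont[OF c(1)]] bor) blast
    qed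
    then show ?thesis unfolding im .
  qed
  define M where "M i = chart_measure (cs ! i) (\<delta> (cs ! i))" for i
  have setsM: "sets (M i) = sets borel" for i by (simp add: M_def chart_measure_def)
  have eM: "emeasure (M i) (B \<inter> P i) = (\<integral>\<^sup>+y\<in>coord (cs ! i) ` (B \<inter> P i). ennreal (\<delta> (cs ! i) y) \<partial>lborel)"
    if "i < length cs" "B \<in> sets borel" for i B
  proof -
    have "B \<inter> P i \<inter> dom_of (cs ! i) = B \<inter> P i" using Psub[OF that(1)] by blast
    then show ?thesis
      unfolding M_def using emeasure_chart_measure[OF C[OF csC[OF that(1)]] cont[OF csC[OF that(1)]], of "B \<inter> P i"] Pb that by simp
  qed
  define \<nu> where "\<nu> = measure_of UNIV (sets borel) (\<lambda>B::'a set. \<Sum>i<length cs. emeasure (M i) (B \<inter> P i))"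
  have sets\<nu>: "sets \<nu> = sets borel" unfolding \<nu>_def using sets.sets_measure_of_eq[of borel] by simp
  have \<nu>: "emeasure \<nu> B = (\<Sum>i<length cs. emeasure (M i) (B \<inter> P i))" if "B \<in> sets borel" for B
  proof (rule emeasure_measure_of[OF \<nu>_def])
    show "countably_additive (sets \<nu>) (\<lambda>B. \<Sum>i<length cs. emeasure (M i) (B \<inter> P i))"
    proof (rule countably_additiveI)
      fix A :: "nat \<Rightarrow> 'a set"
      assume A: "range A \<subseteq> sets \<nu>" "disjoint_family A" "(\<Union>i. A i) \<in> sets \<nu>"
      then have Ab: "A n \<in> sets borel" for n unfolding sets\<nu> by blast
      have "(\<Sum>n. \<Sum>i<length cs. emeasure (M i) (A n \<inter> P i)) = (\<Sum>i<length cs. \<Sum>n. emeasure (M i) (A n \<inter> P i))"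
        by (intro suminf_sum) auto
      also have "\<dots> = (\<Sum>i<length cs. emeasure (M i) (\<Union>n. A n \<inter> P i))"
      proof (intro sum.cong refl suminf_emeasure)
        fix i show "range (\<lambda>n. A n \<inter> P i) \<subseteq> sets (M i)" using Ab Pb by (auto simp: setsM)
        show "disjoint_family (\<lambda>n. A n \<inter> P i)" using A(2) unfolding disjoint_family_on_def by blast
      qed
      finally show "(\<Sum>n. \<Sum>i<length cs. emeasure (M i) (A n \<inter> P i)) = (\<Sum>i<length cs. emeasure (M i) ((\<Union>n. A n) \<inter> P i))"
        by (simp add: Int_UN_distrib2)
    qed
    show "positive (sets \<nu>) (\<lambda>B. \<Sum>i<length cs. emeasure (M i) (B \<inter> P i))" by (simp add: positive_def)
    show "B \<in> sets \<nu>" using that unfolding sets\<nu> .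
  qed simp
  have rep\<nu>: "represents_densities C \<delta> \<nu>" unfolding represents_densities_def
  proof (intro conjI ballI impI)
    show "sets \<nu> = sets borel" by (rule sets\<nu>)
    have "(- S) \<inter> P i = {}" if "i < length cs" for i using PU that by blast
    then show "emeasure \<nu> (- (\<Union>c\<in>C. dom_of c)) = 0" unfolding SC using S by (subst \<nu>) auto
    fix c B assume c: "c \<in> C" and B: "B \<in> sets borel" "B \<subseteq> dom_of c"
    have BU: "(\<Union>i<length cs. B \<inter> P i) = B" using PU B(2) CD(7)[OF c] by blast
    have "emeasure \<nu> B = (\<Sum>i<length cs. \<integral>\<^sup>+y\<in>coord (cs ! i) ` (B \<inter> P i). ennreal (\<delta> (cs ! i) y) \<partial>lborel)"
      using eM B by (simp add: \<nu>)
    also have "\<dots> = (\<Sum>i<length cs. \<integral>\<^sup>+y\<in>coord c ` (B \<inter> P i). ennreal (\<delta> c y) \<partial>lborel)"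
    proof (rule sum.cong)
      fix i assume "i \<in> {..<length cs}"
      then have i: "i < length cs" by simp
      show "(\<integral>\<^sup>+y\<in>coord (cs ! i) ` (B \<inter> P i). ennreal (\<delta> (cs ! i) y) \<partial>lborel) = (\<integral>\<^sup>+y\<in>coord c ` (B \<inter> P i). ennreal (\<delta> c y) \<partial>lborel)"
        using Psub[OF i] B Pb by (intro cov csC[OF i] c) auto
    qed simp
    also have "\<dots> = (\<Sum>i<length cs. emeasure (chart_measure c (\<delta> c)) (B \<inter> P i))"
    proof (rule sum.cong)
      fix i
      have "B \<inter> P i \<inter> dom_of c = B \<inter> P i" using B by blast
      then show "(\<integral>\<^sup>+y\<in>coord c ` (B \<inter> P i). ennreal (\<delta> c y) \<partial>lborel) = emeasure (chart_measure c (\<delta> c)) (B \<inter> P i)"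
        using emeasure_chart_measure[OF C[OF c] cont[OF c], of "B \<inter> P i"] B Pb by simp
    qed simp
    also have "\<dots> = emeasure (chart_measure c (\<delta> c)) (\<Union>i<length cs. B \<inter> P i)"
      using B Pb by (intro sum_emeasure disjB) (auto simp: chart_measure_def)
    also have "\<dots> = emeasure (chart_measure c (\<delta> c)) B" by (simp only: BU)
    also have "\<dots> = (\<integral>\<^sup>+y\<in>coord c ` B. ennreal (\<delta> c y) \<partial>lborel)"
      using emeasure_chart_measure[OF C[OF c] cont[OF c] B(1)] B(2) by (simp add: Int_absorb2)
    finally show "emeasure \<nu> B = (\<integral>\<^sup>+y\<in>coord c ` B. ennreal (\<delta> c y) \<partial>lborel)" .
  qed
  \<comment> \<open>A solution has no mass off \<open>S\<close>, so it is the sum of its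
    restrictions to the pieces.\<close>
  have uniq: "\<mu> = \<nu>" if r: "represents_densities C \<delta> \<mu>" for \<mu>
  proof (rule measure_eqI)
    have s: "sets \<mu> = sets borel" using r by (simp add: represents_densities_def)
    then show "sets \<mu> = sets \<nu>" by (simp add: sets\<nu>)
    fix B assume "B \<in> sets \<mu>"
    then have B: "B \<in> sets borel" using s by simp
    have dec: "emeasure \<rho> B = (\<Sum>i<length cs. \<integral>\<^sup>+y\<in>coord (cs ! i) ` (B \<inter> P i). ennreal (\<delta> (cs ! i) y) \<partial>lborel)"
      if \<rho>: "represents_densities C \<delta> \<rho>" for \<rho>
    proof -
      have s: "sets \<rho> = sets borel" "emeasure \<rho> (- S) = 0" using \<rho> by (simp_all add: represents_densities_def SC)
      have "emeasure \<rho> B = emeasure \<rho> ((\<Union>i<length cs. B \<inter> P i) \<union> (B - S))" using PU by (intro arg_cong2[where f=emeasure]) auto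
      also have "\<dots> = emeasure \<rho> (\<Union>i<length cs. B \<inter> P i)"
      proof (rule emeasure_Un_null_set)
        show "B - S \<in> null_sets \<rho>"
        proof (rule null_sets_subset)
          show "- S \<in> null_sets \<rho>" using s S by (auto simp: null_sets_def)
        qed (use B S s in auto)
      qed (use B Pb s in auto)
      also have "\<dots> = (\<Sum>i<length cs. emeasure \<rho> (B \<inter> P i))" using B Pb s by (intro sum_emeasure[symmetric] disjB) auto
      also have "\<dots> = (\<Sum>i<length cs. \<integral>\<^sup>+y\<in>coord (cs ! i) ` (B \<inter> P i). ennreal (\<delta> (cs ! i) y) \<partial>lborel)"
      proof (rule sum.cong)
        fix i assume "i \<in> {..<length cs}"
        then have i: "i < length cs" by simp
        have "B \<inter> P i \<in> sets borel" "B \<inter> P i \<subseteq> dom_of (cs ! i)" using Psub[OF i] B Pb by auto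
        then show "emeasure \<rho> (B \<inter> P i) = (\<integral>\<^sup>+y\<in>coord (cs ! i) ` (B \<inter> P i). ennreal (\<delta> (cs ! i) y) \<partial>lborel)"
          using \<rho> csC[OF i] unfolding represents_densities_def by blast
      qed simp
      finally show ?thesis .
    qed
    show "emeasure \<mu> B = emeasure \<nu> B" using dec[OF r] dec[OF rep\<nu>] by simp
  qed
  have "density_measure C \<delta> = (THE \<mu>. represents_densities C \<delta> \<mu>)"
    by (simp only: density_measure_def represents_densities_def)
  also have "\<dots> = \<nu>" by (rule the_equality) (rule rep\<nu>, erule uniq)
  finally show ?thesis using rep\<nu> by (simp only:)
qed

section \<open>The fixed point set as a submanifold\<close>

lemma chart_image_open:
  fixes c :: "('a::topological_space, 'b::euclidean_space) chart"
  assumes "chart_on S c" "openin (top_of_set S) U"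
  shows "open (coord c ` (U \<inter> dom_of c))"
proof -
  obtain T where T: "open T" "U = S \<inter> T" using assms(2) unfolding openin_open by blast
  have W: "chart_inv c y \<in> S" if "y \<in> coord c ` dom_of c" for y
    using chart_onD(5)[OF assms(1) that] chart_onD(7)[OF assms(1)] by (rule subsetD[rotated])
  have "coord c ` (U \<inter> dom_of c) = {y \<in> coord c ` dom_of c. chart_inv c y \<in> U}" by (rule chart_image_eq[OF assms(1)])
  also have "\<dots> = coord c ` dom_of c \<inter> chart_inv c -` T" using W by (auto simp: T(2))
  finally show ?thesis using continuous_open_preimage[OF chart_onD(3)[OF assms(1)] chart_onD(1)[OF assms(1)] T(1)] by (simp only:)
qed

lemma chart_preimage_open:
  assumes "chart_on UNIV c" "open U"
  shows "open {p \<in> dom_of c. coord c p \<in> U}"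
proof -
  have "open (dom_of c)" using chart_onD(8)[OF assms(1)] by simp
  then have "open (dom_of c \<inter> coord c -` U)" by (rule continuous_open_preimage[OF chart_onD(2)[OF assms(1)] _ assms(2)])
  then show ?thesis by (simp add: vimage_def Int_def)
qed

text \<open>The continuity of \<open>t\<close> replaces the inverse function theorem:
  \<open>u\<close> is differentiable at the single point \<open>t y0\<close> and need not be
  injective. The lemma serves for transition maps of submanifold charts and for continuous
  roots.\<close>

lemma has_derivative_implicit:
  fixes u :: "'b::real_normed_vector \<Rightarrow> 'b" and t :: "'a::real_normed_vector \<Rightarrow> 'b"
  assumes u: "(u has_derivative (\<lambda>v. v)) (at (t y0))" and h: "(h has_derivative h') (at y0)"
    and t: "isCont t y0" and N: "open N" "y0 \<in> N" "\<And>y. y \<in> N \<Longrightarrow> u (t y) = h y"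
  shows "(t has_derivative h') (at y0)" unfolding has_derivative_at_alt
proof (intro conjI allI impI)
  show bl: "bounded_linear h'" using h by (rule has_derivative_bounded_linear)
  fix e :: real assume e: "0 < e"
  obtain K where K: "0 < K" "\<And>v. norm (h' v) \<le> norm v * K" using bounded_linear.pos_bounded[OF bl] by blast
  \<comment> \<open>\<open>e1 \<le> 1/2\<close> allows the increment of \<open>t\<close> to be
    absorbed, which gives the bound \<open>2 * (K + 1)\<close> in 4; the other bounds make each of
    the two final error terms at most half of \<open>e\<close>.\<close>
  define e1 where "e1 = min (1/2) (e / (4 * (K + 1)))"
  define e2 where "e2 = min 1 (e / 2)"
  have "e1 \<le> e / (4 * (K + 1))" by (simp add: e1_def)
  from mult_right_mono[OF this, of "2 * (K + 1)"] have "e1 * (2 * (K + 1)) \<le> e / (4 * (K + 1)) * (2 * (K + 1))" using K(1) by simp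
  also have "\<dots> = e / 2" using K(1) by (simp add: field_simps)
  finally have "e1 * (2 * (K + 1)) \<le> e / 2" .
  moreover have "e1 \<le> 1/2" unfolding e1_def by (rule min.cobounded1)
  moreover have "0 < e1" "0 < e2" "e2 \<le> 1" "e2 \<le> e / 2" using e K(1) by (simp_all add: e1_def e2_def)
  ultimately have e12: "0 < e1" "0 < e2" "e1 \<le> 1/2" "e1 * (2 * (K + 1)) \<le> e / 2" "e2 \<le> 1" "e2 \<le> e / 2" by blast+
  obtain d1 where d1: "0 < d1" "\<And>z. norm (z - t y0) < d1 \<Longrightarrow> norm (u z - u (t y0) - (z - t y0)) \<le> e1 * norm (z - t y0)"
    using u e12(1) unfolding has_derivative_at_alt by metis
  obtain d2 where d2: "0 < d2" "\<And>y. norm (y - y0) < d2 \<Longrightarrow> norm (h y - h y0 - h' (y - y0)) \<le> e2 * norm (y - y0)"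
    using h e12(2) unfolding has_derivative_at_alt by metis
  obtain d3 where d3: "0 < d3" "\<And>y. dist y y0 < d3 \<Longrightarrow> dist (t y) (t y0) < d1"
    using t d1(1) unfolding continuous_at_eps_delta dist_norm by metis
  obtain d4 where d4: "0 < d4" "ball y0 d4 \<subseteq> N" using N(1,2) by (meson openE)
  show "\<exists>d>0. \<forall>y. norm (y - y0) < d \<longrightarrow> norm (t y - t y0 - h' (y - y0)) \<le> e * norm (y - y0)"
  proof (intro exI conjI allI impI)
    show "0 < min d2 (min d3 d4)" using d2(1) d3(1) d4(1) by simp
    fix y assume "norm (y - y0) < min d2 (min d3 d4)"
    then have y: "norm (y - y0) < d2" "dist y y0 < d3" "y \<in> ball y0 d4" by (auto simp: dist_norm norm_minus_commute)
    have yN: "u (t y) = h y" "u (t y0) = h y0" using N(3) d4(2) y(3) N(2) by blast+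
    have 1: "norm (h y - h y0 - (t y - t y0)) \<le> e1 * norm (t y - t y0)" using d1(2)[of "t y"] d3(2)[OF y(2)] by (simp add: dist_norm yN)
    have 2: "norm (h y - h y0 - h' (y - y0)) \<le> e2 * norm (y - y0)" by (rule d2(2)[OF y(1)])
    have "norm (h y - h y0) \<le> norm (h y - h y0 - h' (y - y0)) + norm (h' (y - y0))" by norm
    also have "\<dots> \<le> (K + 1) * norm (y - y0)"
      using 2 K(2)[of "y - y0"] mult_right_mono[OF e12(5), of "norm (y - y0)"] by (simp add: algebra_simps)
    finally have 3: "norm (h y - h y0) \<le> (K + 1) * norm (y - y0)" .
    have "norm (t y - t y0) \<le> norm (h y - h y0) + norm (h y - h y0 - (t y - t y0))" by norm
    also have "\<dots> \<le> (K + 1) * norm (y - y0) + 1/2 * norm (t y - t y0)"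
      using 1 3 mult_right_mono[OF e12(3), of "norm (t y - t y0)"] by simp
    finally have 4: "norm (t y - t y0) \<le> 2 * (K + 1) * norm (y - y0)" by (simp add: algebra_simps)
    have "norm (t y - t y0 - h' (y - y0)) \<le> norm (h y - h y0 - (t y - t y0)) + norm (h y - h y0 - h' (y - y0))" by norm
    also have "\<dots> \<le> e1 * norm (t y - t y0) + e2 * norm (y - y0)" using 1 2 by simp
    also have "\<dots> \<le> e1 * (2 * (K + 1) * norm (y - y0)) + e / 2 * norm (y - y0)"
      using 4 e12 by (intro add_mono mult_left_mono mult_right_mono) auto
    also have "\<dots> \<le> e / 2 * norm (y - y0) + e / 2 * norm (y - y0)"
      using mult_right_mono[OF e12(4), of "norm (y - y0)"] by (simp add: mult.assoc)
    finally show "norm (t y - t y0 - h' (y - y0)) \<le> e * norm (y - y0)" by (simp add: algebra_simps)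
  qed
qed

lemma smooth_on_differentiable:
  assumes "open S" "smooth_on S f" "x \<in> S"
  shows "(f has_derivative Fd f x) (at x)" using Ck_on_has_derivative[OF smooth_on_Ck_on[OF assms(1,2)] assms(3)] .

section \<open>Charts and transition maps of the complex manifold\<close>

lemma complex_manifoldD:
  assumes "complex_manifold A"
  shows "c \<in> A \<Longrightarrow> chart_on UNIV c" "\<exists>c\<in>A. p \<in> dom_of c"
    "c \<in> A \<Longrightarrow> c' \<in> A \<Longrightarrow> holo_map_on (coord c ` (dom_of c \<inter> dom_of c')) (transition c c')"
    "c \<in> A \<Longrightarrow> open (dom_of c)"
    "c \<in> A \<Longrightarrow> c' \<in> A \<Longrightarrow> open (coord c ` (dom_of c \<inter> dom_of c'))"
proof -
  show 1: "chart_on UNIV c" if "c \<in> A" for c using assms that unfolding complex_manifold_def by blast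
  show "\<exists>c\<in>A. p \<in> dom_of c" using assms unfolding complex_manifold_def by blast
  show "c \<in> A \<Longrightarrow> c' \<in> A \<Longrightarrow> holo_map_on (coord c ` (dom_of c \<inter> dom_of c')) (transition c c')"
    using assms unfolding complex_manifold_def by blast
  show o: "open (dom_of c)" if "c \<in> A" for c using chart_onD(8)[OF 1[OF that]] by simp
  show "open (coord c ` (dom_of c \<inter> dom_of c'))" if c: "c \<in> A" "c' \<in> A"
    using chart_image_open[OF 1[OF c(1)], of "dom_of c'"] o[OF c(2)] by (simp add: Int_commute)
qed

lemma chart_at_in:
  assumes "complex_manifold A"
  shows "chart_at A p \<in> A" "p \<in> dom_of (chart_at A p)"
  using someI_ex[of "\<lambda>c. c \<in> A \<and> p \<in> dom_of c"] complex_manifoldD(2)[OF assms, of p] unfolding chart_at_def by blast+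

lemma transition_coord:
  assumes "chart_on S c" "p \<in> dom_of c"
  shows "transition c c' (coord c p) = coord c' p" using chart_onD(4)[OF assms] by (simp add: transition_def)

lemma transition_has_derivative:
  assumes "complex_manifold A" "c \<in> A" "c' \<in> A" "p \<in> dom_of c" "p \<in> dom_of c'"
  shows "(transition c c' has_derivative (*v) (tjac c c' p)) (at (coord c p))"
  using holo_map_has_derivative[OF complex_manifoldD(3)[OF assms(1-3)], of "coord c p"] assms(4,5) by blast

lemma jacobian_transition_compose:
  assumes "complex_manifold A" "c \<in> A" "c' \<in> A" "c'' \<in> A" "p \<in> dom_of c" "p \<in> dom_of c'" "p \<in> dom_of c''"
  shows "tjac c c'' p = tjac c' c'' p ** tjac c c' p"
proof -
  note cm = complex_manifoldD[OF assms(1)]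
  let ?N = "coord c ` (dom_of c \<inter> dom_of c' \<inter> dom_of c'')"
  have "openin (top_of_set UNIV) (dom_of c' \<inter> dom_of c'')" using cm(4)[OF assms(3)] cm(4)[OF assms(4)] by (simp add: open_Int)
  from chart_image_open[OF cm(1)[OF assms(2)] this] have N: "open ?N" by (simp add: Int_ac)
  have eq: "transition c' c'' (transition c c' y) = transition c c'' y" if "y \<in> ?N" for y
  proof -
    obtain q where q: "y = coord c q" "q \<in> dom_of c" "q \<in> dom_of c'" "q \<in> dom_of c''" using \<open>y \<in> ?N\<close> by blast
    show ?thesis unfolding q(1) transition_coord[OF cm(1)[OF assms(2)] q(2)] by (rule transition_coord[OF cm(1)[OF assms(3)] q(3)])
  qed
  have d1: "(transition c' c'' has_derivative (*v) (tjac c' c'' p)) (at (transition c c' (coord c p)))"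
    unfolding transition_coord[OF cm(1)[OF assms(2)] assms(5)] by (rule transition_has_derivative[OF assms(1,3,4,6,7)])
  have "((\<lambda>y. transition c' c'' (transition c c' y)) has_derivative
    (\<lambda>v. (tjac c' c'' p ** tjac c c' p) *v v)) (at (coord c p))"
    using diff_chain_at[OF transition_has_derivative[OF assms(1,2,3,5,6)] d1] by (simp add: o_def matrix_vector_mul_assoc)
  then have "(transition c c'' has_derivative (\<lambda>v. (tjac c' c'' p ** tjac c c' p) *v v)) (at (coord c p))"
    by (rule has_derivative_transform_within_open[OF _ N]) (use assms(5-7) eq in auto)
  then show ?thesis by (rule jacobian_unique)
qed

lemma jacobian_transition_self:
  fixes A :: "('a::{t2_space,second_countable_topology}, 'b::finite) cchart set"
  assumes "complex_manifold A" "c \<in> A" "p \<in> dom_of c"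
  shows "tjac c c p = mat 1"
proof (rule jacobian_unique)
  note cm = complex_manifoldD[OF assms(1)]
  have N: "open (coord c ` dom_of c)" by (rule chart_onD(1)[OF cm(1)[OF assms(2)]])
  have "((\<lambda>y. y) has_derivative (\<lambda>v. v)) (at (coord c p))" by (rule has_derivative_ident)
  then have "(transition c c has_derivative (\<lambda>v. v)) (at (coord c p))" by (rule has_derivative_transform_within_open[OF _ N])
    (use assms(3) chart_onD(6)[OF cm(1)[OF assms(2)]] in \<open>auto simp: transition_def\<close>)
  moreover have "(*v) (mat 1) = (\<lambda>v::complex^'b. v)" by (simp add: fun_eq_iff)
  ultimately show "(transition c c has_derivative (*v) (mat 1)) (at (coord c p))" by (simp only:)
qed

lemma det_jacobian_transition:
  assumes "complex_manifold A" "c \<in> A" "c' \<in> A" "p \<in> dom_of c" "p \<in> dom_of c'"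
  shows "det (tjac c c' p) * det (tjac c' c p) = 1"
proof -
  have "tjac c' c p ** tjac c c' p = mat 1"
    using jacobian_transition_compose[OF assms(1,2,3,2,4,5,4)] jacobian_transition_self[OF assms(1,2,4)] by simp
  then have "det (tjac c' c p ** tjac c c' p) = 1" by simp
  then show ?thesis by (simp add: det_mul mult.commute)
qed

subsection \<open>Charts of a submanifold\<close>

lemma submanifold_chartsD:
  assumes "x \<in> submanifold_charts A L"
  shows "chart_on L x"
    "c \<in> A \<Longrightarrow> smooth_on (coord x ` (dom_of x \<inter> dom_of c)) (coord c \<circ> chart_inv x)"
    "c \<in> A \<Longrightarrow> y \<in> coord x ` (dom_of x \<inter> dom_of c) \<Longrightarrow> inj (Fd (coord c \<circ> chart_inv x) y)"
  using assms unfolding submanifold_charts_def by blast+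

lemma submanifold_chart_image_open:
  assumes "complex_manifold A" "x \<in> submanifold_charts A L" "open U"
  shows "open (coord x ` (dom_of x \<inter> U))"
proof -
  have "openin (top_of_set L) (L \<inter> U)" using assms(3) by (rule openin_open_Int)
  from chart_image_open[OF submanifold_chartsD(1)[OF assms(2)] this]
  have "open (coord x ` (L \<inter> U \<inter> dom_of x))" .
  moreover have "L \<inter> U \<inter> dom_of x = dom_of x \<inter> U" using chart_onD(7)[OF submanifold_chartsD(1)[OF assms(2)]] by blast
  ultimately show ?thesis by simp
qed

lemma submanifold_chart_has_derivative:
  assumes "complex_manifold A" "x \<in> submanifold_charts A L" "c \<in> A" "p \<in> dom_of x" "p \<in> dom_of c"
  shows "(coord c \<circ> chart_inv x has_derivative Fd (coord c \<circ> chart_inv x) (coord x p)) (at (coord x p))"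
  by (rule smooth_on_differentiable[OF submanifold_chart_image_open[OF assms(1,2)] submanifold_chartsD(2)[OF assms(2,3)]])
    (use complex_manifoldD(4)[OF assms(1,3)] assms(4,5) in auto)

text \<open>The inverse charts are immersions into the ambient manifold, and the transition map is
  at first only continuous. A linear left inverse \<open>l\<close> of the differential of the second
  inverse chart \<open>?G\<close> makes \<open>l \<circ> ?G\<close> tangent to the identity, and
  \<open>has_derivative_implicit\<close> applies to
  \<open>l \<circ> ?G \<circ> transition x x' = l \<circ> ?H\<close>.\<close>

lemma submanifold_transition:
  assumes "complex_manifold A" "x \<in> submanifold_charts A L" "x' \<in> submanifold_charts A L" "p \<in> dom_of x" "p \<in> dom_of x'"
  obtains T where "(transition x x' has_derivative T) (at (coord x p))"
proof -
  obtain c where c: "c \<in> A" "p \<in> dom_of c" using complex_manifoldD(2)[OF assms(1)] by blast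
  note X = submanifold_chartsD(1)[OF assms(2)] and X' = submanifold_chartsD(1)[OF assms(3)]
  let ?H = "coord c \<circ> chart_inv x" and ?G = "coord c \<circ> chart_inv x'"
  let ?y = "coord x p" and ?y' = "coord x' p"
  have dH: "(?H has_derivative Fd ?H ?y) (at ?y)" by (rule submanifold_chart_has_derivative[OF assms(1,2) c(1) assms(4) c(2)])
  have dG: "(?G has_derivative Fd ?G ?y') (at ?y')" by (rule submanifold_chart_has_derivative[OF assms(1,3) c(1) assms(5) c(2)])
  have "inj (Fd ?G ?y')" by (rule submanifold_chartsD(3)[OF assms(3) c(1)]) (use assms(5) c(2) in blast)
  then obtain l where l: "linear l" "l \<circ> Fd ?G ?y' = id" using linear_injective_left_inverse[OF has_derivative_linear[OF dG]] by blast
  then have bl: "bounded_linear l" by (simp add: linear_conv_bounded_linear)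
  obtain O' where O': "open O'" "dom_of x' = L \<inter> O'" using chart_onD(8)[OF X'] unfolding openin_open by blast
  let ?N = "coord x ` (dom_of x \<inter> (O' \<inter> dom_of c))"
  have N: "open ?N" by (rule submanifold_chart_image_open[OF assms(1,2)]) (intro open_Int O'(1) complex_manifoldD(4)[OF assms(1) c(1)])
  have pN: "?y \<in> ?N" using assms(4,5) c(2) O'(2) by blast
  have ty: "transition x x' ?y = ?y'" by (rule transition_coord[OF X assms(4)])
  have N': "chart_inv x y \<in> dom_of x'" "chart_inv x y \<in> dom_of x" "chart_inv x y \<in> dom_of c" if y: "y \<in> ?N" for y
  proof -
    obtain q where q: "y = coord x q" "q \<in> dom_of x" "q \<in> O'" "q \<in> dom_of c" using y by blast
    have "q \<in> dom_of x'" using q O'(2) chart_onD(7)[OF X] by blast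
    then show "chart_inv x y \<in> dom_of x'" "chart_inv x y \<in> dom_of x" "chart_inv x y \<in> dom_of c"
      using q chart_onD(4)[OF X q(2)] by simp_all
  qed
  have "(transition x x' has_derivative (\<lambda>v. l (Fd ?H ?y v))) (at ?y)"
  proof (rule has_derivative_implicit[OF _ _ _ N pN])
    have "((\<lambda>z. l (?G z)) has_derivative (\<lambda>v. l (Fd ?G ?y' v))) (at ?y')" by (rule bounded_linear.has_derivative[OF bl dG])
    moreover have "(\<lambda>v. l (Fd ?G ?y' v)) = (\<lambda>v. v)" using l(2) by (simp add: o_def id_def)
    ultimately show "((\<lambda>z. l (?G z)) has_derivative (\<lambda>v. v)) (at (transition x x' ?y))" by (simp only: ty)
    show "((\<lambda>y. l (?H y)) has_derivative (\<lambda>v. l (Fd ?H ?y v))) (at ?y)" by (rule bounded_linear.has_derivative[OF bl dH])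
    have "continuous_on ?N (coord x' \<circ> chart_inv x)"
    proof (rule continuous_on_compose)
      show "continuous_on ?N (chart_inv x)" by (rule continuous_on_subset[OF chart_onD(3)[OF X]]) blast
      show "continuous_on (chart_inv x ` ?N) (coord x')" by (rule continuous_on_subset[OF chart_onD(2)[OF X']]) (use N'(1) in blast)
    qed
    then show "isCont (transition x x') ?y" using continuous_on_eq_continuous_at[OF N] pN unfolding transition_def by blast
    show "l (?G (transition x x' y)) = l (?H y)" if "y \<in> ?N" for y using chart_onD(4)[OF X' N'(1)[OF that]] by (simp add: transition_def)
  qed
  then show thesis by (rule that)
qed

subsection \<open>Real charts at fixed points\<close>

definition cnj_mat :: "complex^'n^'m \<Rightarrow> complex^'n^'m" where
  "cnj_mat M = (\<chi> i j. cnj (M $ i $ j))"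

definition cvec :: "real^'n \<Rightarrow> complex^'n" where
  "cvec y = (\<chi> i. of_real (y $ i))"

definition re_vec :: "complex^'n \<Rightarrow> real^'n" where
  "re_vec z = (\<chi> i. Re (z $ i))"

lemma bounded_linear_vec_cnj: "bounded_linear (vec_cnj :: complex^'n::finite \<Rightarrow> complex^'n)"
  unfolding linear_conv_bounded_linear[symmetric] by (intro linearI) (simp_all add: vec_cnj_def vec_eq_iff)

lemma bounded_linear_cvec: "bounded_linear (cvec :: real^'n::finite \<Rightarrow> complex^'n)" unfolding linear_conv_bounded_linear[symmetric]
  by (intro linearI) (simp_all add: cvec_def vec_eq_iff scaleR_conv_of_real[where 'a=complex])

lemma bounded_linear_re_vec: "bounded_linear (re_vec :: complex^'n::finite \<Rightarrow> real^'n)"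
  unfolding linear_conv_bounded_linear[symmetric] by (intro linearI) (simp_all add: re_vec_def vec_eq_iff)

lemma vec_cnj_simps [simp]:
  "vec_cnj (vec_cnj z) = z" "vec_cnj (cvec y) = cvec y" "re_vec (cvec y) = y"
  "vec_cnj (M *v z) = cnj_mat M *v vec_cnj z" "cnj_mat (cnj_mat M) = M"
  "vec_cnj (z + w) = vec_cnj z + vec_cnj w" "vec_cnj (z - w) = vec_cnj z - vec_cnj w"
  "vec_cnj (c *s z) = cnj c *s vec_cnj z" by (simp_all add: vec_cnj_def cvec_def re_vec_def cnj_mat_def vec_eq_iff matrix_vector_mult_def)

lemma cvec_re_vec: "vec_cnj z = z \<Longrightarrow> cvec (re_vec z) = z"
  by (simp add: vec_cnj_def cvec_def re_vec_def vec_eq_iff complex_eq_iff)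

lemma cnj_mat_mult: "cnj_mat (M ** N) = cnj_mat M ** cnj_mat N" by (simp add: cnj_mat_def matrix_matrix_mult_def vec_eq_iff)

lemma det_cnj_mat: "det (cnj_mat M) = cnj (det M)" by (simp add: cnj_mat_def det_def)

text \<open>Linearising the involution: if \<open>s\<close> is an antiholomorphic involution fixing \<open>a\<close> and \<open>R\<close> is its
  differential, then \<open>\<Phi> z = ((z - a) + R (s z - a)) / 2\<close> satisfies \<open>\<Phi> \<circ> s = R \<circ> \<Phi>\<close>; a complex linear
  change of coordinates takes \<open>R\<close> to the standard conjugation.\<close>

lemma linearise_antiholomorphic_involution:
  fixes s :: "complex^'n::finite \<Rightarrow> complex^'n"
  assumes W: "open W" "a \<in> W" and hol: "holo_map_on W (\<lambda>z. vec_cnj (s z))"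
    and s: "\<And>z. z \<in> W \<Longrightarrow> s z \<in> W" "\<And>z. z \<in> W \<Longrightarrow> s (s z) = z" "s a = a"
  obtains \<Psi> where "holo_map_on W \<Psi>" "invertible (jacobian \<Psi> a)" "\<And>z. z \<in> W \<Longrightarrow> \<Psi> (s z) = vec_cnj (\<Psi> z)"
proof -
  let ?\<tau> = "\<lambda>z. vec_cnj (s z)"
  define B where "B = jacobian ?\<tau> a"
  let ?Bc = "cnj_mat B"
  have d\<tau>: "(?\<tau> has_derivative (*v) (jacobian ?\<tau> z)) (at z)" if "z \<in> W" for z
    by (rule holo_map_has_derivative[OF hol that])
  have ds: "(s has_derivative (\<lambda>v. vec_cnj (B *v v))) (at a)"
    using bounded_linear.has_derivative[OF bounded_linear_vec_cnj d\<tau>[OF W(2)]] by (simp add: B_def)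
  have "(s has_derivative (\<lambda>v. vec_cnj (B *v v))) (at (s a))" using ds by (simp only: s(3))
  from diff_chain_at[OF ds this]
  have "((\<lambda>z. s (s z)) has_derivative (\<lambda>v. vec_cnj (B *v vec_cnj (B *v v)))) (at a)" by (simp add: o_def)
  then have "((\<lambda>z. z) has_derivative (\<lambda>v. vec_cnj (B *v vec_cnj (B *v v)))) (at a)"
    by (rule has_derivative_transform_within_open[OF _ W]) (rule s(2))
  from has_derivative_unique[OF this has_derivative_ident]
  have "vec_cnj (B *v vec_cnj (B *v v)) = v" for v by (rule fun_cong)
  moreover have "vec_cnj (B *v vec_cnj (B *v v)) = (?Bc ** B) *v v" for v by (simp add: matrix_vector_mul_assoc[symmetric])
  ultimately have "(?Bc ** B) *v v = mat 1 *v v" for v by simp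
  \<comment> \<open>The differential of \<open>s\<close> at \<open>a\<close> is multiplication by
    \<open>B\<close> followed by conjugation; being an involution, it satisfies this
    relation.\<close>
  then have BcB: "?Bc ** B = mat 1" using matrix_eq by blast
  then have BBc: "B ** ?Bc = mat 1" by (simp add: matrix_left_right_inverse)
  obtain l where l: "cmod l = 1" "det (\<chi> i j. l * mat 1 $ i $ j + cnj l * ?Bc $ i $ j) \<noteq> 0" using real_structure_matrix by blast
  define P where "P = (\<chi> i j. l * mat 1 $ i $ j + cnj l * ?Bc $ i $ j)"
  \<comment> \<open>This relation says that the columns of \<open>P\<close> are fixed by the
    differential of \<open>s\<close>; they form a real basis, and \<open>Q\<close>, the inverse of
    \<open>P\<close>, transforms that differential into standard conjugation.\<close>
  have PB: "cnj_mat P = B ** P"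
  proof -
    have "(B ** P) $ i $ j = l * (\<Sum>k\<in>UNIV. B $ i $ k * mat 1 $ k $ j) + cnj l * (B ** ?Bc) $ i $ j" for i j
      by (simp add: matrix_matrix_mult_def P_def sum_distrib_left sum.distrib algebra_simps)
    moreover have "(\<Sum>k\<in>UNIV. B $ i $ k * mat 1 $ k $ j) = B $ i $ j" for i j
      using arg_cong[OF matrix_mul_rid[of B], of "\<lambda>M. M $ i $ j"] by (simp add: matrix_matrix_mult_def)
    ultimately have "(B ** P) $ i $ j = l * B $ i $ j + cnj l * mat 1 $ i $ j" for i j by (simp add: BBc)
    then show ?thesis by (simp add: vec_eq_iff cnj_mat_def P_def mat_def)
  qed
  have "invertible P" using l(2) by (simp add: invertible_det_nz P_def)
  then obtain Q where Q: "P ** Q = mat 1" "Q ** P = mat 1" unfolding invertible_def by blast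
  have QcB: "cnj_mat Q ** B = Q"
  proof -
    have "cnj_mat Q ** cnj_mat P = cnj_mat (mat 1)" by (simp only: cnj_mat_mult[symmetric] Q(2))
    also have "cnj_mat (mat 1) = (mat 1 :: complex^'n^'n)" by (simp add: cnj_mat_def mat_def vec_eq_iff)
    finally have "cnj_mat Q ** B ** P = mat 1" by (simp add: PB matrix_mul_assoc)
    then have "cnj_mat Q ** B ** P ** Q = Q" by simp
    then show ?thesis by (simp add: matrix_mul_assoc[symmetric] Q(1))
  qed
  then have "cnj_mat Q ** B ** ?Bc = Q ** ?Bc" by simp
  then have Qc: "cnj_mat Q = Q ** ?Bc" by (simp add: matrix_mul_assoc[symmetric] BBc)
  define \<Phi> where "\<Phi> z = (1/2) *\<^sub>R ((z - a) + ?Bc *v (?\<tau> z - vec_cnj a))" for z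
  have blM: "bounded_linear ((*v) M)" for M :: "complex^'n^'n" using matrix_vector_mul_linear linear_conv_bounded_linear by blast
  have d\<Phi>: "(\<Phi> has_derivative (\<lambda>v. (1/2) *\<^sub>R (v + ?Bc *v (jacobian ?\<tau> z *v v)))) (at z)" if "z \<in> W" for z
  proof -
    have "((\<lambda>z. ?\<tau> z - vec_cnj a) has_derivative (*v) (jacobian ?\<tau> z)) (at z)"
      using has_derivative_diff[OF d\<tau>[OF that] has_derivative_const[of "vec_cnj a"]] by simp
    from bounded_linear.has_derivative[OF blM this]
    have 1: "((\<lambda>z. ?Bc *v (?\<tau> z - vec_cnj a)) has_derivative (\<lambda>v. ?Bc *v (jacobian ?\<tau> z *v v))) (at z)" .
    have 2: "((\<lambda>z. z - a) has_derivative (\<lambda>v. v)) (at z)"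
      using has_derivative_diff[OF has_derivative_ident has_derivative_const[of a]] by simp
    show ?thesis unfolding \<Phi>_def by (rule has_derivative_scaleR_right[OF has_derivative_add[OF 2 1]])
  qed
  define \<Psi> where "\<Psi> z = Q *v \<Phi> z" for z
  have d\<Psi>: "(\<Psi> has_derivative (\<lambda>v. Q *v ((1/2) *\<^sub>R (v + ?Bc *v (jacobian ?\<tau> z *v v))))) (at z)" if "z \<in> W" for z
    unfolding \<Psi>_def by (rule bounded_linear.has_derivative[OF blM d\<Phi>[OF that]])
  have half: "r *\<^sub>R z = complex_of_real r *s z" for r and z :: "complex^'n"
    by (simp add: vec_eq_iff scaleR_conv_of_real[where 'a=complex])
  show thesis
  proof (rule that[of \<Psi>])
    show "holo_map_on W \<Psi>"
    proof (rule holo_map_onI)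
      fix z assume "z \<in> W"
      from d\<Psi>[OF this] show "\<exists>f'. (\<Psi> has_derivative f') (at z) \<and> (\<forall>v. f' (\<i> *s v) = \<i> *s f' v)"
      proof (intro exI conjI allI)
        fix v
        have i_half: "(1/2) *\<^sub>R (\<i> *s w) = \<i> *s ((1/2) *\<^sub>R w)" for w :: "complex^'n" by (simp add: vec_eq_iff)
        have eq: "(\<i> *s v) + ?Bc *v (jacobian ?\<tau> z *v (\<i> *s v)) = \<i> *s (v + ?Bc *v (jacobian ?\<tau> z *v v))"
          by (simp add: matrix_vector_mult_scale vector_add_ldistrib)
        show "Q *v ((1/2) *\<^sub>R ((\<i> *s v) + ?Bc *v (jacobian ?\<tau> z *v (\<i> *s v)))) =
          \<i> *s (Q *v ((1/2) *\<^sub>R (v + ?Bc *v (jacobian ?\<tau> z *v v))))" unfolding eq i_half by (rule matrix_vector_mult_scale)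
      qed
    qed
    have "?Bc *v (jacobian ?\<tau> a *v v) = v" for v unfolding B_def[symmetric] by (simp add: matrix_vector_mul_assoc BcB)
    then have "(1/2) *\<^sub>R (v + ?Bc *v (jacobian ?\<tau> a *v v)) = v" for v by (simp add: vec_eq_iff)
    then have "(\<Psi> has_derivative (*v) Q) (at a)" using d\<Psi>[OF W(2)] by simp
    then have "jacobian \<Psi> a = Q" by (rule jacobian_unique)
    then show "invertible (jacobian \<Psi> a)" using Q unfolding invertible_def by blast
    fix z assume z: "z \<in> W"
    have "vec_cnj (\<Phi> z) = (1/2) *\<^sub>R (vec_cnj (z - a) + B *v (s z - a))" by (simp add: \<Phi>_def half)
    then have "vec_cnj (\<Psi> z) = Q *v ((1/2) *\<^sub>R (?Bc *v vec_cnj (z - a) + ?Bc *v (B *v (s z - a))))"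
      by (simp add: \<Psi>_def Qc matrix_vector_mul_assoc[symmetric] half matrix_vector_mult_scale
        matrix_vector_right_distrib del: vec_cnj_simps(7))
    also have "?Bc *v (B *v (s z - a)) = s z - a" by (simp add: matrix_vector_mul_assoc BcB)
    also have "Q *v ((1/2) *\<^sub>R (?Bc *v vec_cnj (z - a) + (s z - a))) = \<Psi> (s z)"
      by (simp add: \<Psi>_def \<Phi>_def s(2)[OF z] add.commute)
    finally show "\<Psi> (s z) = vec_cnj (\<Psi> z)" by simp
  qed
qed

text \<open>In the linearising coordinates \<Psi> the involution is standard conjugation, so near
  \<open>p0\<close> its fixed points are the points with real coordinates. The inverse of the
  resulting chart is a holomorphic map restricted to real points, which gives its
  smoothness.\<close>

lemma submanifold_charts_cover_fixed_points:
  fixes A :: "('a::{t2_space,second_countable_topology}, 'n::finite) cchart set"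
  assumes A: "complex_manifold A" and \<sigma>: "antiholomorphic_involution A \<sigma>" and p0: "\<sigma> p0 = p0"
  obtains x where "x \<in> submanifold_charts A {p. \<sigma> p = p}" "p0 \<in> dom_of x"
proof -
  let ?L = "{p. \<sigma> p = p}"
  note cm = complex_manifoldD[OF A]
  have \<sigma>c: "continuous_on UNIV \<sigma>" and \<sigma>\<sigma>: "\<sigma> (\<sigma> p) = p" for p
    using \<sigma> unfolding antiholomorphic_involution_def by blast+
  obtain c where c: "c \<in> A" "p0 \<in> dom_of c" using cm(2) by blast
  note ch = cm(1)[OF c(1)]
  note CD = chart_onD[OF ch]
  let ?k = "chart_inv c"
  define O1 where "O1 = {p \<in> dom_of c. \<sigma> p \<in> dom_of c}"
  have O1: "open O1"
  proof -
    have "O1 = dom_of c \<inter> (\<sigma> -` dom_of c)" by (auto simp: O1_def)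
    moreover have "open (\<sigma> -` dom_of c)" by (rule open_vimage[OF cm(4)[OF c(1)] \<sigma>c])
    ultimately show ?thesis using cm(4)[OF c(1)] by (simp add: open_Int)
  qed
  define W where "W = coord c ` O1"
  have "O1 \<inter> dom_of c = O1" by (auto simp: O1_def)
  then have W: "open W" using chart_image_open[OF ch, of O1] O1 by (simp add: W_def)
  define a where "a = coord c p0"
  have aW: "a \<in> W" using c(2) p0 by (auto simp: W_def O1_def a_def)
  define s where "s z = coord c (\<sigma> (?k z))" for z
  have kW: "?k z \<in> dom_of c" "\<sigma> (?k z) \<in> dom_of c" "coord c (?k z) = z" if z: "z \<in> W" for z
  proof -
    obtain p where p: "z = coord c p" "p \<in> dom_of c" "\<sigma> p \<in> dom_of c" using z by (auto simp: W_def O1_def)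
    then show "?k z \<in> dom_of c" "\<sigma> (?k z) \<in> dom_of c" "coord c (?k z) = z" using CD(4)[OF p(2)] by simp_all
  qed
  have ks: "?k (s z) = \<sigma> (?k z)" if "z \<in> W" for z unfolding s_def by (rule CD(4)[OF kW(2)[OF that]])
  have sW: "s z \<in> W" if z: "z \<in> W" for z using kW[OF z] \<sigma>\<sigma> unfolding W_def O1_def s_def by auto
  have ss: "s (s z) = z" if z: "z \<in> W" for z using ks[OF z] kW[OF z] \<sigma>\<sigma> by (simp add: s_def)
  have sa: "s a = a" using CD(4)[OF c(2)] p0 by (simp add: s_def a_def)
  have "holo_map_on W (vec_cnj \<circ> coord c \<circ> \<sigma> \<circ> ?k)"
    using \<sigma> c(1) unfolding antiholomorphic_involution_def W_def O1_def by blast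
  then have hol: "holo_map_on W (\<lambda>z. vec_cnj (s z))" by (simp add: s_def[abs_def] o_def)
  obtain \<Psi> where \<Psi>: "holo_map_on W \<Psi>" "invertible (jacobian \<Psi> a)" "\<And>z. z \<in> W \<Longrightarrow> \<Psi> (s z) = vec_cnj (\<Psi> z)"
    using linearise_antiholomorphic_involution[OF W aW hol sW ss sa] by metis
  obtain U V G where UV: "open U" "a \<in> U" "U \<subseteq> W" "open V" "homeomorphism U V \<Psi> G" "holo_map_on V G"
    using holo_local_inverse[OF W \<Psi>(1) aW \<Psi>(2)] by metis
  have UV': "\<Psi> ` U = V" "G ` V = U" "\<And>z. z \<in> U \<Longrightarrow> G (\<Psi> z) = z" "\<And>w. w \<in> V \<Longrightarrow> \<Psi> (G w) = w"
    "continuous_on U \<Psi>" "continuous_on V G" using UV(5) unfolding homeomorphism_def by simp_all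
  have \<Psi>inj: "z = z'" if "z \<in> U" "z' \<in> U" "\<Psi> z = \<Psi> z'" for z z'
    using UV'(3)[OF that(1)] UV'(3)[OF that(2)] that(3) by metis
  have s_cont: "continuous_on W s"
  proof -
    have "continuous_on W (\<lambda>z. vec_cnj (s z))"
      using has_derivative_continuous[OF holo_map_has_derivative[OF hol]] by (intro continuous_at_imp_continuous_on ballI)
    then have "continuous_on W (\<lambda>z. vec_cnj (vec_cnj (s z)))" by (rule bounded_linear.continuous_on[OF bounded_linear_vec_cnj])
    then show ?thesis by simp
  qed
  \<comment> \<open>Both \<open>z\<close> and \<open>s z\<close> must lie where \<Psi> is injective
    before \<open>\<Psi> (s z) = \<Psi> z\<close> implies \<open>s z = z\<close>.\<close>
  define U' where "U' = {z \<in> U. s z \<in> U}"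
  have U': "open U'"
  proof -
    have "U' = U \<inter> s -` U" by (auto simp: U'_def)
    moreover have "open (U \<inter> s -` U)" by (rule continuous_open_preimage[OF continuous_on_subset[OF s_cont UV(3)] UV(1) UV(1)])
    ultimately show ?thesis by simp
  qed
  have aU': "a \<in> U'" using UV(2) sa by (simp add: U'_def)
  define d where "d = {q. \<sigma> q = q \<and> q \<in> dom_of c \<and> coord c q \<in> U'}"
  define X where "X q = re_vec (\<Psi> (coord c q))" for q
  define Y where "Y = {y. cvec y \<in> V \<and> G (cvec y) \<in> U'}"
  define k where "k y = ?k (G (cvec y))" for y
  have Y: "open Y"
  proof -
    have "open (V \<inter> G -` U')" by (rule continuous_open_preimage[OF UV'(6) UV(4) U'])
    moreover have "continuous_on UNIV (cvec :: real^'n \<Rightarrow> complex^'n)" by (rule linear_continuous_on[OF bounded_linear_cvec])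
    ultimately have "open (cvec -` (V \<inter> G -` U'))" by (rule open_vimage)
    then show ?thesis by (simp add: Y_def vimage_def Int_def)
  qed
  have dU: "coord c q \<in> U" "coord c q \<in> W" if "q \<in> d" for q using that UV(3) by (auto simp: d_def U'_def)
  have sfix: "s (coord c q) = coord c q" if "q \<in> d" for q using that CD(4)[of q] by (simp add: d_def s_def)
  have cX: "cvec (X q) = \<Psi> (coord c q)" if "q \<in> d" for q
    unfolding X_def by (rule cvec_re_vec) (use \<Psi>(3)[OF dU(2)[OF that]] sfix[OF that] in simp)
  have XY: "X q \<in> Y" and kX: "k (X q) = q" if q: "q \<in> d" for q
  proof -
    have g: "G (cvec (X q)) = coord c q" by (simp add: cX[OF q] UV'(3)[OF dU(1)[OF q]])
    have "cvec (X q) \<in> V" using UV'(1) dU(1)[OF q] by (auto simp: cX[OF q])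
    then show "X q \<in> Y" using q by (simp add: Y_def g d_def)
    show "k (X q) = q" using q CD(4)[of q] by (simp add: k_def g d_def)
  qed
  have kY: "k y \<in> d" and Xk: "X (k y) = y" if y: "y \<in> Y" for y
  proof -
    define z where "z = G (cvec y)"
    have z: "z \<in> U" "s z \<in> U" "\<Psi> z = cvec y" using y UV'(4) by (simp_all add: Y_def U'_def z_def)
    have zW: "z \<in> W" using z(1) UV(3) by blast
    have "\<Psi> (s z) = \<Psi> z" using \<Psi>(3)[OF zW] z(3) by simp
    then have sz: "s z = z" by (rule \<Psi>inj[OF z(2,1)])
    have "\<sigma> (k y) = k y" using ks[OF zW] sz by (simp add: k_def z_def)
    then show "k y \<in> d" using kW[OF zW] y by (simp add: d_def k_def z_def Y_def)
    show "X (k y) = y" using kW(3)[OF zW] z(3) by (simp add: X_def k_def z_def)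
  qed
  let ?x = "(d, X)"
  have im: "X ` d = Y" using XY kY Xk by (metis (no_types, lifting) image_iff subsetI subset_antisym)
  have injX: "inj_on X d" using kX by (rule inj_on_inverseI)
  have ci: "chart_inv ?x y = k y" if y: "y \<in> Y" for y unfolding chart_inv_def by (simp add: inv_into_f_eq[OF injX kY[OF y] Xk[OF y]])
  have kcont: "continuous_on Y k"
  proof -
    have "continuous_on Y (\<lambda>y. G (cvec y))"
      by (rule continuous_on_compose2[OF UV'(6) linear_continuous_on[OF bounded_linear_cvec]]) (auto simp: Y_def)
    moreover have "G (cvec y) \<in> coord c ` dom_of c" if "y \<in> Y" for y using that UV(3) by (auto simp: Y_def U'_def W_def O1_def)
    ultimately show ?thesis unfolding k_def[abs_def] by (intro continuous_on_compose2[OF CD(3)]) auto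
  qed
  have chx: "chart_on ?L ?x" unfolding chart_on_def
  proof (intro conjI)
    have "d = ?L \<inter> {p \<in> dom_of c. coord c p \<in> U'}" by (auto simp: d_def)
    then show "openin (top_of_set ?L) (dom_of ?x)" using openin_open_Int[OF chart_preimage_open[OF ch U'], of ?L] by (simp only: fst_conv)
    show "open (coord ?x ` dom_of ?x)" using Y im by simp
    show "homeomorphism (dom_of ?x) (coord ?x ` dom_of ?x) (coord ?x) (chart_inv ?x)" unfolding fst_conv snd_conv im
    proof (rule homeomorphismI)
      have "continuous_on d (\<lambda>q. \<Psi> (coord c q))"
        by (rule continuous_on_compose2[OF UV'(5) continuous_on_subset[OF CD(2)]]) (use dU(1) in \<open>auto simp: d_def\<close>)
      then show "continuous_on d X" unfolding X_def[abs_def] by (rule bounded_linear.continuous_on[OF bounded_linear_re_vec])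
      show "continuous_on Y (chart_inv ?x)" using kcont ci by (simp cong: continuous_on_cong)
      show "X ` d \<subseteq> Y" using im by simp
      show "chart_inv ?x ` Y \<subseteq> d" using kY ci by auto
      show "chart_inv ?x (X q) = q" if "q \<in> d" for q using ci[OF XY[OF that]] kX[OF that] by simp
      show "X (chart_inv ?x y) = y" if "y \<in> Y" for y using ci[OF that] Xk[OF that] by simp
    qed
  qed
  have "?x \<in> submanifold_charts A ?L" unfolding submanifold_charts_def mem_Collect_eq
  proof (intro conjI ballI chx)
    fix c' assume c': "c' \<in> A"
    define T where "T = X ` (d \<inter> dom_of c')"
    have T: "T = {y \<in> Y. k y \<in> dom_of c'}" using chart_image_eq[OF chx, of "dom_of c'"] ci by (auto simp: T_def im Int_commute)
    have oT: "open T"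
    proof -
      have "open (Y \<inter> k -` dom_of c')" by (rule continuous_open_preimage[OF kcont Y cm(4)[OF c']])
      then show ?thesis by (simp add: T vimage_def Int_def)
    qed
    define S where "S = V \<inter> G -` (coord c ` (dom_of c \<inter> dom_of c'))"
    have oS: "open S" unfolding S_def by (rule continuous_open_preimage[OF UV'(6) UV(4) cm(5)[OF c(1) c']])
    define H where "H = transition c c' \<circ> G"
    have hH: "holo_map_on S H" unfolding H_def
    proof (rule holo_map_on_compose(1)[OF _ cm(3)[OF c(1) c']])
      show "holo_map_on S G" using UV(6) unfolding S_def holo_map_on_def by (auto intro: holo_on_subset)
      show "G ` S \<subseteq> coord c ` (dom_of c \<inter> dom_of c')" by (auto simp: S_def)
    qed
    have TS: "cvec y \<in> S" if y: "y \<in> T" for y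
    proof -
      have "y \<in> Y" "k y \<in> dom_of c'" using y by (simp_all add: T)
      then have "G (cvec y) \<in> W" "cvec y \<in> V" using UV(3) by (auto simp: Y_def U'_def)
      then have "?k (G (cvec y)) \<in> dom_of c \<inter> dom_of c'" "coord c (?k (G (cvec y))) = G (cvec y)"
        using kW(1,3)[of "G (cvec y)"] \<open>k y \<in> dom_of c'\<close> by (simp_all add: k_def)
      then have "G (cvec y) \<in> coord c ` (dom_of c \<inter> dom_of c')" by (metis imageI)
      then show ?thesis using \<open>cvec y \<in> V\<close> by (simp add: S_def)
    qed
    have eq: "H (cvec y) = (coord c' \<circ> chart_inv ?x) y" if y: "y \<in> T" for y using y ci by (simp add: T H_def k_def transition_def)
    show "smooth_on (coord ?x ` (dom_of ?x \<inter> dom_of c')) (coord c' \<circ> chart_inv ?x)"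
      unfolding fst_conv snd_conv T_def[symmetric] smooth_on_def
    proof (intro ballI exI conjI allI)
      fix y k assume "y \<in> T"
      show "Ck_on k T (\<lambda>y. H (cvec y))" by (rule Ck_on_holo_map_linear[OF hH oS bounded_linear_cvec oT]) (use TS in blast)
    qed (use oT eq in auto)
    fix y assume "y \<in> coord ?x ` (dom_of ?x \<inter> dom_of c')"
    then have y: "y \<in> T" by (simp add: T_def)
    have dH: "(H has_derivative (*v) (jacobian H (cvec y))) (at (cvec y))" by (rule holo_map_has_derivative[OF hH TS[OF y]])
    have "((\<lambda>y. H (cvec y)) has_derivative (\<lambda>v. jacobian H (cvec y) *v cvec v)) (at y)"
      using diff_chain_at[OF bounded_linear_imp_has_derivative[OF bounded_linear_cvec] dH] by (simp add: o_def)
    then have "(coord c' \<circ> chart_inv ?x has_derivative (\<lambda>v. jacobian H (cvec y) *v cvec v)) (at y)"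
      by (rule has_derivative_transform_within_open[OF _ oT y]) (rule eq)
    then have fd: "Fd (coord c' \<circ> chart_inv ?x) y = (\<lambda>v. jacobian H (cvec y) *v cvec v)"
      by (rule frechet_derivative_at[symmetric])
    \<comment> \<open>A left inverse of \<open>H\<close>, differentiable at the relevant point;
      hence the differential of the inverse chart is injective.\<close>
    define K where "K = \<Psi> \<circ> transition c' c"
    have GS: "?k (G w) \<in> dom_of c" "?k (G w) \<in> dom_of c'" "coord c (?k (G w)) = G w" if w: "w \<in> S" for w
    proof -
      obtain q where q: "G w = coord c q" "q \<in> dom_of c" "q \<in> dom_of c'" using w by (auto simp: S_def)
      then show "?k (G w) \<in> dom_of c" "?k (G w) \<in> dom_of c'" "coord c (?k (G w)) = G w" using CD(4)[OF q(2)] by simp_all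
    qed
    have tH: "transition c' c (H w) = G w" if w: "w \<in> S" for w
      using chart_onD(4)[OF cm(1)[OF c'] GS(2)[OF w]] GS(3)[OF w] by (simp add: H_def transition_def)
    have KH: "K (H w) = w" if w: "w \<in> S" for w using tH[OF w] UV'(4)[of w] w by (simp add: K_def S_def)
    have "\<exists>K'. (K has_derivative K') (at (H (cvec y)))"
    proof -
      let ?w = "cvec y"
      let ?q = "?k (G ?w)"
      have w: "?w \<in> S" by (rule TS[OF y])
      have Hw: "H ?w = coord c' ?q" by (simp add: H_def transition_def)
      have "G ?w \<in> W" using w UV'(2) UV(3) by (auto simp: S_def)
      then have "(\<Psi> has_derivative (*v) (jacobian \<Psi> (G ?w))) (at (transition c' c (H ?w)))"
        unfolding tH[OF w] by (rule holo_map_has_derivative[OF \<Psi>(1)])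
      moreover have "(transition c' c has_derivative (*v) (tjac c' c ?q)) (at (H ?w))"
        unfolding Hw by (rule transition_has_derivative[OF A c' c(1) GS(2)[OF w] GS(1)[OF w]])
      ultimately show ?thesis unfolding K_def using diff_chain_at by blast
    qed
    then obtain K' where K': "(K has_derivative K') (at (H (cvec y)))" by blast
    from diff_chain_at[OF dH this] have "((\<lambda>w. K (H w)) has_derivative (\<lambda>v. K' (jacobian H (cvec y) *v v))) (at (cvec y))"
      by (simp add: o_def)
    then have "((\<lambda>w. w) has_derivative (\<lambda>v. K' (jacobian H (cvec y) *v v))) (at (cvec y))"
      by (rule has_derivative_transform_within_open[OF _ oS TS[OF y]]) (rule KH)
    from has_derivative_unique[OF this has_derivative_ident]
    have K'H: "K' (jacobian H (cvec y) *v v) = v" for v by (rule fun_cong)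
    show "inj (Fd (coord c' \<circ> chart_inv ?x) y)" unfolding fd
    proof (rule injI)
      fix v w assume "jacobian H (cvec y) *v cvec v = jacobian H (cvec y) *v cvec w"
      then have "K' (jacobian H (cvec y) *v cvec v) = K' (jacobian H (cvec y) *v cvec w)" by (rule arg_cong)
      then have "cvec v = cvec w" unfolding K'H .
      then have "re_vec (cvec v) = re_vec (cvec w)" by (rule arg_cong)
      then show "v = w" by simp
    qed
  qed
  moreover have "p0 \<in> dom_of ?x" using c(2) p0 aU' by (simp add: d_def a_def)
  ultimately show thesis by (rule that)
qed

section \<open>Integration by parts for a family of maps\<close>

lemma Ck_on_2D:
  assumes "Ck_on 2 S f"
  shows "Ck_on (Suc 0) S f" "Ck_on (Suc 0) S (\<lambda>x. Fd f x v)"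
proof -
  have 2: "Ck_on (Suc (Suc 0)) S f" using assms by (simp only: numeral_2_eq_2)
  show "Ck_on (Suc 0) S f" by (rule Ck_on_SucD[OF 2])
  show "Ck_on (Suc 0) S (\<lambda>x. Fd f x v)" using 2 by (simp only: Ck_on.simps(2)) blast
qed

lemma Ck_on_1_continuous:
  assumes "Ck_on (Suc 0) S f"
  shows "continuous_on S (\<lambda>x. Fd f x v)" "continuous_on S f" using assms Ck_on_SucD[OF assms] by auto

lemma has_derivative_line:
  assumes "(f has_derivative f') (at (z + t *\<^sub>R v))"
  shows "((\<lambda>t. f (z + t *\<^sub>R v)) has_vector_derivative f' v) (at t)"
proof -
  have "((\<lambda>t. z + t *\<^sub>R v) has_derivative (\<lambda>h. h *\<^sub>R v)) (at t)" by (auto intro!: derivative_eq_intros)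
  from diff_chain_at[OF this assms] have "((\<lambda>t. f (z + t *\<^sub>R v)) has_derivative (\<lambda>h. f' (h *\<^sub>R v))) (at t)"
    by (simp add: o_def)
  moreover have "f' (h *\<^sub>R v) = h *\<^sub>R f' v" for h by (rule linear_scale[OF has_derivative_linear[OF assms]])
  ultimately show ?thesis by (simp add: has_vector_derivative_def)
qed

text \<open>The increment of \<open>G\<close> in direction \<open>v\<close> is an integral of
  \<open>?D v\<close>. Differentiating it in direction \<open>w\<close> under the integral, and then
  in the length \<open>t\<close> at 0, exchanges the two derivatives.\<close>

lemma second_derivative_symmetric:
  fixes G :: "'a::euclidean_space \<Rightarrow> 'b::euclidean_space"
  assumes "open S" "Ck_on 2 S G" "z \<in> S"
  shows "Fd (\<lambda>x. Fd G x v) z w = Fd (\<lambda>x. Fd G x w) z v"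
proof -
  let ?p = "\<lambda>s t. z + s *\<^sub>R w + t *\<^sub>R v"
  let ?D = "\<lambda>v x. Fd G x v"
  let ?E = "\<lambda>w v x. Fd (?D v) x w"
  have dG: "(G has_derivative Fd G x) (at x)" if "x \<in> S" for x by (rule Ck_on_has_derivative[OF Ck_on_2D(1)[OF assms(2)] that])
  have dD: "(?D v has_derivative Fd (?D v) x) (at x)" if "x \<in> S" for x v by (rule Ck_on_has_derivative[OF Ck_on_2D(2)[OF assms(2)] that])
  have cD: "continuous_on S (?D v)" and cE: "continuous_on S (?E w v)" for v w using Ck_on_1_continuous[OF Ck_on_2D(2)[OF assms(2)]] by blast+
  obtain e where e: "e > 0" "ball z e \<subseteq> S" using assms(1,3) by (meson openE)
  define r where "r = e / (2 * (norm v + norm w + 1))"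
  have pos: "norm v + norm w + 1 > 0" by (simp add: add_nonneg_pos)
  have r: "r > 0" using e(1) pos by (simp add: r_def)
  have inS: "?p s t \<in> S" if "\<bar>s\<bar> \<le> r" "\<bar>t\<bar> \<le> r" for s t
  proof -
    have "norm (s *\<^sub>R w + t *\<^sub>R v) \<le> \<bar>s\<bar> * norm w + \<bar>t\<bar> * norm v" by (rule norm_triangle_le) simp
    also have "\<dots> \<le> r * norm w + r * norm v" using that by (intro add_mono mult_right_mono) auto
    also have "\<dots> \<le> r * (norm v + norm w + 1)" using r by (simp add: algebra_simps)
    also have "\<dots> = e / 2" using pos unfolding r_def by (simp only: times_divide_eq_left) (simp add: divide_simps)
    also have "\<dots> < e" using e(1) by simp
    finally have "?p s t \<in> ball z e" by (simp add: dist_norm add.assoc norm_minus_commute add.commute)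
    then show ?thesis using e(2) by blast
  qed
  let ?U = "{-r<..<r}"
  have key: "?D w (z + t *\<^sub>R v) - ?D w z = integral (cbox 0 t) (\<lambda>u. ?E w v (z + u *\<^sub>R v))" if t: "0 \<le> t" "t \<le> r" for t
  proof -
    have ftc: "G (?p s t) - G (z + s *\<^sub>R w) = integral (cbox 0 t) (\<lambda>u. ?D v (?p s u))" if s: "s \<in> ?U" for s
    proof -
      have "((\<lambda>u. ?D v (?p s u)) has_integral G (?p s t) - G (z + s *\<^sub>R w + 0 *\<^sub>R v)) {0..t}"
      proof (rule fundamental_theorem_of_calculus[OF t(1)])
        fix u assume u: "u \<in> {0..t}"
        have "\<bar>s\<bar> \<le> r" "\<bar>u\<bar> \<le> r" using s u t by (simp_all add: abs_le_iff)
        then have "?p s u \<in> S" by (rule inS)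
        then show "((\<lambda>u. G (?p s u)) has_vector_derivative ?D v (?p s u)) (at u within {0..t})"
          by (rule has_vector_derivative_at_within[OF has_derivative_line[OF dG]])
      qed
      then show ?thesis by (simp add: integral_unique)
    qed
    have "((\<lambda>s. integral (cbox 0 t) (\<lambda>u. ?D v (?p s u))) has_vector_derivative
      integral (cbox 0 t) (\<lambda>u. ?E w v (z + 0 *\<^sub>R w + u *\<^sub>R v))) (at 0 within ?U)"
    proof (rule leibniz_rule_vector_derivative)
      fix s u assume su: "s \<in> ?U" "u \<in> cbox 0 t"
      have "\<bar>s\<bar> \<le> r" "\<bar>u\<bar> \<le> r" using su t by (simp_all add: abs_le_iff)
      then have mem: "?p s u \<in> S" by (rule inS)
      have eq: "?p s u = (z + u *\<^sub>R v) + s *\<^sub>R w" for s by (simp add: ac_simps)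
      show "((\<lambda>s. ?D v (?p s u)) has_vector_derivative ?E w v (?p s u)) (at s within ?U)"
        unfolding eq by (rule has_vector_derivative_at_within[OF has_derivative_line[OF dD[OF mem[unfolded eq]]]])
    next
      fix s assume s: "s \<in> ?U"
      show "(\<lambda>u. ?D v (?p s u)) integrable_on cbox 0 t"
      proof (rule integrable_continuous, rule continuous_on_compose2[OF cD])
        show "(\<lambda>u. ?p s u) ` cbox 0 t \<subseteq> S"
        proof (rule image_subsetI)
          fix u assume "u \<in> cbox 0 t"
          then have "\<bar>s\<bar> \<le> r" "\<bar>u\<bar> \<le> r" using s t by (simp_all add: abs_le_iff)
          then show "?p s u \<in> S" by (rule inS)
        qed
      qed (intro continuous_intros)
    next
      show "continuous_on (?U \<times> cbox 0 t) (\<lambda>(s, u). ?E w v (?p s u))" unfolding split_beta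
      proof (rule continuous_on_compose2[OF cE])
        show "(\<lambda>p. z + fst p *\<^sub>R w + snd p *\<^sub>R v) ` (?U \<times> cbox 0 t) \<subseteq> S"
        proof (rule image_subsetI)
          fix p assume "p \<in> ?U \<times> cbox 0 t"
          then have "\<bar>fst p\<bar> \<le> r" "\<bar>snd p\<bar> \<le> r" using t by (auto simp: abs_le_iff)
          then show "z + fst p *\<^sub>R w + snd p *\<^sub>R v \<in> S" by (rule inS)
        qed
      qed (intro continuous_intros)
    qed (use r in auto)
    then have 1: "((\<lambda>s. G (?p s t) - G (z + s *\<^sub>R w)) has_vector_derivative
      integral (cbox 0 t) (\<lambda>u. ?E w v (z + 0 *\<^sub>R w + u *\<^sub>R v))) (at 0 within ?U)"
      by (rule has_vector_derivative_transform[rotated 2]) (use r ftc in auto)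
    have 2: "((\<lambda>s. G (?p s t) - G (z + s *\<^sub>R w)) has_vector_derivative ?D w (z + t *\<^sub>R v) - ?D w z) (at 0 within ?U)"
    proof (rule has_vector_derivative_at_within, rule has_vector_derivative_diff)
      have eq: "?p s t = (z + t *\<^sub>R v) + s *\<^sub>R w" for s by (simp add: ac_simps)
      have "z + t *\<^sub>R v \<in> S" using inS[of 0 t] t r by simp
      then have "(G has_derivative Fd G (z + t *\<^sub>R v)) (at ((z + t *\<^sub>R v) + 0 *\<^sub>R w))" using dG by simp
      then show "((\<lambda>s. G (?p s t)) has_vector_derivative ?D w (z + t *\<^sub>R v)) (at 0)" unfolding eq by (rule has_derivative_line)
      show "((\<lambda>s. G (z + s *\<^sub>R w)) has_vector_derivative ?D w z) (at 0)"
        by (rule has_derivative_line) (use dG[OF assms(3)] in simp)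
    qed
    have "at 0 within ?U = at 0" using r by (intro at_within_open) auto
    from vector_derivative_unique_at[OF 2[unfolded this] 1[unfolded this]] show ?thesis by simp
  qed
  \<comment> \<open>Only nonnegative \<open>t\<close> occur, so the derivatives at 0 are one-sided;
    this still determines them.\<close>
  have "continuous_on {0..r} (\<lambda>u. ?E w v (z + u *\<^sub>R v))"
  proof (rule continuous_on_compose2[OF cE])
    show "(\<lambda>u. z + u *\<^sub>R v) ` {0..r} \<subseteq> S" using inS[of 0] r by (intro image_subsetI) (simp add: abs_le_iff)
  qed (intro continuous_intros)
  then have "((\<lambda>t. integral {0..t} (\<lambda>u. ?E w v (z + u *\<^sub>R v))) has_vector_derivative ?E w v (z + 0 *\<^sub>R v)) (at 0 within {0..r})"
    by (rule integral_has_vector_derivative) (use r in simp)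
  then have "((\<lambda>t. integral {0..t} (\<lambda>u. ?E w v (z + u *\<^sub>R v))) has_vector_derivative ?E w v z) (at 0 within {0..r})"
    by simp
  then have "((\<lambda>t. ?D w (z + t *\<^sub>R v) - ?D w z) has_vector_derivative ?E w v z) (at 0 within {0..r})"
    using r key by (auto intro: has_vector_derivative_transform[rotated 2])
  moreover have "((\<lambda>t. ?D w (z + t *\<^sub>R v) - ?D w z) has_vector_derivative ?E v w z - 0) (at 0 within {0..r})"
  proof (rule has_vector_derivative_diff[OF has_vector_derivative_at_within has_vector_derivative_const])
    have "(?D w has_derivative Fd (?D w) z) (at (z + 0 *\<^sub>R v))" using dD[OF assms(3)] by simp
    then show "((\<lambda>t. ?D w (z + t *\<^sub>R v)) has_vector_derivative ?E v w z) (at 0)" by (rule has_derivative_line)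
  qed
  ultimately show ?thesis using vector_derivative_unique_within_closed_interval[of 0 r 0] r by simp
qed

lemma Ck_on_det:
  fixes M :: "'a::real_normed_vector \<Rightarrow> complex^'n^'n"
  assumes "open S" "\<And>i. Ck_on k S (\<lambda>z. M z $ i)"
  shows "Ck_on k S (\<lambda>z. det (M z))"
proof -
  have c: "Ck_on k S (\<lambda>z. M z $ i $ j)" for i j by (rule Ck_on_bounded_linear[OF assms(1) bounded_linear_vec_nth assms(2)])
  show ?thesis unfolding det_def by (intro Ck_on_sum Ck_on_mult Ck_on_prod Ck_on_const assms(1) c)
qed

text \<open>The pull-back of the closed form \<open>\<zeta> dz\<^sub>1 \<and> \<dots> \<and> dz\<^sub>n\<close>, where \<open>\<zeta>\<close> is holomorphic with logarithmic
  differential \<open>\<theta>\<close> and pulls back to \<open>\<psi>\<close>, is closed: the time derivative of its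
  \<open>dy\<^sub>1 \<and> \<dots> \<and> dy\<^sub>n\<close>-part is a divergence.\<close>

locale pulled_back_form =
  fixes S :: "((real^'n::finite) \<times> real) set" and G :: "(real^'n) \<times> real \<Rightarrow> complex^'n"
    and \<psi> :: "(real^'n) \<times> real \<Rightarrow> complex" and \<theta> :: "'n \<Rightarrow> (real^'n) \<times> real \<Rightarrow> complex"
  assumes S: "open S" and G: "Ck_on 2 S G"
    and \<theta>: "\<And>i. continuous_on S (\<theta> i)"
    and \<psi>: "\<And>z. z \<in> S \<Longrightarrow> (\<psi> has_derivative (\<lambda>v. \<psi> z * (\<Sum>i\<in>UNIV. \<theta> i z * Fd G z v $ i))) (at z)"
begin

definition rows :: "(real^'n) \<times> real \<Rightarrow> complex^'n^'n" where
  "rows z = (\<chi> j. Fd G z (axis j 1, 0))"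

definition vel :: "(real^'n) \<times> real \<Rightarrow> complex^'n" where
  "vel z = Fd G z (0, 1)"

text \<open>The coefficient of dy_1 wedge ... wedge dy_n in the pulled-back form.\<close>

definition dens :: "(real^'n) \<times> real \<Rightarrow> complex" where
  "dens z = \<psi> z * det (rows z)"

text \<open>The coefficient of the term in which dt takes the place of dy_j.\<close>

definition flux :: "'n \<Rightarrow> (real^'n) \<times> real \<Rightarrow> complex" where
  "flux j z = \<psi> z * det (row_upd (rows z) j (vel z))"

lemma Ck_rows: "Ck_on (Suc 0) S (\<lambda>z. rows z $ i)" and Ck_vel: "Ck_on (Suc 0) S vel"
  using Ck_on_2D(2)[OF G] by (simp_all only: rows_def vec_lambda_beta vel_def[abs_def])

lemma continuous_\<psi>: "continuous_on S \<psi>" using has_derivative_continuous[OF \<psi>] by (intro continuous_at_imp_continuous_on ballI)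

lemma Ck_\<psi>: "Ck_on (Suc 0) S \<psi>"
proof (rule Ck_on_Suc_iff[OF S \<psi>, THEN iffD2], assumption, rule allI)
  fix v
  have c: "continuous_on S (\<lambda>z. Fd G z v $ i)" for i using Ck_on_1_continuous(1)[OF Ck_on_2D(1)[OF G]] by (intro continuous_intros)
  show "Ck_on 0 S (\<lambda>z. \<psi> z * (\<Sum>i\<in>UNIV. \<theta> i z * Fd G z v $ i))"
    unfolding Ck_on.simps(1) by (intro continuous_on_mult continuous_on_sum continuous_\<psi> \<theta> c)
qed

lemma Ck_dens: "Ck_on (Suc 0) S dens" unfolding dens_def[abs_def] by (intro Ck_on_mult Ck_on_det Ck_\<psi> Ck_rows S)

lemma Ck_flux: "Ck_on (Suc 0) S (flux j)"
proof -
  have "Ck_on (Suc 0) S (\<lambda>z. row_upd (rows z) j (vel z) $ i)" for i unfolding row_upd_def vec_lambda_beta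
    by (cases "i = j") (simp_all only: simp_thms if_True if_False Ck_rows Ck_vel)
  then show ?thesis unfolding flux_def[abs_def] by (intro Ck_on_mult Ck_on_det Ck_\<psi> S)
qed

text \<open>Closedness of the pull-back in coordinates. On the right, the terms from the derivative
  of \<psi> add up by \<open>cramer_functional\<close>, those with two space derivatives of
  \<open>G\<close> cancel by antisymmetry, and the mixed ones agree with the left side because
  second derivatives commute.\<close>

lemma divergence:
  assumes z: "z \<in> S"
  shows "Fd dens z (0, 1) = (\<Sum>j\<in>UNIV. Fd (flux j) z (axis j 1, 0))"
proof -
  let ?D = "\<lambda>v x. Fd G x v"
  let ?H = "\<lambda>v w. Fd (?D v) z w"
  let ?e = "\<lambda>j. (axis j 1, 0) :: (real^'n) \<times> real"
  let ?t = "(0, 1) :: (real^'n) \<times> real"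
  let ?M = "rows z" and ?a = "vel z"
  let ?\<theta> = "\<lambda>v. \<Sum>i\<in>UNIV. \<theta> i z * v $ i"
  have sym: "?H v w = ?H w v" for v w by (rule second_derivative_symmetric[OF S G z])
  have dD: "(?D v has_derivative ?H v) (at z)" for v by (rule Ck_on_has_derivative[OF Ck_on_2D(2)[OF G] z])
  have drow: "((\<lambda>x. rows x $ i) has_derivative ?H (?e i)) (at z)" for i using dD[of "?e i"] by (simp only: rows_def vec_lambda_beta)
  have dvel: "(vel has_derivative ?H ?t) (at z)" using dD[of ?t] by (simp only: vel_def[abs_def])
  have "(dens has_derivative (\<lambda>v. \<psi> z * (\<Sum>i\<in>UNIV. det (row_upd ?M i (?H (?e i) v))) + \<psi> z * ?\<theta> (?D v z) * det ?M)) (at z)"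
    unfolding dens_def[abs_def] by (rule has_derivative_mult[OF \<psi>[OF z] has_derivative_det_rows[OF drow]])
  from frechet_derivative_at[OF this, symmetric]
  have 1: "Fd dens z ?t = \<psi> z * (\<Sum>i\<in>UNIV. det (row_upd ?M i (?H (?e i) ?t))) + \<psi> z * ?\<theta> ?a * det ?M"
    by (simp add: vel_def)
  \<comment> \<open>Row \<open>j\<close> of the updated matrix is the velocity, whose derivative is
    the mixed second derivative; therefore the term \<open>i = j\<close> is split off.\<close>
  have 2: "Fd (flux j) z (?e j) = \<psi> z * (\<Sum>i\<in>UNIV-{j}. det (row_upd (row_upd ?M j ?a) i (?H (?e i) (?e j))))
    + \<psi> z * det (row_upd ?M j (?H ?t (?e j))) + \<psi> z * ?\<theta> (?M $ j) * det (row_upd ?M j ?a)" for j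
  proof -
    let ?R = "\<lambda>i. if i = j then ?H ?t else ?H (?e i)"
    have dr: "((\<lambda>x. row_upd (rows x) j (vel x) $ i) has_derivative ?R i) (at z)" for i
      unfolding row_upd_def vec_lambda_beta using drow[of i] dvel by (cases "i = j") (simp_all only: simp_thms if_True if_False)
    have "(flux j has_derivative (\<lambda>v. \<psi> z * (\<Sum>i\<in>UNIV. det (row_upd (row_upd ?M j ?a) i (?R i v)))
      + \<psi> z * ?\<theta> (?D v z) * det (row_upd ?M j ?a))) (at z)"
      unfolding flux_def[abs_def] by (rule has_derivative_mult[OF \<psi>[OF z] has_derivative_det_rows[OF dr]])
    from fun_cong[OF frechet_derivative_at[OF this, symmetric], of "?e j"]
    have "Fd (flux j) z (?e j) = \<psi> z * (\<Sum>i\<in>UNIV. det (row_upd (row_upd ?M j ?a) i (?R i (?e j))))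
      + \<psi> z * ?\<theta> (?D (?e j) z) * det (row_upd ?M j ?a)" .
    moreover have "?D (?e j) z = ?M $ j" by (simp add: rows_def)
    moreover have "(\<Sum>i\<in>UNIV. det (row_upd (row_upd ?M j ?a) i (?R i (?e j)))) =
      det (row_upd (row_upd ?M j ?a) j (?R j (?e j))) + (\<Sum>i\<in>UNIV-{j}. det (row_upd (row_upd ?M j ?a) i (?R i (?e j))))"
      by (rule sum.remove) auto
    moreover have "row_upd (row_upd ?M j ?a) j b = row_upd ?M j b" for b by (simp add: row_upd_def vec_eq_iff)
    moreover have "(\<Sum>i\<in>UNIV-{j}. det (row_upd (row_upd ?M j ?a) i (?R i (?e j)))) =
      (\<Sum>i\<in>UNIV-{j}. det (row_upd (row_upd ?M j ?a) i (?H (?e i) (?e j))))" by (rule sum.cong) auto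
    ultimately show ?thesis by (simp add: algebra_simps)
  qed
  have 3: "(\<Sum>j\<in>UNIV. \<Sum>i\<in>UNIV-{j}. det (row_upd (row_upd ?M j ?a) i (?H (?e i) (?e j)))) = 0"
    by (rule sum_det_row_upd_symmetric[of "\<lambda>j i. ?H (?e i) (?e j)"]) (rule sym)
  have 4: "(\<Sum>j\<in>UNIV. ?\<theta> (?M $ j) * det (row_upd ?M j ?a)) = ?\<theta> ?a * det ?M" by (rule cramer_functional)
  have "(\<Sum>j\<in>UNIV. Fd (flux j) z (?e j)) =
    \<psi> z * (\<Sum>j\<in>UNIV. \<Sum>i\<in>UNIV-{j}. det (row_upd (row_upd ?M j ?a) i (?H (?e i) (?e j))))
    + \<psi> z * (\<Sum>j\<in>UNIV. det (row_upd ?M j (?H ?t (?e j)))) + \<psi> z * (\<Sum>j\<in>UNIV. ?\<theta> (?M $ j) * det (row_upd ?M j ?a))"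
    by (simp only: 2 sum.distrib mult.assoc sum_distrib_left[symmetric])
  also have "\<dots> = Fd dens z ?t" unfolding 1 3 4 sym[of ?t] by (simp add: mult.assoc)
  finally show ?thesis ..
qed

end

lemma integral_compact_support:
  fixes f :: "'a::euclidean_space \<Rightarrow> complex"
  assumes "continuous_on UNIV f" "\<And>y. y \<notin> cbox l h \<Longrightarrow> f y = 0"
  shows "integrable lborel f" "integral\<^sup>L lborel f = integral (cbox l h) f"
proof -
  have f: "(\<lambda>y. indicator (cbox l h) y *\<^sub>R f y) = f" using assms(2) by (auto simp: indicator_def)
  have si: "set_integrable lborel (cbox l h) f" unfolding set_integrable_def
    by (rule borel_integrable_compact[OF compact_cbox continuous_on_subset[OF assms(1) subset_UNIV]])
  then show "integrable lborel f" unfolding set_integrable_def f .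
  show "integral\<^sup>L lborel f = integral (cbox l h) f"
    using set_borel_integral_eq_integral(2)[OF si] unfolding set_lebesgue_integral_def f .
qed

lemma compact_subset_cbox:
  fixes K :: "'a::euclidean_space set"
  assumes "compact K"
  obtains l h where "K \<subseteq> cbox l h" using bounded_subset_cbox_symmetric[OF compact_imp_bounded[OF assms]] by blast

text \<open>By translation invariance the integral of \<open>u (y + s *\<^sub>R e)\<close> does not
  depend on \<open>s\<close>; its derivative at \<open>s = 0\<close> is taken under the integral
  sign.\<close>

lemma integral_directional_derivative_eq_0:
  fixes u :: "'a::euclidean_space \<Rightarrow> complex"
  assumes u: "\<And>y. (u has_derivative u' y) (at y)" and c: "continuous_on UNIV (\<lambda>y. u' y e)"
    and K: "compact K" "\<And>y. y \<notin> K \<Longrightarrow> u y = 0"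
  shows "integrable lborel (\<lambda>y. u' y e)" "integral\<^sup>L lborel (\<lambda>y. u' y e) = 0"
proof -
  have cu: "continuous_on UNIV u" using has_derivative_continuous[OF u] by (intro continuous_at_imp_continuous_on ballI)
  \<comment> \<open>A box around all translates of \<open>K\<close> by up to one unit of
    \<open>e\<close>, so that one domain of integration serves every \<open>s\<close>.\<close>
  have "compact ((\<lambda>p. fst p - snd p *\<^sub>R e) ` (K \<times> {-1..1::real}))"
    by (intro compact_continuous_image compact_Times K compact_Icc continuous_intros)
  then obtain l h where B: "(\<lambda>p. fst p - snd p *\<^sub>R e) ` (K \<times> {-1..1::real}) \<subseteq> cbox l h"
    using compact_subset_cbox by blast
  have supp: "u (y + s *\<^sub>R e) = 0" if "y \<notin> cbox l h" "s \<in> {-1..1}" for y s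
  proof (rule K(2), rule notI)
    assume "y + s *\<^sub>R e \<in> K"
    then have "(\<lambda>p. fst p - snd p *\<^sub>R e) (y + s *\<^sub>R e, s) \<in> cbox l h" using B that(2) by blast
    then show False using that(1) by simp
  qed
  have Kl: "K \<subseteq> cbox l h" using supp B by force
  have supp': "u' y e = 0" if "y \<notin> cbox l h" for y
  proof -
    have o: "open (- K)" "y \<in> - K" using compact_imp_closed[OF K(1)] that Kl by auto
    have "(u has_derivative (\<lambda>v. 0)) (at y)"
      by (rule has_derivative_transform_within_open[OF has_derivative_const[of 0] o]) (use K(2) in auto)
    from has_derivative_unique[OF u this] show ?thesis by (rule fun_cong)
  qed
  show "integrable lborel (\<lambda>y. u' y e)" by (rule integral_compact_support(1)[OF c supp'])
  have trans: "integral (cbox l h) (\<lambda>y. u (y + s *\<^sub>R e)) = integral\<^sup>L lborel u" if s: "s \<in> {-1..1}" for s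
  proof -
    have "continuous_on UNIV (\<lambda>y. u (y + s *\<^sub>R e))" by (rule continuous_on_compose2[OF cu]) (auto intro!: continuous_intros)
    then have "integral (cbox l h) (\<lambda>y. u (y + s *\<^sub>R e)) = integral\<^sup>L lborel (\<lambda>y. u (s *\<^sub>R e + y))"
      using integral_compact_support(2)[of "\<lambda>y. u (y + s *\<^sub>R e)" l h] supp s by (simp add: add.commute)
    also have "\<dots> = integral\<^sup>L (distr lborel borel ((+) (s *\<^sub>R e))) u"
      using borel_measurable_continuous_onI[OF cu] by (intro integral_distr[symmetric]) auto
    also have "\<dots> = integral\<^sup>L lborel u" by (simp only: lborel_distr_plus)
    finally show ?thesis .
  qed
  have "((\<lambda>s. integral (cbox l h) (\<lambda>y. u (y + s *\<^sub>R e))) has_vector_derivative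
    integral (cbox l h) (\<lambda>y. u' (y + 0 *\<^sub>R e) e)) (at 0 within {-1<..<1})"
  proof (rule leibniz_rule_vector_derivative)
    show "((\<lambda>s. u (y + s *\<^sub>R e)) has_vector_derivative u' (y + s *\<^sub>R e) e) (at s within {-1<..<1})" for s y
      by (rule has_vector_derivative_at_within[OF has_derivative_line[OF u]])
    show "(\<lambda>y. u (y + s *\<^sub>R e)) integrable_on cbox l h" for s
      by (intro integrable_continuous continuous_on_compose2[OF cu] continuous_intros) auto
    show "continuous_on ({-1<..<1} \<times> cbox l h) (\<lambda>(s, y). u' (y + s *\<^sub>R e) e)"
      unfolding split_beta by (intro continuous_on_compose2[OF c] continuous_intros) auto
  qed auto
  then have "((\<lambda>s. integral\<^sup>L lborel u) has_vector_derivative integral (cbox l h) (\<lambda>y. u' (y + 0 *\<^sub>R e) e)) (at 0 within {-1<..<1})"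
    by (rule has_vector_derivative_transform[rotated 2]) (use trans in auto)
  then have "((\<lambda>s. integral\<^sup>L lborel u) has_vector_derivative integral (cbox l h) (\<lambda>y. u' y e)) (at (0::real))"
    using at_within_open[of 0 "{-1<..<1::real}"] by simp
  from vector_derivative_unique_at[OF this has_vector_derivative_const]
  have "integral (cbox l h) (\<lambda>y. u' y e) = 0" .
  then show "integral\<^sup>L lborel (\<lambda>y. u' y e) = 0" using integral_compact_support(2)[OF c supp'] by simp
qed

text \<open>\<open>U \<times> W\<close> and \<open>U \<times> (- K)\<close> are relatively open,
  cover the whole space, and carry continuous functions that agree where they overlap.\<close>

lemma continuous_on_extend_zero:
  fixes h :: "'a::topological_space \<times> 'b::t2_space \<Rightarrow> 'c::{t2_space,zero}"
  assumes "open W" "compact K" "K \<subseteq> W" "continuous_on (U \<times> W) h"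
    and "\<And>t y. t \<in> U \<Longrightarrow> y \<in> W - K \<Longrightarrow> h (t, y) = 0"
  shows "continuous_on (U \<times> UNIV) (\<lambda>(t, y). if y \<in> W then h (t, y) else 0)"
proof -
  let ?f = "\<lambda>(t, y). if y \<in> W then h (t, y) else 0"
  have "continuous_on (U \<times> W \<union> U \<times> (- K)) ?f"
  proof (rule continuous_on_Un_local_open)
    have eq: "U \<times> W \<union> U \<times> (- K) = U \<times> UNIV" using assms(3) by blast
    have "U \<times> W = U \<times> UNIV \<inter> UNIV \<times> W" "U \<times> (- K) = U \<times> UNIV \<inter> UNIV \<times> (- K)" by auto
    then show "openin (top_of_set (U \<times> W \<union> U \<times> (- K))) (U \<times> W)"
      "openin (top_of_set (U \<times> W \<union> U \<times> (- K))) (U \<times> (- K))"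
      unfolding eq using openin_open_Int[OF open_Times[OF open_UNIV assms(1)], of "U \<times> UNIV"]
        openin_open_Int[OF open_Times[OF open_UNIV open_Compl[OF compact_imp_closed[OF assms(2)]]], of "U \<times> UNIV"] by simp_all
    show "continuous_on (U \<times> W) ?f" by (rule continuous_on_eq[OF assms(4)]) auto
    have "continuous_on (U \<times> (- K)) (\<lambda>_. 0)" by (rule continuous_on_const)
    then show "continuous_on (U \<times> (- K)) ?f" by (rule continuous_on_eq) (use assms(5) in auto)
  qed
  moreover have "U \<times> W \<union> U \<times> (- K) = U \<times> UNIV" using assms(3) by blast
  ultimately show ?thesis by simp
qed

lemma continuous_on_extend_zero1:
  fixes h :: "'b::t2_space \<Rightarrow> 'c::{t2_space,zero}"
  assumes "open W" "compact K" "K \<subseteq> W" "continuous_on W h" "\<And>y. y \<in> W - K \<Longrightarrow> h y = 0"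
  shows "continuous_on UNIV (\<lambda>y. if y \<in> W then h y else 0)"
proof -
  have "continuous_on (UNIV \<times> UNIV) (\<lambda>(t::real, y). if y \<in> W then h (snd (t, y)) else 0)"
    using assms by (intro continuous_on_extend_zero[where K=K]) (auto intro!: continuous_on_compose2[OF assms(4)] continuous_intros)
  from continuous_on_compose2[OF this, of UNIV "\<lambda>y. (0, y)"]
  show ?thesis by (simp add: continuous_on_Pair cong: if_cong)
qed

text \<open>The root is only assumed continuous; its derivative is forced by the power relation
  through \<open>has_derivative_implicit\<close>.\<close>

lemma has_derivative_root:
  fixes q \<psi> :: "'a::real_normed_vector \<Rightarrow> complex"
  assumes "open N" "z \<in> N" "isCont \<psi> z" "k > 0" "\<And>y. y \<in> N \<Longrightarrow> \<psi> y ^ k = q y"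
    and q: "(q has_derivative q') (at z)" "q z \<noteq> 0"
  shows "(\<psi> has_derivative (\<lambda>v. \<psi> z * (q' v / (of_nat k * q z)))) (at z)"
proof (rule has_derivative_implicit[OF _ _ assms(3,1,2)])
  \<comment> \<open>The reciprocal of the derivative of \<open>w ^ k\<close> at
    \<open>\<psi> z\<close>; it normalises that derivative to 1.\<close>
  let ?m = "\<psi> z / (of_nat k * q z)"
  have p: "\<psi> z ^ k = q z" by (rule assms(5)[OF assms(2)])
  have "\<psi> z ^ k \<noteq> 0" unfolding p by (rule q(2))
  then have "\<psi> z \<noteq> 0" using assms(4) by simp
  have k: "of_nat k \<noteq> (0::complex)" using assms(4) by simp
  have pk: "\<psi> z * \<psi> z ^ (k - 1) = q z" using p assms(4) by (metis power_eq_if not_gr_zero)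
  have "((\<lambda>w. w ^ k) has_field_derivative of_nat k * \<psi> z ^ (k - 1)) (at (\<psi> z))"
    using DERIV_power[OF DERIV_ident, of k "\<psi> z" UNIV] by simp
  then have "((\<lambda>w. w ^ k * ?m) has_field_derivative of_nat k * \<psi> z ^ (k - 1) * ?m) (at (\<psi> z))" by (rule DERIV_cmult_right)
  moreover have "of_nat k * \<psi> z ^ (k - 1) * ?m = 1" using pk k q(2) by (simp add: field_simps)
  ultimately have "((\<lambda>w. w ^ k * ?m) has_field_derivative 1) (at (\<psi> z))" by (simp only:)
  then show "((\<lambda>w. w ^ k * ?m) has_derivative (\<lambda>v. v)) (at (\<psi> z))"
    by (simp only: has_field_derivative_def lambda_one[symmetric])
  have "((\<lambda>y. q y * ?m) has_derivative (\<lambda>v. q' v * ?m)) (at z)" by (rule has_derivative_mult_left[OF q(1)])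
  then show "((\<lambda>y. q y * ?m) has_derivative (\<lambda>v. \<psi> z * (q' v / (of_nat k * q z)))) (at z)" by (simp add: mult.commute)
  show "\<psi> y ^ k * ?m = q y * ?m" if "y \<in> N" for y by (simp only: assms(5)[OF that])
qed

subsection \<open>Transport of roots along a path\<close>

text \<open>The factor by which a continuous \<open>k\<close>-th root of \<gamma> changes from
  \<open>a\<close> to \<open>b\<close>. Every continuous logarithm \<open>g\<close> yields the same
  value.\<close>

definition root_tr :: "nat \<Rightarrow> (real \<Rightarrow> complex) \<Rightarrow> real \<Rightarrow> real \<Rightarrow> complex" where
  "root_tr k \<gamma> a b = (let g = SOME g. continuous_on (closed_segment a b) g \<and> (\<forall>t\<in>closed_segment a b. \<gamma> t = exp (g t))
    in exp ((g b - g a) / of_nat k))"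

text \<open>Two continuous logarithms differ by integer multiples of 2 pi i, and a continuous
  function with such a discrete range is constant on a connected set.\<close>

lemma exp_eq_imp_diff_const:
  fixes g g' :: "real \<Rightarrow> complex"
  assumes "connected S" "continuous_on S g" "continuous_on S g'" "\<And>t. t \<in> S \<Longrightarrow> exp (g t) = exp (g' t)"
    and "a \<in> S" "b \<in> S"
  shows "g b - g a = g' b - g' a"
proof -
  have "(\<lambda>t. g t - g' t) constant_on S"
  proof (rule continuous_discrete_range_constant[OF assms(1)])
    show "continuous_on S (\<lambda>t. g t - g' t)" by (intro continuous_intros assms)
    fix t assume t: "t \<in> S"
    have mul: "\<exists>n::int. g u - g' u = of_int (2 * n) * (of_real pi * \<i>)" if uS: "u \<in> S" for u
    proof -
      obtain n :: int where "g u = g' u + of_real (real_of_int (2 * n) * pi) * \<i>" using assms(4)[OF uS] unfolding exp_eq by blast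
      then show ?thesis by (intro exI[of _ n]) (simp add: mult.assoc)
    qed
    show "\<exists>e>0. \<forall>u. u \<in> S \<and> g u - g' u \<noteq> g t - g' t \<longrightarrow> e \<le> norm (g u - g' u - (g t - g' t))"
    proof (intro exI[of _ "2 * pi"] conjI allI impI)
      fix u assume u: "u \<in> S \<and> g u - g' u \<noteq> g t - g' t"
      obtain m n :: int where mn: "g u - g' u = of_int (2 * m) * (of_real pi * \<i>)" "g t - g' t = of_int (2 * n) * (of_real pi * \<i>)"
        using mul u t by metis
      then have "m \<noteq> n" using u by auto
      then have "1 \<le> \<bar>m - n\<bar>" by linarith
      then have "1 \<le> \<bar>real_of_int (m - n)\<bar>" by linarith
      moreover have "g u - g' u - (g t - g' t) = of_real (2 * real_of_int (m - n) * pi) * \<i>" unfolding mn by (simp add: algebra_simps)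
      then have "norm (g u - g' u - (g t - g' t)) = 2 * \<bar>real_of_int (m - n)\<bar> * pi"
        by (simp only: norm_mult norm_of_real norm_ii abs_mult mult_1_right) simp
      ultimately show "2 * pi \<le> norm (g u - g' u - (g t - g' t))" by simp
    qed simp
  qed
  then have "g a - g' a = g b - g' b" using assms(5,6) unfolding constant_on_def by metis
  then show ?thesis by (simp add: algebra_simps)
qed

lemma root_tr_eq:
  assumes "continuous_on (closed_segment a b) g" "\<And>t. t \<in> closed_segment a b \<Longrightarrow> \<gamma> t = exp (g t)"
  shows "root_tr k \<gamma> a b = exp ((g b - g a) / of_nat k)"
proof -
  define g' where "g' = (SOME g. continuous_on (closed_segment a b) g \<and> (\<forall>t\<in>closed_segment a b. \<gamma> t = exp (g t)))"
  have "continuous_on (closed_segment a b) g' \<and> (\<forall>t\<in>closed_segment a b. \<gamma> t = exp (g' t))"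
    unfolding g'_def by (rule someI[of _ g]) (use assms in blast)
  then have "g' b - g' a = g b - g a" using assms by (intro exp_eq_imp_diff_const[of "closed_segment a b"]) auto
  then show ?thesis unfolding root_tr_def g'_def[symmetric] by (simp add: Let_def)
qed

lemma continuous_logarithm_convex:
  fixes S :: "'a::euclidean_space set" and f :: "'a \<Rightarrow> complex"
  assumes "convex S" "continuous_on S f" "\<And>t. t \<in> S \<Longrightarrow> f t \<noteq> 0"
  obtains g where "continuous_on S g" "\<And>t. t \<in> S \<Longrightarrow> f t = exp (g t)"
proof -
  have "contractible S" by (rule convex_imp_contractible[OF assms(1)])
  then show thesis using continuous_logarithm_on_contractible[of S f] assms(2,3) that by metis
qed

lemma log_exists:
  fixes \<gamma> :: "real \<Rightarrow> complex"
  assumes "continuous_on (closed_segment a b) \<gamma>" "\<And>t. t \<in> closed_segment a b \<Longrightarrow> \<gamma> t \<noteq> 0"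
  obtains g where "continuous_on (closed_segment a b) g" "\<And>t. t \<in> closed_segment a b \<Longrightarrow> \<gamma> t = exp (g t)"
  using continuous_logarithm_convex[OF convex_closed_segment assms] by blast

lemma root_tr_power:
  assumes "continuous_on (closed_segment a b) \<gamma>" "\<And>t. t \<in> closed_segment a b \<Longrightarrow> \<gamma> t \<noteq> 0" "k > 0"
  shows "root_tr k \<gamma> a b ^ k = \<gamma> b / \<gamma> a"
proof -
  obtain g where g: "continuous_on (closed_segment a b) g" "\<And>t. t \<in> closed_segment a b \<Longrightarrow> \<gamma> t = exp (g t)"
    using log_exists[OF assms(1,2)] by blast
  have "root_tr k \<gamma> a b ^ k = exp (of_nat k * ((g b - g a) / of_nat k))" by (simp only: root_tr_eq[OF g] exp_of_nat_mult)
  also have "\<dots> = exp (g b - g a)" using assms(3) by simp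
  finally show ?thesis using g(2)[of a] g(2)[of b] by (simp add: exp_diff)
qed

text \<open>A change of chart multiplies the section by the \<open>k\<close>-th power of a Jacobian
  \<open>j\<close>. Since \<open>k\<close> times a logarithm of \<open>j\<close> is a logarithm of
  \<open>j ^ k\<close>, the transported root changes by \<open>j\<close> itself.\<close>

lemma root_tr_mult_power:
  assumes "continuous_on (closed_segment a b) \<gamma>" "\<And>t. t \<in> closed_segment a b \<Longrightarrow> \<gamma> t \<noteq> 0" "k > 0"
    and "continuous_on (closed_segment a b) j" "\<And>t. t \<in> closed_segment a b \<Longrightarrow> j t \<noteq> 0"
    and "\<And>t. t \<in> closed_segment a b \<Longrightarrow> \<gamma>' t = \<gamma> t * j t ^ k"
  shows "root_tr k \<gamma>' a b = root_tr k \<gamma> a b * (j b / j a)"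
proof -
  obtain g where g: "continuous_on (closed_segment a b) g" "\<And>t. t \<in> closed_segment a b \<Longrightarrow> \<gamma> t = exp (g t)"
    using log_exists[OF assms(1,2)] by blast
  obtain h where h: "continuous_on (closed_segment a b) h" "\<And>t. t \<in> closed_segment a b \<Longrightarrow> j t = exp (h t)"
    using log_exists[OF assms(4,5)] by blast
  have "root_tr k \<gamma>' a b = exp ((g b + of_nat k * h b - (g a + of_nat k * h a)) / of_nat k)"
    by (rule root_tr_eq) (use g h assms(6) in \<open>auto intro!: continuous_intros simp: exp_add exp_of_nat_mult\<close>)
  also have "(g b + of_nat k * h b - (g a + of_nat k * h a)) / of_nat k = (g b - g a) / of_nat k + (h b - h a)"
    using assms(3) by (simp add: field_simps)
  finally show ?thesis using h(2)[of a] h(2)[of b] by (simp add: root_tr_eq[OF g] exp_add exp_diff)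
qed

lemma root_tr_same:
  assumes "\<gamma> a \<noteq> 0"
  shows "root_tr k \<gamma> a a = 1"
proof -
  have "root_tr k \<gamma> a a = exp ((Ln (\<gamma> a) - Ln (\<gamma> a)) / of_nat k)"
  proof (rule root_tr_eq[where g="\<lambda>_. Ln (\<gamma> a)"])
    fix t assume "t \<in> closed_segment a a"
    then have "t = a" by simp
    then show "\<gamma> t = exp (Ln (\<gamma> a))" by (simp only: exp_Ln[OF assms])
  qed (rule continuous_on_const)
  then show ?thesis by (simp only: diff_self div_0 exp_zero)
qed

lemma continuous_on_locally_open:
  fixes f :: "'a::t2_space \<Rightarrow> 'b::topological_space"
  assumes "\<And>z. z \<in> S \<Longrightarrow> \<exists>T. open T \<and> z \<in> T \<and> continuous_on (S \<inter> T) f"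
  shows "continuous_on S f" unfolding continuous_on_eq_continuous_within
proof
  fix z assume z: "z \<in> S"
  then obtain T where T: "open T" "z \<in> T" "continuous_on (S \<inter> T) f" using assms by blast
  have "at z within S = at z within (S \<inter> T)" by (rule at_within_nhd[OF T(2,1)]) blast
  then show "continuous (at z within S) f" using T(3) z T(2) by (simp add: continuous_on_eq_continuous_within)
qed

text \<open>A ball times an interval is convex, so one logarithm exists on it and serves all the
  paths with \<open>y\<close> in the ball simultaneously.\<close>

lemma continuous_on_root_tr:
  fixes \<gamma> :: "'a::euclidean_space \<times> real \<Rightarrow> complex"
  assumes "open Y" "convex I" "a \<in> I" "continuous_on (Y \<times> I) \<gamma>" "\<And>z. z \<in> Y \<times> I \<Longrightarrow> \<gamma> z \<noteq> 0"
  shows "continuous_on (Y \<times> I) (\<lambda>(y, t). root_tr k (\<lambda>t. \<gamma> (y, t)) a t)"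
proof -
  let ?R = "\<lambda>(y, t). root_tr k (\<lambda>t. \<gamma> (y, t)) a t"
  have "\<exists>T. open T \<and> z \<in> T \<and> continuous_on (Y \<times> I \<inter> T) ?R" if z: "z \<in> Y \<times> I" for z
  proof -
    obtain y0 t0 where yt: "z = (y0, t0)" "y0 \<in> Y" "t0 \<in> I" using z by blast
    obtain e where e: "e > 0" "ball y0 e \<subseteq> Y" using assms(1) yt(2) by (meson openE)
    have sub: "ball y0 e \<times> I \<subseteq> Y \<times> I" using e(2) by blast
    obtain l where l: "continuous_on (ball y0 e \<times> I) l" "\<And>z. z \<in> ball y0 e \<times> I \<Longrightarrow> \<gamma> z = exp (l z)"
      using continuous_logarithm_convex[OF convex_Times[OF convex_ball assms(2)] continuous_on_subset[OF assms(4) sub]]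
        assms(5) sub by blast
    have R: "exp ((l (y, t) - l (y, a)) / of_nat k) = ?R (y, t)" if "y \<in> ball y0 e" "t \<in> I" for y t
    proof -
      have seg: "closed_segment a t \<subseteq> I" using closed_segment_subset[OF assms(3) that(2) assms(2)] .
      have "root_tr k (\<lambda>t. \<gamma> (y, t)) a t = exp ((l (y, t) - l (y, a)) / of_nat k)"
      proof (rule root_tr_eq)
        show "continuous_on (closed_segment a t) (\<lambda>t. l (y, t))"
          by (rule continuous_on_compose2[OF l(1)]) (use seg that(1) in \<open>auto intro!: continuous_intros\<close>)
        show "\<gamma> (y, u) = exp (l (y, u))" if "u \<in> closed_segment a t" for u
          by (rule l(2)) (use seg \<open>y \<in> ball y0 e\<close> that in blast)
      qed
      then show ?thesis by simp
    qed
    have cont: "continuous_on (ball y0 e \<times> I) (\<lambda>z. exp ((l z - l (fst z, a)) / of_nat k))"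
    proof -
      have "continuous_on (ball y0 e \<times> I) (\<lambda>z. l (fst z, a))"
        by (rule continuous_on_compose2[OF l(1)]) (use assms(3) in \<open>auto intro!: continuous_intros\<close>)
      then show ?thesis using l(1) unfolding divide_inverse by (intro continuous_intros)
    qed
    have "continuous_on (ball y0 e \<times> I) ?R" by (rule continuous_on_eq[OF cont]) (use R in auto)
    moreover have "ball y0 e \<times> I = Y \<times> I \<inter> ball y0 e \<times> UNIV" using e(2) by blast
    ultimately show ?thesis using yt e(1) by (intro exI[of _ "ball y0 e \<times> UNIV"]) (auto intro!: open_Times)
  qed
  then show ?thesis by (rule continuous_on_locally_open)
qed

subsection \<open>Localised densities\<close>

text \<open>The time derivative of \<open>dens\<close> is a divergence; integration by parts against
  the cut-off \<beta>, which vanishes off a compact part of \<open>W\<close>, moves the space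
  derivatives to \<beta>.\<close>

lemma (in pulled_back_form) integral_localised_density:
  fixes \<beta> :: "real^'n \<Rightarrow> real"
  assumes W: "open W" and I: "open I" "convex I" "t0 \<in> I" and sub: "W \<times> I \<subseteq> S"
    and K: "compact K" "K \<subseteq> W" "\<And>y. y \<in> W - K \<Longrightarrow> \<beta> y = 0"
    and \<beta>: "\<And>y. y \<in> W \<Longrightarrow> (\<beta> has_derivative \<beta>' y) (at y)" "\<And>v. continuous_on W (\<lambda>y. \<beta>' y v)"
  shows "((\<lambda>t. integral\<^sup>L lborel (\<lambda>y. if y \<in> W then of_real (\<beta> y) * dens (y, t) else 0)) has_vector_derivative
    - integral\<^sup>L lborel (\<lambda>y. if y \<in> W then \<Sum>j\<in>UNIV. of_real (\<beta>' y (axis j 1)) * flux j (y, t0) else 0)) (at t0)"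
    and "integrable lborel (\<lambda>y. if y \<in> W then \<Sum>j\<in>UNIV. of_real (\<beta>' y (axis j 1)) * flux j (y, t0) else 0)"
proof -
  obtain l h where lh: "K \<subseteq> cbox l h" using compact_subset_cbox[OF K(1)] by blast
  let ?e = "\<lambda>j. (axis j 1, 0) :: (real^'n) \<times> real"
  let ?t = "(0, 1) :: (real^'n) \<times> real"
  let ?f = "\<lambda>t y. if y \<in> W then of_real (\<beta> y) * dens (y, t) else 0"
  let ?f' = "\<lambda>t y. if y \<in> W then of_real (\<beta> y) * Fd dens (y, t) ?t else 0"
  have ddens: "(dens has_derivative Fd dens z) (at z)" if "z \<in> S" for z by (rule Ck_on_has_derivative[OF Ck_dens that])
  have dflux: "(flux j has_derivative Fd (flux j) z) (at z)" if "z \<in> S" for z j by (rule Ck_on_has_derivative[OF Ck_flux that])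
  have c\<beta>: "continuous_on W \<beta>" using has_derivative_continuous[OF \<beta>(1)] by (intro continuous_at_imp_continuous_on ballI)
  have \<beta>K: "\<beta>' y v = 0" if "y \<in> W - K" for y v
  proof -
    have o: "open (W - K)" using W compact_imp_closed[OF K(1)] by (rule open_Diff)
    have "(\<beta> has_derivative (\<lambda>v. 0)) (at y)"
      by (rule has_derivative_transform_within_open[OF has_derivative_const[of 0] o that]) (simp add: K(3))
    from has_derivative_unique[OF \<beta>(1) this] that show ?thesis by (simp add: fun_eq_iff)
  qed
  have swap: "(\<lambda>p. (snd p, fst p)) ` (I \<times> W) \<subseteq> S" using sub by auto
  have csw: "continuous_on (I \<times> W) (\<lambda>p. g (snd p, fst p))" if "continuous_on S g" for g :: "_ \<Rightarrow> complex"
    by (rule continuous_on_compose2[OF that _ swap]) (intro continuous_intros)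
  have c\<beta>2: "continuous_on (I \<times> W) (\<lambda>p. complex_of_real (\<beta> (snd p)))"
    by (intro continuous_on_of_real continuous_on_compose2[OF c\<beta>] continuous_intros) auto
  have cf: "continuous_on (I \<times> UNIV) (\<lambda>(t, y). ?f t y)"
  proof -
    have "continuous_on (I \<times> UNIV) (\<lambda>(t, y). if y \<in> W then (\<lambda>p. of_real (\<beta> (snd p)) * dens (snd p, fst p)) (t, y) else 0)"
      by (rule continuous_on_extend_zero[OF W K(1,2)])
        (intro continuous_on_mult c\<beta>2 csw Ck_on_1_continuous(2)[OF Ck_dens], simp only: snd_conv K(3) of_real_0 mult_zero_left)
    then show ?thesis by (simp only: fst_conv snd_conv)
  qed
  have cf': "continuous_on (I \<times> UNIV) (\<lambda>(t, y). ?f' t y)"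
  proof -
    have "continuous_on (I \<times> UNIV) (\<lambda>(t, y). if y \<in> W then (\<lambda>p. of_real (\<beta> (snd p)) * Fd dens (snd p, fst p) ?t) (t, y) else 0)"
      by (rule continuous_on_extend_zero[OF W K(1,2)])
        (intro continuous_on_mult c\<beta>2 csw[of "\<lambda>z. Fd dens z ?t"] Ck_on_1_continuous(1)[OF Ck_dens], simp only: snd_conv K(3) of_real_0 mult_zero_left)
    then show ?thesis by (simp only: fst_conv snd_conv)
  qed
  have slice: "continuous_on UNIV (\<lambda>y. g t y)" if "t \<in> I" "continuous_on (I \<times> UNIV) (\<lambda>(t, y). g t y)"
    for g :: "real \<Rightarrow> real^'n \<Rightarrow> complex" and t
  proof -
    have p: "continuous_on UNIV (\<lambda>y. (t, y))" by (rule continuous_on_Pair[OF continuous_on_const continuous_on_id])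
    have "continuous_on UNIV (\<lambda>y. (\<lambda>(t, y). g t y) (t, y))"
      by (rule continuous_on_compose2[OF that(2) p]) (use that(1) in auto)
    then show ?thesis by (simp only: split_conv)
  qed
  have f0: "?f t y = 0" "?f' t y = 0" if "y \<notin> cbox l h" for t y using that lh K(3) by auto
  have "((\<lambda>t. integral (cbox l h) (?f t)) has_vector_derivative integral (cbox l h) (?f' t0)) (at t0 within I)"
  proof (rule leibniz_rule_vector_derivative[OF _ _ _ I(3,2)])
    fix t y assume t: "t \<in> I"
    show "((\<lambda>t. ?f t y) has_vector_derivative ?f' t y) (at t within I)"
    proof (cases "y \<in> W")
      case True
      then have "(dens has_derivative Fd dens (y, t)) (at ((y, 0) + t *\<^sub>R ?t))" using ddens[of "(y, t)"] sub t by auto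
      from has_vector_derivative_at_within[OF has_derivative_line[OF this], of I]
      have "((\<lambda>t. dens (y, t)) has_vector_derivative Fd dens (y, t) ?t) (at t within I)" by simp
      then have "((\<lambda>t. of_real (\<beta> y) * dens (y, t)) has_vector_derivative of_real (\<beta> y) * Fd dens (y, t) ?t) (at t within I)"
        by (rule has_vector_derivative_mult_right)
      then show ?thesis using True by simp
    qed simp
    show "?f t integrable_on cbox l h" by (intro integrable_continuous continuous_on_subset[OF slice[OF t cf] subset_UNIV])
  next
    show "continuous_on (I \<times> cbox l h) (\<lambda>(t, y). ?f' t y)" by (rule continuous_on_subset[OF cf']) blast
  qed
  moreover have "at t0 within I = at t0" by (rule at_within_open[OF I(3,1)])
  ultimately have 1: "((\<lambda>t. integral (cbox l h) (?f t)) has_vector_derivative integral (cbox l h) (?f' t0)) (at t0)" by simp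
  have 2: "integral (cbox l h) (?f t) = integral\<^sup>L lborel (?f t)" if "t \<in> I" for t
    by (rule integral_compact_support(2)[OF slice[OF that cf] f0(1), symmetric])
  have 3: "integral (cbox l h) (?f' t0) = integral\<^sup>L lborel (?f' t0)"
    by (rule integral_compact_support(2)[OF slice[OF I(3) cf'] f0(2), symmetric])
  have der: "((\<lambda>t. integral\<^sup>L lborel (?f t)) has_vector_derivative integral\<^sup>L lborel (?f' t0)) (at t0)"
    using has_vector_derivative_transform_within_open[OF 1 I(1,3) 2] by (simp only: 3)
  \<comment> \<open>The cut-off times a flux component, extended by zero to a compactly supported
    function to which \<open>integral_directional_derivative_eq_0\<close> applies.\<close>
  let ?u = "\<lambda>j y. if y \<in> W then of_real (\<beta> y) * flux j (y, t0) else 0"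
  let ?u' = "\<lambda>j y v. if y \<in> W then of_real (\<beta> y) * Fd (flux j) (y, t0) (v, 0) + of_real (\<beta>' y v) * flux j (y, t0) else 0"
  have du: "(?u j has_derivative ?u' j y) (at y)" for j y
  proof (cases "y \<in> W")
    case True
    then have yS: "(y, t0) \<in> S" using sub I(3) by blast
    have "((\<lambda>y. (y, t0)) has_derivative (\<lambda>v. (v, 0))) (at y)"
      by (intro has_derivative_Pair has_derivative_ident has_derivative_const)
    from diff_chain_at[OF this dflux[OF yS]]
    have a: "((\<lambda>y. flux j (y, t0)) has_derivative (\<lambda>v. Fd (flux j) (y, t0) (v, 0))) (at y)" by (simp add: o_def)
    have b: "((\<lambda>y. complex_of_real (\<beta> y)) has_derivative (\<lambda>v. of_real (\<beta>' y v))) (at y)"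
      by (rule bounded_linear.has_derivative[OF bounded_linear_of_real \<beta>(1)[OF True]])
    have "(?u j has_derivative (\<lambda>v. of_real (\<beta> y) * Fd (flux j) (y, t0) (v, 0) + of_real (\<beta>' y v) * flux j (y, t0))) (at y)"
      by (rule has_derivative_transform_within_open[OF has_derivative_mult[OF b a] W True]) simp
    then show ?thesis using True by simp
  next
    case False
    then have o: "open (- K)" "y \<in> - K" using compact_imp_closed[OF K(1)] K(2) by auto
    have "(?u j has_derivative (\<lambda>v. 0)) (at y)"
      by (rule has_derivative_transform_within_open[OF has_derivative_const[of 0] o]) (use K(3) in auto)
    then show ?thesis using False by simp
  qed
  have emb: "(\<lambda>y. (y, t0)) ` W \<subseteq> S" using sub I(3) by auto
  have cS: "continuous_on W (\<lambda>y. g (y, t0))" if "continuous_on S g" for g :: "_ \<Rightarrow> complex"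
    by (rule continuous_on_compose2[OF that _ emb]) (intro continuous_intros)
  have c1: "continuous_on W (\<lambda>y. of_real (\<beta>' y v) * flux j (y, t0))" for j v
    by (intro continuous_on_mult continuous_on_of_real \<beta>(2) cS Ck_on_1_continuous(2)[OF Ck_flux])
  have c2: "continuous_on W (\<lambda>y. of_real (\<beta> y) * Fd (flux j) (y, t0) (v, 0))" for j v
    by (intro continuous_on_mult continuous_on_of_real c\<beta> cS[of "\<lambda>z. Fd (flux j) z (v, 0)"]
      Ck_on_1_continuous(1)[OF Ck_flux])
  have cu': "continuous_on UNIV (\<lambda>y. ?u' j y v)" for j v
    by (rule continuous_on_extend_zero1[OF W K(1,2) continuous_on_add[OF c2 c1]]) (simp add: K(3) \<beta>K)
  note u0 = integral_directional_derivative_eq_0[OF du cu' K(1)]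
  have uK: "?u j y = 0" if "y \<notin> K" for j y using K(3) that by simp
  let ?w = "\<lambda>j y. if y \<in> W then of_real (\<beta>' y (axis j 1)) * flux j (y, t0) else 0"
  have cw: "continuous_on UNIV (?w j)" for j by (rule continuous_on_extend_zero1[OF W K(1,2) c1]) (simp add: \<beta>K)
  have iw: "integrable lborel (?w j)" for j by (rule integral_compact_support(1)[OF cw, of l h]) (use lh \<beta>K in auto)
  have sw: "(\<lambda>y. if y \<in> W then \<Sum>j\<in>UNIV. of_real (\<beta>' y (axis j 1)) * flux j (y, t0) else 0) = (\<lambda>y. \<Sum>j\<in>UNIV. ?w j y)"
    by (rule ext) simp
  show "integrable lborel (\<lambda>y. if y \<in> W then \<Sum>j\<in>UNIV. of_real (\<beta>' y (axis j 1)) * flux j (y, t0) else 0)"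
    unfolding sw by (rule Bochner_Integration.integrable_sum[OF iw])
  have iu': "integrable lborel (\<lambda>y. ?u' j y (axis j 1))" "integral\<^sup>L lborel (\<lambda>y. ?u' j y (axis j 1)) = 0" for j
    using u0[of j "axis j 1"] uK by blast+
  have "?f' t0 y = (\<Sum>j\<in>UNIV. ?u' j y (axis j 1) - ?w j y)" for y
  proof (cases "y \<in> W")
    case True
    then have "(y, t0) \<in> S" using sub I(3) by blast
    from divergence[OF this] True show ?thesis by (simp add: sum_distrib_left)
  qed simp
  then have "integral\<^sup>L lborel (?f' t0) = integral\<^sup>L lborel (\<lambda>y. \<Sum>j\<in>UNIV. ?u' j y (axis j 1) - ?w j y)"
    by (simp only:)
  also have "\<dots> = (\<Sum>j\<in>UNIV. integral\<^sup>L lborel (\<lambda>y. ?u' j y (axis j 1) - ?w j y))"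
    by (rule Bochner_Integration.integral_sum) (intro Bochner_Integration.integrable_diff iu'(1) iw)
  also have "\<dots> = (\<Sum>j\<in>UNIV. - integral\<^sup>L lborel (?w j))"
  proof (rule sum.cong[OF refl])
    fix j
    have "integral\<^sup>L lborel (\<lambda>y. ?u' j y (axis j 1) - ?w j y) = integral\<^sup>L lborel (\<lambda>y. ?u' j y (axis j 1)) - integral\<^sup>L lborel (?w j)"
      by (rule Bochner_Integration.integral_diff[OF iu'(1) iw])
    then show "integral\<^sup>L lborel (\<lambda>y. ?u' j y (axis j 1) - ?w j y) = - integral\<^sup>L lborel (?w j)" unfolding iu'(2) by simp
  qed
  also have "\<dots> = - integral\<^sup>L lborel (\<lambda>y. \<Sum>j\<in>UNIV. ?w j y)"
    by (subst Bochner_Integration.integral_sum[OF iw]) (simp add: sum_negf)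
  finally have "integral\<^sup>L lborel (?f' t0) = - integral\<^sup>L lborel (\<lambda>y. \<Sum>j\<in>UNIV. ?w j y)" .
  then show "((\<lambda>t. integral\<^sup>L lborel (?f t)) has_vector_derivative
    - integral\<^sup>L lborel (\<lambda>y. if y \<in> W then \<Sum>j\<in>UNIV. of_real (\<beta>' y (axis j 1)) * flux j (y, t0) else 0)) (at t0)"
    using der unfolding sw by (simp only:)
qed

text \<open>Here \<rho> is merely continuous and \<open>I\<close> arbitrary, so that end points of
  the time interval are included, where no time derivative is at hand.\<close>

lemma continuous_on_integral_localised:
  fixes \<rho> :: "(real^'n::finite) \<times> real \<Rightarrow> complex" and \<beta> :: "real^'n \<Rightarrow> real"
  assumes W: "open W" and K: "compact K" "K \<subseteq> W" "\<And>y. y \<in> W - K \<Longrightarrow> \<beta> y = 0"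
    and \<beta>: "continuous_on W \<beta>" and \<rho>: "continuous_on (W \<times> I) \<rho>"
  shows "continuous_on I (\<lambda>t. integral\<^sup>L lborel (\<lambda>y. if y \<in> W then of_real (\<beta> y) * \<rho> (y, t) else 0))"
    and "t \<in> I \<Longrightarrow> integrable lborel (\<lambda>y. if y \<in> W then of_real (\<beta> y) * \<rho> (y, t) else 0)"
proof -
  obtain l h where lh: "K \<subseteq> cbox l h" using compact_subset_cbox[OF K(1)] by blast
  let ?f = "\<lambda>t y. if y \<in> W then of_real (\<beta> y) * \<rho> (y, t) else 0"
  have a: "continuous_on (I \<times> W) (\<lambda>p. complex_of_real (\<beta> (snd p)))"
    by (intro continuous_on_of_real continuous_on_compose2[OF \<beta>] continuous_intros) auto
  have b: "continuous_on (I \<times> W) (\<lambda>p. \<rho> (snd p, fst p))"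
    by (intro continuous_on_compose2[OF \<rho>] continuous_intros) auto
  have "continuous_on (I \<times> UNIV) (\<lambda>(t, y). if y \<in> W then (\<lambda>p. of_real (\<beta> (snd p)) * \<rho> (snd p, fst p)) (t, y) else 0)"
    by (rule continuous_on_extend_zero[OF W K(1,2) continuous_on_mult[OF a b]]) (simp only: snd_conv K(3) of_real_0 mult_zero_left)
  then have cf: "continuous_on (I \<times> UNIV) (\<lambda>(t, y). ?f t y)" by (simp only: fst_conv snd_conv)
  have f0: "?f t y = 0" if "y \<notin> cbox l h" for t y using that lh K(3) by auto
  have slice: "continuous_on UNIV (?f t)" if "t \<in> I" for t
  proof -
    have p: "continuous_on UNIV (\<lambda>y. (t, y))" by (rule continuous_on_Pair[OF continuous_on_const continuous_on_id])
    have "continuous_on UNIV (\<lambda>y. (\<lambda>(t, y). ?f t y) (t, y))" by (rule continuous_on_compose2[OF cf p]) (use that in auto)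
    then show ?thesis by (simp only: split_conv)
  qed
  then show "t \<in> I \<Longrightarrow> integrable lborel (?f t)" using integral_compact_support(1)[OF slice f0] by blast
  have "continuous_on I (\<lambda>t. integral (cbox l h) (?f t))"
    by (rule integral_continuous_on_param) (rule continuous_on_subset[OF cf], blast)
  then show "continuous_on I (\<lambda>t. integral\<^sup>L lborel (?f t))"
    by (rule continuous_on_eq) (use integral_compact_support(2)[OF slice f0] in auto)
qed

section \<open>Transporting a root of a section along a homotopy\<close>

lemma cpt_linear_axis_expand:
  fixes f :: "real^'n::finite \<Rightarrow> 'b::real_vector"
  assumes "linear f"
  shows "f v = (\<Sum>k\<in>UNIV. (v $ k) *\<^sub>R f (axis k 1))"
proof -
  have "v = (\<Sum>k\<in>UNIV. (v $ k) *\<^sub>R axis k 1)" using basis_expansion[of v] by (simp add: scalar_mult_eq_scaleR)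
  then have "f v = f (\<Sum>k\<in>UNIV. (v $ k) *\<^sub>R axis k 1)" by (rule arg_cong)
  also have "\<dots> = (\<Sum>k\<in>UNIV. (v $ k) *\<^sub>R f (axis k 1))" by (simp only: linear_sum[OF assms] linear_scale[OF assms])
  finally show ?thesis .
qed

lemma holomorphic_sectionsD:
  assumes "s \<in> holomorphic_sections A m"
  shows "c \<in> A \<Longrightarrow> holo_on (coord c ` dom_of c) (s c \<circ> chart_inv c)"
    "c \<in> A \<Longrightarrow> c' \<in> A \<Longrightarrow> p \<in> dom_of c \<Longrightarrow> p \<in> dom_of c' \<Longrightarrow>
      s c p = s c' p * det (tjac c c' p) ^ m" using assms unfolding holomorphic_sections_def by blast+

text \<open>By \<open>\<delta>root\<close> the positive density \<delta> of \<open>L\<close> is a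
  \<open>k\<close>-th root of \<open>C\<close> times \<phi> evaluated on the coordinate frame; this
  selects the branch from which the continuation starts. \<open>nz\<close> says in all charts that
  the homotopy avoids the zeros of \<phi>.\<close>

locale homotopy_setup =
  fixes A :: "('a::{t2_space,second_countable_topology}, 'n::finite) cchart set"
    and L :: "'a set" and F :: "'a \<times> real \<Rightarrow> 'a"
    and \<phi> :: "('a, 'n) bundle_section" and k :: nat
    and \<delta> :: "('a, real^'n) chart \<Rightarrow> real^'n \<Rightarrow> real" and C :: "'a \<Rightarrow> complex"
  assumes A: "complex_manifold A" and L: "compact L"
    and cover: "L \<subseteq> (\<Union>x\<in>submanifold_charts A L. dom_of x)"
    and F: "smooth_homotopy A L F" and F0: "\<And>p. p \<in> L \<Longrightarrow> F (p, 0) = p"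
    and \<phi>: "\<phi> \<in> holomorphic_sections A k" and k: "k > 0"
    and nz: "\<And>p t c. p \<in> L \<Longrightarrow> t \<in> {0..1} \<Longrightarrow> c \<in> A \<Longrightarrow> F (p, t) \<in> dom_of c \<Longrightarrow> \<phi> c (F (p, t)) \<noteq> 0"
    and \<delta>pos: "\<And>x y. x \<in> submanifold_charts A L \<Longrightarrow> y \<in> coord x ` dom_of x \<Longrightarrow> 0 < \<delta> x y"
    and \<delta>root: "\<And>x c p. x \<in> submanifold_charts A L \<Longrightarrow> c \<in> A \<Longrightarrow> p \<in> dom_of x \<Longrightarrow> p \<in> dom_of c \<Longrightarrow>
      complex_of_real (\<delta> x (coord x p)) ^ k = C p * \<phi> c p *
      det (\<chi> j. Fd (coord c \<circ> chart_inv x) (coord x p) (axis j 1)) ^ k"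
    and C: "\<And>p. p \<in> L \<Longrightarrow> \<exists>U. open U \<and> p \<in> U \<and> (\<forall>q\<in>U \<inter> L. C q = C p)"
begin

abbreviation "X \<equiv> submanifold_charts A L"

abbreviation "img x \<equiv> coord x ` dom_of x"

definition loc :: "('a, real^'n) chart \<Rightarrow> ('a, 'n) cchart \<Rightarrow> (real^'n) \<times> real \<Rightarrow> complex^'n" where
  "loc x c z = coord c (F (chart_inv x (fst z), snd z))"

definition rws :: "('a, real^'n) chart \<Rightarrow> ('a, 'n) cchart \<Rightarrow> real \<Rightarrow> real^'n \<Rightarrow> complex^'n^'n" where
  "rws x c t y = (\<chi> j. Fd (\<lambda>y. loc x c (y, t)) y (axis j 1))"

definition vl :: "('a, 'n) cchart \<Rightarrow> 'a \<Rightarrow> real \<Rightarrow> complex^'n" where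
  "vl c p t = vector_derivative (\<lambda>s. coord c (F (p, s))) (at t)"

text \<open>The time set is a parameter: statements up to the end points use \<open>{0..1}\<close>,
  while time derivatives call for the open set that belongs to \<open>{0<..<1}\<close>.\<close>

definition dmn :: "('a, real^'n) chart \<Rightarrow> ('a, 'n) cchart \<Rightarrow> real set \<Rightarrow> ((real^'n) \<times> real) set" where
  "dmn x c T = {z. fst z \<in> img x \<and> snd z \<in> T \<and> F (chart_inv x (fst z), snd z) \<in> dom_of c}"

abbreviation "cp p \<equiv> chart_at A p"

abbreviation "jac c c' q \<equiv> det (tjac c c' q)"

lemmas cm = complex_manifoldD[OF A]
lemmas X1 = submanifold_chartsD(1)
lemmas XD = chart_onD[OF submanifold_chartsD(1)]
lemmas cpA = chart_at_in[OF A]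

section \<open>The homotopy in charts\<close>

lemma X_dom: "x \<in> X \<Longrightarrow> p \<in> dom_of x \<Longrightarrow> p \<in> L" using XD(7) by blast

lemma X_exists: "p \<in> L \<Longrightarrow> \<exists>x\<in>X. p \<in> dom_of x" using cover by blast

lemma openin_dmn:
  assumes "x \<in> X" "c \<in> A" "T \<subseteq> {0..1}"
  obtains U where "open U" "dmn x c T = img x \<times> T \<inter> U"
proof -
  let ?f = "\<lambda>z. F (chart_inv x (fst z), snd z)"
  have Fc: "continuous_on (L \<times> {0..1}) F" using F unfolding smooth_homotopy_def by blast
  have "continuous_on (img x \<times> T) (\<lambda>z. chart_inv x (fst z))"
    by (rule continuous_on_compose2[OF XD(3)[OF assms(1)] continuous_on_fst[OF continuous_on_id]]) auto
  then have "continuous_on (img x \<times> T) (\<lambda>z. (chart_inv x (fst z), snd z))"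
    by (intro continuous_on_Pair continuous_on_snd continuous_on_id)
  then have "continuous_on (img x \<times> T) ?f"
  proof (rule continuous_on_compose2[OF Fc])
    show "(\<lambda>z. (chart_inv x (fst z), snd z)) ` (img x \<times> T) \<subseteq> L \<times> {0..1}"
    proof (rule image_subsetI)
      fix z assume "z \<in> img x \<times> T"
      then have "fst z \<in> img x" "snd z \<in> {0..1}" using assms(3) by auto
      moreover from this(1) have "chart_inv x (fst z) \<in> L" by (rule X_dom[OF assms(1) XD(5)[OF assms(1)]])
      ultimately show "(chart_inv x (fst z), snd z) \<in> L \<times> {0..1}" by simp
    qed
  qed
  from continuous_openin_preimage_gen[OF this cm(4)[OF assms(2)]]
  obtain U where "open U" "img x \<times> T \<inter> ?f -` dom_of c = img x \<times> T \<inter> U" unfolding openin_open by blast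
  moreover have "dmn x c T = img x \<times> T \<inter> ?f -` dom_of c" by (auto simp: dmn_def)
  ultimately show thesis using that by simp
qed

lemma open_dmn:
  assumes "x \<in> X" "c \<in> A" "T \<subseteq> {0..1}" "open T"
  shows "open (dmn x c T)"
proof -
  obtain U where "open U" "dmn x c T = img x \<times> T \<inter> U" using openin_dmn[OF assms(1-3)] by blast
  then show ?thesis using XD(1)[OF assms(1)] assms(4) by (auto intro: open_Times open_Int)
qed

lemma open_slice:
  assumes "x \<in> X" "c \<in> A" "t \<in> {0..1}"
  shows "open {y. (y, t) \<in> dmn x c {0..1}}"
proof -
  obtain U where U: "open U" "dmn x c {0..1} = img x \<times> {0..1} \<inter> U" using openin_dmn[OF assms(1,2) order_refl] by blast
  have "open ((\<lambda>y. (y, t)) -` U)" by (rule open_vimage[OF U(1)]) (intro continuous_intros)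
  moreover have "{y. (y, t) \<in> dmn x c {0..1}} = img x \<inter> (\<lambda>y. (y, t)) -` U" using U(2) assms(3) by auto
  ultimately show ?thesis using XD(1)[OF assms(1)] by (simp add: open_Int)
qed

text \<open>At the times 0 and 1 the set \<open>dmn x c {0..1}\<close> is not open; the extension
  has derivatives there.\<close>

lemma loc_extension:
  assumes "x \<in> X" "c \<in> A" "z \<in> dmn x c {0..1}"
  obtains U g where "open U" "z \<in> U" "\<And>k. Ck_on k U g" "\<And>w. w \<in> U \<Longrightarrow> w \<in> dmn x c {0..1} \<Longrightarrow> g w = loc x c w"
proof -
  let ?S = "{(y, t). y \<in> img x \<and> t \<in> {0..1} \<and> F (chart_inv x y, t) \<in> dom_of c}"
  have S: "?S = dmn x c {0..1}" by (auto simp: dmn_def)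
  have "smooth_on ?S (\<lambda>(y, t). coord c (F (chart_inv x y, t)))" using F assms(1,2) unfolding smooth_homotopy_def by blast
  then have "\<exists>U g. open U \<and> z \<in> U \<and> (\<forall>k. Ck_on k U g) \<and> (\<forall>w\<in>U \<inter> dmn x c {0..1}. g w = (\<lambda>(y, t). coord c (F (chart_inv x y, t))) w)"
    using assms(3) unfolding smooth_on_def S by blast
  then obtain U g where U: "open U" "z \<in> U" "\<forall>k. Ck_on k U g"
    "\<forall>w\<in>U \<inter> dmn x c {0..1}. g w = (\<lambda>(y, t). coord c (F (chart_inv x y, t))) w" by blast
  show thesis
  proof (rule that[OF U(1,2)])
    show "Ck_on k U g" for k using U(3) by blast
    show "g w = loc x c w" if "w \<in> U" "w \<in> dmn x c {0..1}" for w using U(4) that by (simp add: loc_def split_beta)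
  qed
qed

text \<open>A slice at fixed time is open in the chart of \<open>L\<close> even for
  \<open>t = 0\<close> and \<open>t = 1\<close>, so its derivative can be computed from an
  extension.\<close>

lemma loc_slice_derivative:
  assumes x: "x \<in> X" "c \<in> A" and U: "open U" "Ck_on (Suc 0) U g" "\<And>w. w \<in> U \<Longrightarrow> w \<in> dmn x c {0..1} \<Longrightarrow> g w = loc x c w"
    and w: "(y, t) \<in> U" "(y, t) \<in> dmn x c {0..1}"
  shows "((\<lambda>y. loc x c (y, t)) has_derivative (\<lambda>v. Fd g (y, t) (v, 0))) (at y)"
proof -
  have t: "t \<in> {0..1}" using w(2) by (simp add: dmn_def)
  have "((\<lambda>y. (y, t)) has_derivative (\<lambda>v. (v, 0))) (at y)"
    by (intro has_derivative_Pair has_derivative_ident has_derivative_const)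
  from diff_chain_at[OF this Ck_on_has_derivative[OF U(2) w(1)]]
  have 1: "((\<lambda>y. g (y, t)) has_derivative (\<lambda>v. Fd g (y, t) (v, 0))) (at y)" by (simp add: o_def)
  have "open ((\<lambda>y. (y, t)) -` U)" by (rule open_vimage[OF U(1)]) (intro continuous_intros)
  then have o: "open ((\<lambda>y. (y, t)) -` U \<inter> {y. (y, t) \<in> dmn x c {0..1}})" using open_slice[OF x t] by (rule open_Int)
  show ?thesis by (rule has_derivative_transform_within_open[OF 1 o]) (use w U(3) in auto)
qed

lemma loc_slice_has_derivative:
  assumes "x \<in> X" "c \<in> A" "(y, t) \<in> dmn x c {0..1}"
  shows "((\<lambda>y. loc x c (y, t)) has_derivative Fd (\<lambda>y. loc x c (y, t)) y) (at y)"
proof -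
  obtain U g where U: "open U" "(y, t) \<in> U" "\<And>k. Ck_on k U g" "\<And>w. w \<in> U \<Longrightarrow> w \<in> dmn x c {0..1} \<Longrightarrow> g w = loc x c w"
    using loc_extension[OF assms] by metis
  from loc_slice_derivative[OF assms(1,2) U(1,3,4,2) assms(3)] show ?thesis by (metis frechet_derivative_at)
qed

text \<open>Up to the end times, since the rows are partial derivatives of a smooth extension near
  each point.\<close>

lemma continuous_on_rws:
  assumes "x \<in> X" "c \<in> A"
  shows "continuous_on (dmn x c {0..1}) (\<lambda>z. rws x c (snd z) (fst z))"
proof (rule continuous_on_locally_open)
  fix z assume z: "z \<in> dmn x c {0..1}"
  obtain U g where U: "open U" "z \<in> U" "\<And>k. Ck_on k U g" "\<And>w. w \<in> U \<Longrightarrow> w \<in> dmn x c {0..1} \<Longrightarrow> g w = loc x c w"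
    using loc_extension[OF assms z] by metis
  have "continuous_on U (\<lambda>w. \<chi> j. Fd g w (axis j 1, 0))" by (rule continuous_on_vec_lambda) (rule Ck_on_1_continuous(1)[OF U(3)])
  then have "continuous_on (dmn x c {0..1} \<inter> U) (\<lambda>w. \<chi> j. Fd g w (axis j 1, 0))" by (rule continuous_on_subset) blast
  then have "continuous_on (dmn x c {0..1} \<inter> U) (\<lambda>z. rws x c (snd z) (fst z))"
  proof (rule continuous_on_eq)
    fix w assume w: "w \<in> dmn x c {0..1} \<inter> U"
    then have "((\<lambda>y. loc x c (y, snd w)) has_derivative (\<lambda>v. Fd g (fst w, snd w) (v, 0))) (at (fst w))"
      by (intro loc_slice_derivative[OF assms U(1,3,4)]) simp_all
    from frechet_derivative_at[OF this]
    show "(\<chi> j. Fd g w (axis j 1, 0)) = rws x c (snd w) (fst w)" by (simp add: rws_def fun_eq_iff)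
  qed
  then show "\<exists>T. open T \<and> z \<in> T \<and> continuous_on (dmn x c {0..1} \<inter> T) (\<lambda>z. rws x c (snd z) (fst z))"
    using U(1,2) by blast
qed

lemma loc_Ck_on:
  assumes "x \<in> X" "c \<in> A" "T \<subseteq> {0..1}" "open T"
  shows "Ck_on j (dmn x c T) (loc x c)"
proof (rule Ck_on_local)
  fix z assume z: "z \<in> dmn x c T"
  then have z1: "z \<in> dmn x c {0..1}" using assms(3) by (auto simp: dmn_def)
  obtain U g where U: "open U" "z \<in> U" "\<And>k. Ck_on k U g" "\<And>w. w \<in> U \<Longrightarrow> w \<in> dmn x c {0..1} \<Longrightarrow> g w = loc x c w"
    using loc_extension[OF assms(1,2) z1] by metis
  have o: "open (U \<inter> dmn x c T)" using U(1) open_dmn[OF assms] by (rule open_Int)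
  have "Ck_on j (U \<inter> dmn x c T) g" using U(3) by (rule Ck_on_subset) blast
  moreover have "Ck_on j (U \<inter> dmn x c T) g \<longleftrightarrow> Ck_on j (U \<inter> dmn x c T) (loc x c)"
    using U(4) assms(3) by (intro Ck_on_cong[OF o]) (auto simp: dmn_def)
  ultimately show "\<exists>U. open U \<and> z \<in> U \<and> Ck_on j U (loc x c)" using o z U(2) by blast
qed

lemma loc_has_derivative:
  assumes "x \<in> X" "c \<in> A" "z \<in> dmn x c {0<..<1}"
  shows "(loc x c has_derivative Fd (loc x c) z) (at z)"
  by (rule Ck_on_has_derivative[OF loc_Ck_on[OF assms(1,2), of "{0<..<1}" "Suc 0"] assms(3)]) auto

lemma rws_interior:
  assumes "x \<in> X" "c \<in> A" "(y, t) \<in> dmn x c {0<..<1}"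
  shows "rws x c t y $ j = Fd (loc x c) (y, t) (axis j 1, 0)"
proof -
  have "((\<lambda>y. loc x c (y, t)) has_derivative (\<lambda>v. Fd (loc x c) (y, t) (v, 0))) (at y)"
    by (rule loc_slice_derivative[OF assms(1,2) open_dmn[OF assms(1,2)] loc_Ck_on[OF assms(1,2)] _ assms(3)])
      (use assms(3) in \<open>auto simp: dmn_def\<close>)
  from frechet_derivative_at[OF this] show ?thesis by (simp add: rws_def fun_eq_iff)
qed

lemma vl_interior:
  assumes "x \<in> X" "c \<in> A" "p \<in> dom_of x" "(coord x p, t) \<in> dmn x c {0<..<1}"
  shows "vl c p t = Fd (loc x c) (coord x p, t) (0, 1)"
proof -
  have "(loc x c has_derivative Fd (loc x c) (coord x p, t)) (at ((coord x p, 0) + t *\<^sub>R (0, 1)))"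
    using loc_has_derivative[OF assms(1,2,4)] by simp
  from has_derivative_line[OF this]
  have "((\<lambda>s. coord c (F (p, s))) has_vector_derivative Fd (loc x c) (coord x p, t) (0, 1)) (at t)"
    by (simp add: loc_def XD(4)[OF assms(1,3)])
  then show ?thesis unfolding vl_def by (rule vector_derivative_at)
qed

lemma mem_dmn:
  assumes "x \<in> X" "p \<in> dom_of x"
  shows "(coord x p, t) \<in> dmn x c T \<longleftrightarrow> t \<in> T \<and> F (p, t) \<in> dom_of c"
  using assms by (auto simp: dmn_def XD(4)[OF assms])

lemma loc_coord:
  assumes "x \<in> X" "p \<in> dom_of x"
  shows "loc x c (coord x p, t) = coord c (F (p, t))" by (simp add: loc_def XD(4)[OF assms])

lemma loc_transition:
  assumes "c \<in> A" "z \<in> dmn x c T"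
  shows "transition c c' (loc x c z) = loc x c' z" using assms(2) transition_coord[OF cm(1)[OF assms(1)]] by (simp add: loc_def dmn_def)

lemma rws_change_c:
  assumes "x \<in> X" "c \<in> A" "c' \<in> A" "p \<in> dom_of x" "t \<in> {0..1}" "F (p, t) \<in> dom_of c" "F (p, t) \<in> dom_of c'"
  shows "rws x c' t (coord x p) = (\<chi> j. tjac c c' (F (p, t)) *v rws x c t (coord x p) $ j)"
proof -
  let ?y = "coord x p" and ?J = "tjac c c' (F (p, t))"
  let ?D = "Fd (\<lambda>y. loc x c (y, t)) ?y"
  have d: "(?y, t) \<in> dmn x c {0..1}" "(?y, t) \<in> dmn x c' {0..1}" using assms by (simp_all add: mem_dmn)
  have "(transition c c' has_derivative (*v) ?J) (at (loc x c (?y, t)))"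
    unfolding loc_coord[OF assms(1,4)] by (rule transition_has_derivative[OF A assms(2,3,6,7)])
  from diff_chain_at[OF loc_slice_has_derivative[OF assms(1,2) d(1)] this]
  have 1: "((\<lambda>y. transition c c' (loc x c (y, t))) has_derivative (\<lambda>v. ?J *v ?D v)) (at ?y)" by (simp add: o_def)
  have "((\<lambda>y. loc x c' (y, t)) has_derivative (\<lambda>v. ?J *v ?D v)) (at ?y)"
    by (rule has_derivative_transform_within_open[OF 1 open_slice[OF assms(1,2,5)]]) (use d loc_transition[OF assms(2)] in auto)
  from frechet_derivative_at[OF this] show ?thesis by (simp add: rws_def vec_eq_iff fun_eq_iff)
qed

lemma vl_change_c:
  assumes "x \<in> X" "c \<in> A" "c' \<in> A" "p \<in> dom_of x" "t \<in> {0<..<1}" "F (p, t) \<in> dom_of c" "F (p, t) \<in> dom_of c'"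
  shows "vl c' p t = tjac c c' (F (p, t)) *v vl c p t"
proof -
  let ?z = "(coord x p, t)" and ?J = "tjac c c' (F (p, t))"
  have d: "?z \<in> dmn x c {0<..<1}" "?z \<in> dmn x c' {0<..<1}" using assms by (simp_all add: mem_dmn)
  have "(transition c c' has_derivative (*v) ?J) (at (loc x c ?z))"
    unfolding loc_coord[OF assms(1,4)] by (rule transition_has_derivative[OF A assms(2,3,6,7)])
  from diff_chain_at[OF loc_has_derivative[OF assms(1,2) d(1)] this]
  have 1: "((\<lambda>z. transition c c' (loc x c z)) has_derivative (\<lambda>v. ?J *v Fd (loc x c) ?z v)) (at ?z)" by (simp add: o_def)
  have o: "open (dmn x c {0<..<1})" by (rule open_dmn[OF assms(1,2)]) auto
  have "(loc x c' has_derivative (\<lambda>v. ?J *v Fd (loc x c) ?z v)) (at ?z)"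
    by (rule has_derivative_transform_within_open[OF 1 o d(1)]) (rule loc_transition[OF assms(2)])
  from frechet_derivative_at[OF this, symmetric] show ?thesis
    by (simp add: vl_interior[OF assms(1,2,4) d(1)] vl_interior[OF assms(1,3,4) d(2)])
qed

lemma rws_change_x:
  assumes "x \<in> X" "x' \<in> X" "c \<in> A" "p \<in> dom_of x" "p \<in> dom_of x'" "t \<in> {0..1}" "F (p, t) \<in> dom_of c"
    and T: "(transition x x' has_derivative T) (at (coord x p))"
  shows "rws x c t (coord x p) = (\<chi> j. \<Sum>k\<in>UNIV. (\<chi> k j. complex_of_real (matrix T $ k $ j)) $ k $ j *s rws x' c t (coord x' p) $ k)"
proof -
  let ?y = "coord x p" and ?y' = "coord x' p"
  let ?D = "Fd (\<lambda>y. loc x' c (y, t)) ?y'"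
  have d: "(?y, t) \<in> dmn x c {0..1}" "(?y', t) \<in> dmn x' c {0..1}" using assms(1-7) by (simp_all add: mem_dmn)
  have ty: "transition x x' ?y = ?y'" by (rule transition_coord[OF X1[OF assms(1)] assms(4)])
  have D: "((\<lambda>y. loc x' c (y, t)) has_derivative ?D) (at (transition x x' ?y))"
    unfolding ty by (rule loc_slice_has_derivative[OF assms(2,3) d(2)])
  from diff_chain_at[OF T D]
  have 1: "((\<lambda>y. loc x' c (transition x x' y, t)) has_derivative (\<lambda>v. ?D (T v))) (at ?y)" by (simp add: o_def)
  obtain O' where O': "open O'" "dom_of x' = L \<inter> O'" using XD(8)[OF assms(2)] unfolding openin_open by blast
  have o: "open (coord x ` (dom_of x \<inter> O'))" by (rule submanifold_chart_image_open[OF A assms(1) O'(1)])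
  have yo: "?y \<in> coord x ` (dom_of x \<inter> O')" using assms(4,5) O'(2) by blast
  have "((\<lambda>y. loc x c (y, t)) has_derivative (\<lambda>v. ?D (T v))) (at ?y)"
  proof (rule has_derivative_transform_within_open[OF 1 o yo])
    fix y assume "y \<in> coord x ` (dom_of x \<inter> O')"
    then obtain q where q: "y = coord x q" "q \<in> dom_of x" "q \<in> O'" by blast
    have q': "q \<in> dom_of x'" using q(2,3) O'(2) X_dom[OF assms(1)] by blast
    show "loc x' c (transition x x' y, t) = loc x c (y, t)"
      unfolding q(1) transition_coord[OF X1[OF assms(1)] q(2)] by (simp add: loc_coord assms(1,2) q(2) q')
  qed
  from frechet_derivative_at[OF this, symmetric]
  have "rws x c t ?y $ j = ?D (T (axis j 1))" for j by (simp add: rws_def)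
  moreover have "?D (T (axis j 1)) = (\<Sum>k\<in>UNIV. (T (axis j 1) $ k) *\<^sub>R ?D (axis k 1))" for j
    by (rule cpt_linear_axis_expand[OF has_derivative_linear[OF D]])
  ultimately have "rws x c t ?y $ j = (\<Sum>k\<in>UNIV. (matrix T $ k $ j) *\<^sub>R rws x' c t ?y' $ k)" for j
    by (simp add: rws_def matrix_def)
  moreover have "r *\<^sub>R z = complex_of_real r *s z" for r and z :: "complex^'n"
    by (simp add: vec_eq_iff scaleR_conv_of_real[where 'a=complex])
  ultimately show ?thesis by (subst vec_eq_iff) simp
qed

lemma rws_0:
  assumes "x \<in> X" "y \<in> img x"
  shows "rws x c 0 y = (\<chi> j. Fd (coord c \<circ> chart_inv x) y (axis j 1))"
proof -
  have eq: "loc x c (y, 0) = (coord c \<circ> chart_inv x) y" if "y \<in> img x" for y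
    using F0[OF X_dom[OF assms(1) XD(5)[OF assms(1) that]]] by (simp add: loc_def)
  have "Fd (\<lambda>y. loc x c (y, 0)) y = Fd (coord c \<circ> chart_inv x) y"
  proof -
    have "((\<lambda>y. loc x c (y, 0)) has_derivative D) (at y) \<longleftrightarrow> (coord c \<circ> chart_inv x has_derivative D) (at y)" for D
      using has_derivative_transform_within_open[OF _ XD(1)[OF assms(1)] assms(2), of "\<lambda>y. loc x c (y, 0)" D UNIV "coord c \<circ> chart_inv x"]
        has_derivative_transform_within_open[OF _ XD(1)[OF assms(1)] assms(2), of "coord c \<circ> chart_inv x" D UNIV "\<lambda>y. loc x c (y, 0)"] eq
      by auto
    then show ?thesis unfolding frechet_derivative_def by simp
  qed
  then show ?thesis by (simp add: rws_def)
qed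

text \<open>Positivity of \<delta> forces the complex determinant of a frame of \<open>L\<close> to
  be nonzero, that is, \<open>L\<close> is totally real.\<close>

lemma \<delta>_rws:
  assumes "x \<in> X" "c \<in> A" "p \<in> dom_of x" "p \<in> dom_of c"
  shows "complex_of_real (\<delta> x (coord x p)) ^ k = C p * \<phi> c p * det (rws x c 0 (coord x p)) ^ k"
    and "det (rws x c 0 (coord x p)) \<noteq> 0"
proof -
  show 1: "complex_of_real (\<delta> x (coord x p)) ^ k = C p * \<phi> c p * det (rws x c 0 (coord x p)) ^ k"
    using \<delta>root[OF assms] rws_0[OF assms(1), of "coord x p" c] assms(3) by simp
  have "0 < \<delta> x (coord x p)" using \<delta>pos[OF assms(1)] assms(3) by blast
  then have "complex_of_real (\<delta> x (coord x p)) ^ k \<noteq> 0" by simp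
  then show "det (rws x c 0 (coord x p)) \<noteq> 0" unfolding 1 using k by (auto simp: zero_power)
qed

text \<open>dz_1 wedge ... wedge dz_n at \<open>p\<close> on the coordinate frame of
  \<open>x\<close>. The chart \<open>cp p\<close> may jump with \<open>p\<close>, so continuity can
  be demanded only of quotients by \<open>den\<close>, in which this choice cancels.\<close>

definition den :: "('a, real^'n) chart \<Rightarrow> 'a \<Rightarrow> complex" where
  "den x p = det (rws x (cp p) 0 (coord x p))"

lemma den_nonzero: "x \<in> X \<Longrightarrow> p \<in> dom_of x \<Longrightarrow> den x p \<noteq> 0"
  unfolding den_def by (rule \<delta>_rws(2)[OF _ cpA(1) _ cpA(2)])

text \<open>\<open>e\<close> is a field of \<open>k\<close>-th roots of the section along \<open>F (\<cdot>, s)\<close>; its value at \<open>p\<close> is an element of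
  the fibre of \<open>K(M)\<close> at \<open>F (p, s)\<close> divided by the element \<open>dz\<^sub>1 \<and> \<dots> \<and> dz\<^sub>n\<close> of the fibre at \<open>p\<close>, taken
  in the chart \<open>chart_at A p\<close>.\<close>

definition good :: "real \<Rightarrow> (('a, 'n) cchart \<Rightarrow> 'a \<Rightarrow> complex) \<Rightarrow> bool" where
  "good s e \<longleftrightarrow>
    (\<forall>p\<in>L. \<forall>c\<in>A. F (p, s) \<in> dom_of c \<longrightarrow> e c p ^ k * \<phi> (cp p) p = \<phi> c (F (p, s))) \<and>
    (\<forall>p\<in>L. \<forall>c\<in>A. \<forall>c'\<in>A. F (p, s) \<in> dom_of c \<longrightarrow> F (p, s) \<in> dom_of c' \<longrightarrow> e c p = e c' p * jac c c' (F (p, s))) \<and>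
    (\<forall>x\<in>X. \<forall>c\<in>A. continuous_on {y. (y, s) \<in> dmn x c {0..1}} (\<lambda>y. e c (chart_inv x y) / den x (chart_inv x y)))"

lemma goodD:
  assumes "good s e"
  shows "p \<in> L \<Longrightarrow> c \<in> A \<Longrightarrow> F (p, s) \<in> dom_of c \<Longrightarrow> e c p ^ k * \<phi> (cp p) p = \<phi> c (F (p, s))"
    "p \<in> L \<Longrightarrow> c \<in> A \<Longrightarrow> c' \<in> A \<Longrightarrow> F (p, s) \<in> dom_of c \<Longrightarrow> F (p, s) \<in> dom_of c' \<Longrightarrow> e c p = e c' p * jac c c' (F (p, s))"
    "x \<in> X \<Longrightarrow> c \<in> A \<Longrightarrow> continuous_on {y. (y, s) \<in> dmn x c {0..1}} (\<lambda>y. e c (chart_inv x y) / den x (chart_inv x y))"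
  using assms unfolding good_def by blast+

lemma jac_compose:
  assumes "c \<in> A" "c' \<in> A" "c'' \<in> A" "q \<in> dom_of c" "q \<in> dom_of c'" "q \<in> dom_of c''"
  shows "jac c c'' q = jac c c' q * jac c' c'' q" unfolding jacobian_transition_compose[OF A assms] det_mul by (rule mult.commute)

lemma jac_self: "c \<in> A \<Longrightarrow> q \<in> dom_of c \<Longrightarrow> jac c c q = 1" by (simp add: jacobian_transition_self[OF A])

lemma jac_nonzero:
  assumes "c \<in> A" "c' \<in> A" "q \<in> dom_of c" "q \<in> dom_of c'"
  shows "jac c c' q \<noteq> 0" using det_jacobian_transition[OF A assms] by auto

lemma continuous_on_jac:
  assumes "c \<in> A" "c' \<in> A"
  shows "continuous_on (dom_of c \<inter> dom_of c') (jac c c')"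
proof -
  let ?V = "coord c ` (dom_of c \<inter> dom_of c')"
  have h: "holo_on ?V (\<lambda>z. transition c c' z $ i)" for i using cm(3)[OF assms] unfolding holo_map_on_def by blast
  have "continuous_on ?V (\<lambda>z. jacobian (transition c c') z)"
    unfolding jacobian_def by (intro continuous_on_vec_lambda continuous_on_d_z[OF h cm(5)[OF assms]])
  then have "continuous_on ?V (\<lambda>z. det (jacobian (transition c c') z))" by (rule continuous_on_det)
  then show ?thesis by (rule continuous_on_compose2[OF _ continuous_on_subset[OF chart_onD(2)[OF cm(1)[OF assms(1)]]]]) auto
qed

lemma continuous_on_\<phi>:
  assumes "c \<in> A"
  shows "continuous_on (dom_of c) (\<phi> c)"
proof -
  have "continuous_on (dom_of c) (\<lambda>p. (\<phi> c \<circ> chart_inv c) (coord c p))"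
    by (rule continuous_on_compose2[OF holo_on_continuous[OF holomorphic_sectionsD(1)[OF \<phi> assms]] chart_onD(2)[OF cm(1)[OF assms]]]) blast
  then show ?thesis by (rule continuous_on_eq) (simp add: chart_onD(4)[OF cm(1)[OF assms]])
qed

lemma \<phi>_change: "c \<in> A \<Longrightarrow> c' \<in> A \<Longrightarrow> q \<in> dom_of c \<Longrightarrow> q \<in> dom_of c' \<Longrightarrow> \<phi> c q = \<phi> c' q * jac c c' q ^ k"
  by (rule holomorphic_sectionsD(2)[OF \<phi>])

lemma continuous_on_path:
  assumes "p \<in> L" "T \<subseteq> {0..1}"
  shows "continuous_on T (\<lambda>t. F (p, t))"
proof -
  have "continuous_on (L \<times> {0..1}) F" using F unfolding smooth_homotopy_def by blast
  then show ?thesis by (rule continuous_on_compose2) (use assms in \<open>auto intro!: continuous_intros\<close>)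
qed

text \<open>At time 0 the quotient of the roots is the identity of the fibre at \<open>p\<close>,
  which in the charts \<open>c\<close> and \<open>cp p\<close> reads as a Jacobian
  determinant.\<close>

lemma good_0: "good 0 (\<lambda>c p. jac c (cp p) p)" unfolding good_def
proof (intro conjI ballI impI)
  fix p c assume p: "p \<in> L" and c: "c \<in> A" "F (p, 0) \<in> dom_of c"
  have pc: "p \<in> dom_of c" using c(2) F0[OF p] by simp
  show "jac c (cp p) p ^ k * \<phi> (cp p) p = \<phi> c (F (p, 0))"
    using \<phi>_change[OF c(1) cpA(1) pc cpA(2)] by (simp add: F0[OF p] mult.commute)
  fix c' assume c': "c' \<in> A" "F (p, 0) \<in> dom_of c'"
  have pc': "p \<in> dom_of c'" using c'(2) F0[OF p] by simp
  show "jac c (cp p) p = jac c' (cp p) p * jac c c' (F (p, 0))"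
    using jac_compose[OF c(1) c'(1) cpA(1) pc pc' cpA(2)] by (simp add: F0[OF p] mult.commute)
next
  fix x c assume x: "x \<in> X" and c: "c \<in> A"
  let ?S = "{y. (y, 0) \<in> dmn x c {0..1}}"
  have "continuous_on ?S (\<lambda>y. (\<lambda>z. rws x c (snd z) (fst z)) (y, 0))"
    by (rule continuous_on_compose2[OF continuous_on_rws[OF x c]]) (auto intro!: continuous_intros)
  then have "continuous_on ?S (\<lambda>y. det (rws x c 0 y))" by (intro continuous_on_det) simp
  moreover have eq: "jac c (cp p) p / den x p = 1 / det (rws x c 0 (coord x p)) \<and> det (rws x c 0 (coord x p)) \<noteq> 0"
    if p: "p \<in> dom_of x" "p \<in> dom_of c" for p
  proof -
    have L: "p \<in> L" by (rule X_dom[OF x p(1)])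
    have "rws x (cp p) 0 (coord x p) = (\<chi> j. jacobian (transition c (cp p)) (coord c (F (p, 0))) *v rws x c 0 (coord x p) $ j)"
      by (rule rws_change_c[OF x c cpA(1) p(1)]) (simp_all add: F0[OF L] p(2) cpA(2))
    then have "den x p = jac c (cp p) p * det (rws x c 0 (coord x p))" unfolding den_def by (simp add: det_rows_transform_right F0[OF L])
    then show ?thesis using den_nonzero[OF x p(1)] by auto
  qed
  have S: "chart_inv x y \<in> dom_of x" "chart_inv x y \<in> dom_of c" "coord x (chart_inv x y) = y" if "y \<in> ?S" for y
  proof -
    have y: "y \<in> img x" "F (chart_inv x y, 0) \<in> dom_of c" using that by (simp_all add: dmn_def)
    show d: "chart_inv x y \<in> dom_of x" by (rule XD(5)[OF x y(1)])
    show "chart_inv x y \<in> dom_of c" using y(2) F0[OF X_dom[OF x d]] by simp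
    show "coord x (chart_inv x y) = y" by (rule XD(6)[OF x y(1)])
  qed
  ultimately have "continuous_on ?S (\<lambda>y. 1 / det (rws x c 0 y))"
    by (intro continuous_on_divide continuous_on_const) (use eq S in \<open>metis+\<close>)
  then show "continuous_on ?S (\<lambda>y. jac c (cp (chart_inv x y)) (chart_inv x y) / den x (chart_inv x y))"
    by (rule continuous_on_eq) (use eq S in auto)
qed

text \<open>The continued root on the image of the frame, divided by the root at \<open>p\<close> on
  the frame itself. Relative to the measure with density \<delta> this is the density of the
  pulled-back form.\<close>

definition dens_at :: "(('a, 'n) cchart \<Rightarrow> 'a \<Rightarrow> complex) \<Rightarrow> ('a, 'n) cchart \<Rightarrow> ('a, real^'n) chart \<Rightarrow> real \<Rightarrow> 'a \<Rightarrow> complex" where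
  "dens_at e c x t p = e c p * det (rws x c t (coord x p)) / den x p"

text \<open>The same quotient for the wedge of the differential of \<open>b\<close> with the
  contraction of the root by the velocity.\<close>

definition flux_at :: "(('a, 'n) cchart \<Rightarrow> 'a \<Rightarrow> complex) \<Rightarrow> ('a, 'n) cchart \<Rightarrow> ('a, real^'n) chart \<Rightarrow> real \<Rightarrow> ('a \<Rightarrow> real) \<Rightarrow> 'a \<Rightarrow> complex" where
  "flux_at e c x t b p = e c p * (\<Sum>j\<in>UNIV. complex_of_real (Fd (b \<circ> chart_inv x) (coord x p) (axis j 1)) *
    det (row_upd (rws x c t (coord x p)) j (vl c p t))) / den x p"

text \<open>The complexified Jacobian of the real transition map acts on the rows at every time. At
  time 0 this gives the factor of \<open>den\<close>, which cancels the corresponding factor of the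
  numerators in \<open>dens_at\<close> and \<open>flux_at\<close>.\<close>

lemma change_of_chart_matrix:
  assumes "x \<in> X" "x' \<in> X" "p \<in> dom_of x" "p \<in> dom_of x'"
  shows "\<exists>T. \<exists>Tc::complex^'n^'n. (transition x x' has_derivative T) (at (coord x p)) \<and>
    Tc = (\<chi> k j. complex_of_real (matrix T $ k $ j)) \<and> det Tc \<noteq> 0 \<and> den x p = det Tc * den x' p \<and>
    (\<forall>c\<in>A. \<forall>t\<in>{0..1}. F (p, t) \<in> dom_of c \<longrightarrow>
    rws x c t (coord x p) = (\<chi> j. \<Sum>k\<in>UNIV. Tc $ k $ j *s rws x' c t (coord x' p) $ k))"
proof -
  obtain T where T: "(transition x x' has_derivative T) (at (coord x p))" using submanifold_transition[OF A assms] by blast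
  define Tc where "Tc = (\<chi> k j. complex_of_real (matrix T $ k $ j))"
  have r: "rws x c t (coord x p) = (\<chi> j. \<Sum>k\<in>UNIV. Tc $ k $ j *s rws x' c t (coord x' p) $ k)"
    if "c \<in> A" "t \<in> {0..1}" "F (p, t) \<in> dom_of c" for c t
    unfolding Tc_def by (rule rws_change_x[OF assms(1,2) that(1) assms(3,4) that(2,3) T])
  have "rws x (cp p) 0 (coord x p) = (\<chi> j. \<Sum>k\<in>UNIV. Tc $ k $ j *s rws x' (cp p) 0 (coord x' p) $ k)"
    by (rule r[OF cpA(1)]) (simp_all add: F0[OF X_dom[OF assms(1,3)]] cpA(2))
  then have d: "den x p = det Tc * den x' p" unfolding den_def by (simp only: det_rows_transform_left)
  then have "det Tc \<noteq> 0" using den_nonzero[OF assms(1,3)] by auto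
  then show ?thesis using T Tc_def d r by (intro exI[of _ T] exI[of _ Tc] conjI ballI impI) simp_all
qed

lemma dens_at_indep:
  assumes g: "good t e" and t: "t \<in> {0..1}" and x: "x \<in> X" "x' \<in> X" "p \<in> dom_of x" "p \<in> dom_of x'"
    and c: "c \<in> A" "c' \<in> A" "F (p, t) \<in> dom_of c" "F (p, t) \<in> dom_of c'"
  shows "dens_at e c x t p = dens_at e c' x' t p"
proof -
  have pL: "p \<in> L" by (rule X_dom[OF x(1,3)])
  have "det (rws x c' t (coord x p)) = jac c c' (F (p, t)) * det (rws x c t (coord x p))"
    unfolding rws_change_c[OF x(1) c(1,2) x(3) t c(3,4)] by (rule det_rows_transform_right)
  then have 1: "dens_at e c x t p = dens_at e c' x t p" using goodD(2)[OF g pL c] by (simp add: dens_at_def)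
  obtain Tc :: "complex^'n^'n" where T: "det Tc \<noteq> 0" "den x p = det Tc * den x' p"
    "rws x c' t (coord x p) = (\<chi> j. \<Sum>k\<in>UNIV. Tc $ k $ j *s rws x' c' t (coord x' p) $ k)"
    using change_of_chart_matrix[OF x] c(2,4) t by blast
  have "det (rws x c' t (coord x p)) = det Tc * det (rws x' c' t (coord x' p))" unfolding T(3) by (rule det_rows_transform_left)
  then have "dens_at e c' x t p = dens_at e c' x' t p" using T(1) by (simp add: dens_at_def T(2))
  then show ?thesis using 1 by simp
qed

text \<open>The differential of \<open>b\<close> transforms like the rows, so
  \<open>row_upd_transform_left\<close> gives a factor \<open>det Tc\<close>, cancelled by
  \<open>den\<close>. The time is interior because the velocity occurs.\<close>

lemma flux_at_indep:
  assumes g: "good t e" and t: "t \<in> {0<..<1}" and x: "x \<in> X" "x' \<in> X" "p \<in> dom_of x" "p \<in> dom_of x'"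
    and c: "c \<in> A" "c' \<in> A" "F (p, t) \<in> dom_of c" "F (p, t) \<in> dom_of c'"
    and b: "(b \<circ> chart_inv x') differentiable (at (coord x' p))"
  shows "flux_at e c x t b p = flux_at e c' x' t b p"
proof -
  have pL: "p \<in> L" by (rule X_dom[OF x(1,3)])
  have t1: "t \<in> {0..1}" using t by simp
  let ?J = "tjac c c' (F (p, t))"
  have "det (row_upd (rws x c' t (coord x p)) j (vl c' p t)) = det ?J * det (row_upd (rws x c t (coord x p)) j (vl c p t))" for j
    unfolding rws_change_c[OF x(1) c(1,2) x(3) t1 c(3,4)] vl_change_c[OF x(1) c(1,2) x(3) t c(3,4)] by (rule row_upd_transform_right)
  then have 1: "flux_at e c x t b p = flux_at e c' x t b p" using goodD(2)[OF g pL c] by (simp add: flux_at_def sum_distrib_left mult_ac)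
  obtain T and Tc :: "complex^'n^'n" where T: "(transition x x' has_derivative T) (at (coord x p))" "Tc = (\<chi> k j. complex_of_real (matrix T $ k $ j))"
    "det Tc \<noteq> 0" "den x p = det Tc * den x' p"
    "rws x c' t (coord x p) = (\<chi> j. \<Sum>k\<in>UNIV. Tc $ k $ j *s rws x' c' t (coord x' p) $ k)"
    using change_of_chart_matrix[OF x] c(2,4) t1 by blast
  let ?b' = "Fd (b \<circ> chart_inv x') (coord x' p)"
  have ty: "transition x x' (coord x p) = coord x' p" by (rule transition_coord[OF X1[OF x(1)] x(3)])
  have db: "((b \<circ> chart_inv x') has_derivative ?b') (at (transition x x' (coord x p)))"
    unfolding ty using b by (simp add: frechet_derivative_works)
  from diff_chain_at[OF T(1) this]
  have 2: "((\<lambda>y. (b \<circ> chart_inv x') (transition x x' y)) has_derivative (\<lambda>v. ?b' (T v))) (at (coord x p))" by (simp add: o_def)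
  obtain O' where O': "open O'" "dom_of x' = L \<inter> O'" using XD(8)[OF x(2)] unfolding openin_open by blast
  have o: "open (coord x ` (dom_of x \<inter> O'))" by (rule submanifold_chart_image_open[OF A x(1) O'(1)])
  have yo: "coord x p \<in> coord x ` (dom_of x \<inter> O')" using x(3,4) O'(2) by blast
  have "((b \<circ> chart_inv x) has_derivative (\<lambda>v. ?b' (T v))) (at (coord x p))"
  proof (rule has_derivative_transform_within_open[OF 2 o yo])
    fix y assume "y \<in> coord x ` (dom_of x \<inter> O')"
    then obtain q where q: "y = coord x q" "q \<in> dom_of x" "q \<in> O'" by blast
    have q': "q \<in> dom_of x'" using q(2,3) O'(2) X_dom[OF x(1)] by blast
    show "(b \<circ> chart_inv x') (transition x x' y) = (b \<circ> chart_inv x) y"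
      unfolding q(1) transition_coord[OF X1[OF x(1)] q(2)] by (simp add: XD(4)[OF x(1) q(2)] XD(4)[OF x(2) q'])
  qed
  from frechet_derivative_at[OF this, symmetric]
  have "Fd (b \<circ> chart_inv x) (coord x p) (axis j 1) = ?b' (T (axis j 1))" for j by simp
  also have "?b' (T (axis j 1)) = (\<Sum>k\<in>UNIV. (T (axis j 1) $ k) *\<^sub>R ?b' (axis k 1))" for j
    by (rule cpt_linear_axis_expand[OF has_derivative_linear[OF db]])
  finally have 3: "complex_of_real (Fd (b \<circ> chart_inv x) (coord x p) (axis j 1)) =
    (\<Sum>k\<in>UNIV. Tc $ k $ j * complex_of_real (?b' (axis k 1)))" for j by (simp add: T(2) matrix_def)
  have "(\<Sum>j\<in>UNIV. complex_of_real (Fd (b \<circ> chart_inv x) (coord x p) (axis j 1)) *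
    det (row_upd (rws x c' t (coord x p)) j (vl c' p t))) =
    det Tc * (\<Sum>k\<in>UNIV. complex_of_real (?b' (axis k 1)) * det (row_upd (rws x' c' t (coord x' p)) k (vl c' p t)))"
    unfolding 3 T(5) by (rule row_upd_transform_left[OF T(3)])
  then have "flux_at e c' x t b p = flux_at e c' x' t b p" using T(3) by (simp add: flux_at_def T(4))
  then show ?thesis using 1 by simp
qed

end

section \<open>Partitions of unity\<close>

text \<open>The square of the positive part is C^1 across 0, and cut-offs of class C^1 are what the
  integration by parts requires.\<close>

lemma Ck_on_max_square:
  fixes f :: "'a::real_normed_vector \<Rightarrow> real"
  assumes "open S" "Ck_on (Suc 0) S f"
  shows "Ck_on (Suc 0) S (\<lambda>x. (max 0 (f x))\<^sup>2)"
proof -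
  have sq: "((\<lambda>s. (max 0 s)\<^sup>2) has_field_derivative 2 * max 0 s) (at s)" for s :: real
  proof -
    \<comment> \<open>A quadratic bound for the remainder, valid for all signs of \<open>s\<close>
      and \<open>y\<close>; it permits the choice of \<open>e\<close> itself as the radius
      below.\<close>
    have 1: "\<bar>(max 0 y)\<^sup>2 - (max 0 s)\<^sup>2 - 2 * max 0 s * (y - s)\<bar> \<le> \<bar>y - s\<bar> * \<bar>y - s\<bar>" for y
    proof (cases "0 \<le> s"; cases "0 \<le> y")
      assume "\<not> 0 \<le> s" "0 \<le> y"
      then have "y * y \<le> (y - s) * (y - s)" by (intro mult_mono) auto
      then show ?thesis using \<open>\<not> 0 \<le> s\<close> \<open>0 \<le> y\<close> by (simp add: max_def power2_eq_square)
    next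
      assume h: "0 \<le> s" "\<not> 0 \<le> y"
      have "- (s * s) - 2 * s * (y - s) = s * s - 2 * s * y" by (simp add: algebra_simps)
      moreover have "0 \<le> s * s - 2 * s * y"
      proof -
        have "s * y \<le> 0" "0 \<le> s * s" using h by (simp_all add: mult_nonneg_nonpos)
        then show ?thesis by linarith
      qed
      moreover have "s * s - 2 * s * y \<le> (y - s) * (y - s)" by (simp add: algebra_simps)
      moreover have "\<bar>y - s\<bar> * \<bar>y - s\<bar> = (y - s) * (y - s)" by (rule abs_mult_self_eq)
      ultimately show ?thesis using h by (simp add: max_def power2_eq_square)
    next
      assume h: "0 \<le> s" "0 \<le> y"
      have "y * y - s * s - 2 * s * (y - s) = (y - s) * (y - s)" by (simp add: algebra_simps)
      then show ?thesis using h by (simp add: max_def power2_eq_square)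
    qed (simp add: max_def)
    show ?thesis unfolding has_field_derivative_def has_derivative_at_alt
    proof (intro conjI allI impI)
      show "bounded_linear ((*) (2 * max 0 s))" by (rule bounded_linear_mult_right)
      fix e :: real assume e: "0 < e"
      show "\<exists>d>0. \<forall>y. norm (y - s) < d \<longrightarrow>
        norm ((max 0 y)\<^sup>2 - (max 0 s)\<^sup>2 - 2 * max 0 s * (y - s)) \<le> e * norm (y - s)"
      proof (intro exI[of _ e] conjI allI impI e)
        fix y assume "norm (y - s) < e"
        then have "\<bar>y - s\<bar> * \<bar>y - s\<bar> \<le> e * \<bar>y - s\<bar>" by (intro mult_right_mono) auto
        then show "norm ((max 0 y)\<^sup>2 - (max 0 s)\<^sup>2 - 2 * max 0 s * (y - s)) \<le> e * norm (y - s)"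
          using order_trans[OF 1[of y]] by (simp only: real_norm_def)
      qed
    qed
  qed
  have der: "((\<lambda>x. (max 0 (f x))\<^sup>2) has_derivative (\<lambda>v. 2 * max 0 (f x) * Fd f x v)) (at x)" if "x \<in> S" for x
    using diff_chain_at[OF Ck_on_has_derivative[OF assms(2) that] sq[unfolded has_field_derivative_def]] by (simp add: o_def)
  have "continuous_on S (\<lambda>x. 2 * max 0 (f x) * Fd f x v)" for v
    using Ck_on_1_continuous[OF assms(2)] by (intro continuous_on_mult continuous_on_max continuous_on_const)
  then show ?thesis using Ck_on_Suc_iff[OF assms(1) der, of 0] by simp
qed

context homotopy_setup
begin

lemma submanifold_chart_Ck:
  assumes "x \<in> X" "c \<in> A"
  shows "Ck_on j (coord x ` (dom_of x \<inter> dom_of c)) (coord c \<circ> chart_inv x)"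
  by (rule smooth_on_Ck_on[OF submanifold_chart_image_open[OF A assms(1) cm(4)[OF assms(2)]] submanifold_chartsD(2)[OF assms]])

text \<open>The squared positive part of r^2 - |z - a|^2 in a chart of the ambient manifold,
  extended by 0; its regularity is measured in the charts of \<open>L\<close>.\<close>

lemma bump_exists:
  assumes "open U" "p \<in> U"
  shows "\<exists>b K. compact K \<and> K \<subseteq> U \<and> (\<forall>q. 0 \<le> b q) \<and> b p > 0 \<and> open {q. b q > (0::real)} \<and> (\<forall>q. q \<notin> K \<longrightarrow> b q = 0) \<and>
    (\<forall>x\<in>X. Ck_on (Suc 0) (img x) (b \<circ> chart_inv x))"
proof -
  obtain c where c: "c \<in> A" "p \<in> dom_of c" using cm(2) by blast
  note CD = chart_onD[OF cm(1)[OF c(1)]]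
  let ?a = "coord c p"
  have oV: "open (coord c ` (U \<inter> dom_of c))" using chart_image_open[OF cm(1)[OF c(1)], of U] assms(1) by simp
  have "?a \<in> coord c ` (U \<inter> dom_of c)" using assms(2) c(2) by blast
  then obtain r where r: "r > 0" "cball ?a r \<subseteq> coord c ` (U \<inter> dom_of c)" using oV open_contains_cball by metis
  define K where "K = chart_inv c ` cball ?a r"
  have cb: "cball ?a r \<subseteq> coord c ` dom_of c" using r(2) by blast
  have K: "compact K" unfolding K_def by (rule compact_continuous_image[OF continuous_on_subset[OF CD(3) cb] compact_cball])
  have KU: "K \<subseteq> U \<inter> dom_of c"
  proof
    fix q assume "q \<in> K"
    then obtain z where z: "z \<in> cball ?a r" "q = chart_inv c z" by (auto simp: K_def)
    then obtain q' where "z = coord c q'" "q' \<in> U" "q' \<in> dom_of c" using r(2) by blast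
    then show "q \<in> U \<inter> dom_of c" using z(2) CD(4)[of q'] by simp
  qed
  define h where "h z = r\<^sup>2 - (z - ?a) \<bullet> (z - ?a)" for z
  define b where "b q = (if q \<in> dom_of c then (max 0 (h (coord c q)))\<^sup>2 else 0)" for q
  have hpos: "h z > 0 \<longleftrightarrow> norm (z - ?a) < r" for z
  proof -
    have "h z = r\<^sup>2 - (norm (z - ?a))\<^sup>2" unfolding h_def power2_norm_eq_inner ..
    moreover have "(norm (z - ?a))\<^sup>2 < r\<^sup>2 \<longleftrightarrow> norm (z - ?a) < r"
    proof
      show "(norm (z - ?a))\<^sup>2 < r\<^sup>2 \<Longrightarrow> norm (z - ?a) < r" by (erule power2_less_imp_less) (use r(1) in simp)
      show "norm (z - ?a) < r \<Longrightarrow> (norm (z - ?a))\<^sup>2 < r\<^sup>2" by (erule power_strict_mono) simp_all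
    qed
    ultimately show ?thesis by simp
  qed
  have b0: "b q = 0" if "q \<notin> K" for q
  proof (cases "q \<in> dom_of c")
    case True
    have "coord c q \<notin> cball ?a r" using that CD(4)[OF True] by (metis K_def imageI)
    then have "\<not> h (coord c q) > 0" by (simp add: hpos dist_norm norm_minus_commute)
    then show ?thesis by (simp add: b_def max_def)
  qed (simp add: b_def)
  have bp: "b p > 0" using c(2) hpos[of ?a] r(1) by (simp add: b_def max_def)
  have "{q. b q > 0} = {q \<in> dom_of c. coord c q \<in> {z. h z > 0}}" by (auto simp: b_def max_def split: if_splits)
  moreover have "open {z. h z > 0}" unfolding h_def by (intro open_Collect_less continuous_intros)
  ultimately have bo: "open {q. b q > 0}" using chart_preimage_open[OF cm(1)[OF c(1)], of "{z. h z > 0}"] by simp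
  have bC: "Ck_on (Suc 0) (img x) (b \<circ> chart_inv x)" if x: "x \<in> X" for x
  proof (rule Ck_on_local)
    fix y assume y: "y \<in> img x"
    let ?q = "chart_inv x y"
    have q: "?q \<in> dom_of x" "coord x ?q = y" using XD(5)[OF x y] XD(6)[OF x y] by simp_all
    show "\<exists>T. open T \<and> y \<in> T \<and> Ck_on (Suc 0) T (b \<circ> chart_inv x)"
    proof (cases "?q \<in> dom_of c")
      case True
      let ?T = "coord x ` (dom_of x \<inter> dom_of c)"
      have oT: "open ?T" by (rule submanifold_chart_image_open[OF A x cm(4)[OF c(1)]])
      have yT: "y \<in> ?T" using q True by (metis IntI imageI)
      have G: "Ck_on (Suc 0) ?T (coord c \<circ> chart_inv x)" by (rule submanifold_chart_Ck[OF x c(1)])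
      have "Ck_on (Suc 0) ?T (\<lambda>y. (coord c \<circ> chart_inv x) y + (- ?a))" by (intro Ck_on_add oT G Ck_on_const)
      from Ck_on_add[OF oT Ck_on_const[of _ _ "r\<^sup>2"] Ck_on_bounded_linear[OF oT bounded_linear_minus[OF bounded_linear_ident] Ck_on_inner[OF oT this this]]]
      have "Ck_on (Suc 0) ?T (\<lambda>y. r\<^sup>2 + - (((coord c \<circ> chart_inv x) y + (- ?a)) \<bullet> ((coord c \<circ> chart_inv x) y + (- ?a))))" .
      then have "Ck_on (Suc 0) ?T (\<lambda>y. h ((coord c \<circ> chart_inv x) y))" by (simp only: h_def diff_conv_add_uminus)
      from Ck_on_max_square[OF oT this]
      have "Ck_on (Suc 0) ?T (\<lambda>y. (max 0 (h ((coord c \<circ> chart_inv x) y)))\<^sup>2)" .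
      moreover have "(max 0 (h ((coord c \<circ> chart_inv x) y)))\<^sup>2 = (b \<circ> chart_inv x) y" if yy: "y \<in> ?T" for y
      proof -
        obtain q where q: "y = coord x q" "q \<in> dom_of x" "q \<in> dom_of c" using yy by blast
        then show ?thesis by (simp add: b_def XD(4)[OF x])
      qed
      ultimately have "Ck_on (Suc 0) ?T (b \<circ> chart_inv x)" using Ck_on_cong[OF oT, of "\<lambda>y. (max 0 (h ((coord c \<circ> chart_inv x) y)))\<^sup>2"] by blast
      then show ?thesis using oT yT by blast
    next
      case False
      let ?T = "coord x ` (dom_of x \<inter> (- K))"
      have oT: "open ?T" by (rule submanifold_chart_image_open[OF A x open_Compl[OF compact_imp_closed[OF K]]])
      have "?q \<notin> K" using False KU by blast
      then have yT: "y \<in> ?T" using q by (metis ComplI IntI imageI)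
      have "(b \<circ> chart_inv x) y = 0" if yy: "y \<in> ?T" for y
      proof -
        obtain q where q: "y = coord x q" "q \<in> dom_of x" "q \<notin> K" using yy by blast
        then show ?thesis by (simp add: b0 XD(4)[OF x])
      qed
      then have "Ck_on (Suc 0) ?T (b \<circ> chart_inv x)"
        using Ck_on_cong[OF oT, of "\<lambda>_. 0" "b \<circ> chart_inv x"] Ck_on_const by metis
      then show ?thesis using oT yT by blast
    qed
  qed
  show ?thesis by (intro exI[of _ b] exI[of _ K] conjI K bp bo) (use KU b0 bC in \<open>auto simp: b_def\<close>)
qed

text \<open>Finitely many bump functions are divided by their sum. That sum is known to be positive
  on \<open>L\<close>, so the functions add up to 1 there and are regular in the charts of
  \<open>L\<close>.\<close>

lemma partition_of_unity:
  assumes U: "\<And>p. p \<in> L \<Longrightarrow> open (U p) \<and> p \<in> U p"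
  obtains P b K where "finite P" "P \<subseteq> L" "\<And>p. p \<in> P \<Longrightarrow> compact (K p) \<and> K p \<subseteq> U p"
    "\<And>p q. p \<in> P \<Longrightarrow> q \<notin> K p \<Longrightarrow> b p q = (0::real)"
    "\<And>q. q \<in> L \<Longrightarrow> (\<Sum>p\<in>P. b p q) = 1" "\<And>p x. p \<in> P \<Longrightarrow> x \<in> X \<Longrightarrow> Ck_on (Suc 0) (img x) (b p \<circ> chart_inv x)"
proof -
  have "\<exists>b K. compact K \<and> K \<subseteq> U p \<and> (\<forall>q. 0 \<le> b q) \<and> b p > 0 \<and> open {q. b q > (0::real)} \<and> (\<forall>q. q \<notin> K \<longrightarrow> b q = 0) \<and>
    (\<forall>x\<in>X. Ck_on (Suc 0) (img x) (b \<circ> chart_inv x))" if "p \<in> L" for p by (rule bump_exists) (use U[OF that] in blast)+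
  then obtain b K where b: "\<And>p. p \<in> L \<Longrightarrow> compact (K p) \<and> K p \<subseteq> U p \<and> (\<forall>q. 0 \<le> b p q) \<and> b p p > 0 \<and> open {q. b p q > (0::real)} \<and>
    (\<forall>q. q \<notin> K p \<longrightarrow> b p q = 0) \<and> (\<forall>x\<in>X. Ck_on (Suc 0) (img x) (b p \<circ> chart_inv x))"
    by metis
  obtain P where P: "P \<subseteq> L" "finite P" "L \<subseteq> (\<Union>p\<in>P. {q. b p q > 0})"
  proof (rule compactE_image[OF L, of L "\<lambda>p. {q. b p q > 0}"])
    show "open {q. b p q > 0}" if "p \<in> L" for p using b[OF that] by blast
    show "L \<subseteq> (\<Union>p\<in>L. {q. b p q > 0})" using b by blast
  qed
  let ?s = "\<lambda>q. \<Sum>p\<in>P. b p q"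
  have spos: "?s q > 0" if q: "q \<in> L" for q
  proof -
    obtain p where p: "p \<in> P" "b p q > 0" using P(3) q by blast
    have "b p q \<le> ?s q" by (rule member_le_sum[OF p(1) _ P(2)]) (use b P(1) in blast)
    then show ?thesis using p(2) by simp
  qed
  define B where "B p q = b p q * inverse (?s q)" for p q
  show thesis
  proof (rule that[OF P(2,1), of K B])
    show "compact (K p) \<and> K p \<subseteq> U p" if "p \<in> P" for p using b P(1) that by blast
    show "B p q = 0" if "p \<in> P" "q \<notin> K p" for p q
    proof -
      have "b p q = 0" using b[of p] P(1) that by blast
      then show ?thesis by (simp add: B_def)
    qed
    show "(\<Sum>p\<in>P. B p q) = 1" if "q \<in> L" for q using spos[OF that] by (simp add: B_def sum_distrib_right[symmetric])
    fix p x assume p: "p \<in> P" and x: "x \<in> X"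
    have o: "open (img x)" by (rule XD(1)[OF x])
    have bx: "Ck_on (Suc 0) (img x) (\<lambda>y. b p (chart_inv x y))" if "p \<in> P" for p
    proof -
      have "Ck_on (Suc 0) (img x) (b p \<circ> chart_inv x)" using b[of p] P(1) that x by blast
      then show ?thesis by (simp only: o_def)
    qed
    have "?s (chart_inv x y) \<noteq> 0" if "y \<in> img x" for y using spos[OF X_dom[OF x XD(5)[OF x that]]] by simp
    then have "Ck_on (Suc 0) (img x) (\<lambda>y. b p (chart_inv x y) * inverse (\<Sum>p\<in>P. b p (chart_inv x y)))"
      by (intro Ck_on_mult Ck_on_inverse Ck_on_sum o bx p) auto
    then show "Ck_on (Suc 0) (img x) (B p \<circ> chart_inv x)" by (simp only: o_def B_def)
  qed
qed

end

section \<open>Invariance of the total density\<close>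

text \<open>\<mu> is the reference measure on \<open>L\<close>, regarded as a measure on the whole
  manifold; the functions below are integrated against it.\<close>

locale homotopy_measure = homotopy_setup A L F \<phi> k \<delta> C
  for A :: "('a::{t2_space,second_countable_topology}, 'n::finite) cchart set" and L F \<phi> k \<delta> C +
  fixes \<mu> :: "'a measure"
  assumes \<delta>cont: "\<And>x. x \<in> submanifold_charts A L \<Longrightarrow> continuous_on (coord x ` dom_of x) (\<delta> x)"
    and \<mu>: "represents_densities (submanifold_charts A L) \<delta> \<mu>"
begin

lemma L_borel: "L \<in> sets borel" using compact_imp_closed[OF L] by simp

lemma sets_\<mu>: "sets \<mu> = sets borel" using \<mu> unfolding represents_densities_def by blast

lemma \<mu>_chart: "x \<in> X \<Longrightarrow> B \<in> sets borel \<Longrightarrow> B \<subseteq> dom_of x \<Longrightarrow> emeasure \<mu> B = (\<integral>\<^sup>+y\<in>coord x ` B. ennreal (\<delta> x y) \<partial>lborel)"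
  using \<mu> unfolding represents_densities_def by blast

text \<open>Continuity in the charts makes \<open>f\<close> continuous on \<open>L\<close>, which is
  closed and hence Borel, and \<open>f\<close> is 0 elsewhere.\<close>

lemma borel_measurable_locally:
  fixes f :: "'a \<Rightarrow> complex"
  assumes f0: "\<And>p. p \<notin> L \<Longrightarrow> f p = 0"
    and loc: "\<And>p. p \<in> L \<Longrightarrow> \<exists>x U. x \<in> X \<and> p \<in> dom_of x \<and> open U \<and> coord x p \<in> U \<and> U \<subseteq> img x \<and> continuous_on U (f \<circ> chart_inv x)"
  shows "f \<in> borel_measurable borel"
proof -
  have "continuous_on L f"
  proof (rule continuous_on_locally_open)
    fix p assume "p \<in> L"
    then obtain x U where x: "x \<in> X" "p \<in> dom_of x" "open U" "coord x p \<in> U" "U \<subseteq> img x" "continuous_on U (f \<circ> chart_inv x)"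
      using loc by blast
    have "openin (top_of_set (dom_of x)) (dom_of x \<inter> coord x -` U)" by (rule continuous_openin_preimage_gen[OF XD(2)[OF x(1)] x(3)])
    then have "openin (top_of_set L) (dom_of x \<inter> coord x -` U)" using XD(8)[OF x(1)] openin_trans by blast
    then obtain T where T: "open T" "dom_of x \<inter> coord x -` U = L \<inter> T" unfolding openin_open by blast
    have "continuous_on (L \<inter> T) (\<lambda>q. (f \<circ> chart_inv x) (coord x q))"
    proof (rule continuous_on_compose2[OF x(6)])
      show "continuous_on (L \<inter> T) (coord x)" by (rule continuous_on_subset[OF XD(2)[OF x(1)]]) (use T(2) in blast)
      show "coord x ` (L \<inter> T) \<subseteq> U" using T(2) by blast
    qed
    then have "continuous_on (L \<inter> T) f"
    proof (rule continuous_on_eq)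
      fix q assume "q \<in> L \<inter> T"
      then have "q \<in> dom_of x" using T(2) by blast
      then show "(f \<circ> chart_inv x) (coord x q) = f q" by (simp add: XD(4)[OF x(1)])
    qed
    moreover have "p \<in> T" using T(2) x(2,4) by blast
    ultimately show "\<exists>T. open T \<and> p \<in> T \<and> continuous_on (L \<inter> T) f" using T(1) by blast
  qed
  then have "(\<lambda>p. indicator L p *\<^sub>R f p) \<in> borel_measurable borel"
    by (rule borel_measurable_continuous_on_indicator[OF L_borel])
  moreover have "indicator L p *\<^sub>R f p = f p" for p using f0[of p] by (auto simp: indicator_def)
  ultimately show ?thesis by simp
qed

definition xp :: "'a \<Rightarrow> ('a, real^'n) chart" where
  "xp p = (SOME x. x \<in> X \<and> p \<in> dom_of x)"

lemma xp: "p \<in> L \<Longrightarrow> xp p \<in> X \<and> p \<in> dom_of (xp p)" unfolding xp_def by (rule someI_ex) (use X_exists in blast)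

text \<open>An arbitrary choice of charts gives a total function; by \<open>rr_eq\<close> any other
  admissible charts compute the same value for a root field.\<close>

definition rr :: "(('a, 'n) cchart \<Rightarrow> 'a \<Rightarrow> complex) \<Rightarrow> real \<Rightarrow> 'a \<Rightarrow> complex" where
  "rr e t p = (if p \<in> L then dens_at e (cp (F (p, t))) (xp p) t p else 0)"

definition ff :: "(('a, 'n) cchart \<Rightarrow> 'a \<Rightarrow> complex) \<Rightarrow> real \<Rightarrow> ('a \<Rightarrow> real) \<Rightarrow> 'a \<Rightarrow> complex" where
  "ff e t b p = (if p \<in> L then flux_at e (cp (F (p, t))) (xp p) t b p else 0)"

lemma rr_eq:
  assumes "good t e" "t \<in> {0..1}" "x \<in> X" "p \<in> dom_of x" "c \<in> A" "F (p, t) \<in> dom_of c"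
  shows "rr e t p = dens_at e c x t p"
  using dens_at_indep[OF assms(1,2) _ assms(3) _ assms(4) cpA(1) assms(5) cpA(2) assms(6)] xp X_dom[OF assms(3,4)] by (simp add: rr_def)

lemma ff_eq:
  assumes "good t e" "t \<in> {0<..<1}" "x \<in> X" "p \<in> dom_of x" "c \<in> A" "F (p, t) \<in> dom_of c"
    "(b \<circ> chart_inv x) differentiable (at (coord x p))"
  shows "ff e t b p = flux_at e c x t b p"
  using flux_at_indep[OF assms(1,2) _ assms(3) _ assms(4) cpA(1) assms(5) cpA(2) assms(6,7)] xp X_dom[OF assms(3,4)] by (simp add: ff_def)

lemma continuous_on_dens_slice:
  assumes "good t e" "t \<in> {0..1}" "x \<in> X" "c \<in> A"
  shows "continuous_on {y. (y, t) \<in> dmn x c {0..1}} (rr e t \<circ> chart_inv x)"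
proof -
  let ?S = "{y. (y, t) \<in> dmn x c {0..1}}"
  have "continuous_on ?S (\<lambda>y. (\<lambda>z. rws x c (snd z) (fst z)) (y, t))"
    by (rule continuous_on_compose2[OF continuous_on_rws[OF assms(3,4)]]) (auto intro!: continuous_intros)
  then have "continuous_on ?S (\<lambda>y. det (rws x c t y))" by (intro continuous_on_det) simp
  from continuous_on_mult[OF goodD(3)[OF assms(1,3,4)] this]
  show ?thesis
  proof (rule continuous_on_eq)
    fix y assume "y \<in> ?S"
    then have y: "y \<in> img x" "F (chart_inv x y, t) \<in> dom_of c" by (simp_all add: dmn_def)
    from rr_eq[OF assms(1-3) XD(5)[OF assms(3) y(1)] assms(4) y(2)]
    show "e c (chart_inv x y) / den x (chart_inv x y) * det (rws x c t y) = (rr e t \<circ> chart_inv x) y"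
      by (simp add: dens_at_def XD(6)[OF assms(3) y(1)])
  qed
qed

lemma chart_point:
  assumes "p \<in> L"
  obtains x c where "x \<in> X" "p \<in> dom_of x" "c \<in> A" "F (p, t) \<in> dom_of c" using X_exists[OF assms] cpA by metis

lemma dmn_slice:
  assumes "x \<in> X" "p \<in> dom_of x" "t \<in> T" "F (p, t) \<in> dom_of c"
  shows "coord x p \<in> {y. (y, t) \<in> dmn x c T}" "{y. (y, t) \<in> dmn x c T} \<subseteq> img x"
  using mem_dmn[OF assms(1,2), of t c T] assms(3,4) by (simp, auto simp: dmn_def)

lemma rr_measurable:
  assumes "good t e" "t \<in> {0..1}" and b: "\<And>x. x \<in> X \<Longrightarrow> continuous_on (img x) (b \<circ> chart_inv x)"
  shows "(\<lambda>p. of_real (b p) * rr e t p) \<in> borel_measurable borel"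
proof (rule borel_measurable_locally)
  show "of_real (b p) * rr e t p = 0" if "p \<notin> L" for p using that by (simp add: rr_def)
  fix p assume "p \<in> L"
  then obtain x c where x: "x \<in> X" "p \<in> dom_of x" "c \<in> A" "F (p, t) \<in> dom_of c" using chart_point by metis
  let ?S = "{y. (y, t) \<in> dmn x c {0..1}}"
  note S = dmn_slice[OF x(1,2) assms(2) x(4)]
  have "continuous_on ?S (\<lambda>y. of_real ((b \<circ> chart_inv x) y) * (rr e t \<circ> chart_inv x) y)"
    by (intro continuous_on_mult continuous_on_of_real continuous_on_subset[OF b[OF x(1)] S(2)]
      continuous_on_dens_slice[OF assms(1,2) x(1,3)])
  then have "continuous_on ?S ((\<lambda>p. of_real (b p) * rr e t p) \<circ> chart_inv x)" by (simp only: o_def)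
  then show "\<exists>x U. x \<in> X \<and> p \<in> dom_of x \<and> open U \<and> coord x p \<in> U \<and> U \<subseteq> img x \<and>
    continuous_on U ((\<lambda>p. of_real (b p) * rr e t p) \<circ> chart_inv x)" using x(1,2) S open_slice[OF x(1,3) assms(2)] by blast
qed

lemma ff_measurable:
  assumes "good t e" "t \<in> {0<..<1}" and b: "\<And>x. x \<in> X \<Longrightarrow> Ck_on (Suc 0) (img x) (b \<circ> chart_inv x)"
  shows "ff e t b \<in> borel_measurable borel"
proof (rule borel_measurable_locally)
  show "ff e t b p = 0" if "p \<notin> L" for p using that by (simp add: ff_def)
  fix p assume "p \<in> L"
  then obtain x c where x: "x \<in> X" "p \<in> dom_of x" "c \<in> A" "F (p, t) \<in> dom_of c" using chart_point by metis
  have t: "t \<in> {0..1}" using assms(2) by simp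
  let ?S = "{y. (y, t) \<in> dmn x c {0..1}}"
  note S = dmn_slice[OF x(1,2) t x(4)]
  have S': "(\<lambda>y. (y, t)) ` ?S \<subseteq> dmn x c {0<..<1}" using assms(2) by (auto simp: dmn_def)
  have pr: "continuous_on ?S (\<lambda>y. (y, t))" by (intro continuous_intros)
  have "continuous_on ?S (\<lambda>y. (\<lambda>z. rws x c (snd z) (fst z)) (y, t))"
    by (rule continuous_on_compose2[OF continuous_on_rws[OF x(1,3)] pr]) blast
  then have c1: "continuous_on ?S (\<lambda>y. rws x c t y)" by simp
  have "Ck_on (Suc 0) (dmn x c {0<..<1}) (loc x c)" by (rule loc_Ck_on[OF x(1,3)]) auto
  from continuous_on_compose2[OF Ck_on_1_continuous(1)[OF this] pr S']
  have c2: "continuous_on ?S (\<lambda>y. Fd (loc x c) (y, t) (0, 1))" .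
  have ru: "continuous_on ?S (\<lambda>y. row_upd (rws x c t y) j (Fd (loc x c) (y, t) (0, 1)))" for j unfolding row_upd_def
  proof (rule continuous_on_vec_lambda)
    fix i show "continuous_on ?S (\<lambda>y. if i = j then Fd (loc x c) (y, t) (0, 1) else rws x c t y $ i)"
      using c1 c2 by (cases "i = j") (simp_all add: continuous_on_component)
  qed
  have b': "continuous_on ?S (\<lambda>y. Fd (b \<circ> chart_inv x) y v)" for v
    by (rule continuous_on_subset[OF Ck_on_1_continuous(1)[OF b[OF x(1)]] S(2)])
  have "continuous_on ?S (\<lambda>y. e c (chart_inv x y) / den x (chart_inv x y) *
    (\<Sum>j\<in>UNIV. of_real (Fd (b \<circ> chart_inv x) y (axis j 1)) * det (row_upd (rws x c t y) j (Fd (loc x c) (y, t) (0, 1)))))"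
    by (intro continuous_on_mult continuous_on_sum continuous_on_of_real goodD(3)[OF assms(1) x(1,3)] b' continuous_on_det ru)
  then have "continuous_on ?S (ff e t b \<circ> chart_inv x)"
  proof (rule continuous_on_eq)
    fix y assume yS: "y \<in> ?S"
    then have y: "y \<in> img x" "F (chart_inv x y, t) \<in> dom_of c" by (simp_all add: dmn_def)
    note q = XD(5)[OF x(1) y(1)] and cq = XD(6)[OF x(1) y(1)]
    have db: "(b \<circ> chart_inv x) differentiable (at (coord x (chart_inv x y)))"
      unfolding cq using Ck_on_has_derivative[OF b[OF x(1)] y(1)] by (rule differentiableI)
    have "(coord x (chart_inv x y), t) \<in> dmn x c {0<..<1}" using yS S' by (simp add: cq image_subset_iff)
    from vl_interior[OF x(1,3) q this] ff_eq[OF assms(1,2) x(1) q x(3) y(2) db]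
    show "e c (chart_inv x y) / den x (chart_inv x y) * (\<Sum>j\<in>UNIV. of_real (Fd (b \<circ> chart_inv x) y (axis j 1)) *
      det (row_upd (rws x c t y) j (Fd (loc x c) (y, t) (0, 1)))) = (ff e t b \<circ> chart_inv x) y" by (simp add: flux_at_def cq)
  qed
  then show "\<exists>x U. x \<in> X \<and> p \<in> dom_of x \<and> open U \<and> coord x p \<in> U \<and> U \<subseteq> img x \<and> continuous_on U (ff e t b \<circ> chart_inv x)"
    using x(1,2) S open_slice[OF x(1,3) t] by blast
qed

lemma ff_zero:
  assumes "p \<in> L" "closed K" "p \<notin> K" "\<And>q. q \<notin> K \<Longrightarrow> b q = 0"
  shows "ff e t b p = 0"
proof -
  note x = xp[OF assms(1), THEN conjunct1] xp[OF assms(1), THEN conjunct2]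
  let ?T = "coord (xp p) ` (dom_of (xp p) \<inter> - K)"
  have o: "open ?T" by (rule submanifold_chart_image_open[OF A x(1) open_Compl[OF assms(2)]])
  have m: "coord (xp p) p \<in> ?T" using x(2) assms(3) by blast
  have "((b \<circ> chart_inv (xp p)) has_derivative (\<lambda>v. 0)) (at (coord (xp p) p))"
  proof (rule has_derivative_transform_within_open[OF has_derivative_const[of 0] o m])
    fix y assume "y \<in> ?T"
    then obtain q where q: "y = coord (xp p) q" "q \<in> dom_of (xp p)" "q \<notin> K" by blast
    then show "0 = (b \<circ> chart_inv (xp p)) y" by (simp add: XD(4)[OF x(1)] assms(4))
  qed
  from frechet_derivative_at[OF this, symmetric] show ?thesis by (simp add: ff_def flux_at_def)
qed

text \<open>The functions add up to 1 on \<open>L\<close>, so their differentials add up to 0. Hence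
  the terms left over by the localised integrations by parts cancel.\<close>

lemma sum_ff_zero:
  assumes "finite P" "\<And>q. q \<in> L \<Longrightarrow> (\<Sum>p\<in>P. b p q) = 1"
    and b: "\<And>p x. p \<in> P \<Longrightarrow> x \<in> X \<Longrightarrow> Ck_on (Suc 0) (img x) (b p \<circ> chart_inv x)"
  shows "(\<Sum>p\<in>P. ff e t (b p) q) = 0"
proof (cases "q \<in> L")
  case True
  note x = xp[OF True, THEN conjunct1] xp[OF True, THEN conjunct2]
  let ?x = "xp q" and ?y = "coord (xp q) q"
  have y: "?y \<in> img ?x" using x(2) by blast
  have d: "((b p \<circ> chart_inv ?x) has_derivative Fd (b p \<circ> chart_inv ?x) ?y) (at ?y)" if "p \<in> P" for p
    by (rule Ck_on_has_derivative[OF b[OF that x(1)] y])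
  have "((\<lambda>y. \<Sum>p\<in>P. (b p \<circ> chart_inv ?x) y) has_derivative (\<lambda>v. \<Sum>p\<in>P. Fd (b p \<circ> chart_inv ?x) ?y v)) (at ?y)"
    by (rule has_derivative_sum) (rule d)
  moreover have "((\<lambda>y. \<Sum>p\<in>P. (b p \<circ> chart_inv ?x) y) has_derivative (\<lambda>v. 0)) (at ?y)"
    by (rule has_derivative_transform_within_open[OF has_derivative_const[of 1] XD(1)[OF x(1)] y])
      (simp add: assms(2) X_dom[OF x(1) XD(5)[OF x(1)]])
  ultimately have "(\<lambda>v. \<Sum>p\<in>P. Fd (b p \<circ> chart_inv ?x) ?y v) = (\<lambda>v. 0)" by (rule has_derivative_unique)
  then have s: "(\<Sum>p\<in>P. Fd (b p \<circ> chart_inv ?x) ?y v) = 0" for v by (rule fun_cong)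
  let ?D = "\<lambda>j. det (row_upd (rws ?x (cp (F (q, t))) t ?y) j (vl (cp (F (q, t))) q t))"
  have "(\<Sum>p\<in>P. \<Sum>j\<in>UNIV. of_real (Fd (b p \<circ> chart_inv ?x) ?y (axis j 1)) * ?D j)
    = (\<Sum>j\<in>UNIV. of_real (\<Sum>p\<in>P. Fd (b p \<circ> chart_inv ?x) ?y (axis j 1)) * ?D j)"
    by (subst sum.swap) (simp only: of_real_sum sum_distrib_right)
  also have "\<dots> = 0" by (simp only: s of_real_0 mult_zero_left sum.neutral_const)
  finally have "(\<Sum>p\<in>P. \<Sum>j\<in>UNIV. of_real (Fd (b p \<circ> chart_inv ?x) ?y (axis j 1)) * ?D j) = 0" .
  then show ?thesis using True by (simp add: ff_def flux_at_def sum_divide_distrib[symmetric] sum_distrib_left[symmetric])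
qed (simp add: ff_def)

end

section \<open>Transport of a root field over a short time window\<close>

locale homotopy_window = homotopy_measure A L F \<phi> k \<delta> C \<mu>
  for A :: "('a::{t2_space,second_countable_topology}, 'n::finite) cchart set" and L F \<phi> k \<delta> C \<mu> +
  fixes J :: "real set" and a :: real and e :: "('a, 'n) cchart \<Rightarrow> 'a \<Rightarrow> complex"
  assumes J: "J \<subseteq> {0..1}" "convex J" "a \<in> J" and e: "good a e"
    and win: "\<And>p. p \<in> L \<Longrightarrow> \<exists>U c. open U \<and> p \<in> U \<and> c \<in> A \<and> (\<forall>q\<in>U \<inter> L. \<forall>t\<in>J. F (q, t) \<in> dom_of c)"
begin

text \<open>A chart that contains the path of \<open>p\<close> during all of \<open>J\<close>. It
  may jump with \<open>p\<close>, which does no harm because transport does not depend on it by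
  \<open>tr_eq\<close>.\<close>

definition pick :: "'a \<Rightarrow> ('a, 'n) cchart" where
  "pick p = (SOME c. c \<in> A \<and> (\<forall>t\<in>J. F (p, t) \<in> dom_of c))"

lemma pick:
  assumes "p \<in> L"
  shows "pick p \<in> A" "t \<in> J \<Longrightarrow> F (p, t) \<in> dom_of (pick p)"
proof -
  have "\<exists>c. c \<in> A \<and> (\<forall>t\<in>J. F (p, t) \<in> dom_of c)" using win[OF assms] assms by blast
  then have "pick p \<in> A \<and> (\<forall>t\<in>J. F (p, t) \<in> dom_of (pick p))" unfolding pick_def by (rule someI_ex)
  then show "pick p \<in> A" "t \<in> J \<Longrightarrow> F (p, t) \<in> dom_of (pick p)" by blast+
qed

text \<open>Continuation of \<open>e\<close> from time \<open>a\<close>: in the chart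
  \<open>pick p\<close> the coefficient is multiplied by the factor of the continued root, and the
  result is converted to the chart \<open>c\<close>.\<close>

definition tr :: "real \<Rightarrow> ('a, 'n) cchart \<Rightarrow> 'a \<Rightarrow> complex" where
  "tr t c p = e (pick p) p * root_tr k (\<lambda>s. \<phi> (pick p) (F (p, s))) a t * jac c (pick p) (F (p, t))"

lemma seg: "t \<in> J \<Longrightarrow> closed_segment a t \<subseteq> J" by (rule closed_segment_subset[OF J(3) _ J(2)])

lemma path_facts:
  assumes "p \<in> L" "c \<in> A" "\<And>s. s \<in> J \<Longrightarrow> F (p, s) \<in> dom_of c" "t \<in> J"
  shows "continuous_on (closed_segment a t) (\<lambda>s. \<phi> c (F (p, s)))"
    "s \<in> closed_segment a t \<Longrightarrow> \<phi> c (F (p, s)) \<noteq> 0"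
proof -
  have "continuous_on (closed_segment a t) (\<lambda>s. F (p, s))"
    by (rule continuous_on_path[OF assms(1)]) (use seg[OF assms(4)] J(1) in blast)
  then show "continuous_on (closed_segment a t) (\<lambda>s. \<phi> c (F (p, s)))"
    by (rule continuous_on_compose2[OF continuous_on_\<phi>[OF assms(2)]]) (use seg[OF assms(4)] assms(3) in blast)
  show "s \<in> closed_segment a t \<Longrightarrow> \<phi> c (F (p, s)) \<noteq> 0"
    using nz[OF assms(1) _ assms(2)] assms(3) seg[OF assms(4)] J(1) by blast
qed

text \<open>In two charts along the path the coefficients of \<phi> differ by the
  \<open>k\<close>-th power of a Jacobian without zeros. Its value at time \<open>a\<close> cancels
  against the change of \<open>e\<close>, and its value at time \<open>t\<close> is the change of
  chart of the result.\<close>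

lemma tr_eq:
  assumes p: "p \<in> L" and c: "c \<in> A" "\<And>s. s \<in> J \<Longrightarrow> F (p, s) \<in> dom_of c" and t: "t \<in> J" and c': "c' \<in> A" "F (p, t) \<in> dom_of c'"
  shows "tr t c' p = e c p * root_tr k (\<lambda>s. \<phi> c (F (p, s))) a t * jac c' c (F (p, t))"
proof -
  let ?d = "pick p"
  note d = pick[OF p]
  have sJ: "s \<in> J" if "s \<in> closed_segment a t" for s using seg[OF t] that by blast
  have cj: "continuous_on (closed_segment a t) (\<lambda>s. jac c ?d (F (p, s)))"
  proof (rule continuous_on_compose2[OF continuous_on_jac[OF c(1) d(1)] continuous_on_path[OF p]])
    show "closed_segment a t \<subseteq> {0..1}" using seg[OF t] J(1) by blast
    show "(\<lambda>s. F (p, s)) ` closed_segment a t \<subseteq> dom_of c \<inter> dom_of ?d" using sJ c(2) d(2) by blast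
  qed
  have jn: "jac c ?d (F (p, s)) \<noteq> 0" if "s \<in> J" for s by (rule jac_nonzero[OF c(1) d(1) c(2)[OF that] d(2)[OF that]])
  have 1: "root_tr k (\<lambda>s. \<phi> c (F (p, s))) a t = root_tr k (\<lambda>s. \<phi> ?d (F (p, s))) a t * (jac c ?d (F (p, t)) / jac c ?d (F (p, a)))"
  proof (rule root_tr_mult_power[OF path_facts[OF p d(1) d(2) t] k cj])
    show "jac c ?d (F (p, s)) \<noteq> 0" if "s \<in> closed_segment a t" for s by (rule jn[OF sJ[OF that]])
    show "\<phi> c (F (p, s)) = \<phi> ?d (F (p, s)) * jac c ?d (F (p, s)) ^ k" if "s \<in> closed_segment a t" for s
      by (rule \<phi>_change[OF c(1) d(1) c(2)[OF sJ[OF that]] d(2)[OF sJ[OF that]]])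
  qed
  have 2: "e c p = e ?d p * jac c ?d (F (p, a))" by (rule goodD(2)[OF e p c(1) d(1) c(2)[OF J(3)] d(2)[OF J(3)]])
  have 3: "jac c' ?d (F (p, t)) = jac c' c (F (p, t)) * jac c ?d (F (p, t))"
    by (rule jac_compose[OF c'(1) c(1) d(1) c'(2) c(2)[OF t] d(2)[OF t]])
  show ?thesis unfolding tr_def 1 2 3 using jn[OF J(3)] by simp
qed

lemma tr_a:
  assumes "p \<in> L" "c \<in> A" "F (p, a) \<in> dom_of c"
  shows "tr a c p = e c p"
proof -
  have "\<phi> (pick p) (F (p, a)) \<noteq> 0" using nz[OF assms(1) _ pick(1)[OF assms(1)] pick(2)[OF assms(1) J(3)]] J(1,3) by blast
  then have "root_tr k (\<lambda>s. \<phi> (pick p) (F (p, s))) a a = 1" by (rule root_tr_same)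
  then show ?thesis unfolding tr_def using goodD(2)[OF e assms(1,2) pick(1)[OF assms(1)] assms(3) pick(2)[OF assms(1) J(3)]] by simp
qed

definition patch :: "'a set \<Rightarrow> ('a, real^'n) chart \<Rightarrow> ('a, 'n) cchart \<Rightarrow> bool" where
  "patch U x c \<longleftrightarrow> open U \<and> x \<in> X \<and> c \<in> A \<and> L \<inter> U \<subseteq> dom_of x \<and> (\<forall>q\<in>L \<inter> U. \<forall>t\<in>J. F (q, t) \<in> dom_of c)"

lemma patch_exists:
  assumes "p \<in> L"
  shows "\<exists>U x c. patch U x c \<and> p \<in> U"
proof -
  obtain U c where U: "open U" "p \<in> U" "c \<in> A" "\<forall>q\<in>U \<inter> L. \<forall>t\<in>J. F (q, t) \<in> dom_of c" using win[OF assms] by blast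
  obtain x where x: "x \<in> X" "p \<in> dom_of x" using X_exists[OF assms] by blast
  obtain T where T: "open T" "dom_of x = L \<inter> T" using XD(8)[OF x(1)] unfolding openin_open by blast
  have "patch (U \<inter> T) x c" unfolding patch_def using U T x(1) by blast
  then show ?thesis using U(2) T(2) x(2) by blast
qed

text \<open>By \<open>\<delta>root\<close> the quotient of \<delta> by \<open>den\<close> is a
  \<open>k\<close>-th root of \<open>C p * \<phi> (cp p) p\<close>. Multiplication by it turns the
  quotient \<open>tr\<close> back into the coefficient of the continued n-form.\<close>

definition psi :: "('a, real^'n) chart \<Rightarrow> ('a, 'n) cchart \<Rightarrow> (real^'n) \<times> real \<Rightarrow> complex" where
  "psi x c z = tr (snd z) c (chart_inv x (fst z)) / den x (chart_inv x (fst z)) * of_real (\<delta> x (fst z))"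

abbreviation "pimg U x \<equiv> coord x ` (dom_of x \<inter> U)"

lemma patchD:
  assumes "patch U x c"
  shows "x \<in> X" "c \<in> A" "open (pimg U x)" "pimg U x \<subseteq> img x"
    "y \<in> pimg U x \<Longrightarrow> chart_inv x y \<in> dom_of x" "y \<in> pimg U x \<Longrightarrow> chart_inv x y \<in> L"
    "y \<in> pimg U x \<Longrightarrow> t \<in> J \<Longrightarrow> F (chart_inv x y, t) \<in> dom_of c" "y \<in> pimg U x \<Longrightarrow> coord x (chart_inv x y) = y"
    "pimg U x \<times> J \<subseteq> dmn x c {0..1}"
proof -
  show x: "x \<in> X" and c: "c \<in> A" using assms unfolding patch_def by blast+
  have "open U" using assms unfolding patch_def by blast
  then show "open (pimg U x)" by (rule submanifold_chart_image_open[OF A x])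
  show s: "pimg U x \<subseteq> img x" by blast
  have q: "chart_inv x y \<in> dom_of x \<and> chart_inv x y \<in> L \<and> coord x (chart_inv x y) = y \<and> (\<forall>t\<in>J. F (chart_inv x y, t) \<in> dom_of c)"
    if y: "y \<in> pimg U x" for y
  proof -
    obtain q where q: "y = coord x q" "q \<in> dom_of x" "q \<in> U" using y by blast
    have "q \<in> L" by (rule X_dom[OF x q(2)])
    then have "\<forall>t\<in>J. F (q, t) \<in> dom_of c" using assms q(3) unfolding patch_def by blast
    moreover have "chart_inv x y = q" unfolding q(1) by (rule XD(4)[OF x q(2)])
    ultimately show ?thesis using q(1,2) \<open>q \<in> L\<close> by simp
  qed
  show "y \<in> pimg U x \<Longrightarrow> chart_inv x y \<in> dom_of x" "y \<in> pimg U x \<Longrightarrow> chart_inv x y \<in> L"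
    "y \<in> pimg U x \<Longrightarrow> t \<in> J \<Longrightarrow> F (chart_inv x y, t) \<in> dom_of c" "y \<in> pimg U x \<Longrightarrow> coord x (chart_inv x y) = y"
    using q by blast+
  show "pimg U x \<times> J \<subseteq> dmn x c {0..1}"
  proof
    fix z assume "z \<in> pimg U x \<times> J"
    then have "fst z \<in> pimg U x" "snd z \<in> J" by auto
    then show "z \<in> dmn x c {0..1}" using q J(1) s unfolding dmn_def by blast
  qed
qed

text \<open>On a patch the chart \<open>c\<close> serves all the paths, so the field is its
  continuous value at time \<open>a\<close> times a root factor that is jointly continuous.\<close>

lemma continuous_on_tr:
  assumes "patch U x c"
  shows "continuous_on (pimg U x \<times> J) (\<lambda>z. tr (snd z) c (chart_inv x (fst z)) / den x (chart_inv x (fst z)))"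
proof -
  note P = patchD[OF assms]
  let ?V = "pimg U x"
  let ?g = "\<lambda>z. \<phi> c (F (chart_inv x (fst z), snd z))"
  have cF: "continuous_on (?V \<times> J) (\<lambda>z. F (chart_inv x (fst z), snd z))"
  proof (rule continuous_on_compose2[of "L \<times> {0..1}" F])
    show "continuous_on (L \<times> {0..1}) F" using F unfolding smooth_homotopy_def by blast
    have "continuous_on (?V \<times> J) (\<lambda>z. chart_inv x (fst z))"
      by (rule continuous_on_compose2[OF XD(3)[OF P(1)] continuous_on_fst[OF continuous_on_id]]) auto
    then show "continuous_on (?V \<times> J) (\<lambda>z. (chart_inv x (fst z), snd z))"
      by (intro continuous_on_Pair continuous_on_snd continuous_on_id)
    show "(\<lambda>z. (chart_inv x (fst z), snd z)) ` (?V \<times> J) \<subseteq> L \<times> {0..1}"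
    proof (rule image_subsetI)
      fix z assume "z \<in> ?V \<times> J"
      then have "fst z \<in> ?V" "snd z \<in> J" by auto
      then show "(chart_inv x (fst z), snd z) \<in> L \<times> {0..1}" using P(6) J(1) by blast
    qed
  qed
  have dom: "F (chart_inv x (fst z), snd z) \<in> dom_of c" if "z \<in> ?V \<times> J" for z using that by (intro P(7)) auto
  have cg: "continuous_on (?V \<times> J) ?g" by (rule continuous_on_compose2[OF continuous_on_\<phi>[OF P(2)] cF]) (use dom in blast)
  have ng: "?g z \<noteq> 0" if "z \<in> ?V \<times> J" for z
  proof (rule nz[OF _ _ P(2) dom[OF that]])
    show "chart_inv x (fst z) \<in> L" "snd z \<in> {0..1}" using that J(1) by (auto intro: P(6))
  qed
  have "continuous_on (?V \<times> J) (\<lambda>(y, t). root_tr k (\<lambda>t. ?g (y, t)) a t)"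
    by (rule continuous_on_root_tr[OF P(3) J(2,3) cg ng])
  then have c1: "continuous_on (?V \<times> J) (\<lambda>z. root_tr k (\<lambda>t. \<phi> c (F (chart_inv x (fst z), t))) a (snd z))"
    by (simp only: case_prod_beta' fst_conv snd_conv)
  have sub: "?V \<subseteq> {y. (y, a) \<in> dmn x c {0..1}}" using P(9) J(3) by blast
  have "continuous_on ?V (\<lambda>y. e c (chart_inv x y) / den x (chart_inv x y))"
    by (rule continuous_on_subset[OF goodD(3)[OF e P(1,2)] sub])
  then have c2: "continuous_on (?V \<times> J) (\<lambda>z. e c (chart_inv x (fst z)) / den x (chart_inv x (fst z)))"
    by (rule continuous_on_compose2[OF _ continuous_on_fst[OF continuous_on_id]]) auto
  from continuous_on_mult[OF c2 c1] show ?thesis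
  proof (rule continuous_on_eq)
    fix z assume z: "z \<in> ?V \<times> J"
    then have v: "fst z \<in> ?V" "snd z \<in> J" by auto
    have "tr (snd z) c (chart_inv x (fst z)) = e c (chart_inv x (fst z)) *
      root_tr k (\<lambda>t. \<phi> c (F (chart_inv x (fst z), t))) a (snd z) * jac c c (F (chart_inv x (fst z), snd z))"
      by (rule tr_eq[OF P(6)[OF v(1)] P(2) P(7)[OF v(1)] v(2) P(2) dom[OF z]])
    then show "e c (chart_inv x (fst z)) / den x (chart_inv x (fst z)) *
      root_tr k (\<lambda>t. \<phi> c (F (chart_inv x (fst z), t))) a (snd z) =
      tr (snd z) c (chart_inv x (fst z)) / den x (chart_inv x (fst z))" using jac_self[OF P(2) dom[OF z]] by simp
  qed
qed

text \<open>The algebraic conditions follow from those on \<open>e\<close> and the power law of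
  \<open>root_tr\<close>. For continuity the chart \<open>c\<close> may contain only the end points
  of the paths; near each point the field is therefore computed in a chart that contains the paths
  during \<open>J\<close> and then converted.\<close>

lemma good_tr:
  assumes t: "t \<in> J"
  shows "good t (tr t)" unfolding good_def
proof (intro conjI ballI impI)
  fix p c assume p: "p \<in> L" and c: "c \<in> A" "F (p, t) \<in> dom_of c"
  let ?d = "pick p"
  note d = pick[OF p]
  have r: "root_tr k (\<lambda>s. \<phi> ?d (F (p, s))) a t ^ k = \<phi> ?d (F (p, t)) / \<phi> ?d (F (p, a))"
    by (rule root_tr_power[OF path_facts[OF p d t] k])
  have n: "\<phi> ?d (F (p, a)) \<noteq> 0" using nz[OF p _ d(1) d(2)[OF J(3)]] J(1,3) by blast
  have "tr t c p ^ k * \<phi> (cp p) p = (e ?d p ^ k * \<phi> (cp p) p) * root_tr k (\<lambda>s. \<phi> ?d (F (p, s))) a t ^ k * jac c ?d (F (p, t)) ^ k"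
    by (simp add: tr_def power_mult_distrib mult_ac)
  also have "\<dots> = \<phi> ?d (F (p, t)) * jac c ?d (F (p, t)) ^ k" unfolding goodD(1)[OF e p d(1) d(2)[OF J(3)]] r using n by simp
  also have "\<dots> = \<phi> c (F (p, t))" by (rule \<phi>_change[OF c(1) d(1) c(2) d(2)[OF t], symmetric])
  finally show "tr t c p ^ k * \<phi> (cp p) p = \<phi> c (F (p, t))" .
  fix c' assume c': "c' \<in> A" "F (p, t) \<in> dom_of c'"
  show "tr t c p = tr t c' p * jac c c' (F (p, t))" unfolding tr_def jac_compose[OF c(1) c'(1) d(1) c(2) c'(2) d(2)[OF t]] by simp
next
  fix x c assume x: "x \<in> X" and c: "c \<in> A"
  let ?S = "{y. (y, t) \<in> dmn x c {0..1}}"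
  show "continuous_on ?S (\<lambda>y. tr t c (chart_inv x y) / den x (chart_inv x y))"
  proof (rule continuous_on_locally_open)
    fix y assume "y \<in> ?S"
    then have y: "y \<in> img x" "F (chart_inv x y, t) \<in> dom_of c" by (simp_all add: dmn_def)
    let ?p = "chart_inv x y"
    have p: "?p \<in> dom_of x" "?p \<in> L" using XD(5)[OF x y(1)] X_dom[OF x] by blast+
    obtain U d where U: "open U" "?p \<in> U" "d \<in> A" "\<forall>q\<in>U \<inter> L. \<forall>t\<in>J. F (q, t) \<in> dom_of d" using win[OF p(2)] by blast
    obtain T where T: "open T" "dom_of x = L \<inter> T" using XD(8)[OF x] unfolding openin_open by blast
    have pt: "patch (U \<inter> T) x d" unfolding patch_def using U T x by blast
    note P = patchD[OF pt]
    let ?V = "pimg (U \<inter> T) x"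
    have yV: "y \<in> ?V" using p(1) U(2) T(2) XD(6)[OF x y(1)] by (metis IntD2 IntI imageI)
    have "continuous_on ?V (\<lambda>y. (\<lambda>z. tr (snd z) d (chart_inv x (fst z)) / den x (chart_inv x (fst z))) (y, t))"
      by (rule continuous_on_compose2[OF continuous_on_tr[OF pt]]) (use t in \<open>auto intro!: continuous_intros\<close>)
    then have "continuous_on ?V (\<lambda>y. tr t d (chart_inv x y) / den x (chart_inv x y))" by (simp only: fst_conv snd_conv)
    then have 1: "continuous_on (?S \<inter> ?V) (\<lambda>y. tr t d (chart_inv x y) / den x (chart_inv x y))"
      by (rule continuous_on_subset) (rule Int_lower2)
    have "continuous_on (?S \<inter> ?V) (\<lambda>y. F (chart_inv x y, t))"
    proof (rule continuous_on_compose2[of "L \<times> {0..1}" F])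
      show "continuous_on (L \<times> {0..1}) F" using F unfolding smooth_homotopy_def by blast
      have "continuous_on (?S \<inter> ?V) (chart_inv x)" by (rule continuous_on_subset[OF XD(3)[OF x]]) blast
      then show "continuous_on (?S \<inter> ?V) (\<lambda>y. (chart_inv x y, t))" by (intro continuous_on_Pair continuous_on_const)
      show "(\<lambda>y. (chart_inv x y, t)) ` (?S \<inter> ?V) \<subseteq> L \<times> {0..1}" using P(6) t J(1) by blast
    qed
    then have 2: "continuous_on (?S \<inter> ?V) (\<lambda>y. jac c d (F (chart_inv x y, t)))"
    proof (rule continuous_on_compose2[OF continuous_on_jac[OF c U(3)]])
      show "(\<lambda>y. F (chart_inv x y, t)) ` (?S \<inter> ?V) \<subseteq> dom_of c \<inter> dom_of d"
        using P(7)[OF _ t] by (auto simp: dmn_def)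
    qed
    from continuous_on_mult[OF 1 2]
    have "continuous_on (?S \<inter> ?V) (\<lambda>y. tr t c (chart_inv x y) / den x (chart_inv x y))"
    proof (rule continuous_on_eq)
      fix y assume yy: "y \<in> ?S \<inter> ?V"
      then have v: "y \<in> ?V" "F (chart_inv x y, t) \<in> dom_of c" by (simp_all add: dmn_def)
      have "tr t c (chart_inv x y) = tr t d (chart_inv x y) * jac c d (F (chart_inv x y, t))"
        unfolding tr_def jac_compose[OF c U(3) pick(1)[OF P(6)[OF v(1)]] v(2) P(7)[OF v(1) t] pick(2)[OF P(6)[OF v(1)] t]] by simp
      then show "tr t d (chart_inv x y) / den x (chart_inv x y) * jac c d (F (chart_inv x y, t)) = tr t c (chart_inv x y) / den x (chart_inv x y)"
        by simp
    qed
    then show "\<exists>T. open T \<and> y \<in> T \<and> continuous_on (?S \<inter> T) (\<lambda>y. tr t c (chart_inv x y) / den x (chart_inv x y))"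
      using P(3) yV by blast
  qed
qed

end

lemma (in homotopy_setup) finite_subcover: obtains C0 where "finite C0" "C0 \<subseteq> X" "L \<subseteq> (\<Union>x\<in>C0. dom_of x)"
proof -
  have "\<exists>T. open T \<and> dom_of x = L \<inter> T" if "x \<in> X" for x using XD(8)[OF that] unfolding openin_open .
  then obtain T where T: "\<And>x. x \<in> X \<Longrightarrow> open (T x) \<and> dom_of x = L \<inter> T x" by metis
  obtain C0 where "C0 \<subseteq> X" "finite C0" "L \<subseteq> (\<Union>x\<in>C0. T x)"
  proof (rule compactE_image[OF L, of X T])
    show "open (T x)" if "x \<in> X" for x using T[OF that] by blast
    show "L \<subseteq> (\<Union>x\<in>X. T x)" using cover T by blast
  qed
  then show thesis using T by (intro that[of C0]) blast+
qed

context homotopy_window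
begin

lemma continuous_on_psi:
  assumes "patch U x c"
  shows "continuous_on (pimg U x \<times> J) (psi x c)"
proof -
  note P = patchD[OF assms]
  have "continuous_on (pimg U x) (\<delta> x)" by (rule continuous_on_subset[OF \<delta>cont[OF P(1)] P(4)])
  then have "continuous_on (pimg U x \<times> J) (\<lambda>z. \<delta> x (fst z))"
    by (rule continuous_on_compose2[OF _ continuous_on_fst[OF continuous_on_id]]) auto
  from continuous_on_mult[OF continuous_on_tr[OF assms] continuous_on_of_real[OF this]]
  show ?thesis unfolding psi_def[abs_def] .
qed

lemma \<delta>_den: "x \<in> X \<Longrightarrow> p \<in> dom_of x \<Longrightarrow> of_real (\<delta> x (coord x p)) ^ k = C p * \<phi> (cp p) p * den x p ^ k"
  using \<delta>_rws(1)[OF _ cpA(1) _ cpA(2)] unfolding den_def .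

lemma C_nonzero: "p \<in> L \<Longrightarrow> C p \<noteq> 0"
proof
  assume p: "p \<in> L" and 0: "C p = 0"
  obtain x where x: "x \<in> X" "p \<in> dom_of x" using X_exists[OF p] by blast
  have "complex_of_real (\<delta> x (coord x p)) ^ k = 0" unfolding \<delta>_den[OF x] 0 by simp
  moreover have "\<delta> x (coord x p) > 0" by (rule \<delta>pos[OF x(1)]) (use x(2) in blast)
  ultimately show False by simp
qed

text \<open>The value of \<phi> at the starting point and \<open>den\<close> cancel between the
  power condition on \<open>tr\<close> and that on \<delta>.\<close>

lemma psi_power:
  assumes "patch U x c" "y \<in> pimg U x" "t \<in> J"
  shows "psi x c (y, t) ^ k = C (chart_inv x y) * \<phi> c (F (chart_inv x y, t))"
proof -
  note P = patchD[OF assms(1)]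
  let ?p = "chart_inv x y"
  have 1: "tr t c ?p ^ k * \<phi> (cp ?p) ?p = \<phi> c (F (?p, t))"
    by (rule goodD(1)[OF good_tr[OF assms(3)] P(6)[OF assms(2)] P(2) P(7)[OF assms(2,3)]])
  have 2: "of_real (\<delta> x y) ^ k = C ?p * \<phi> (cp ?p) ?p * den x ?p ^ k"
    using \<delta>_den[OF P(1) P(5)[OF assms(2)]] unfolding P(8)[OF assms(2)] .
  have 3: "den x ?p \<noteq> 0" by (rule den_nonzero[OF P(1) P(5)[OF assms(2)]])
  have "psi x c (y, t) ^ k = tr t c ?p ^ k * (of_real (\<delta> x y) ^ k / den x ?p ^ k)"
    by (simp add: psi_def power_mult_distrib power_divide)
  also have "\<dots> = (tr t c ?p ^ k * \<phi> (cp ?p) ?p) * C ?p" unfolding 2 using 3 by simp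
  finally show ?thesis unfolding 1 by (simp add: mult.commute)
qed

lemma psi_rr:
  assumes "patch U x c" "y \<in> pimg U x" "t \<in> J"
  shows "psi x c (y, t) * det (rws x c t y) = of_real (\<delta> x y) * rr (tr t) t (chart_inv x y)"
proof -
  note P = patchD[OF assms(1)]
  have t: "t \<in> {0..1}" using assms(3) J(1) by blast
  show ?thesis unfolding rr_eq[OF good_tr[OF assms(3)] t P(1) P(5)[OF assms(2)] P(2) P(7)[OF assms(2,3)]] psi_def dens_at_def
    by (simp add: P(8)[OF assms(2)])
qed

lemma interior_J: "interior J \<subseteq> {0<..<1}" using interior_mono[OF J(1)] by (simp add: interior_atLeastAtMost_real)

lemma interior_J_subset: "t \<in> interior J \<Longrightarrow> t \<in> J" using interior_subset by blast

lemma patch_interior_subset: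
  assumes "patch U x c"
  shows "pimg U x \<times> interior J \<subseteq> dmn x c {0<..<1}"
proof
  fix z assume z: "z \<in> pimg U x \<times> interior J"
  then have "z \<in> pimg U x \<times> J" using interior_subset by auto
  then have "z \<in> dmn x c {0..1}" using patchD(9)[OF assms] by blast
  moreover have "snd z \<in> {0<..<1}" using z interior_J by auto
  ultimately show "z \<in> dmn x c {0<..<1}" by (simp add: dmn_def)
qed

text \<open>The coefficients of the logarithmic differential of \<phi> divided by \<open>k\<close>,
  taken along the homotopy; neither the branch nor \<open>C\<close> enters.\<close>

definition theta :: "('a, real^'n) chart \<Rightarrow> ('a, 'n) cchart \<Rightarrow> 'n \<Rightarrow> (real^'n) \<times> real \<Rightarrow> complex" where
  "theta x c i z = d_z i (\<phi> c \<circ> chart_inv c) (loc x c z) / (of_nat k * (\<phi> c \<circ> chart_inv c) (loc x c z))"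

text \<open>\<open>psi\<close> is known to be continuous and to have a differentiable
  \<open>k\<close>-th power; \<open>has_derivative_root\<close> supplies its derivative.\<close>

lemma pulled_back_form_patch:
  assumes p: "patch U x c"
  shows "pulled_back_form (pimg U x \<times> interior J) (loc x c) (psi x c) (theta x c)"
proof
  note P = patchD[OF p]
  let ?S = "pimg U x \<times> interior J" and ?f = "\<phi> c \<circ> chart_inv c"
  note sub = patch_interior_subset[OF p]
  show oS: "open ?S" by (intro open_Times P(3) open_interior)
  show "Ck_on 2 ?S (loc x c)" by (rule Ck_on_subset[OF loc_Ck_on[OF P(1,2), of "{0<..<1}"] sub]) auto
  have hf: "holo_on (coord c ` dom_of c) ?f" by (rule holomorphic_sectionsD(1)[OF \<phi> P(2)])
  have o: "open (coord c ` dom_of c)" by (rule chart_onD(1)[OF cm(1)[OF P(2)]])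
  have dm: "F (chart_inv x (fst z), snd z) \<in> dom_of c" if "z \<in> ?S" for z using sub that unfolding dmn_def by blast
  have im: "loc x c z \<in> coord c ` dom_of c" if "z \<in> ?S" for z using dm[OF that] unfolding loc_def by blast
  have fl: "?f (loc x c z) = \<phi> c (F (chart_inv x (fst z), snd z))" if "z \<in> ?S" for z
    using chart_onD(4)[OF cm(1)[OF P(2)] dm[OF that]] by (simp add: loc_def)
  have pt: "fst z \<in> pimg U x" "snd z \<in> J" "chart_inv x (fst z) \<in> L" if "z \<in> ?S" for z
    using that interior_J_subset by (auto intro: P(6))
  have nf: "?f (loc x c z) \<noteq> 0" if "z \<in> ?S" for z
    unfolding fl[OF that] by (rule nz[OF pt(3)[OF that] _ P(2) dm[OF that]]) (use pt(2)[OF that] J(1) in blast)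
  have ld: "(loc x c has_derivative Fd (loc x c) z) (at z)" if "z \<in> ?S" for z
    by (rule loc_has_derivative[OF P(1,2)]) (use sub that in blast)
  have cl: "continuous_on ?S (loc x c)" by (intro continuous_at_imp_continuous_on ballI has_derivative_continuous[OF ld])
  have im': "loc x c ` ?S \<subseteq> coord c ` dom_of c" using im by blast
  show "continuous_on ?S (theta x c i)" for i unfolding theta_def[abs_def]
  proof (rule continuous_on_divide)
    show "continuous_on ?S (\<lambda>z. d_z i ?f (loc x c z))" by (rule continuous_on_compose2[OF continuous_on_d_z[OF hf o] cl im'])
    show "continuous_on ?S (\<lambda>z. of_nat k * ?f (loc x c z))"
      by (intro continuous_on_mult continuous_on_const continuous_on_compose2[OF holo_on_continuous[OF hf] cl im'])
    show "\<forall>z\<in>?S. of_nat k * ?f (loc x c z) \<noteq> 0" using nf k by simp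
  qed
  fix z assume z: "z \<in> ?S"
  let ?p = "chart_inv x (fst z)"
  \<comment> \<open>On \<open>W \<inter> L\<close> the factor \<open>C\<close> is constant, so there
    the power of \<open>psi\<close> is a constant times a holomorphic function along the
    homotopy.\<close>
  obtain W where W: "open W" "?p \<in> W" "\<forall>q\<in>W \<inter> L. C q = C ?p" using C[OF pt(3)[OF z]] by blast
  let ?N = "pimg (U \<inter> W) x \<times> interior J"
  have U: "open U" using p unfolding patch_def by blast
  have oN: "open ?N" by (intro open_Times open_interior submanifold_chart_image_open[OF A P(1)] open_Int U W(1))
  have NS: "?N \<subseteq> ?S" by blast
  have "fst z \<in> pimg (U \<inter> W) x"
  proof -
    obtain q where q: "fst z = coord x q" "q \<in> dom_of x" "q \<in> U" using pt(1)[OF z] by blast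
    then have "?p = q" using XD(4)[OF P(1)] by simp
    then show ?thesis using q W(2) by blast
  qed
  then have zN: "z \<in> ?N" using z by (auto simp: mem_Times_iff)
  have cp: "isCont (psi x c) z" using continuous_on_subset[OF continuous_on_psi[OF p]] oS z interior_subset continuous_on_eq_continuous_at
    by (metis Sigma_mono order_refl)
  have pw: "psi x c w ^ k = C ?p * ?f (loc x c w)" if w: "w \<in> ?N" for w
  proof -
    have wS: "w \<in> ?S" using w NS by blast
    have "fst w \<in> pimg (U \<inter> W) x" using w by auto
    then obtain q where q: "fst w = coord x q" "q \<in> dom_of x" "q \<in> W" by blast
    then have "chart_inv x (fst w) = q" using XD(4)[OF P(1)] by simp
    then have "C (chart_inv x (fst w)) = C ?p" using W(3) q X_dom[OF P(1)] by blast
    then show ?thesis using psi_power[OF p pt(1,2)[OF wS]] fl[OF wS] by simp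
  qed
  let ?q' = "\<lambda>v. C ?p * (\<Sum>i\<in>UNIV. d_z i ?f (loc x c z) * Fd (loc x c) z v $ i)"
  have qd: "((\<lambda>w. C ?p * ?f (loc x c w)) has_derivative ?q') (at z)"
    by (rule has_derivative_mult_right[OF has_derivative_compose[OF ld[OF z] holo_on_has_derivative[OF hf im[OF z]]]])
  have Cn: "C ?p \<noteq> 0" by (rule C_nonzero[OF pt(3)[OF z]])
  have qn: "C ?p * ?f (loc x c z) \<noteq> 0" using Cn nf[OF z] by simp
  have e: "?q' v / (of_nat k * (C ?p * ?f (loc x c z))) = (\<Sum>i\<in>UNIV. theta x c i z * Fd (loc x c) z v $ i)" for v
  proof -
    have "?q' v / (of_nat k * (C ?p * ?f (loc x c z))) =
      (\<Sum>i\<in>UNIV. d_z i ?f (loc x c z) * Fd (loc x c) z v $ i) / (of_nat k * ?f (loc x c z))" using Cn by (simp add: field_simps)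
    then show ?thesis by (simp only: theta_def sum_divide_distrib times_divide_eq_left)
  qed
  show "(psi x c has_derivative (\<lambda>v. psi x c z * (\<Sum>i\<in>UNIV. theta x c i z * Fd (loc x c) z v $ i))) (at z)"
    using has_derivative_root[OF oN zN cp k pw qd qn] unfolding e .
qed

lemma form_dens_flux:
  assumes p: "patch U x c" and y: "y \<in> pimg U x" and t: "t \<in> interior J"
  shows "pulled_back_form.dens (loc x c) (psi x c) (y, t) = of_real (\<delta> x y) * rr (tr t) t (chart_inv x y)"
    and "(b \<circ> chart_inv x) differentiable (at y) \<Longrightarrow>
      (\<Sum>j\<in>UNIV. of_real (Fd (b \<circ> chart_inv x) y (axis j 1)) * pulled_back_form.flux (loc x c) (psi x c) j (y, t))
      = of_real (\<delta> x y) * ff (tr t) t b (chart_inv x y)"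
proof -
  interpret pulled_back_form "pimg U x \<times> interior J" "loc x c" "psi x c" "theta x c" by (rule pulled_back_form_patch[OF p])
  note P = patchD[OF p]
  note tJ = interior_J_subset[OF t]
  have d: "(y, t) \<in> dmn x c {0<..<1}" using patch_interior_subset[OF p] y t by blast
  have r: "rows (y, t) = rws x c t y" by (simp add: vec_eq_iff rows_def rws_interior[OF P(1,2) d])
  have d': "(coord x (chart_inv x y), t) \<in> dmn x c {0<..<1}" using d by (simp only: P(8)[OF y])
  have v: "vel (y, t) = vl c (chart_inv x y) t" unfolding vel_def vl_interior[OF P(1,2) P(5)[OF y] d'] P(8)[OF y] ..
  show "dens (y, t) = of_real (\<delta> x y) * rr (tr t) t (chart_inv x y)" unfolding dens_def r by (rule psi_rr[OF p y tJ])
  assume b: "(b \<circ> chart_inv x) differentiable (at y)"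
  have b': "(b \<circ> chart_inv x) differentiable (at (coord x (chart_inv x y)))" using b by (simp only: P(8)[OF y])
  have t': "t \<in> {0<..<1}" using t interior_J by blast
  have "ff (tr t) t b (chart_inv x y) = flux_at (tr t) c x t b (chart_inv x y)"
    by (rule ff_eq[OF good_tr[OF tJ] t' P(1) P(5)[OF y] P(2) P(7)[OF y tJ] b'])
  then show "(\<Sum>j\<in>UNIV. of_real (Fd (b \<circ> chart_inv x) y (axis j 1)) * flux j (y, t))
    = of_real (\<delta> x y) * ff (tr t) t b (chart_inv x y)"
    by (simp add: flux_def r v flux_at_def P(8)[OF y] psi_def sum_distrib_left sum_divide_distrib mult_ac)
qed

lemma chart_integral:
  assumes x: "x \<in> X" and f: "f \<in> borel_measurable borel" "\<And>q. q \<notin> dom_of x \<Longrightarrow> f q = 0"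
    and V: "V \<subseteq> img x" "\<And>y. y \<in> img x - V \<Longrightarrow> f (chart_inv x y) = 0"
    and g: "\<And>y. y \<in> V \<Longrightarrow> complex_of_real (\<delta> x y) * f (chart_inv x y) = g y"
  shows "integrable \<mu> f \<longleftrightarrow> integrable lborel (\<lambda>y. if y \<in> V then g y else 0)"
    and "integral\<^sup>L \<mu> f = integral\<^sup>L lborel (\<lambda>y. if y \<in> V then g y else 0)"
proof -
  have e: "(\<lambda>y. indicator (img x) y *\<^sub>R (\<delta> x y *\<^sub>R f (chart_inv x y))) = (\<lambda>y. if y \<in> V then g y else 0)"
  proof
    fix y
    consider "y \<in> V" | "y \<in> img x - V" | "y \<notin> img x" using V(1) by blast
    then show "indicator (img x) y *\<^sub>R (\<delta> x y *\<^sub>R f (chart_inv x y)) = (if y \<in> V then g y else 0)"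
    proof cases
      case 1
      then have "y \<in> img x" using V(1) by blast
      then show ?thesis using 1 g[OF 1] by (simp add: scaleR_conv_of_real[where 'a=complex])
    next
      case 2 then show ?thesis using V(2)[OF 2] by simp
    next
      case 3
      then have "y \<notin> V" using V(1) by blast
      then show ?thesis using 3 by simp
    qed
  qed
  note ic = integral_chart[OF X1[OF x] L_borel \<delta>cont[OF x] sets_\<mu> \<mu>_chart[OF x] less_imp_le[OF \<delta>pos[OF x]] f]
  show "integrable \<mu> f \<longleftrightarrow> integrable lborel (\<lambda>y. if y \<in> V then g y else 0)"
    using ic(1) unfolding e by blast
  show "integral\<^sup>L \<mu> f = integral\<^sup>L lborel (\<lambda>y. if y \<in> V then g y else 0)" using ic(2) unfolding e by blast
qed

context
  fixes U x c b K
  assumes pa: "patch U x c" and K: "compact K" "K \<subseteq> U" and b0: "\<And>q. q \<notin> K \<Longrightarrow> b q = (0::real)"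
    and bC: "\<And>x. x \<in> X \<Longrightarrow> Ck_on (Suc 0) (img x) (b \<circ> chart_inv x)"
begin

private lemmas P = patchD[OF pa]

private lemma K_L: "q \<in> L \<Longrightarrow> q \<in> K \<Longrightarrow> q \<in> dom_of x" using K(2) pa unfolding patch_def by blast

private lemma compact_K: "compact (coord x ` (K \<inter> L))" "coord x ` (K \<inter> L) \<subseteq> pimg U x"
proof -
  have s: "K \<inter> L \<subseteq> dom_of x" using K_L by blast
  show "compact (coord x ` (K \<inter> L))" by (rule compact_continuous_image[OF continuous_on_subset[OF XD(2)[OF P(1)] s]])
    (intro compact_Int_closed K(1) compact_imp_closed[OF L])
  show "coord x ` (K \<inter> L) \<subseteq> pimg U x" using K_L K(2) by blast
qed

private lemma off_K: "y \<in> img x \<Longrightarrow> y \<notin> coord x ` (K \<inter> L) \<Longrightarrow> chart_inv x y \<notin> K"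
proof
  assume y: "y \<in> img x" "y \<notin> coord x ` (K \<inter> L)" and q: "chart_inv x y \<in> K"
  have "chart_inv x y \<in> L" by (rule X_dom[OF P(1) XD(5)[OF P(1) y(1)]])
  then have "coord x (chart_inv x y) \<in> coord x ` (K \<inter> L)" using q by blast
  then show False using y XD(6)[OF P(1) y(1)] by simp
qed

private lemma b_zero: "y \<in> pimg U x - coord x ` (K \<inter> L) \<Longrightarrow> (b \<circ> chart_inv x) y = 0"
  using b0[OF off_K] P(4) by (metis DiffE comp_apply subsetD)

private lemma off_V: "y \<in> img x - pimg U x \<Longrightarrow> chart_inv x y \<notin> K" using off_K compact_K(2) by blast

text \<open>The localised function vanishes off one patch, so its integral over \<open>L\<close> is
  an integral over Euclidean space, whose integrability and continuity up to the end points of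
  \<open>J\<close> are already known.\<close>

lemma patch_integral:
  assumes t: "t \<in> J"
  shows "integrable \<mu> (\<lambda>p. of_real (b p) * rr (tr t) t p)" (is ?i)
    and "integral\<^sup>L \<mu> (\<lambda>p. of_real (b p) * rr (tr t) t p) =
      integral\<^sup>L lborel (\<lambda>y. if y \<in> pimg U x then of_real ((b \<circ> chart_inv x) y) *
      (\<lambda>z. psi x c z * det (rws x c (snd z) (fst z))) (y, t) else 0)" (is ?e)
    and "continuous_on J (\<lambda>t. integral\<^sup>L lborel (\<lambda>y. if y \<in> pimg U x then of_real ((b \<circ> chart_inv x) y) *
      (\<lambda>z. psi x c z * det (rws x c (snd z) (fst z))) (y, t) else 0))"
proof -
  have t1: "t \<in> {0..1}" using t J(1) by blast
  let ?f = "\<lambda>p. of_real (b p) * rr (tr t) t p"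
  have bc: "continuous_on (img x) (b \<circ> chart_inv x)" if "x \<in> X" for x using Ck_on_SucD[OF bC[OF that]] by simp
  have m: "?f \<in> borel_measurable borel" by (rule rr_measurable[OF good_tr[OF t] t1 bc])
  have z: "?f q = 0" if "q \<notin> dom_of x" for q using K_L[of q] b0[of q] that by (cases "q \<in> L") (auto simp: rr_def)
  have v: "?f (chart_inv x y) = 0" if "y \<in> img x - pimg U x" for y using b0[OF off_V[OF that]] by simp
  have g: "of_real (\<delta> x y) * ?f (chart_inv x y) =
    of_real ((b \<circ> chart_inv x) y) * (\<lambda>z. psi x c z * det (rws x c (snd z) (fst z))) (y, t)" if "y \<in> pimg U x" for y
    using psi_rr[OF pa that t] by simp
  note ci = chart_integral[OF P(1) m z P(4) v g]
  have \<rho>: "continuous_on (pimg U x \<times> J) (\<lambda>z. psi x c z * det (rws x c (snd z) (fst z)))"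
    by (intro continuous_on_mult continuous_on_psi[OF pa] continuous_on_det continuous_on_subset[OF continuous_on_rws[OF P(1,2)] P(9)])
  note co = continuous_on_integral_localised[OF P(3) compact_K b_zero continuous_on_subset[OF bc[OF P(1)] P(4)] \<rho>]
  show ?i using co(2)[OF _ t] ci(1) by blast
  show ?e by (rule ci(2))
  show "continuous_on J (\<lambda>t. integral\<^sup>L lborel (\<lambda>y. if y \<in> pimg U x then of_real ((b \<circ> chart_inv x) y) *
    (\<lambda>z. psi x c z * det (rws x c (snd z) (fst z))) (y, t) else 0))" by (rule co(1))
qed

lemma patch_integral_continuous: "continuous_on J (\<lambda>t. integral\<^sup>L \<mu> (\<lambda>p. of_real (b p) * rr (tr t) t p))"
  by (rule continuous_on_eq[OF patch_integral(3)[OF J(3)] patch_integral(2)[symmetric]])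

text \<open>\<open>integral_localised_density\<close> with both integrals read back as integrals
  over \<open>L\<close>; in this form those of different patches can be added.\<close>

lemma patch_integral_derivative:
  assumes t: "t \<in> interior J"
  shows "integrable \<mu> (ff (tr t) t b)"
    and "((\<lambda>t. integral\<^sup>L \<mu> (\<lambda>p. of_real (b p) * rr (tr t) t p)) has_vector_derivative - integral\<^sup>L \<mu> (ff (tr t) t b)) (at t)"
proof -
  interpret pulled_back_form "pimg U x \<times> interior J" "loc x c" "psi x c" "theta x c" by (rule pulled_back_form_patch[OF pa])
  note tJ = interior_J_subset[OF t]
  have t1: "t \<in> {0<..<1}" using t interior_J by blast
  have bd: "((b \<circ> chart_inv x) has_derivative Fd (b \<circ> chart_inv x) y) (at y)" if "y \<in> pimg U x" for y
    by (rule Ck_on_has_derivative[OF bC[OF P(1)]]) (use that P(4) in blast)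
  have bcd: "continuous_on (pimg U x) (\<lambda>y. Fd (b \<circ> chart_inv x) y v)" for v
    by (rule continuous_on_subset[OF Ck_on_1_continuous(1)[OF bC[OF P(1)]] P(4)])
  note il = integral_localised_density[OF P(3) open_interior convex_interior[OF J(2)] t order_refl compact_K b_zero bd bcd]
  let ?f = "ff (tr t) t b"
  have m: "?f \<in> borel_measurable borel" by (rule ff_measurable[OF good_tr[OF tJ] t1 bC])
  have kz: "?f q = 0" if "q \<notin> K" for q
  proof (cases "q \<in> L")
    case True then show ?thesis by (rule ff_zero[OF _ compact_imp_closed[OF K(1)] that b0])
  qed (simp add: ff_def)
  have z: "?f q = 0" if "q \<notin> dom_of x" for q using K_L[of q] kz[of q] that by (cases "q \<in> L") (auto simp: ff_def)
  have v: "?f (chart_inv x y) = 0" if "y \<in> img x - pimg U x" for y by (rule kz[OF off_V[OF that]])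
  have g: "of_real (\<delta> x y) * ?f (chart_inv x y) =
    (\<Sum>j\<in>UNIV. of_real (Fd (b \<circ> chart_inv x) y (axis j 1)) * flux j (y, t))" if "y \<in> pimg U x" for y
    by (rule form_dens_flux(2)[OF pa that t differentiableI[OF bd[OF that]], symmetric])
  note ci = chart_integral[OF P(1) m z P(4) v g]
  have e: "integral\<^sup>L \<mu> ?f = integral\<^sup>L lborel (\<lambda>y. if y \<in> pimg U x then
    \<Sum>j\<in>UNIV. of_real (Fd (b \<circ> chart_inv x) y (axis j 1)) * flux j (y, t) else 0)" by (rule ci(2))
  show "integrable \<mu> ?f" using il(2) ci(1) by blast
  show "((\<lambda>t. integral\<^sup>L \<mu> (\<lambda>p. of_real (b p) * rr (tr t) t p)) has_vector_derivative - integral\<^sup>L \<mu> ?f) (at t)"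
    unfolding e
  proof (rule has_vector_derivative_transform_within_open[OF il(1) open_interior t])
    fix s assume s: "s \<in> interior J"
    have "(\<lambda>y. if y \<in> pimg U x then of_real ((b \<circ> chart_inv x) y) * dens (y, s) else 0) =
      (\<lambda>y. if y \<in> pimg U x then of_real ((b \<circ> chart_inv x) y) *
      (\<lambda>z. psi x c z * det (rws x c (snd z) (fst z))) (y, s) else 0)"
    proof
      fix y
      show "(if y \<in> pimg U x then of_real ((b \<circ> chart_inv x) y) * dens (y, s) else 0) =
        (if y \<in> pimg U x then of_real ((b \<circ> chart_inv x) y) *
        (\<lambda>z. psi x c z * det (rws x c (snd z) (fst z))) (y, s) else 0)"
      proof (cases "y \<in> pimg U x")
        case True
        have "dens (y, s) = psi x c (y, s) * det (rws x c s y)"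
          unfolding form_dens_flux(1)[OF pa True s] by (rule psi_rr[OF pa True interior_J_subset[OF s], symmetric])
        then show ?thesis by simp
      qed simp
    qed
    then show "integral\<^sup>L lborel (\<lambda>y. if y \<in> pimg U x then of_real ((b \<circ> chart_inv x) y) * dens (y, s) else 0) =
      integral\<^sup>L \<mu> (\<lambda>p. of_real (b p) * rr (tr s) s p)" by (simp only: patch_integral(2)[OF interior_J_subset[OF s]])
  qed
qed

end

text \<open>Summed over a partition of unity, the time derivative is minus the integral of the sum
  of all \<open>ff\<close>, which is 0. Continuity extends the constancy to the end points of
  \<open>J\<close>.\<close>

lemma window_integral:
  assumes s: "s \<in> J"
  shows "integrable \<mu> (rr (tr s) s)" and "integral\<^sup>L \<mu> (rr (tr s) s) = integral\<^sup>L \<mu> (rr e a)" and "integrable \<mu> (rr e a)"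
proof -
  have "\<forall>p\<in>L. \<exists>w. patch (fst w) (fst (snd w)) (snd (snd w)) \<and> p \<in> fst w" using patch_exists by force
  then obtain w where w: "\<And>p. p \<in> L \<Longrightarrow> patch (fst (w p)) (fst (snd (w p))) (snd (snd (w p))) \<and> p \<in> fst (w p)" by metis
  let ?U = "\<lambda>p. fst (w p)"
  have U: "open (?U p) \<and> p \<in> ?U p" if "p \<in> L" for p using w[OF that] unfolding patch_def by blast
  obtain P b K where P: "finite P" "P \<subseteq> L" "\<And>p. p \<in> P \<Longrightarrow> compact (K p) \<and> K p \<subseteq> ?U p"
    and b0: "\<And>p q. p \<in> P \<Longrightarrow> q \<notin> K p \<Longrightarrow> b p q = (0::real)" and b1: "\<And>q. q \<in> L \<Longrightarrow> (\<Sum>p\<in>P. b p q) = 1"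
    and bC: "\<And>p x. p \<in> P \<Longrightarrow> x \<in> X \<Longrightarrow> Ck_on (Suc 0) (img x) (b p \<circ> chart_inv x)"
    by (rule partition_of_unity[OF U]) (assumption, blast)
  have pa: "patch (?U p) (fst (snd (w p))) (snd (snd (w p)))" if "p \<in> P" for p using w P(2) that by blast
  note K1 = P(3)[THEN conjunct1] and K2 = P(3)[THEN conjunct2]
  let ?I = "\<lambda>t. \<Sum>p\<in>P. integral\<^sup>L \<mu> (\<lambda>q. of_real (b p q) * rr (tr t) t q)"
  have dec: "rr (tr t) t = (\<lambda>q. \<Sum>p\<in>P. of_real (b p q) * rr (tr t) t q)" for t
  proof
    fix q show "rr (tr t) t q = (\<Sum>p\<in>P. of_real (b p q) * rr (tr t) t q)"
    proof (cases "q \<in> L")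
      case True
      have "(\<Sum>p\<in>P. of_real (b p q) * rr (tr t) t q) = of_real (\<Sum>p\<in>P. b p q) * rr (tr t) t q"
        by (simp only: sum_distrib_right of_real_sum)
      then show ?thesis using b1[OF True] by simp
    qed (simp add: rr_def)
  qed
  have int: "integrable \<mu> (\<lambda>q. of_real (b p q) * rr (tr t) t q)" if "p \<in> P" "t \<in> J" for p t
    by (rule patch_integral(1)[OF pa[OF that(1)] K1[OF that(1)] K2[OF that(1)] b0[OF that(1)] bC[OF that(1)] that(2)])
  have i: "integrable \<mu> (rr (tr t) t)" if "t \<in> J" for t by (subst dec) (intro Bochner_Integration.integrable_sum int that)
  have I: "integral\<^sup>L \<mu> (rr (tr t) t) = ?I t" if "t \<in> J" for t
    by (subst dec, rule Bochner_Integration.integral_sum) (rule int[OF _ that])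
  have cI: "continuous_on J ?I" by (rule continuous_on_sum, rule patch_integral_continuous[OF pa K1 K2 b0 bC], assumption+)
  have dI: "(?I has_derivative (\<lambda>h. 0)) (at t)" if t: "t \<in> interior J" for t
  proof -
    have d1: "(?I has_vector_derivative (\<Sum>p\<in>P. - integral\<^sup>L \<mu> (ff (tr t) t (b p)))) (at t)"
      by (rule has_vector_derivative_sum, rule patch_integral_derivative(2)[OF pa K1 K2 b0 bC t], assumption+)
    have fi: "integrable \<mu> (ff (tr t) t (b p))" if "p \<in> P" for p
      by (rule patch_integral_derivative(1)[OF pa[OF that] K1[OF that] K2[OF that] b0[OF that] bC[OF that] t])
    have z: "(\<lambda>q. \<Sum>p\<in>P. ff (tr t) t (b p) q) = (\<lambda>q. 0)" by (rule ext, rule sum_ff_zero[OF P(1) b1 bC], assumption+)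
    have "(\<Sum>p\<in>P. integral\<^sup>L \<mu> (ff (tr t) t (b p))) = integral\<^sup>L \<mu> (\<lambda>q. \<Sum>p\<in>P. ff (tr t) t (b p) q)"
      by (rule Bochner_Integration.integral_sum[symmetric]) (rule fi)
    also have "\<dots> = 0" unfolding z by simp
    finally have "(\<Sum>p\<in>P. - integral\<^sup>L \<mu> (ff (tr t) t (b p))) = 0" by (simp only: sum_negf neg_equal_0_iff_equal)
    then show ?thesis using d1 by (simp add: has_vector_derivative_def)
  qed
  have seg_s: "closed_segment a s \<subseteq> J" by (rule seg[OF s])
  \<comment> \<open>The vanishing of the derivative is known in the open segment, so the two end
    points are exceptional and only continuity is used there.\<close>
  have "?I s = ?I a"
  proof (rule has_derivative_zero_unique_strong_convex[OF convex_closed_segment[of a s], of "{a, s}"])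
    show "continuous_on (closed_segment a s) ?I" by (rule continuous_on_subset[OF cI seg_s])
    fix t assume "t \<in> closed_segment a s - {a, s}"
    then have "t \<in> open_segment a s" by (simp add: open_segment_def)
    moreover have "open (open_segment a s)" by (auto simp: open_segment_eq_real_ivl)
    moreover have "open_segment a s \<subseteq> J" using seg_s segment_open_subset_closed by blast
    ultimately have "t \<in> interior J" by (meson interior_maximal subsetD)
    then show "(?I has_derivative (\<lambda>h. 0)) (at t within closed_segment a s)" by (rule has_derivative_at_withinI[OF dI])
  qed auto
  moreover have ra: "rr (tr a) a = rr e a"
  proof
    fix p show "rr (tr a) a p = rr e a p" by (cases "p \<in> L") (simp_all add: rr_def dens_at_def tr_a[OF _ cpA])
  qed
  ultimately show "integral\<^sup>L \<mu> (rr (tr s) s) = integral\<^sup>L \<mu> (rr e a)" using I[OF s] I[OF J(3)] by simp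
  show "integrable \<mu> (rr (tr s) s)" by (rule i[OF s])
  show "integrable \<mu> (rr e a)" using i[OF J(3)] unfolding ra .
qed

end

section \<open>Continuation over the whole unit interval\<close>

context homotopy_measure
begin

text \<open>A tube argument: each point has a neighbourhood and a time interval on which one chart
  suffices, and finitely many of these neighbourhoods cover the compact set
  \<open>L\<close>.\<close>

lemma window_exists:
  assumes a: "a \<in> {0..1}"
  obtains \<epsilon> where "\<epsilon> > 0" "\<And>p. p \<in> L \<Longrightarrow> \<exists>U c. open U \<and> p \<in> U \<and> c \<in> A \<and> (\<forall>q\<in>U \<inter> L. \<forall>t\<in>{0..1} \<inter> ball a \<epsilon>. F (q, t) \<in> dom_of c)"
proof -
  have Fc: "continuous_on (L \<times> {0..1}) F" using F unfolding smooth_homotopy_def by blast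
  have "\<exists>w. fst w \<in> A \<and> open (fst (snd w)) \<and> p \<in> fst (snd w) \<and> open (snd (snd w)) \<and> a \<in> snd (snd w) \<and>
    (\<forall>q\<in>fst (snd w) \<inter> L. \<forall>t\<in>snd (snd w) \<inter> {0..1}. F (q, t) \<in> dom_of (fst w))" if p: "p \<in> L" for p
  proof -
    let ?c = "cp (F (p, a))"
    have "openin (top_of_set (L \<times> {0..1})) (L \<times> {0..1} \<inter> F -` dom_of ?c)"
      by (rule continuous_openin_preimage_gen[OF Fc cm(4)[OF cpA(1)]])
    then obtain T where T: "open T" "L \<times> {0..1} \<inter> F -` dom_of ?c = L \<times> {0..1} \<inter> T" unfolding openin_open by blast
    have "(p, a) \<in> L \<times> {0..1} \<inter> F -` dom_of ?c" using p a cpA(2) by simp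
    then have "(p, a) \<in> T" unfolding T(2) by blast
    then obtain U V where UV: "open U" "open V" "(p, a) \<in> U \<times> V" "U \<times> V \<subseteq> T" by (rule open_prod_elim[OF T(1)])
    have "F (q, t) \<in> dom_of ?c" if "q \<in> U \<inter> L" "t \<in> V \<inter> {0..1}" for q t
    proof -
      have "(q, t) \<in> L \<times> {0..1} \<inter> T" using that UV(4) by blast
      then show ?thesis unfolding T(2)[symmetric] by blast
    qed
    then show ?thesis using UV cpA(1) by (intro exI[of _ "(?c, U, V)"]) auto
  qed
  then obtain w where w: "\<And>p. p \<in> L \<Longrightarrow> fst (w p) \<in> A \<and> open (fst (snd (w p))) \<and> p \<in> fst (snd (w p)) \<and> open (snd (snd (w p))) \<and> a \<in> snd (snd (w p)) \<and>
    (\<forall>q\<in>fst (snd (w p)) \<inter> L. \<forall>t\<in>snd (snd (w p)) \<inter> {0..1}. F (q, t) \<in> dom_of (fst (w p)))" by metis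
  let ?U = "\<lambda>p. fst (snd (w p))" and ?V = "\<lambda>p. snd (snd (w p))"
  obtain P where P: "P \<subseteq> L" "finite P" "L \<subseteq> (\<Union>p\<in>P. ?U p)"
  proof (rule compactE_image[OF L, of L ?U])
    show "open (?U p)" if "p \<in> L" for p using w[OF that] by blast
    show "L \<subseteq> (\<Union>p\<in>L. ?U p)" using w by blast
  qed
  have "open (\<Inter>p\<in>P. ?V p)" by (rule open_INT[OF P(2)]) (use w P(1) in blast)
  moreover have "a \<in> (\<Inter>p\<in>P. ?V p)" using w P(1) by blast
  ultimately obtain \<epsilon> where \<epsilon>: "\<epsilon> > 0" "ball a \<epsilon> \<subseteq> (\<Inter>p\<in>P. ?V p)" by (rule openE)
  show thesis
  proof (rule that[OF \<epsilon>(1)])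
    fix p assume "p \<in> L"
    then obtain p' where p': "p' \<in> P" "p \<in> ?U p'" using P(3) by blast
    have W: "fst (w p') \<in> A" "open (?U p')"
      "\<forall>q\<in>?U p' \<inter> L. \<forall>t\<in>?V p' \<inter> {0..1}. F (q, t) \<in> dom_of (fst (w p'))"
      using w[of p'] p'(1) P(1) by blast+
    have "\<forall>q\<in>?U p' \<inter> L. \<forall>t\<in>{0..1} \<inter> ball a \<epsilon>. F (q, t) \<in> dom_of (fst (w p'))"
      using W(3) \<epsilon>(2) p'(1) by blast
    then show "\<exists>U c. open U \<and> p \<in> U \<and> c \<in> A \<and> (\<forall>q\<in>U \<inter> L. \<forall>t\<in>{0..1} \<inter> ball a \<epsilon>. F (q, t) \<in> dom_of c)"
      using W(1,2) p'(2) by blast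
  qed
qed

definition start :: "('a, 'n) cchart \<Rightarrow> 'a \<Rightarrow> complex" where
  "start c p = jac c (cp p) p"

lemma good_start: "good 0 start" using good_0 unfolding start_def[abs_def] .

lemma rr_start: "rr start 0 = (\<lambda>p. indicator L p)"
proof
  fix p show "rr start 0 p = indicator L p"
  proof (cases "p \<in> L")
    case True
    note x = xp[OF True, THEN conjunct1] xp[OF True, THEN conjunct2]
    show ?thesis using True den_nonzero[OF x] by (simp add: rr_def F0 dens_at_def start_def jac_self[OF cpA] den_def)
  qed (simp add: rr_def)
qed

text \<open>Only the existence of a field at time \<open>s'\<close> with the same integral is
  recorded, which is enough to chain windows together.\<close>

definition linked :: "real \<Rightarrow> (('a, 'n) cchart \<Rightarrow> 'a \<Rightarrow> complex) \<Rightarrow> real \<Rightarrow> bool" where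
  "linked s e s' \<longleftrightarrow> (\<exists>e'. good s' e' \<and> integrable \<mu> (rr e s) \<and> integrable \<mu> (rr e' s') \<and> integral\<^sup>L \<mu> (rr e' s') = integral\<^sup>L \<mu> (rr e s))"

lemma integral_step:
  assumes a: "a \<in> {0..1}"
  obtains \<epsilon> where "\<epsilon> > 0" "\<And>s s' e. s \<in> {0..1} \<inter> ball a \<epsilon> \<Longrightarrow> s' \<in> {0..1} \<inter> ball a \<epsilon> \<Longrightarrow> good s e \<Longrightarrow>
    linked s e s'"
proof -
  obtain \<epsilon> where \<epsilon>: "\<epsilon> > 0" "\<And>p. p \<in> L \<Longrightarrow> \<exists>U c. open U \<and> p \<in> U \<and> c \<in> A \<and> (\<forall>q\<in>U \<inter> L. \<forall>t\<in>{0..1} \<inter> ball a \<epsilon>. F (q, t) \<in> dom_of c)"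
    by (rule window_exists[OF a]) blast
  show thesis
  proof (rule that[OF \<epsilon>(1)])
    fix s s' e assume s: "s \<in> {0..1} \<inter> ball a \<epsilon>" and s': "s' \<in> {0..1} \<inter> ball a \<epsilon>" and e: "good s e"
    interpret homotopy_window A L F \<phi> k \<delta> C \<mu> "{0..1} \<inter> ball a \<epsilon>" s e
      by unfold_locales (use s e \<epsilon>(2) in \<open>auto intro: convex_Int\<close>)
    show "linked s e s'" unfolding linked_def using good_tr[OF s'] window_integral[OF s'] by blast
  qed
qed

text \<open>The indicator function of \<open>L\<close> is \<open>rr start 0\<close>, so the
  integrability obtained from the window at time 0 yields the finiteness of the measure.\<close>

lemma start_integral:
  shows "integrable \<mu> (rr start 0)" and "emeasure \<mu> L < \<infinity>" and "integral\<^sup>L \<mu> (rr start 0) = complex_of_real (measure \<mu> L)"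
proof -
  have z: "(0::real) \<in> {0..1}" by simp
  obtain \<epsilon> where \<epsilon>: "\<epsilon> > 0" "\<And>s s' e. s \<in> {0..1} \<inter> ball 0 \<epsilon> \<Longrightarrow> s' \<in> {0..1} \<inter> ball 0 \<epsilon> \<Longrightarrow> good s e \<Longrightarrow>
    linked s e s'" using integral_step[OF z] by metis
  have "(0::real) \<in> {0..1} \<inter> ball 0 \<epsilon>" using \<epsilon>(1) by simp
  from \<epsilon>(2)[OF this this good_start, unfolded linked_def] show i: "integrable \<mu> (rr start 0)" by blast
  have o: "rr start 0 = (\<lambda>p. complex_of_real (indicator L p))" unfolding rr_start by (auto simp: indicator_def)
  have Ls: "L \<in> sets \<mu>" using L_borel sets_\<mu> by simp
  have "integrable \<mu> (indicator L :: 'a \<Rightarrow> real)" using i unfolding o by (simp add: complex_of_real_integrable_eq)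
  then show "emeasure \<mu> L < \<infinity>" using Ls sets.sets_into_space[OF Ls] by (simp add: integrable_indicator_iff Int_absorb2)
  show "integral\<^sup>L \<mu> (rr start 0) = complex_of_real (measure \<mu> L)"
    unfolding o using sets.sets_into_space[OF Ls] by (simp add: Int_absorb2)
qed

text \<open>Induction along the connected interval, with overlapping windows as steps; the property
  carried on is the existence of a root field with the initial integral.\<close>

lemma integral_invariant:
  assumes t: "t \<in> {0..1}"
  shows "\<exists>e. good t e \<and> integrable \<mu> (rr e t) \<and> integral\<^sup>L \<mu> (rr e t) = integral\<^sup>L \<mu> (rr start 0)"
proof (rule connected_induction_simple[of "{0..1::real}" 0 t])
  show "connected {0..1::real}" "0 \<in> {0..1::real}" by auto
  show "t \<in> {0..1}" by (rule t)
  show "\<exists>e. good 0 e \<and> integrable \<mu> (rr e 0) \<and> integral\<^sup>L \<mu> (rr e 0) = integral\<^sup>L \<mu> (rr start 0)"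
  proof -
    show ?thesis using good_start start_integral(1) by blast
  qed
next
  fix a :: real assume a: "a \<in> {0..1}"
  obtain \<epsilon> where \<epsilon>: "\<epsilon> > 0" "\<And>s s' e. s \<in> {0..1} \<inter> ball a \<epsilon> \<Longrightarrow> s' \<in> {0..1} \<inter> ball a \<epsilon> \<Longrightarrow> good s e \<Longrightarrow>
    linked s e s'" using integral_step[OF a] by metis
  show "\<exists>T. openin (top_of_set {0..1}) T \<and> a \<in> T \<and> (\<forall>x\<in>T. \<forall>y\<in>T.
    (\<exists>e. good x e \<and> integrable \<mu> (rr e x) \<and> integral\<^sup>L \<mu> (rr e x) = integral\<^sup>L \<mu> (rr start 0)) \<longrightarrow>
    (\<exists>e. good y e \<and> integrable \<mu> (rr e y) \<and> integral\<^sup>L \<mu> (rr e y) = integral\<^sup>L \<mu> (rr start 0)))"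
  proof (intro exI[of _ "{0..1} \<inter> ball a \<epsilon>"] conjI ballI impI)
    show "openin (top_of_set {0..1}) ({0..1} \<inter> ball a \<epsilon>)" by (rule openin_open_Int[OF open_ball])
    show "a \<in> {0..1} \<inter> ball a \<epsilon>" using a \<epsilon>(1) by simp
    fix x y assume xy: "x \<in> {0..1} \<inter> ball a \<epsilon>" "y \<in> {0..1} \<inter> ball a \<epsilon>"
      and "\<exists>e. good x e \<and> integrable \<mu> (rr e x) \<and> integral\<^sup>L \<mu> (rr e x) = integral\<^sup>L \<mu> (rr start 0)"
    then obtain e where e: "good x e" "integral\<^sup>L \<mu> (rr e x) = integral\<^sup>L \<mu> (rr start 0)" by blast
    show "\<exists>e. good y e \<and> integrable \<mu> (rr e y) \<and> integral\<^sup>L \<mu> (rr e y) = integral\<^sup>L \<mu> (rr start 0)"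
      using \<epsilon>(2)[OF xy e(1)] unfolding linked_def e(2) by blast
  qed
qed

text \<open>In the \<open>k\<close>-th power the branch disappears: the field contributes the value
  of \<phi> at \<open>F (p, t)\<close> over its value at \<open>p\<close>, and \<delta> contributes
  \<open>C\<close> times the latter.\<close>

lemma rr_norm:
  assumes e: "good t e" and t: "t \<in> {0..1}" and x: "x \<in> X" "p \<in> dom_of x" and c: "c \<in> A" "F (p, t) \<in> dom_of c"
  shows "(cmod (rr e t p) * \<delta> x (coord x p)) ^ k = cmod (C p) * cmod (\<phi> c (F (p, t))) * cmod (det (rws x c t (coord x p))) ^ k"
proof -
  have pL: "p \<in> L" by (rule X_dom[OF x])
  have dn: "den x p \<noteq> 0" by (rule den_nonzero[OF x])
  have pos: "0 \<le> \<delta> x (coord x p)" by (rule less_imp_le[OF \<delta>pos[OF x(1)]]) (use x(2) in blast)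
  let ?D = "det (rws x c t (coord x p))"
  have "(rr e t p * of_real (\<delta> x (coord x p))) ^ k = e c p ^ k * ?D ^ k / den x p ^ k * of_real (\<delta> x (coord x p)) ^ k"
    unfolding rr_eq[OF e t x c] dens_at_def by (simp add: power_mult_distrib power_divide)
  also have "\<dots> = (e c p ^ k * \<phi> (cp p) p) * ?D ^ k * C p"
    using \<delta>_rws(1)[OF x(1) cpA(1) x(2) cpA(2)] dn unfolding den_def by simp
  also have "\<dots> = C p * \<phi> c (F (p, t)) * ?D ^ k" unfolding goodD(1)[OF e pL c] by simp
  finally have "cmod ((rr e t p * of_real (\<delta> x (coord x p))) ^ k) = cmod (C p * \<phi> c (F (p, t)) * ?D ^ k)" by simp
  then show ?thesis using pos by (simp add: norm_power norm_mult)
qed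

text \<open>The mass of \<open>L\<close> is the integral of \<open>rr\<close> at time 0, hence that
  at time \<open>t\<close>, hence at most the integral of its modulus. By \<open>rr_norm\<close> the
  hypothesis \<open>ge\<close> says that this modulus times \<delta> is at most \<eta>.\<close>

lemma emeasure_comparison:
  assumes t: "t \<in> {0..1}" and \<nu>: "represents_densities X \<eta> \<nu>"
    and \<eta>: "\<And>x y. x \<in> X \<Longrightarrow> y \<in> img x \<Longrightarrow> 0 \<le> \<eta> x y"
    and ge: "\<And>x p c. x \<in> X \<Longrightarrow> p \<in> dom_of x \<Longrightarrow> c \<in> A \<Longrightarrow> F (p, t) \<in> dom_of c \<Longrightarrow>
      cmod (C p) * cmod (\<phi> c (F (p, t))) * cmod (det (rws x c t (coord x p))) ^ k \<le> \<eta> x (coord x p) ^ k"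
  shows "emeasure \<mu> L \<le> emeasure \<nu> L"
proof -
  have \<nu>s: "sets \<nu> = sets borel" using \<nu> unfolding represents_densities_def by blast
  obtain e where e: "good t e" "integrable \<mu> (rr e t)" "integral\<^sup>L \<mu> (rr e t) = integral\<^sup>L \<mu> (rr start 0)"
    using integral_invariant[OF t] by blast
  have Ls: "L \<in> sets \<mu>" using L_borel sets_\<mu> by simp
  have n: "(\<lambda>p. ennreal (cmod (rr e t p))) \<in> borel_measurable borel"
    using borel_measurable_integrable[OF e(2)] sets_\<mu> by (simp cong: measurable_cong_sets)
  \<comment> \<open>The inequality between densities is integrated over a Borel set inside a single
    chart domain.\<close>
  have local: "(\<integral>\<^sup>+p\<in>B. ennreal (cmod (rr e' s p)) \<partial>\<mu>) \<le> emeasure \<nu>' B"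
    if H: "good s e'" "s \<in> {0..1}" "(\<lambda>p. ennreal (cmod (rr e' s p))) \<in> borel_measurable borel" "represents_densities X \<eta>' \<nu>'"
      "\<And>x y. x \<in> X \<Longrightarrow> y \<in> img x \<Longrightarrow> cmod (rr e' s (chart_inv x y)) * \<delta> x y \<le> \<eta>' x y"
      "B \<in> sets borel" "x \<in> X" "B \<subseteq> dom_of x" for B x e' s \<eta>' \<nu>'
  proof -
    let ?f = "\<lambda>p. ennreal (cmod (rr e' s p)) * indicator B p"
    have f: "?f \<in> borel_measurable borel" using H(3,6) by simp
    have im: "coord x ` B \<subseteq> img x" using H(8) by blast
    have "(\<integral>\<^sup>+p\<in>B. ennreal (cmod (rr e' s p)) \<partial>\<mu>) = (\<integral>\<^sup>+p\<in>dom_of x. ?f p \<partial>\<mu>)"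
      by (rule nn_integral_cong) (use H(8) in \<open>auto simp: indicator_def\<close>)
    also have "\<dots> = (\<integral>\<^sup>+y\<in>img x. ennreal (\<delta> x y) * ?f (chart_inv x y) \<partial>lborel)"
      by (rule nn_integral_chart[OF X1[OF H(7)] L_borel \<delta>cont[OF H(7)] sets_\<mu> \<mu>_chart[OF H(7)] f])
    also have "\<dots> \<le> (\<integral>\<^sup>+y\<in>coord x ` B. ennreal (\<eta>' x y) \<partial>lborel)"
    proof (rule nn_integral_mono)
      fix y
      show "ennreal (\<delta> x y) * ?f (chart_inv x y) * indicator (img x) y \<le> ennreal (\<eta>' x y) * indicator (coord x ` B) y"
      proof (cases "y \<in> img x \<and> chart_inv x y \<in> B")
        case True
        then have "coord x (chart_inv x y) \<in> coord x ` B" by blast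
        then have "y \<in> coord x ` B" using XD(6)[OF H(7)] True by simp
        moreover have "ennreal (\<delta> x y) * ennreal (cmod (rr e' s (chart_inv x y))) \<le> ennreal (\<eta>' x y)"
          using H(5)[OF H(7)] True less_imp_le[OF \<delta>pos[OF H(7)]] by (simp add: ennreal_mult''[symmetric] mult.commute ennreal_leI)
        ultimately show ?thesis using True by simp
      qed auto
    qed
    also have "\<dots> = emeasure \<nu>' B" using H(4,6,7,8) unfolding represents_densities_def by simp
    finally show ?thesis .
  qed
  obtain C0 where C0: "finite C0" "C0 \<subseteq> X" "L \<subseteq> (\<Union>x\<in>C0. dom_of x)" by (rule finite_subcover)
  \<comment> \<open>Induction over a finite cover: the part of \<open>B\<close> in one more chart
    domain is split off and treated by the local estimate.\<close>
  have "(\<integral>\<^sup>+p\<in>B. ennreal (cmod (rr e t p)) \<partial>\<mu>) \<le> emeasure \<nu> B" if "B \<in> sets borel" "B \<subseteq> (\<Union>x\<in>C0. dom_of x)" for B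
    using C0(1,2) that
  proof (induction arbitrary: B rule: finite_induct)
    case (insert x C0)
    have x: "x \<in> X" using insert.prems by blast
    have dx: "dom_of x \<in> sets borel" by (rule chart_dom_borel[OF X1[OF x] L_borel])
    have B: "B \<inter> dom_of x \<in> sets borel" "B - dom_of x \<in> sets borel" using insert.prems(2) dx by auto
    have u: "B \<inter> dom_of x \<union> (B - dom_of x) = B" by blast
    have "(\<integral>\<^sup>+p\<in>B \<inter> dom_of x \<union> (B - dom_of x). ennreal (cmod (rr e t p)) \<partial>\<mu>) =
      (\<integral>\<^sup>+p\<in>B \<inter> dom_of x. ennreal (cmod (rr e t p)) \<partial>\<mu>) + (\<integral>\<^sup>+p\<in>B - dom_of x. ennreal (cmod (rr e t p)) \<partial>\<mu>)"
      by (rule nn_integral_disjoint_pair) (use n B sets_\<mu> in \<open>auto cong: measurable_cong_sets\<close>)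
    also have "\<dots> \<le> emeasure \<nu> (B \<inter> dom_of x) + emeasure \<nu> (B - dom_of x)"
    proof (rule add_mono)
      show "(\<integral>\<^sup>+p\<in>B - dom_of x. ennreal (cmod (rr e t p)) \<partial>\<mu>) \<le> emeasure \<nu> (B - dom_of x)"
        by (rule insert.IH) (use insert.prems B in auto)
      show "(\<integral>\<^sup>+p\<in>B \<inter> dom_of x. ennreal (cmod (rr e t p)) \<partial>\<mu>) \<le> emeasure \<nu> (B \<inter> dom_of x)"
      proof (rule local[OF e(1) t n \<nu> _ B(1) x Int_lower2])
        fix x y assume xy: "x \<in> X" "y \<in> img x"
        let ?p = "chart_inv x y"
        have q: "?p \<in> dom_of x" "coord x ?p = y" by (rule XD(5)[OF xy], rule XD(6)[OF xy])
        have "(cmod (rr e t ?p) * \<delta> x y) ^ k \<le> \<eta> x y ^ k"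
          using rr_norm[OF e(1) t xy(1) q(1) cpA] ge[OF xy(1) q(1) cpA] unfolding q(2) by simp
        then show "cmod (rr e t ?p) * \<delta> x y \<le> \<eta> x y"
          using \<eta>[OF xy] k power_mono_iff power_less_imp_less_base by (metis linorder_not_le power_strict_mono)
      qed
    qed
    also have "\<dots> = emeasure \<nu> (B \<inter> dom_of x \<union> (B - dom_of x))" by (rule plus_emeasure) (use B \<nu>s in auto)
    finally show ?case unfolding u .
  qed simp
  then have nL: "(\<integral>\<^sup>+p\<in>L. ennreal (cmod (rr e t p)) \<partial>\<mu>) \<le> emeasure \<nu> L" using L_borel C0(3) by blast
  note fin = start_integral(2)
  have "integral\<^sup>L \<mu> (rr start 0) = of_real (measure \<mu> L)" by (rule start_integral(3))
  then have "ennreal (measure \<mu> L) = ennreal (norm (integral\<^sup>L \<mu> (rr e t)))" unfolding e(3) by simp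
  also have "\<dots> \<le> (\<integral>\<^sup>+p. ennreal (norm (rr e t p)) \<partial>\<mu>)" by (rule integral_norm_bound_ennreal[OF e(2)])
  also have "\<dots> = (\<integral>\<^sup>+p\<in>L. ennreal (cmod (rr e t p)) \<partial>\<mu>)"
    by (rule nn_integral_cong) (simp add: rr_def indicator_def)
  finally show ?thesis using nL emeasure_eq_ennreal_measure[of \<mu> L] fin by (simp add: less_top[symmetric])
qed

end

section \<open>Pluriharmonicity of the conformal factor\<close>

lemma d_z_linear:
  assumes "f differentiable (at x)" "g differentiable (at x)"
  shows "d_z j (\<lambda>x. a * f x + b * g x) x = a * d_z j f x + b * d_z j g x"
    and "d_zbar j (\<lambda>x. a * f x + b * g x) x = a * d_zbar j f x + b * d_zbar j g x"
proof -
  have "((\<lambda>x. a * f x + b * g x) has_derivative (\<lambda>v. a * Fd f x v + b * Fd g x v)) (at x)"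
    using assms by (intro has_derivative_add has_derivative_mult_right) (simp_all add: frechet_derivative_works)
  then have "Fd (\<lambda>x. a * f x + b * g x) x = (\<lambda>v. a * Fd f x v + b * Fd g x v)" by (rule frechet_derivative_at[symmetric])
  then show "d_z j (\<lambda>x. a * f x + b * g x) x = a * d_z j f x + b * d_z j g x"
    "d_zbar j (\<lambda>x. a * f x + b * g x) x = a * d_zbar j f x + b * d_zbar j g x" by (simp_all add: d_z_def d_zbar_def field_simps)
qed

lemma d_zbar_differentiable:
  assumes "Ck_on 2 S f" "x \<in> S"
  shows "d_zbar k f differentiable (at x)"
proof -
  have "(\<lambda>x. Fd f x v) differentiable (at x)" for v
    by (rule differentiableI[OF Ck_on_has_derivative[OF Ck_on_2D(2)[OF assms(1)] assms(2)]])
  then show ?thesis unfolding d_zbar_def[abs_def]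
    by (intro differentiable_divide differentiable_add differentiable_mult differentiable_const) auto
qed

lemma d_z_d_zbar_linear:
  assumes "open S" "Ck_on 2 S f" "Ck_on 2 S g" "x \<in> S"
  shows "d_z j (d_zbar k (\<lambda>x. a * f x + b * g x)) x = a * d_z j (d_zbar k f) x + b * d_z j (d_zbar k g) x"
proof -
  have d: "f differentiable (at y)" "g differentiable (at y)" if "y \<in> S" for y
    using Ck_on_has_derivative[OF Ck_on_2D(1)[OF assms(2)] that] Ck_on_has_derivative[OF Ck_on_2D(1)[OF assms(3)] that]
    by (auto intro: differentiableI)
  let ?h = "\<lambda>y. a * d_zbar k f y + b * d_zbar k g y"
  have h: "?h differentiable (at x)"
    by (intro differentiable_add differentiable_mult differentiable_const d_zbar_differentiable[OF assms(2,4)] d_zbar_differentiable[OF assms(3,4)])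
  have "Fd ?h x = Fd (d_zbar k (\<lambda>x. a * f x + b * g x)) x"
    by (rule frechet_derivative_transform_within_open[OF h assms(1,4)]) (simp add: d_z_linear(2)[OF d])
  then have "d_z j (d_zbar k (\<lambda>x. a * f x + b * g x)) x = d_z j ?h x" by (simp add: d_z_def)
  then show ?thesis using d_z_linear(1)[OF d_zbar_differentiable[OF assms(2,4)] d_zbar_differentiable[OF assms(3,4)]] by simp
qed

locale kodaira_metric =
  fixes A :: "('a::{t2_space,second_countable_topology}, 'n::finite) cchart set"
    and g :: "('a, 'n) metric" and m N :: nat and \<kappa> :: "nat \<Rightarrow> ('a, 'n) bundle_section" and f :: "'a \<Rightarrow> real"
  assumes compact: "compact (UNIV :: 'a set)" and A: "complex_manifold A" and g: "hermitian_metric A g"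
    and m: "m > 0" and \<kappa>: "\<And>i. i \<le> N \<Longrightarrow> \<kappa> i \<in> holomorphic_sections A m"
    and nz: "\<And>c p. c \<in> A \<Longrightarrow> p \<in> dom_of c \<Longrightarrow> \<exists>i\<le>N. \<kappa> i c p \<noteq> 0"
    and f: "smooth_function A f"
    and curv: "\<And>c p. c \<in> A \<Longrightarrow> p \<in> dom_of c \<Longrightarrow> real CARD('n) *\<^sub>R i_ddbar f c p =
      curvature_form (induced_metric m N \<kappa>) c p - curvature_form (canonical_metric g) c p"
begin

lemmas cm = complex_manifoldD[OF A]
lemmas cpA = chart_at_in[OF A]

abbreviation "cp p \<equiv> chart_at A p"

abbreviation "jac c c' q \<equiv> det (tjac c c' q)"

definition vol :: "('a, 'n) cchart \<Rightarrow> 'a \<Rightarrow> real" where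
  "vol c p = Re (det (herm_matrix (g c p)))"

definition sq :: "('a, 'n) cchart \<Rightarrow> 'a \<Rightarrow> real" where
  "sq c p = (\<Sum>i\<le>N. (cmod (\<kappa> i c p))\<^sup>2)"

text \<open>This is e^(m u) with u = ln h_m - ln h + n f, since h is 1 / \<open>vol\<close> and the
  \<open>m\<close>-th power of h_m is 1 / \<open>sq\<close>.\<close>

definition fac :: "('a, 'n) cchart \<Rightarrow> 'a \<Rightarrow> real" where
  "fac c p = exp (f p) ^ (CARD('n) * m) * vol c p ^ m / sq c p"

definition Fac :: "'a \<Rightarrow> real" where
  "Fac p = fac (cp p) p"

lemma hermitian: "c \<in> A \<Longrightarrow> p \<in> dom_of c \<Longrightarrow> hermitian_product (g c p)"
  using g unfolding hermitian_metric_def by unfold_locales blast+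

lemma metric_change:
  assumes "c \<in> A" "c' \<in> A" "p \<in> dom_of c" "p \<in> dom_of c'"
  shows "g c p v w = g c' p (tjac c c' p *v v) (tjac c c' p *v w)"
proof -
  have G: "\<forall>c\<in>A. \<forall>c'\<in>A. \<forall>p\<in>dom_of c \<inter> dom_of c'. \<forall>v w.
    (let D = Fd (transition c c') (coord c p) in g c p v w = g c' p (D v) (D w))" using g unfolding hermitian_metric_def by (elim conjE)
  have "(let D = Fd (transition c c') (coord c p) in g c p v w = g c' p (D v) (D w))"
    by (rule G[THEN bspec, OF assms(1), THEN bspec, OF assms(2), THEN bspec, OF IntI[OF assms(3,4)], THEN spec, THEN spec])
  moreover have "Fd (transition c c') (coord c p) = (*v) (tjac c c' p)"
    by (rule frechet_derivative_at[OF transition_has_derivative[OF A assms], symmetric])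
  ultimately show ?thesis by (simp add: Let_def)
qed

lemma vol_pos: "c \<in> A \<Longrightarrow> p \<in> dom_of c \<Longrightarrow> vol c p > 0"
  unfolding vol_def by (rule hermitian_product.det_herm_matrix(2)[OF hermitian])

lemma vol_change:
  assumes "c \<in> A" "c' \<in> A" "p \<in> dom_of c" "p \<in> dom_of c'"
  shows "vol c p = (cmod (jac c c' p))\<^sup>2 * vol c' p"
proof -
  interpret h: hermitian_product "g c' p" by (rule hermitian[OF assms(2,4)])
  let ?J = "tjac c c' p"
  let ?M = "(\<chi> j. ?J *v (mat 1 :: complex^'n^'n) $ j) :: complex^'n^'n"
  have ax: "(mat 1 :: complex^'n^'n) $ j = axis j 1" for j by (simp add: vec_eq_iff mat_def axis_def)
  have "herm_matrix (g c p) = (\<chi> i j. herm (g c' p) (?M $ i) (?M $ j))" unfolding herm_matrix_def herm_def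
    by (simp add: vec_eq_iff ax metric_change[OF assms] matrix_vector_mult_scale)
  then have "det (herm_matrix (g c p)) = of_real ((cmod (det ?M))\<^sup>2) * det (herm_matrix (g c' p))" by (simp only: h.det_herm_rows)
  moreover have "det ?M = det ?J" unfolding det_rows_transform_right by simp
  ultimately show ?thesis by (simp add: vol_def)
qed

lemma sq_pos: "c \<in> A \<Longrightarrow> p \<in> dom_of c \<Longrightarrow> sq c p > 0"
proof -
  assume c: "c \<in> A" "p \<in> dom_of c"
  obtain i where i: "i \<le> N" "\<kappa> i c p \<noteq> 0" using nz[OF c] by blast
  have "(cmod (\<kappa> i c p))\<^sup>2 \<le> sq c p" unfolding sq_def by (rule member_le_sum) (use i in auto)
  moreover have "0 < (cmod (\<kappa> i c p))\<^sup>2" using i(2) by simp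
  ultimately show ?thesis by linarith
qed

lemma sq_change:
  assumes "c \<in> A" "c' \<in> A" "p \<in> dom_of c" "p \<in> dom_of c'"
  shows "sq c p = sq c' p * (cmod (jac c c' p)) ^ (2 * m)"
proof -
  have "(cmod (\<kappa> i c p))\<^sup>2 = (cmod (\<kappa> i c' p))\<^sup>2 * (cmod (jac c c' p)) ^ (2 * m)" if "i \<le> N" for i
    unfolding holomorphic_sectionsD(2)[OF \<kappa>[OF that] assms]
    by (simp add: norm_mult norm_power power_mult_distrib power_mult[symmetric] mult.commute)
  then show ?thesis unfolding sq_def by (simp add: sum_distrib_right)
qed

lemma jac_nonzero:
  assumes "c \<in> A" "c' \<in> A" "p \<in> dom_of c" "p \<in> dom_of c'"
  shows "jac c c' p \<noteq> 0" using det_jacobian_transition[OF A assms] by auto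

text \<open>Under a change of chart \<open>vol c p ^ m\<close> and \<open>sq c p\<close> acquire the
  same factor, the \<open>2 * m\<close>-th power of the modulus of the Jacobian determinant.\<close>

lemma Fac_eq:
  assumes "c \<in> A" "p \<in> dom_of c"
  shows "Fac p = fac c p"
proof -
  let ?d = "cp p"
  note c = cpA[of p] assms
  have n: "cmod (jac ?d c p) ^ (2 * m) \<noteq> 0" using jac_nonzero[OF c(1,3,2,4)] by simp
  have "vol ?d p ^ m = cmod (jac ?d c p) ^ (2 * m) * vol c p ^ m"
    unfolding vol_change[OF c(1,3,2,4)] by (simp add: power_mult_distrib power_mult)
  moreover have "a * (s * b) / (q * s) = a * b / q" if "s \<noteq> 0" for a b q s :: real using that by simp
  ultimately show ?thesis unfolding Fac_def fac_def sq_change[OF c(1,3,2,4)] using n by metis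
qed

lemma Fac_pos: "Fac p > 0" unfolding Fac_def fac_def using vol_pos[OF cpA] sq_pos[OF cpA] by simp

lemma Ck_on_f: "c \<in> A \<Longrightarrow> Ck_on k (coord c ` dom_of c) (\<lambda>z. f (chart_inv c z))"
  using smooth_on_Ck_on[OF chart_onD(1)[OF cm(1)]] f unfolding smooth_function_def o_def by blast

lemma Ck_on_herm_matrix:
  assumes "c \<in> A"
  shows "Ck_on k (coord c ` dom_of c) (\<lambda>z. herm_matrix (g c (chart_inv c z)) $ i $ j)"
proof -
  note o = chart_onD(1)[OF cm(1)[OF assms]]
  have s: "Ck_on k (coord c ` dom_of c) (\<lambda>z. g c (chart_inv c z) v w)" for v w
    using smooth_on_Ck_on[OF o] g assms unfolding hermitian_metric_def by blast
  have "Ck_on k (coord c ` dom_of c) (\<lambda>z. complex_of_real (g c (chart_inv c z) (axis i 1) (axis j 1)) +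
    complex_of_real (g c (chart_inv c z) (axis i 1) (\<i> *s axis j 1)) * \<i>)"
    by (intro Ck_on_add o Ck_on_mult Ck_on_const Ck_on_bounded_linear[OF o bounded_linear_of_real] s)
  then show ?thesis by (simp add: herm_matrix_def herm_def Complex_eq mult.commute)
qed

lemma Ck_on_vec:
  fixes h :: "'b::real_normed_vector \<Rightarrow> complex^'m::finite"
  assumes "open S" "\<And>i. Ck_on k S (\<lambda>z. h z $ i)"
  shows "Ck_on k S h"
proof -
  have "Ck_on k S (\<lambda>z. \<Sum>i\<in>UNIV. axis i (h z $ i) :: complex^'m)"
    by (intro Ck_on_sum assms(1) Ck_on_bounded_linear[OF assms(1) bounded_linear_axis assms(2)])
  moreover have "(\<Sum>i\<in>UNIV. axis i (v $ i)) = v" for v :: "complex^'m" by (simp add: vec_eq_iff axis_def if_distrib cong: if_cong)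
  ultimately show ?thesis by simp
qed

lemma Ck_on_vol: "c \<in> A \<Longrightarrow> Ck_on k (coord c ` dom_of c) (\<lambda>z. vol c (chart_inv c z))" unfolding vol_def
  by (intro Ck_on_bounded_linear[OF chart_onD(1)[OF cm(1)] bounded_linear_Re] Ck_on_det Ck_on_vec
    chart_onD(1)[OF cm(1)] Ck_on_herm_matrix)

lemma Ck_on_sq:
  assumes c: "c \<in> A"
  shows "Ck_on k (coord c ` dom_of c) (\<lambda>z. sq c (chart_inv c z))"
proof -
  note o = chart_onD(1)[OF cm(1)[OF c]]
  have "Ck_on k (coord c ` dom_of c) (\<lambda>z. \<kappa> i c (chart_inv c z))" if "i \<le> N" for i
    using Ck_on_holo[OF holomorphic_sectionsD(1)[OF \<kappa>[OF that] c] o] by (simp add: o_def)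
  then have "Ck_on k (coord c ` dom_of c) (\<lambda>z. \<Sum>i\<le>N. \<kappa> i c (chart_inv c z) \<bullet> \<kappa> i c (chart_inv c z))"
    by (intro Ck_on_sum o Ck_on_inner) auto
  then show ?thesis by (simp add: sq_def power2_norm_eq_inner)
qed

text \<open>The logarithm is \<open>m\<close> times n f + ln h_m - ln h, and the curvature forms are
  minus \<open>i_ddbar\<close> of ln h_m and of ln h; so the equation \<open>curv\<close> for
  \<open>f\<close> says that its mixed second derivatives vanish.\<close>

lemma ln_fac_pluriharmonic:
  assumes c: "c \<in> A" and z: "z \<in> coord c ` dom_of c"
  shows "Ck_on 2 (coord c ` dom_of c) (\<lambda>z. complex_of_real (ln (fac c (chart_inv c z))))"
    and "d_z j (d_zbar k (\<lambda>z. complex_of_real (ln (fac c (chart_inv c z))))) z = 0"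
proof -
  let ?S = "coord c ` dom_of c"
  note CD = chart_onD[OF cm(1)[OF c]]
  note o = CD(1)
  let ?f = "\<lambda>z. complex_of_real (f (chart_inv c z))"
  let ?i = "\<lambda>z. complex_of_real (ln (induced_metric m N \<kappa> c (chart_inv c z)))"
  let ?h = "\<lambda>z. complex_of_real (ln (canonical_metric g c (chart_inv c z)))"
  have vp: "vol c (chart_inv c z) > 0" and sp: "sq c (chart_inv c z) > 0" if "z \<in> ?S" for z
    using vol_pos[OF c CD(5)[OF that]] sq_pos[OF c CD(5)[OF that]] .
  have li: "ln (induced_metric m N \<kappa> c (chart_inv c z)) = - ln (sq c (chart_inv c z)) / m" if "z \<in> ?S" for z
    using m sp[OF that] by (simp add: induced_metric_def sq_def[symmetric] ln_root ln_div)
  have lh: "ln (canonical_metric g c (chart_inv c z)) = - ln (vol c (chart_inv c z))" if "z \<in> ?S" for z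
    using vp[OF that] by (simp add: canonical_metric_def vol_def[symmetric] ln_div)
  have cf: "Ck_on 2 ?S ?f" by (rule Ck_on_bounded_linear[OF o bounded_linear_of_real Ck_on_f[OF c]])
  have ls: "Ck_on 2 ?S (\<lambda>z. ln (sq c (chart_inv c z)))" "Ck_on 2 ?S (\<lambda>z. ln (vol c (chart_inv c z)))"
    using sp vp by (intro Ck_on_ln[OF o] Ck_on_sq[OF c] Ck_on_vol[OF c]; blast)+
  have "Ck_on 2 ?S (\<lambda>z. complex_of_real (- ln (sq c (chart_inv c z)) / m))" by (rule Ck_on_bounded_linear[OF o _ ls(1)])
    (intro bounded_linear_intros bounded_linear_compose[OF bounded_linear_of_real] bounded_linear_compose[OF bounded_linear_divide] bounded_linear_minus[OF bounded_linear_ident])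
  then have ci: "Ck_on 2 ?S ?i" by (subst Ck_on_cong[OF o]) (simp_all add: li)
  have "Ck_on 2 ?S (\<lambda>z. complex_of_real (- ln (vol c (chart_inv c z))))" by (rule Ck_on_bounded_linear[OF o _ ls(2)])
    (intro bounded_linear_compose[OF bounded_linear_of_real] bounded_linear_minus[OF bounded_linear_ident])
  then have ch: "Ck_on 2 ?S ?h" by (subst Ck_on_cong[OF o]) (simp_all add: lh)
  let ?n = "of_nat CARD('n) :: complex" and ?m = "of_nat m :: complex"
  let ?b = "\<lambda>z. ?m * ?i z + (- ?m) * ?h z"
  let ?u = "\<lambda>z. (?m * ?n) * ?f z + 1 * ?b z"
  have u: "?u z = complex_of_real (ln (fac c (chart_inv c z)))" if "z \<in> ?S" for z
  proof -
    have "ln (fac c (chart_inv c z)) = CARD('n) * m * f (chart_inv c z) + m * ln (vol c (chart_inv c z)) - ln (sq c (chart_inv c z))"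
      unfolding fac_def using vp[OF that] sp[OF that] by (simp add: ln_div ln_mult ln_realpow)
    then have e: "ln (fac c (chart_inv c z)) = (real m * real CARD('n)) * f (chart_inv c z) +
      (real m * ln (induced_metric m N \<kappa> c (chart_inv c z)) + (- real m) * ln (canonical_metric g c (chart_inv c z)))"
      using m by (simp add: li[OF that] lh[OF that] field_simps)
    show ?thesis unfolding e by simp
  qed
  have cb: "Ck_on 2 ?S ?b" by (intro Ck_on_add o Ck_on_mult Ck_on_const ci ch)
  have cu: "Ck_on 2 ?S ?u" by (intro Ck_on_add[OF o] Ck_on_mult[OF o] Ck_on_const cb cf)
  show "Ck_on 2 ?S (\<lambda>z. complex_of_real (ln (fac c (chart_inv c z))))" by (rule Ck_on_cong[OF o, THEN iffD1, OF _ cu]) (rule u)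
  have D: "?n * d_z j (d_zbar k ?f) z + d_z j (d_zbar k ?i) z - d_z j (d_zbar k ?h) z = 0"
  proof -
    have "(real CARD('n) *\<^sub>R i_ddbar f c (chart_inv c z)) $ j $ k =
      (curvature_form (induced_metric m N \<kappa>) c (chart_inv c z) - curvature_form (canonical_metric g) c (chart_inv c z)) $ j $ k"
      using curv[OF c CD(5)[OF z]] by simp
    then show ?thesis by (simp add: curvature_form_def i_ddbar_def CD(6)[OF z] scaleR_conv_of_real[where 'a=complex])
  qed
  have "d_z j (d_zbar k ?u) z = (?m * ?n) * d_z j (d_zbar k ?f) z + 1 * d_z j (d_zbar k ?b) z" by (rule d_z_d_zbar_linear[OF o cf cb z])
  also have "\<dots> = ?m * (?n * d_z j (d_zbar k ?f) z + d_z j (d_zbar k ?i) z - d_z j (d_zbar k ?h) z)"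
    unfolding d_z_d_zbar_linear[OF o ci ch z] by (simp add: algebra_simps)
  finally have 0: "d_z j (d_zbar k ?u) z = 0" unfolding D by simp
  let ?w = "\<lambda>z. complex_of_real (ln (fac c (chart_inv c z)))"
  \<comment> \<open>\<open>?u\<close> and \<open>?w\<close> agree only on the image of the chart, so
    the equality is carried through each of the two derivatives on this open set.\<close>
  have e1: "Fd ?u y = Fd ?w y" if y: "y \<in> ?S" for y
    by (rule frechet_derivative_transform_within_open[OF differentiableI[OF Ck_on_has_derivative[OF Ck_on_2D(1)[OF cu] y]] o y]) (rule u)
  have e2: "d_zbar k ?u y = d_zbar k ?w y" if y: "y \<in> ?S" for y unfolding d_zbar_def e1[OF y] ..
  have "Fd (d_zbar k ?u) z = Fd (d_zbar k ?w) z"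
    by (rule frechet_derivative_transform_within_open[OF d_zbar_differentiable[OF cu z] o z]) (rule e2)
  then have "d_z j (d_zbar k ?u) z = d_z j (d_zbar k ?w) z" unfolding d_z_def by (simp only:)
  then show "d_z j (d_zbar k (\<lambda>z. complex_of_real (ln (fac c (chart_inv c z))))) z = 0" using 0 by simp
qed

lemma continuous_on_Fac: "continuous_on UNIV Fac"
proof (rule continuous_on_locally_open)
  fix p :: 'a
  let ?c = "cp p"
  note CD = chart_onD[OF cm(1)[OF cpA(1)[of p]]]
  have "continuous_on (coord ?c ` dom_of ?c) (\<lambda>z. exp (f (chart_inv ?c z)) ^ (CARD('n) * m) * vol ?c (chart_inv ?c z) ^ m / sq ?c (chart_inv ?c z))"
    using Ck_on_f[OF cpA(1), of 0 p] Ck_on_vol[OF cpA(1), of 0 p] Ck_on_sq[OF cpA(1), of 0 p] sq_pos[OF cpA(1) CD(5)]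
    by (intro continuous_intros) (auto simp: less_imp_neq[symmetric] dest: less_imp_neq)
  then have "continuous_on (dom_of ?c) (\<lambda>q. exp (f (chart_inv ?c (coord ?c q))) ^ (CARD('n) * m) * vol ?c (chart_inv ?c (coord ?c q)) ^ m / sq ?c (chart_inv ?c (coord ?c q)))"
    by (rule continuous_on_compose2[OF _ CD(2)]) blast
  then have "continuous_on (dom_of ?c) Fac" by (rule continuous_on_eq) (simp add: CD(4) Fac_eq[OF cpA(1)] fac_def)
  then have "continuous_on (UNIV \<inter> dom_of ?c) Fac" by simp
  then show "\<exists>T. open T \<and> p \<in> T \<and> continuous_on (UNIV \<inter> T) Fac"
    by (intro exI[of _ "dom_of ?c"] conjI cm(4)[OF cpA(1)] cpA(2))
qed

lemma chart_ball:
  assumes "c \<in> A" "r > 0" "ball (coord c x) r \<subseteq> coord c ` dom_of c" "x \<in> dom_of c"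
  shows "open (chart_inv c ` ball (coord c x) r)" "connected (chart_inv c ` ball (coord c x) r)" "x \<in> chart_inv c ` ball (coord c x) r"
proof -
  note CD = chart_onD[OF cm(1)[OF assms(1)]]
  have "chart_inv c ` ball (coord c x) r = {p \<in> dom_of c. coord c p \<in> ball (coord c x) r}"
  proof (intro set_eqI iffI)
    fix p assume "p \<in> chart_inv c ` ball (coord c x) r"
    then obtain z where z: "p = chart_inv c z" "z \<in> ball (coord c x) r" by blast
    have "z \<in> coord c ` dom_of c" using z(2) assms(3) by blast
    then show "p \<in> {p \<in> dom_of c. coord c p \<in> ball (coord c x) r}" using CD(5,6) z by simp
  next
    fix p assume "p \<in> {p \<in> dom_of c. coord c p \<in> ball (coord c x) r}"
    then show "p \<in> chart_inv c ` ball (coord c x) r" using CD(4)[of p] by (metis (mono_tags, lifting) imageI mem_Collect_eq)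
  qed
  then show "open (chart_inv c ` ball (coord c x) r)" using chart_preimage_open[OF cm(1)[OF assms(1)] open_ball] by simp
  show "connected (chart_inv c ` ball (coord c x) r)"
    by (rule connected_continuous_image[OF continuous_on_subset[OF CD(3) assms(3)] connected_ball])
  show "x \<in> chart_inv c ` ball (coord c x) r" by (rule image_eqI[of _ _ "coord c x"]) (simp_all add: CD(4)[OF assms(4)] assms(2))
qed

text \<open>Coordinate balls are connected, so the manifold is locally connected.\<close>

lemma open_component: "open (connected_component_set UNIV (p::'a))"
proof (subst open_subopen, rule ballI)
  fix x assume x: "x \<in> connected_component_set UNIV p"
  obtain c where c: "c \<in> A" "x \<in> dom_of c" using cm(2) by blast
  have "coord c x \<in> coord c ` dom_of c" using c(2) by blast
  then obtain r where r: "r > 0" "ball (coord c x) r \<subseteq> coord c ` dom_of c"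
    using chart_onD(1)[OF cm(1)[OF c(1)]] open_contains_ball by blast
  note b = chart_ball[OF c(1) r c(2)]
  have "chart_inv c ` ball (coord c x) r \<subseteq> connected_component_set UNIV x" by (rule connected_component_maximal[OF b(3,2)]) blast
  then show "\<exists>T. open T \<and> x \<in> T \<and> T \<subseteq> connected_component_set UNIV p"
    using b connected_component_eq[OF x] by blast
qed

text \<open>The maximum principle on a compact component: the set where \<open>Fac\<close> attains
  its maximum is closed by continuity and open by \<open>pluriharmonic_max\<close>, hence the whole
  component.\<close>

lemma Fac_component:
  assumes "q \<in> connected_component_set UNIV p"
  shows "Fac q = Fac p"
proof -
  let ?K = "connected_component_set UNIV p"
  have pK: "p \<in> ?K" by simp
  have cK: "compact ?K" using compact_Int_closed[OF compact closed_connected_component[OF closed_UNIV, of p]] by simp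
  have ne: "?K \<noteq> {}" using pK by blast
  obtain a where a: "a \<in> ?K" "\<And>x. x \<in> ?K \<Longrightarrow> Fac x \<le> Fac a"
    using continuous_attains_sup[OF cK ne continuous_on_subset[OF continuous_on_Fac subset_UNIV]] by blast
  have "Fac x = Fac a" if x: "x \<in> ?K" for x
  proof (rule connected_induction_simple[OF connected_connected_component a(1) x, where P = "\<lambda>x. Fac x = Fac a"])
    show "Fac a = Fac a" ..
    fix b assume b: "b \<in> ?K"
    show "\<exists>T. openin (top_of_set ?K) T \<and> b \<in> T \<and> (\<forall>x\<in>T. \<forall>y\<in>T. Fac x = Fac a \<longrightarrow> Fac y = Fac a)"
    proof (cases "Fac b = Fac a")
      case False
      let ?T = "{x \<in> ?K. Fac x \<in> - {Fac a}}"
      have "open (Fac -` (- {Fac a}))" by (rule open_vimage[OF _ continuous_on_Fac]) auto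
      then have "openin (top_of_set ?K) (?K \<inter> Fac -` (- {Fac a}))" by (rule openin_open_Int)
      then show ?thesis using False b by (intro exI[of _ "?K \<inter> Fac -` (- {Fac a})"]) auto
    next
      case True
      obtain c where c: "c \<in> A" "b \<in> dom_of c" using cm(2) by blast
      note CD = chart_onD[OF cm(1)[OF c(1)]]
      let ?S = "coord c ` (?K \<inter> dom_of c)" and ?v = "\<lambda>z. ln (fac c (chart_inv c z))"
      have oS: "open ?S" by (rule chart_image_open[OF cm(1)[OF c(1)]]) (simp add: open_component)
      have SS: "?S \<subseteq> coord c ` dom_of c" by blast
      have Sp: "chart_inv c z \<in> ?K \<and> chart_inv c z \<in> dom_of c" if z: "z \<in> ?S" for z using z CD(4) by auto
      have mx: "?v z \<le> ?v (coord c b)" if z: "z \<in> ?S" for z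
      proof -
        have 1: "fac c (chart_inv c z) = Fac (chart_inv c z)" by (rule Fac_eq[OF c(1) Sp[OF z, THEN conjunct2], symmetric])
        have 2: "fac c (chart_inv c (coord c b)) = Fac b" unfolding CD(4)[OF c(2)] by (rule Fac_eq[OF c, symmetric])
        have "Fac (chart_inv c z) \<le> Fac b" unfolding True by (rule a(2)[OF Sp[OF z, THEN conjunct1]])
        then show ?thesis unfolding 1 2 using Fac_pos by (simp add: ln_le_cancel_iff)
      qed
      have bS: "coord c b \<in> ?S" using b c(2) by blast
      have ck: "Ck_on 2 ?S (\<lambda>z. complex_of_real (?v z))"
        by (rule Ck_on_subset[OF ln_fac_pluriharmonic(1)[OF c(1) subsetD[OF SS bS]] SS])
      have ph: "d_z j (d_zbar k (\<lambda>z. complex_of_real (?v z))) z = 0" if z: "z \<in> ?S" for z j k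
        by (rule ln_fac_pluriharmonic(2)[OF c(1) subsetD[OF SS z]])
      have "\<exists>r>0. ball (coord c b) r \<subseteq> ?S \<and> (\<forall>z\<in>ball (coord c b) r. ?v z = ?v (coord c b))"
      proof (rule pluriharmonic_max[where v = ?v, OF oS ck bS ph mx])
        fix e :: real
        assume e: "0 < e" "ball (coord c b) e \<subseteq> ?S" "\<And>z. z \<in> ball (coord c b) e \<Longrightarrow> ?v z = ?v (coord c b)"
        show "\<exists>r>0. ball (coord c b) r \<subseteq> ?S \<and> (\<forall>z\<in>ball (coord c b) r. ?v z = ?v (coord c b))"
          by (intro exI[of _ e] conjI ballI e)
      qed
      then obtain r where r: "r > 0" "ball (coord c b) r \<subseteq> ?S"
        and r3: "\<forall>z\<in>ball (coord c b) r. ?v z = ?v (coord c b)" by (elim exE conjE)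
      let ?T = "chart_inv c ` ball (coord c b) r"
      note ball = chart_ball[OF c(1) r(1) order_trans[OF r(2) SS] c(2)]
      have "Fac y = Fac a" if y: "y \<in> ?T" for y
      proof -
        obtain z where z: "z \<in> ball (coord c b) r" "y = chart_inv c z" using y by blast
        have d: "y \<in> dom_of c" unfolding z(2) by (rule Sp[OF subsetD[OF r(2) z(1)], THEN conjunct2])
        have 1: "Fac y = fac c (chart_inv c z)" using Fac_eq[OF c(1) d] by (simp only: z(2))
        have 2: "Fac b = fac c (chart_inv c (coord c b))" unfolding CD(4)[OF c(2)] by (rule Fac_eq[OF c])
        have "ln (Fac y) = ln (Fac b)" unfolding 1 2 by (rule r3[THEN bspec, OF z(1)])
        then show ?thesis unfolding ln_inj_iff[OF Fac_pos Fac_pos] True .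
      qed
      moreover have "?T \<subseteq> ?K" using Sp[THEN conjunct1, OF subsetD[OF r(2)]] by (rule image_subsetI)
      ultimately show ?thesis using ball(3) open_subset[OF _ ball(1)] by (intro exI[of _ ?T] conjI ballI impI) simp_all
    qed
  qed
  then show ?thesis using assms pK by metis
qed

section \<open>The holomorphic section given by the sum of squares\<close>

lemma sum_of_squares_section: "sum_of_squares N \<kappa> \<in> holomorphic_sections A (2 * m)"
  unfolding holomorphic_sections_def mem_Collect_eq
proof (intro conjI ballI allI impI)
  fix c p assume "c \<notin> A \<or> p \<notin> dom_of c"
  then have "\<kappa> i c p = 0" if "i \<le> N" for i using \<kappa>[OF that] unfolding holomorphic_sections_def by blast
  then show "sum_of_squares N \<kappa> c p = 0" by (simp add: sum_of_squares_def)
next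
  fix c assume c: "c \<in> A"
  show "holo_on (coord c ` dom_of c) (sum_of_squares N \<kappa> c \<circ> chart_inv c)"
  proof (rule holo_onI)
    fix z assume z: "z \<in> coord c ` dom_of c"
    let ?k = "\<lambda>i. \<kappa> i c \<circ> chart_inv c"
    have d: "(?k i has_derivative (\<lambda>v. \<Sum>l\<in>UNIV. d_z l (?k i) z * v $ l)) (at z)" if "i \<le> N" for i
      by (rule holo_on_has_derivative[OF holomorphic_sectionsD(1)[OF \<kappa>[OF that] c] z])
    let ?d = "\<lambda>i v. \<Sum>l\<in>UNIV. d_z l (?k i) z * v $ l"
    let ?D = "\<lambda>v. \<Sum>i\<le>N. ?k i z * ?d i v + ?d i v * ?k i z"
    have "((\<lambda>z. \<Sum>i\<le>N. ?k i z * ?k i z) has_derivative ?D) (at z)" by (intro has_derivative_sum has_derivative_mult d) auto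
    moreover have "(\<lambda>z. \<Sum>i\<le>N. ?k i z * ?k i z) = sum_of_squares N \<kappa> c \<circ> chart_inv c"
      by (simp add: fun_eq_iff sum_of_squares_def power2_eq_square)
    ultimately have D: "(sum_of_squares N \<kappa> c \<circ> chart_inv c has_derivative ?D) (at z)" by (simp only:)
    have ax: "?d i (axis j w) = d_z j (?k i) z * w" for i j w by (simp add: axis_def if_distrib cong: if_cong)
    have "\<forall>j. ?D (axis j \<i>) = \<i> * ?D (axis j 1)" unfolding ax by (simp add: sum_distrib_left algebra_simps)
    then show "\<exists>f'. (sum_of_squares N \<kappa> c \<circ> chart_inv c has_derivative f') (at z) \<and> (\<forall>j. f' (axis j \<i>) = \<i> * f' (axis j 1))"
      by (intro exI[of _ ?D] conjI D)
  qed
next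
  fix c c' p assume c: "c \<in> A" "c' \<in> A" "p \<in> dom_of c \<inter> dom_of c'"
  have "(\<kappa> i c p)\<^sup>2 = (\<kappa> i c' p)\<^sup>2 * jac c c' p ^ (2 * m)" if "i \<le> N" for i
    using holomorphic_sectionsD(2)[OF \<kappa>[OF that] c(1,2)] c(3) by (simp add: power_mult_distrib power_mult[symmetric] mult.commute)
  then show "sum_of_squares N \<kappa> c p = sum_of_squares N \<kappa> c' p * jac c c' p ^ (2 * m)"
    by (simp add: sum_of_squares_def sum_distrib_right)
qed

lemma norm_sum_of_squares: "cmod (sum_of_squares N \<kappa> c p) \<le> sq c p"
  unfolding sum_of_squares_def sq_def by (rule sum_norm_le) (simp add: norm_power)

end

section \<open>Volume densities\<close>

context kodaira_metric
begin

text \<open>The volume, for the conformal metric, of the parallelepiped spanned by the rows of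
  \<open>M\<close>.\<close>

definition gram :: "('a, 'n) cchart \<Rightarrow> 'a \<Rightarrow> complex^'n^'n \<Rightarrow> real" where
  "gram c q M = sqrt (det (\<chi> j k. conformal_metric f g c q (M $ j) (M $ k) :: real^'n^'n))"

lemma det_conformal:
  "det (\<chi> j k. conformal_metric f g c q (M $ j) (M $ k) :: real^'n^'n) =
    exp (f q) ^ CARD('n) * det (\<chi> j k. g c q (M $ j) (M $ k) :: real^'n^'n)"
proof -
  let ?G = "(\<chi> j k. g c q (M $ j) (M $ k)) :: real^'n^'n"
  let ?E = "matrix ((*\<^sub>R) (exp (f q))) :: real^'n^'n"
  have E: "?E *v v = exp (f q) *\<^sub>R v" for v by (simp add: matrix_works linear_scale_self)
  have "(\<chi> j k. conformal_metric f g c q (M $ j) (M $ k)) = (\<chi> j. ?E *v ?G $ j)"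
    unfolding E by (simp add: vec_eq_iff conformal_metric_def)
  then show ?thesis by (simp only: det_rows_transform_right det_matrix_scaleR)
qed

lemma gram_det_nonneg:
  assumes "c \<in> A" "q \<in> dom_of c"
  shows "0 \<le> det (\<chi> j k. g c q (M $ j) (M $ k) :: real^'n^'n)"
  using hermitian_product.gram_det_ge[OF hermitian[OF assms], of M] vol_pos[OF assms]
  by (smt (verit) vol_def zero_le_power2 mult_nonneg_nonneg)

lemma gram_nonneg: "c \<in> A \<Longrightarrow> q \<in> dom_of c \<Longrightarrow> 0 \<le> gram c q M"
  unfolding gram_def det_conformal using gram_det_nonneg by simp

lemma gram_power:
  assumes "c \<in> A" "q \<in> dom_of c"
  shows "gram c q M ^ (2 * m) = exp (f q) ^ (CARD('n) * m) * det (\<chi> j k. g c q (M $ j) (M $ k) :: real^'n^'n) ^ m"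
proof -
  have "(gram c q M)\<^sup>2 = exp (f q) ^ CARD('n) * det (\<chi> j k. g c q (M $ j) (M $ k) :: real^'n^'n)"
    unfolding gram_def det_conformal using gram_det_nonneg[OF assms] by simp
  then show ?thesis by (simp add: power_mult power_mult_distrib)
qed

lemma fac_sq:
  assumes "c \<in> A" "q \<in> dom_of c"
  shows "exp (f q) ^ (CARD('n) * m) * ((cmod d)\<^sup>2 * vol c q) ^ m = fac c q * sq c q * cmod d ^ (2 * m)"
  using sq_pos[OF assms] by (simp add: fac_def power_mult power_mult_distrib)

text \<open>The calibration inequality raised to the power \<open>2 * m\<close>. It combines the
  triangle inequality for the sum of squares with \<open>gram_det_ge\<close>.\<close>

lemma gram_ge:
  assumes "c \<in> A" "q \<in> dom_of c"
  shows "fac c q * cmod (sum_of_squares N \<kappa> c q) * cmod (det M) ^ (2 * m) \<le> gram c q M ^ (2 * m)"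
proof -
  have f0: "fac c q > 0" using Fac_pos Fac_eq[OF assms] by metis
  have "fac c q * cmod (sum_of_squares N \<kappa> c q) * cmod (det M) ^ (2 * m) \<le> fac c q * sq c q * cmod (det M) ^ (2 * m)"
    by (intro mult_right_mono mult_left_mono norm_sum_of_squares less_imp_le[OF f0]) simp
  also have "\<dots> = exp (f q) ^ (CARD('n) * m) * ((cmod (det M))\<^sup>2 * vol c q) ^ m" by (rule fac_sq[OF assms, symmetric])
  also have "\<dots> \<le> exp (f q) ^ (CARD('n) * m) * det (\<chi> j k. g c q (M $ j) (M $ k) :: real^'n^'n) ^ m"
    using hermitian_product.gram_det_ge[OF hermitian[OF assms], of M] less_imp_le[OF vol_pos[OF assms]]
    unfolding vol_def by (intro mult_left_mono power_mono) simp_all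
  finally show ?thesis unfolding gram_power[OF assms] .
qed

text \<open>For a Lagrangian frame the determinant estimate is an equality. That \<open>sq\<close>
  is also the modulus of the sum of squares on \<open>L\<close> comes from
  \<open>real_structure\<close>.\<close>

lemma gram_eq:
  assumes "c \<in> A" "q \<in> dom_of c" and 0: "\<And>j k. g c q (M $ j) (\<i> *s M $ k) = 0"
  shows "gram c q M ^ (2 * m) = fac c q * sq c q * cmod (det M) ^ (2 * m)"
  unfolding gram_power[OF assms(1,2)] hermitian_product.gram_det_eq[OF hermitian[OF assms(1,2)] 0]
  using fac_sq[OF assms(1,2), of "det M"] unfolding vol_def .

lemma gram_change:
  assumes "c \<in> A" "c' \<in> A" "q \<in> dom_of c" "q \<in> dom_of c'"
  shows "gram c q M = gram c' q (\<chi> j. tjac c c' q *v M $ j)" unfolding gram_def conformal_metric_def metric_change[OF assms] by simp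

text \<open>A real change of frame multiplies the Gram matrix by \<open>T\<close> on one side and
  its transpose on the other; this is the transformation law of a density.\<close>

lemma gram_real_combination:
  fixes R :: "complex^'n^'n" and T :: "real^'n^'n"
  assumes "c \<in> A" "q \<in> dom_of c"
  shows "gram c q (\<chi> j. \<Sum>k\<in>UNIV. complex_of_real (T $ k $ j) *s R $ k) = \<bar>det T\<bar> * gram c q R"
proof -
  interpret h: hermitian_product "g c q" by (rule hermitian[OF assms])
  have rs: "complex_of_real r *s v = r *\<^sub>R v" for r and v :: "complex^'n"
    by (simp add: vec_eq_iff scaleR_conv_of_real[where 'a=complex])
  interpret b: bounded_bilinear "g c q" by (rule h.bounded_bilinear)
  let ?G = "(\<chi> j k. g c q (R $ j) (R $ k)) :: real^'n^'n"
  let ?M = "(\<chi> j. \<Sum>k\<in>UNIV. complex_of_real (T $ k $ j) *s R $ k) :: complex^'n^'n"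
  have "g c q (?M $ i) (?M $ j) = (\<Sum>k\<in>UNIV. \<Sum>l\<in>UNIV. T $ k $ i * (T $ l $ j * g c q (R $ k) (R $ l)))" for i j
    by (simp add: rs b.sum_left b.sum_right b.scaleR_left b.scaleR_right sum_distrib_left) (subst sum.swap, simp add: mult_ac)
  then have "(\<chi> i j. g c q (?M $ i) (?M $ j)) = transpose T ** (?G ** T)"
    by (simp add: vec_eq_iff matrix_matrix_mult_def transpose_def sum_distrib_left mult_ac)
  then have "det (\<chi> i j. g c q (?M $ i) (?M $ j)) = (det T)\<^sup>2 * det ?G" by (simp add: det_mul det_transpose power2_eq_square)
  then show ?thesis unfolding gram_def det_conformal by (simp add: real_sqrt_mult mult_ac)
qed

lemma continuous_on_gram:
  fixes q :: "'b::topological_space \<Rightarrow> 'a"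
  assumes c: "c \<in> A" and q: "continuous_on S q" "q ` S \<subseteq> dom_of c" and M: "continuous_on S M"
  shows "continuous_on S (\<lambda>y. gram c (q y) (M y))"
proof -
  note CD = chart_onD[OF cm(1)[OF c]]
  have cq: "continuous_on S (\<lambda>y. coord c (q y))" by (rule continuous_on_compose2[OF CD(2) q])
  have im: "(\<lambda>y. coord c (q y)) ` S \<subseteq> coord c ` dom_of c" using q(2) by blast
  have chart_back: "chart_inv c (coord c (q y)) = q y" if "y \<in> S" for y using CD(4) q(2) that by blast
  have "continuous_on S (\<lambda>y. f (chart_inv c (coord c (q y))))"
    using continuous_on_compose2[OF Ck_on_f[OF c, of 0, unfolded Ck_on.simps] cq im] .
  then have cf: "continuous_on S (\<lambda>y. f (q y))" by (rule continuous_on_eq) (simp add: chart_back)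
  have "continuous_on S (\<lambda>y. herm_matrix (g c (chart_inv c (coord c (q y)))) $ i $ j)" for i j
    using continuous_on_compose2[OF Ck_on_herm_matrix[OF c, of 0, unfolded Ck_on.simps] cq im] .
  then have ch: "continuous_on S (\<lambda>y. herm_matrix (g c (q y)) $ i $ j)" for i j by (rule continuous_on_eq) (simp add: chart_back)
  have cM: "continuous_on S (\<lambda>y. M y $ i $ j)" for i j using M by (intro continuous_on_component)
  have "continuous_on S (\<lambda>y. Re (\<Sum>a\<in>UNIV. \<Sum>b\<in>UNIV. M y $ j $ a * herm_matrix (g c (q y)) $ a $ b * cnj (M y $ k $ b)))" for j k
    by (intro continuous_on_Re continuous_on_sum continuous_on_mult continuous_on_cnj cM ch)
  then have cg: "continuous_on S (\<lambda>y. g c (q y) (M y $ j) (M y $ k))" for j k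
  proof (rule continuous_on_eq)
    fix y assume "y \<in> S"
    then have "q y \<in> dom_of c" using q(2) by blast
    then interpret h: hermitian_product "g c (q y)" by (rule hermitian[OF c])
    show "Re (\<Sum>a\<in>UNIV. \<Sum>b\<in>UNIV. M y $ j $ a * herm_matrix (g c (q y)) $ a $ b * cnj (M y $ k $ b)) = g c (q y) (M y $ j) (M y $ k)"
      unfolding h.herm_expand[symmetric] by simp
  qed
  show ?thesis unfolding gram_def conformal_metric_def
    by (intro continuous_on_real_sqrt continuous_on_det continuous_on_vec_lambda continuous_on_mult continuous_on_exp cf cg)
qed

definition vdens :: "('a \<Rightarrow> 'a) \<Rightarrow> ('a, real^'n) chart \<Rightarrow> real^'n \<Rightarrow> real" where
  "vdens H x y = gram (cp (H (chart_inv x y))) (H (chart_inv x y))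
    (\<chi> j. Fd (coord (cp (H (chart_inv x y))) \<circ> H \<circ> chart_inv x) y (axis j 1))"

lemma map_volume_eq: "map_volume A (conformal_metric f g) L H = emeasure (density_measure (submanifold_charts A L) (vdens H)) L"
  unfolding map_volume_def vdens_def[abs_def] gram_def Let_def by simp

end

section \<open>The fixed point set\<close>

locale kodaira_involution = kodaira_metric A g m N \<kappa> f
  for A :: "('a::{t2_space,second_countable_topology}, 'n::finite) cchart set" and g m N \<kappa> f +
  fixes \<sigma> :: "'a \<Rightarrow> 'a" and L :: "'a set"
  assumes \<sigma>: "antiholomorphic_involution A \<sigma>" and inv: "invariant_metric A \<sigma> g"
    and real: "\<And>i. i \<le> N \<Longrightarrow> cnj_pullback A \<sigma> m (\<kappa> i) = \<kappa> i" and L: "L = {p. \<sigma> p = p}"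
begin

lemma compact_L: "compact L"
proof -
  have "continuous_on UNIV \<sigma>" using \<sigma> unfolding antiholomorphic_involution_def by blast
  then have "closed L" unfolding L by (intro closed_Collect_eq continuous_on_id)
  from compact_Int_closed[OF compact this] show ?thesis by simp
qed

lemma L_cover: "L \<subseteq> (\<Union>x\<in>submanifold_charts A L. dom_of x)"
proof
  fix p assume "p \<in> L"
  then have "\<sigma> p = p" by (simp add: L)
  then obtain x where "x \<in> submanifold_charts A {p. \<sigma> p = p}" "p \<in> dom_of x"
    by (rule submanifold_charts_cover_fixed_points[OF A \<sigma>])
  then show "p \<in> (\<Union>x\<in>submanifold_charts A L. dom_of x)" unfolding L by blast
qed

definition frame :: "('a, 'n) cchart \<Rightarrow> ('a, real^'n) chart \<Rightarrow> 'a \<Rightarrow> complex^'n^'n" where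
  "frame c x p = (\<chi> j. Fd (coord c \<circ> chart_inv x) (coord x p) (axis j 1))"

lemma frame_change:
  assumes x: "x \<in> submanifold_charts A L" "p \<in> dom_of x" and c: "c \<in> A" "c' \<in> A" "p \<in> dom_of c" "p \<in> dom_of c'"
  shows "frame c' x p = (\<chi> j. tjac c c' p *v frame c x p $ j)"
proof -
  note XD = chart_onD[OF submanifold_chartsD(1)[OF x(1)]]
  let ?J = "tjac c c' p" and ?y = "coord x p"
  let ?V = "coord c \<circ> chart_inv x"
  have V: "(?V has_derivative Fd ?V ?y) (at ?y)" by (rule submanifold_chart_has_derivative[OF A x(1) c(1) x(2) c(3)])
  have Vy: "?V ?y = coord c p" by (simp add: XD(4)[OF x(2)])
  have "(transition c c' has_derivative (*v) ?J) (at (?V ?y))" unfolding Vy by (rule transition_has_derivative[OF A c])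
  from has_derivative_compose[OF V this]
  have "((\<lambda>y. transition c c' (?V y)) has_derivative (\<lambda>v. ?J *v Fd ?V ?y v)) (at ?y)" .
  then have "((coord c' \<circ> chart_inv x) has_derivative (\<lambda>v. ?J *v Fd ?V ?y v)) (at ?y)"
  proof (rule has_derivative_transform_within_open[OF _ submanifold_chart_image_open[OF A x(1) cm(4)[OF c(1)]]])
    show "?y \<in> coord x ` (dom_of x \<inter> dom_of c)" using x(2) c(3) by blast
    fix y assume "y \<in> coord x ` (dom_of x \<inter> dom_of c)"
    then obtain q where q: "y = coord x q" "q \<in> dom_of x" "q \<in> dom_of c" by blast
    then show "transition c c' (?V y) = (coord c' \<circ> chart_inv x) y" using transition_coord[OF cm(1)[OF c(1)] q(3)] by (simp add: XD(4))
  qed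
  then have "Fd (coord c' \<circ> chart_inv x) ?y = (\<lambda>v. ?J *v Fd ?V ?y v)" by (rule frechet_derivative_at[symmetric])
  then show ?thesis by (simp add: frame_def)
qed

text \<open>Let \<open>B\<close> be the Jacobian of the conjugated involution. Vectors tangent to
  \<open>L\<close> satisfy \<open>B *v D v = vec_cnj (D v)\<close>; the complex independence of the
  frame, the Lagrangian condition, and the reality of each section on the frame all follow from this
  relation.\<close>

lemma real_structure:
  assumes x: "x \<in> submanifold_charts A L" "p \<in> dom_of x"
  shows "det (frame (cp p) x p) \<noteq> 0"
    and "g (cp p) p (frame (cp p) x p $ j) (\<i> *s frame (cp p) x p $ k) = 0"
    and "sum_of_squares N \<kappa> (cp p) p * det (frame (cp p) x p) ^ (2 * m) =
      complex_of_real (sq (cp p) p * cmod (det (frame (cp p) x p)) ^ (2 * m))"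
proof -
  let ?c = "cp p" and ?y = "coord x p"
  note c = cpA[of p]
  note XD = chart_onD[OF submanifold_chartsD(1)[OF x(1)]] and CD = chart_onD[OF cm(1)[OF c(1)]]
  have fixd: "\<sigma> q = q" if "q \<in> dom_of x" for q using XD(7) that unfolding L by blast
  let ?V = "coord ?c \<circ> chart_inv x"
  define D where "D = Fd ?V ?y"
  let ?\<tau> = "vec_cnj \<circ> coord ?c \<circ> \<sigma> \<circ> chart_inv ?c"
  define B where "B = jacobian ?\<tau> (coord ?c p)"
  define M where "M = frame ?c x p"
  have Mj: "M $ j = D (axis j 1)" for j by (simp add: M_def frame_def D_def)
  have V: "(?V has_derivative D) (at ?y)" unfolding D_def by (rule submanifold_chart_has_derivative[OF A x(1) c(1) x(2) c(2)])
  have lD: "linear D" by (rule has_derivative_linear[OF V])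
  have Vy: "?V ?y = coord ?c p" by (simp add: XD(4)[OF x(2)])
  have yT: "?y \<in> coord x ` (dom_of x \<inter> dom_of ?c)" using x(2) c(2) by blast
  have "holo_map_on (coord ?c ` {q \<in> dom_of ?c. \<sigma> q \<in> dom_of ?c}) ?\<tau>"
    using \<sigma> c(1) unfolding antiholomorphic_involution_def by blast
  moreover have "coord ?c p \<in> coord ?c ` {q \<in> dom_of ?c. \<sigma> q \<in> dom_of ?c}" using c(2) fixd[OF x(2)] by simp
  ultimately have \<tau>: "(?\<tau> has_derivative (*v) B) (at (coord ?c p))" unfolding B_def by (rule holo_map_has_derivative)
  \<comment> \<open>On \<open>L\<close> the involution is trivial, so there \<open>?\<tau>\<close>
    only conjugates coordinates; the two ways of differentiating along \<open>L\<close> must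
    agree.\<close>
  have "((\<lambda>y. ?\<tau> (?V y)) has_derivative (\<lambda>v. B *v D v)) (at ?y)"
    by (rule has_derivative_compose[OF V]) (unfold Vy, rule \<tau>)
  then have "((\<lambda>y. vec_cnj (?V y)) has_derivative (\<lambda>v. B *v D v)) (at ?y)"
  proof (rule has_derivative_transform_within_open[OF _ submanifold_chart_image_open[OF A x(1) cm(4)[OF c(1)]] yT])
    fix y assume "y \<in> coord x ` (dom_of x \<inter> dom_of ?c)"
    then obtain q where q: "y = coord x q" "q \<in> dom_of x" "q \<in> dom_of ?c" by blast
    then show "?\<tau> (?V y) = vec_cnj (?V y)" by (simp add: XD(4) CD(4) fixd)
  qed
  moreover have "((\<lambda>y. vec_cnj (?V y)) has_derivative (\<lambda>v. vec_cnj (D v))) (at ?y)"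
    by (rule bounded_linear.has_derivative[OF bounded_linear_vec_cnj V])
  ultimately have "(\<lambda>v. B *v D v) = (\<lambda>v. vec_cnj (D v))" by (rule has_derivative_unique)
  then have BD: "B *v D v = vec_cnj (D v)" for v by (rule fun_cong)
  have BM: "B *v M $ j = vec_cnj (M $ j)" for j unfolding Mj by (rule BD)
  have "\<kappa> i ?c p = cnj (\<kappa> i ?c p) * det B ^ m" if "i \<le> N" for i
  proof -
    have "\<kappa> i ?c p = cnj_pullback A \<sigma> m (\<kappa> i) ?c p" using real[OF that] by simp
    then show ?thesis using c fixd[OF x(2)] by (simp add: cnj_pullback_def B_def Let_def)
  qed
  note \<kappa>B = this
  \<comment> \<open>An invariant section that is nonzero at \<open>p\<close> shows that
    \<open>B\<close> is invertible.\<close>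
  obtain i0 where i0: "i0 \<le> N" "\<kappa> i0 ?c p \<noteq> 0" using nz[OF c] by blast
  have "det B ^ m \<noteq> 0" using \<kappa>B[OF i0(1)] i0(2) by (metis mult_zero_right)
  then have dB: "det B \<noteq> 0" using m by (metis power_eq_0_iff)
  have "vec_cnj (M $ j) = cnj_mat M $ j" for j by (simp add: vec_eq_iff vec_cnj_def cnj_mat_def)
  then have "cnj_mat M = (\<chi> j. B *v M $ j)" by (simp add: vec_eq_iff[of "cnj_mat M"] BM)
  then have cM: "cnj (det M) = det B * det M" by (simp add: det_cnj_mat[symmetric] det_rows_transform_right)
  have "inj D" unfolding D_def by (rule submanifold_chartsD(3)[OF x(1) c(1) yT])
  have rv: "cvec u = 0 \<Longrightarrow> u = 0" for u :: "real^'n" by (simp add: vec_eq_iff cvec_def)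
  have Dsum: "D u = (\<Sum>j\<in>UNIV. complex_of_real (u $ j) *s M $ j)" for u
  proof -
    have "D u = (\<Sum>j\<in>UNIV. (u $ j) *\<^sub>R D (axis j 1))" by (rule cpt_linear_axis_expand[OF lD])
    then show ?thesis by (simp add: Mj vec_eq_iff scaleR_conv_of_real[where 'a=complex])
  qed
  have "det M \<noteq> 0"
  proof
    assume "det M = 0"
    then have "\<not> invertible (transpose M)" by (simp add: invertible_det_nz det_transpose)
    \<comment> \<open>A complex relation between the rows gives
      \<open>D ?r + \<i> *s D ?s = 0\<close>; conjugating it and cancelling \<open>B\<close> gives
      the relation with a minus sign. Hence both vectors vanish, and \<open>D\<close> is
      injective.\<close>
    then obtain w where w: "transpose M *v w = 0" "w \<noteq> 0" unfolding invertible_left_inverse matrix_left_invertible_ker by blast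
    let ?r = "(\<chi> i. Re (w $ i)) :: real^'n" and ?s = "(\<chi> i. Im (w $ i)) :: real^'n"
    have tw: "transpose M *v w = D ?r + \<i> *s D ?s"
    proof -
      have "(transpose M *v w) $ i = (D ?r + \<i> *s D ?s) $ i" for i
        unfolding Dsum by (simp add: matrix_vector_mult_def transpose_def sum_distrib_left sum.distrib[symmetric])
          (rule sum.cong, rule refl, simp add: complex_eq_iff algebra_simps)
      then show ?thesis by (simp add: vec_eq_iff)
    qed
    then have 1: "D ?r + \<i> *s D ?s = 0" using w(1) by simp
    have "vec_cnj (D ?r + \<i> *s D ?s) = 0" unfolding 1 by (simp add: vec_cnj_def vec_eq_iff)
    then have "B *v D ?r + - \<i> *s (B *v D ?s) = 0" by (simp add: BD)
    then have "B *v (D ?r - \<i> *s D ?s) = 0" by (simp add: matrix_vector_mult_diff_distrib matrix_vector_mult_scale)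
    then have 2: "D ?r - \<i> *s D ?s = 0"
      using dB invertible_det_nz[of B] unfolding invertible_left_inverse matrix_left_invertible_ker by blast
    have r0: "D ?r = 0"
    proof -
      have "D ?r + D ?r = (D ?r + \<i> *s D ?s) + (D ?r - \<i> *s D ?s)" by simp
      then have "2 *\<^sub>R D ?r = 0" unfolding 1 2 by (simp add: scaleR_2)
      then show ?thesis by simp
    qed
    then have s0: "D ?s = 0" using 1 by (simp add: vec_eq_iff)
    have "D 0 = 0" by (rule linear_0[OF lD])
    then have "?r = 0" "?s = 0" using r0 s0 \<open>inj D\<close> by (metis injD)+
    then have "w = 0" by (simp add: vec_eq_iff complex_eq_iff)
    then show False using w(2) by simp
  qed
  then show "det (frame ?c x p) \<noteq> 0" by (simp add: M_def)
  interpret h: hermitian_product "g ?c p" by (rule hermitian[OF c])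
  have \<sigma>D: "Fd (coord ?c \<circ> \<sigma> \<circ> chart_inv ?c) (coord ?c p) = (\<lambda>v. vec_cnj (B *v v))"
  proof -
    have "((\<lambda>z. vec_cnj (?\<tau> z)) has_derivative (\<lambda>v. vec_cnj (B *v v))) (at (coord ?c p))"
      by (rule bounded_linear.has_derivative[OF bounded_linear_vec_cnj \<tau>])
    moreover have "(\<lambda>z. vec_cnj (?\<tau> z)) = coord ?c \<circ> \<sigma> \<circ> chart_inv ?c" by (simp add: fun_eq_iff)
    ultimately show ?thesis by (metis frechet_derivative_at)
  qed
  have "\<sigma> p \<in> dom_of ?c" using fixd[OF x(2)] c(2) by simp
  then have gi: "g ?c p v w = g ?c (\<sigma> p) (vec_cnj (B *v v)) (vec_cnj (B *v w))" for v w
    using inv[unfolded invariant_metric_def, THEN bspec, OF c(1), THEN bspec, OF c(1), THEN bspec, OF c(2), THEN mp, THEN spec, THEN spec, of v w]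
    unfolding Let_def \<sigma>D by blast
  \<comment> \<open>The differential of the involution preserves \<open>g\<close>, fixes the frame
    and reverses its multiples by \<i>; the value is therefore its own negative.\<close>
  have "g ?c p (M $ j) (\<i> *s M $ k) = g ?c p (M $ j) (- (\<i> *s M $ k))"
    unfolding gi[of "M $ j" "\<i> *s M $ k"] matrix_vector_mult_scale BM fixd[OF x(2)] by (simp add: vector_smult_lneg)
  then show "g ?c p (frame ?c x p $ j) (\<i> *s frame ?c x p $ k) = 0" unfolding M_def[symmetric] h.linear_simps by simp
  \<comment> \<open>The section coefficient times \<open>det M ^ m\<close> equals its own conjugate,
    so its square is its squared modulus.\<close>
  have r: "\<kappa> i ?c p ^ 2 * det M ^ (2 * m) = complex_of_real ((cmod (\<kappa> i ?c p))\<^sup>2 * cmod (det M) ^ (2 * m))" if "i \<le> N" for i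
  proof -
    let ?r = "\<kappa> i ?c p * det M ^ m"
    have "cnj ?r = cnj (\<kappa> i ?c p) * det B ^ m * det M ^ m" by (simp add: cM power_mult_distrib)
    then have "cnj ?r = ?r" using \<kappa>B[OF that] by simp
    then have "?r * ?r = ?r * cnj ?r" by simp
    also have "\<dots> = complex_of_real ((cmod ?r)\<^sup>2)" by (rule complex_norm_square[symmetric])
    finally have 1: "?r * ?r = complex_of_real ((cmod ?r)\<^sup>2)" .
    have 2: "\<kappa> i ?c p ^ 2 * det M ^ (2 * m) = ?r * ?r"
    proof -
      have "det M ^ (2 * m) = (det M ^ m)\<^sup>2" by (simp add: power_mult[symmetric] mult.commute)
      then show ?thesis unfolding power2_eq_square by simp
    qed
    have 3: "(cmod ?r)\<^sup>2 = (cmod (\<kappa> i ?c p))\<^sup>2 * cmod (det M) ^ (2 * m)"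
      by (simp add: norm_mult norm_power power_mult_distrib power_mult[symmetric] mult.commute)
    show ?thesis unfolding 2 1 3 ..
  qed
  show "sum_of_squares N \<kappa> ?c p * det (frame ?c x p) ^ (2 * m) = complex_of_real (sq ?c p * cmod (det (frame ?c x p)) ^ (2 * m))"
    unfolding M_def[symmetric] sum_of_squares_def sq_def sum_distrib_right of_real_sum by (rule sum.cong) (simp_all add: r)
qed

end

section \<open>Comparison of volumes\<close>

locale volume_comparison = kodaira_involution A g m N \<kappa> f \<sigma> L
  for A :: "('a::{t2_space,second_countable_topology}, 'n::finite) cchart set" and g m N \<kappa> f \<sigma> L +
  fixes F :: "'a \<times> real \<Rightarrow> 'a"
  assumes F: "smooth_homotopy A L F" and F0: "\<And>p. p \<in> L \<Longrightarrow> F (p, 0) = p"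
    and avoid: "\<And>p t. p \<in> L \<Longrightarrow> t \<in> {0..1} \<Longrightarrow> F (p, t) \<notin> zero_set A (sum_of_squares N \<kappa>)"
begin

abbreviation "\<phi> \<equiv> sum_of_squares N \<kappa>"

lemma vdens_id:
  assumes "x \<in> submanifold_charts A L" "p \<in> dom_of x"
  shows "vdens (\<lambda>p. p) x (coord x p) = gram (cp p) p (frame (cp p) x p)"
proof -
  have "chart_inv x (coord x p) = p" by (rule chart_onD(4)[OF submanifold_chartsD(1)[OF assms(1)] assms(2)])
  then show ?thesis by (simp add: vdens_def frame_def o_def)
qed

text \<open>Here the density \<delta> is that of the inclusion. The equality cases on
  \<open>L\<close> make its \<open>2 * m\<close>-th power equal to \<open>Fac\<close> times the
  section on the frame, with a positive value, as \<open>\<delta>root\<close> demands.\<close>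

sublocale hs: homotopy_setup A L F \<phi> "2 * m" "vdens (\<lambda>p. p)" "\<lambda>p. complex_of_real (Fac p)"
proof
  show "complex_manifold A" "compact L" "L \<subseteq> (\<Union>x\<in>submanifold_charts A L. dom_of x)" "smooth_homotopy A L F"
    by (rule A compact_L L_cover F)+
  show "F (p, 0) = p" if "p \<in> L" for p by (rule F0[OF that])
  show \<phi>: "\<phi> \<in> holomorphic_sections A (2 * m)" by (rule sum_of_squares_section)
  show "0 < 2 * m" using m by simp
  show "\<phi> c (F (p, t)) \<noteq> 0" if "p \<in> L" "t \<in> {0..1}" "c \<in> A" "F (p, t) \<in> dom_of c" for p t c
  proof -
    let ?q = "F (p, t)"
    have "\<phi> (cp ?q) ?q \<noteq> 0" using avoid[OF that(1,2)] unfolding zero_set_def by blast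
    then show ?thesis unfolding holomorphic_sectionsD(2)[OF \<phi> cpA(1) that(3) cpA(2) that(4)] by (metis mult_zero_left)
  qed
  have pw: "vdens (\<lambda>p. p) x (coord x p) ^ (2 * m) = Fac p * (sq (cp p) p * cmod (det (frame (cp p) x p)) ^ (2 * m))"
    if "x \<in> submanifold_charts A L" "p \<in> dom_of x" for x p
    unfolding vdens_id[OF that] gram_eq[OF cpA real_structure(2)[OF that]] Fac_eq[OF cpA] by simp
  show "0 < vdens (\<lambda>p. p) x y" if x: "x \<in> submanifold_charts A L" and y: "y \<in> coord x ` dom_of x" for x y
  proof -
    obtain p where p: "y = coord x p" "p \<in> dom_of x" using y by blast
    have "0 < vdens (\<lambda>p. p) x y ^ (2 * m)"
      unfolding p(1) pw[OF x p(2)] using Fac_pos sq_pos[OF cpA] real_structure(1)[OF x p(2)] by simp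
    moreover have "0 \<le> vdens (\<lambda>p. p) x y" unfolding p(1) vdens_id[OF x p(2)] by (rule gram_nonneg[OF cpA])
    ultimately show ?thesis using m by (cases "vdens (\<lambda>p. p) x y = 0") (auto simp: power_0_left)
  qed
  show "complex_of_real (vdens (\<lambda>p. p) x (coord x p)) ^ (2 * m) = complex_of_real (Fac p) * \<phi> c p *
    det (\<chi> j. Fd (coord c \<circ> chart_inv x) (coord x p) (axis j 1)) ^ (2 * m)"
    if x: "x \<in> submanifold_charts A L" and c: "c \<in> A" and p: "p \<in> dom_of x" "p \<in> dom_of c" for x c p
  proof -
    let ?d = "cp p"
    have "complex_of_real (vdens (\<lambda>p. p) x (coord x p)) ^ (2 * m) = complex_of_real (vdens (\<lambda>p. p) x (coord x p) ^ (2 * m))" by simp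
    also have "\<dots> = complex_of_real (Fac p) * (\<phi> ?d p * det (frame ?d x p) ^ (2 * m))"
      unfolding pw[OF x p(1)] real_structure(3)[OF x p(1)] by simp
    also have "\<phi> ?d p * det (frame ?d x p) ^ (2 * m) = \<phi> c p * det (frame c x p) ^ (2 * m)"
      unfolding frame_change[OF x p(1) c cpA(1) p(2) cpA(2)] det_rows_transform_right
        holomorphic_sectionsD(2)[OF \<phi> c cpA(1) p(2) cpA(2)] by (simp add: power_mult_distrib)
    finally show ?thesis by (simp add: frame_def)
  qed
  show "\<exists>U. open U \<and> p \<in> U \<and> (\<forall>q\<in>U \<inter> L. complex_of_real (Fac q) = complex_of_real (Fac p))" for p
    by (intro exI[of _ "connected_component_set UNIV p"] conjI open_component) (use Fac_component in auto)
qed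

lemma vdens_F:
  assumes "x \<in> hs.X" "p \<in> dom_of x" "t \<in> {0..1}" "c \<in> A" "F (p, t) \<in> dom_of c"
  shows "vdens (\<lambda>p. F (p, t)) x (coord x p) = gram c (F (p, t)) (hs.rws x c t (coord x p))"
proof -
  let ?q = "F (p, t)"
  let ?d = "cp ?q"
  have "chart_inv x (coord x p) = p" by (rule hs.XD(4)[OF assms(1,2)])
  moreover have "(\<lambda>y. hs.loc x ?d (y, t)) = coord ?d \<circ> (\<lambda>p. F (p, t)) \<circ> chart_inv x"
    by (simp add: fun_eq_iff hs.loc_def)
  ultimately have "vdens (\<lambda>p. F (p, t)) x (coord x p) = gram ?d ?q (hs.rws x ?d t (coord x p))" by (simp add: vdens_def hs.rws_def)
  also have "\<dots> = gram c ?q (hs.rws x c t (coord x p))"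
    unfolding gram_change[OF assms(4) cpA(1) assms(5) cpA(2)] hs.rws_change_c[OF assms(1,4) cpA(1) assms(2,3,5) cpA(2)] ..
  finally show ?thesis .
qed

text \<open>\<open>F (p, 0) = p\<close> is given for points of \<open>L\<close> only, so the two
  maps may differ elsewhere; the density depends only on their values on \<open>L\<close>.\<close>

lemma vdens_0:
  assumes "x \<in> hs.X" "y \<in> hs.img x"
  shows "vdens (\<lambda>p. p) x y = vdens (\<lambda>p. F (p, 0)) x y"
proof -
  obtain p where p: "y = coord x p" "p \<in> dom_of x" using assms(2) by blast
  have q: "F (p, 0) = p" by (rule F0[OF hs.X_dom[OF assms(1) p(2)]])
  have "F (p, 0) \<in> dom_of (cp p)" unfolding q by (rule cpA)
  from vdens_F[OF assms(1) p(2) _ cpA(1) this]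
  show ?thesis using assms(2) by (simp add: p(1) vdens_id[OF assms(1) p(2)] frame_def hs.rws_0[OF assms(1)] q)
qed

lemma vdens_nonneg:
  assumes "x \<in> hs.X" "y \<in> hs.img x" "t \<in> {0..1}"
  shows "0 \<le> vdens (\<lambda>p. F (p, t)) x y" unfolding vdens_def by (rule gram_nonneg[OF cpA])

lemma continuous_on_vdens:
  assumes x: "x \<in> hs.X" and t: "t \<in> {0..1}"
  shows "continuous_on (hs.img x) (vdens (\<lambda>p. F (p, t)) x)"
proof (rule continuous_on_locally_open)
  fix y assume y: "y \<in> hs.img x"
  let ?c = "cp (F (chart_inv x y, t))"
  let ?S = "{y. (y, t) \<in> hs.dmn x ?c {0..1}}"
  have S: "y' \<in> hs.img x" "F (chart_inv x y', t) \<in> dom_of ?c" if "y' \<in> ?S" for y' using that by (simp_all add: hs.dmn_def)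
  have cr: "continuous_on ?S (\<lambda>y. hs.rws x ?c t y)"
  proof -
    have "continuous_on ?S (\<lambda>y. (\<lambda>z. hs.rws x ?c (snd z) (fst z)) (y, t))"
      by (rule continuous_on_compose2[OF hs.continuous_on_rws[OF x cpA(1)]]) (auto intro!: continuous_intros)
    then show ?thesis by simp
  qed
  have cF: "continuous_on ?S (\<lambda>y. F (chart_inv x y, t))"
  proof (rule continuous_on_compose2[of "L \<times> {0..1}" F])
    show "continuous_on (L \<times> {0..1}) F" using F unfolding smooth_homotopy_def by blast
    have "continuous_on ?S (chart_inv x)" by (rule continuous_on_subset[OF hs.XD(3)[OF x]]) (use S(1) in blast)
    then show "continuous_on ?S (\<lambda>y. (chart_inv x y, t))" by (intro continuous_on_Pair continuous_on_const)
    show "(\<lambda>y. (chart_inv x y, t)) ` ?S \<subseteq> L \<times> {0..1}" using hs.X_dom[OF x hs.XD(5)[OF x S(1)]] t by blast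
  qed
  have "continuous_on ?S (\<lambda>y. gram ?c (F (chart_inv x y, t)) (hs.rws x ?c t y))"
    by (rule continuous_on_gram[OF cpA(1) cF _ cr]) (use S(2) in blast)
  then have "continuous_on ?S (vdens (\<lambda>p. F (p, t)) x)"
  proof (rule continuous_on_eq)
    fix y' assume y': "y' \<in> ?S"
    show "gram ?c (F (chart_inv x y', t)) (hs.rws x ?c t y') = vdens (\<lambda>p. F (p, t)) x y'"
      using vdens_F[OF x hs.XD(5)[OF x S(1)[OF y']] t cpA(1) S(2)[OF y']] by (simp only: hs.XD(6)[OF x S(1)[OF y']])
  qed
  then have "continuous_on (hs.img x \<inter> ?S) (vdens (\<lambda>p. F (p, t)) x)" by (rule continuous_on_subset) (rule Int_lower2)
  moreover have "y \<in> ?S" using y t cpA(2) by (simp add: hs.dmn_def)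
  ultimately show "\<exists>T. open T \<and> y \<in> T \<and> continuous_on (hs.img x \<inter> T) (vdens (\<lambda>p. F (p, t)) x)"
    using hs.open_slice[OF x cpA(1) t] by blast
qed

lemma vdens_transition:
  assumes x: "x \<in> hs.X" "x' \<in> hs.X" "p \<in> dom_of x" "p \<in> dom_of x'" and t: "t \<in> {0..1}"
  shows "\<exists>T. (transition x x' has_derivative T) (at (coord x p)) \<and>
    vdens (\<lambda>p. F (p, t)) x (coord x p) = \<bar>det (matrix T)\<bar> * vdens (\<lambda>p. F (p, t)) x' (coord x' p)"
proof -
  let ?c = "cp (F (p, t))"
  obtain T where T: "(transition x x' has_derivative T) (at (coord x p))" by (rule submanifold_transition[OF A x])
  have "hs.rws x ?c t (coord x p) = (\<chi> j. \<Sum>k\<in>UNIV. complex_of_real (matrix T $ k $ j) *s hs.rws x' ?c t (coord x' p) $ k)"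
    using hs.rws_change_x[OF x(1,2) cpA(1) x(3,4) t cpA(2) T] by simp
  then have "vdens (\<lambda>p. F (p, t)) x (coord x p) = \<bar>det (matrix T)\<bar> * vdens (\<lambda>p. F (p, t)) x' (coord x' p)"
    unfolding vdens_F[OF x(1,3) t cpA] vdens_F[OF x(2,4) t cpA] by (simp only: gram_real_combination[OF cpA])
  then show ?thesis using T by blast
qed

lemma L_sets: "L \<in> sets borel" using compact_imp_closed[OF compact_L] by simp

lemma represents_vdens:
  assumes t: "t \<in> {0..1}"
  shows "represents_densities hs.X (vdens (\<lambda>p. F (p, t))) (density_measure hs.X (vdens (\<lambda>p. F (p, t))))"
proof -
  obtain C0 where C0: "finite C0" "C0 \<subseteq> hs.X" "L \<subseteq> (\<Union>x\<in>C0. dom_of x)" by (rule hs.finite_subcover)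
  show ?thesis
    by (rule represents_densities_density_measure[OF L_sets hs.X1 C0 continuous_on_vdens[OF _ t] vdens_nonneg[OF _ _ t] vdens_transition[OF _ _ _ _ t]])
qed

lemma represents_vdens_id:
  "represents_densities hs.X (vdens (\<lambda>p. p)) (density_measure hs.X (vdens (\<lambda>p. p)))"
proof -
  obtain C0 where C0: "finite C0" "C0 \<subseteq> hs.X" "L \<subseteq> (\<Union>x\<in>C0. dom_of x)" by (rule hs.finite_subcover)
  have z: "(0::real) \<in> {0..1}" by simp
  show ?thesis
  proof (rule represents_densities_density_measure[OF L_sets hs.X1 C0])
    show "continuous_on (hs.img x) (vdens (\<lambda>p. p) x)" if "x \<in> hs.X" for x
      using continuous_on_vdens[OF that z] by (rule continuous_on_eq) (simp add: vdens_0[OF that])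
    show "0 \<le> vdens (\<lambda>p. p) x y" if "x \<in> hs.X" "y \<in> hs.img x" for x y
      unfolding vdens_0[OF that] by (rule vdens_nonneg[OF that z])
    show "\<exists>T. (transition x x' has_derivative T) (at (coord x p)) \<and>
      vdens (\<lambda>p. p) x (coord x p) = \<bar>det (matrix T)\<bar> * vdens (\<lambda>p. p) x' (coord x' p)"
      if "x \<in> hs.X" "x' \<in> hs.X" "p \<in> dom_of x" "p \<in> dom_of x'" for x x' p
      using vdens_transition[OF that z] that by (simp add: vdens_0)
  qed
qed

text \<open>The path of \<open>p\<close> stays in the connected component of
  \<open>p\<close>.\<close>

lemma Fac_path:
  assumes "p \<in> L" "t \<in> {0..1}"
  shows "Fac (F (p, t)) = Fac p"
proof (rule Fac_component)
  have "connected ((\<lambda>t. F (p, t)) ` {0..1})"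
    by (rule connected_continuous_image[OF hs.continuous_on_path[OF assms(1) order_refl]]) simp
  moreover have "p \<in> (\<lambda>t. F (p, t)) ` {0..1}" using F0[OF assms(1)] by (intro image_eqI[of _ _ 0]) auto
  ultimately have "(\<lambda>t. F (p, t)) ` {0..1} \<subseteq> connected_component_set UNIV p" by (intro connected_component_maximal) auto
  then show "F (p, t) \<in> connected_component_set UNIV p" using assms(2) by blast
qed

text \<open>As \<open>Fac\<close> is constant along each path, the hypothesis of
  \<open>emeasure_comparison\<close> becomes \<open>gram_ge\<close> at the end point of the
  path.\<close>

lemma map_volume_mono:
  assumes t: "t \<in> {0..1}"
  shows "map_volume A (conformal_metric f g) L (\<lambda>p. p) \<le> map_volume A (conformal_metric f g) L (\<lambda>p. F (p, t))"
proof -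
  interpret homotopy_measure A L F \<phi> "2 * m" "vdens (\<lambda>p. p)" "\<lambda>p. complex_of_real (Fac p)" "density_measure hs.X (vdens (\<lambda>p. p))"
  proof
    show "continuous_on (hs.img x) (vdens (\<lambda>p. p) x)" if "x \<in> hs.X" for x
      using continuous_on_vdens[OF that, of 0] by (rule continuous_on_eq) (simp_all add: vdens_0[OF that])
    show "represents_densities hs.X (vdens (\<lambda>p. p)) (density_measure hs.X (vdens (\<lambda>p. p)))" by (rule represents_vdens_id)
  qed
  show ?thesis unfolding map_volume_eq
  proof (rule emeasure_comparison[OF t represents_vdens[OF t] vdens_nonneg[OF _ _ t]])
    fix x p c assume x: "x \<in> hs.X" "p \<in> dom_of x" and c: "c \<in> A" "F (p, t) \<in> dom_of c"
    have "cmod (complex_of_real (Fac p)) = fac c (F (p, t))" using Fac_pos[of p] Fac_path[OF hs.X_dom[OF x] t] Fac_eq[OF c] by simp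
    then show "cmod (complex_of_real (Fac p)) * cmod (\<phi> c (F (p, t))) * cmod (det (hs.rws x c t (coord x p))) ^ (2 * m)
      \<le> vdens (\<lambda>p. F (p, t)) x (coord x p) ^ (2 * m)" unfolding vdens_F[OF x t c] using gram_ge[OF c] by simp
  qed
qed

end

theorem theorem1:
  fixes A :: "('a::{t2_space,second_countable_topology}, 'n::finite) cchart set"
    and \<sigma> :: "'a \<Rightarrow> 'a"
    and g g\<^sub>m :: "('a, 'n) metric"
    and h h\<^sub>m :: "('a, 'n) line_metric"
    and \<omega> \<omega>\<^sub>m :: "('a, 'n) form11"
    and L D\<^sub>m :: "'a set"
    and m N :: nat
    and \<kappa> :: "nat \<Rightarrow> ('a, 'n) bundle_section"
    and \<phi>\<^sub>m :: "('a, 'n) bundle_section"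
    and f\<^sub>m :: "'a \<Rightarrow> real"
    and F :: "'a \<times> real \<Rightarrow> 'a"
  assumes "compact (UNIV :: 'a set)"
    and "complex_manifold A"
    and "antiholomorphic_involution A \<sigma>"
    and "hermitian_metric A g"
    and "invariant_metric A \<sigma> g"
    and "h = canonical_metric g"
    and "\<omega> = curvature_form h"
    and "kahler_form A \<omega>"
    and "L = {p. \<sigma> p = p}"
    and "m > 0"
    and "orthonormal_basis_of_invariant_sections A \<sigma> h (kahler_volume A \<omega>) m N \<kappa>"
    and "kodaira_embedding A N \<kappa>"
    and "h\<^sub>m = induced_metric m N \<kappa>"
    and "\<omega>\<^sub>m = curvature_form h\<^sub>m"
    and "smooth_function A f\<^sub>m"
    and "\<And>c p. c \<in> A \<Longrightarrow> p \<in> dom_of c \<Longrightarrow> real CARD('n) *\<^sub>R i_ddbar f\<^sub>m c p = \<omega>\<^sub>m c p - \<omega> c p"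
    and "(LINT p|kahler_volume A \<omega>. f\<^sub>m p) = 0"
    and "g\<^sub>m = conformal_metric f\<^sub>m g"
    and "\<phi>\<^sub>m = sum_of_squares N \<kappa>"
    and "D\<^sub>m = zero_set A \<phi>\<^sub>m"
    and "smooth_homotopy A L F"
    and "\<And>p. p \<in> L \<Longrightarrow> F (p, 0) = p"
    and "\<And>p t. p \<in> L \<Longrightarrow> t \<in> {0..1} \<Longrightarrow> F (p, t) \<notin> D\<^sub>m"
  shows "\<forall>t\<in>{0..1}. map_volume A g\<^sub>m L (\<lambda>p. F (p, t)) \<ge> map_volume A g\<^sub>m L (\<lambda>p. p)"
proof -
  have \<kappa>: "\<kappa> i \<in> holomorphic_sections A m" "cnj_pullback A \<sigma> m (\<kappa> i) = \<kappa> i" if "i \<le> N" for i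
    using assms(11) that unfolding orthonormal_basis_of_invariant_sections_def invariant_sections_def by blast+
  interpret volume_comparison A g m N \<kappa> f\<^sub>m \<sigma> L F
  proof
    show "\<exists>i\<le>N. \<kappa> i c p \<noteq> 0" if "c \<in> A" "p \<in> dom_of c" for c p
      using assms(12) that unfolding kodaira_embedding_def by blast
    show "real CARD('n) *\<^sub>R i_ddbar f\<^sub>m c p = curvature_form (induced_metric m N \<kappa>) c p - curvature_form (canonical_metric g) c p"
      if "c \<in> A" "p \<in> dom_of c" for c p using assms(16)[OF that] unfolding assms(6,7,13,14) .
    show "F (p, t) \<notin> zero_set A (sum_of_squares N \<kappa>)" if "p \<in> L" "t \<in> {0..1}" for p t
      using assms(23)[OF that] unfolding assms(19,20) .
  qed (rule assms \<kappa> | assumption)+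
  show ?thesis unfolding assms(18) using map_volume_mono by blast
qed

end
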